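(* Let $\mathfrak{g}=SHO(m,m;\underline t)$ be the special odd Hamiltonian superalgebra over a field of characteristic $p>3$, with $m>3$. Then the outer derivation algebra $\mathrm{Der}_{\mathrm{out}}(\mathfrak{g})=\mathrm{Der}(\mathfrak{g})/\mathrm{ad}(\mathfrak{g})$ is isomorphic, as a Lie superalgebra, to the $(\sum_{i=1}^m t_i+2)$-dimensional Lie superalgebra $G=G_{\bar0}\oplus G_{\bar1}$ with $\mathbb{F}$-basis $h_{-1},h_0,h_1,\dots,h_\iota$ of $G_{\bar0}$, where $\iota:=\sum_{i=1}^m t_i-m$, and $\mathbb{F}$-basis $g_1,\dots,g_m$ of $G_{\bar1}$, and brackets $$[h_{-1},g_j]=0,\quad [h_0,g_j]=-2g_j,\quad [h_i,g_j]=0\ (1\le i\le\iota),\quad [h_i,h_k]=[g_j,g_l]=0$$ for all $-1\le i,k\le\iota$ (in the last relation) and $1\le j,l\le m$.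
   Context: Let $\mathbb{F}$ be a field of characteristic $p>3$, $m>3$ an integer, $\underline t=(t_1,\dots,t_m)$ a tuple of positive integers, $\pi_i:=p^{t_i}-1$. $\mathcal{O}(m;\underline t)$ is the divided power algebra with basis $x^{(\alpha)}$, $\alpha\in\mathbb{N}_0^m$, $\alpha_i\le\pi_i$, and product $x^{(\alpha)}x^{(\beta)}=\binom{\alpha+\beta}{\alpha}x^{(\alpha+\beta)}$; $x_i:=x^{(\varepsilon_i)}$ for $1\le i\le m$, where $\varepsilon_i$ is the $i$-th unit tuple. $\Lambda(m)$ is the exterior algebra in the odd variables $x_{m+1},\dots,x_{2m}$. $\mathcal{O}=\mathcal{O}(m;\underline t)\otimes\Lambda(m)$ is a supercommutative superalgebra. For $1\le r\le 2m$, $\partial_r$ is the superderivation of $\mathcal{O}$ with $\partial_r(x^{(\alpha)}x^u)=x^{(\alpha-\varepsilon_r)}x^u$ if $r\le m$ and $\partial_r(x^{(\alpha)}x^u)=x^{(\alpha)}\,\partial x^u/\partial x_r$ if $r>m$. $W=\{\sum_r f_r\partial_r\mid f_r\in\mathcal{O}\}$ is a Lie superalgebra of superderivations of $\mathcal{O}$. Put $i'=i+m$ for $i\le m$, $i'=i-m$ for $i>m$; $\mu(i)=\bar0$ for $i\le m$, $\mu(i)=\bar1$ for $i>m$; $\mathrm{p}$ denotes parity. Define linear maps $\mathrm{T_H}:\mathcal{O}\to W$, $\mathrm{T_H}(a)=\sum_{i=1}^{2m}(-1)^{\mu(i)\mathrm{p}(a)}\partial_i(a)\partial_{i'}$ for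 homogeneous $a$, and $\mathrm{div}:W\to\mathcal{O}$, $\mathrm{div}(f\partial_r)=(-1)^{\mu(r)\mathrm{p}(f)}\partial_r(f)$. Then $\mathfrak{g}=SHO(m,m;\underline t):=\{D\in W\mid \mathrm{div}D=0\}\cap\{\mathrm{T_H}(a)\mid a\in\mathcal{O}\}$, a Lie superalgebra. $\mathrm{Der}$ denotes the Lie superalgebra of all superderivations and $\mathrm{ad}(\mathfrak{g})$ the ideal of inner derivations. *)

theory Defs
  imports Complex_Main "HOL-Library.Z2" "HOL-Library.Function_Algebras"
    "HOL-Computational_Algebra.Primes"
begin

section \<open>Superspaces and Lie superalgebras over a field\<close>

text \<open>Parities are elements of the two-element field \<^typ>\<open>bit\<close>, 0 being even and 1 odd.
  \<open>psign b\<close> is \<open>(-1)^b\<close>.\<close>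

definition psign :: "bit \<Rightarrow> 'k::field" where
  "psign b = (if b = 0 then 1 else - 1)"

record ('k, 'a) superspace =
  carr :: "'a set"
  vzero :: 'a
  vadd :: "'a \<Rightarrow> 'a \<Rightarrow> 'a"
  vscale :: "'k \<Rightarrow> 'a \<Rightarrow> 'a"
  grade :: "bit \<Rightarrow> 'a set"

record ('k, 'a) lie_super = "('k, 'a) superspace" +
  bracket :: "'a \<Rightarrow> 'a \<Rightarrow> 'a"

definition vsubspace :: "('k::field, 'a, 'm) superspace_scheme \<Rightarrow> 'a set \<Rightarrow> bool" where
  "vsubspace V S \<longleftrightarrow> S \<subseteq> carr V \<and> vzero V \<in> S \<and>
     (\<forall>x\<in>S. \<forall>y\<in>S. vadd V x y \<in> S) \<and> (\<forall>c. \<forall>x\<in>S. vscale V c x \<in> S)"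

locale superspace =
  fixes V :: "('k::field, 'a, 'm) superspace_scheme"
  assumes zero_closed: "vzero V \<in> carr V"
    and add_closed: "x \<in> carr V \<Longrightarrow> y \<in> carr V \<Longrightarrow> vadd V x y \<in> carr V"
    and scale_closed: "x \<in> carr V \<Longrightarrow> vscale V c x \<in> carr V"
    and add_assoc: "x \<in> carr V \<Longrightarrow> y \<in> carr V \<Longrightarrow> z \<in> carr V \<Longrightarrow>
          vadd V (vadd V x y) z = vadd V x (vadd V y z)"
    and add_comm: "x \<in> carr V \<Longrightarrow> y \<in> carr V \<Longrightarrow> vadd V x y = vadd V y x"
    and add_zero: "x \<in> carr V \<Longrightarrow> vadd V x (vzero V) = x"
    and add_inverse: "x \<in> carr V \<Longrightarrow> vadd V x (vscale V (- 1) x) = vzero V"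
    and scale_add_right: "x \<in> carr V \<Longrightarrow> y \<in> carr V \<Longrightarrow>
          vscale V c (vadd V x y) = vadd V (vscale V c x) (vscale V c y)"
    and scale_add_left: "x \<in> carr V \<Longrightarrow>
          vscale V (c + d) x = vadd V (vscale V c x) (vscale V d x)"
    and scale_scale: "x \<in> carr V \<Longrightarrow> vscale V c (vscale V d x) = vscale V (c * d) x"
    and scale_one: "x \<in> carr V \<Longrightarrow> vscale V 1 x = x"
    and grade_subspace: "vsubspace V (grade V b)"
    and grade_direct_sum: "x \<in> carr V \<Longrightarrow>
          \<exists>!(y, z). y \<in> grade V 0 \<and> z \<in> grade V 1 \<and> x = vadd V y z"

locale lie_superalgebra = superspace L
  for L :: "('k::field, 'a, 'm) lie_super_scheme" +
  assumes bracket_closed: "x \<in> carr L \<Longrightarrow> y \<in> carr L \<Longrightarrow> bracket L x y \<in> carr L"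
    and bracket_add_left: "x \<in> carr L \<Longrightarrow> y \<in> carr L \<Longrightarrow> z \<in> carr L \<Longrightarrow>
          bracket L (vadd L x y) z = vadd L (bracket L x z) (bracket L y z)"
    and bracket_add_right: "x \<in> carr L \<Longrightarrow> y \<in> carr L \<Longrightarrow> z \<in> carr L \<Longrightarrow>
          bracket L x (vadd L y z) = vadd L (bracket L x y) (bracket L x z)"
    and bracket_scale_left: "x \<in> carr L \<Longrightarrow> y \<in> carr L \<Longrightarrow>
          bracket L (vscale L k x) y = vscale L k (bracket L x y)"
    and bracket_scale_right: "x \<in> carr L \<Longrightarrow> y \<in> carr L \<Longrightarrow>
          bracket L x (vscale L k y) = vscale L k (bracket L x y)"
    and bracket_grade: "x \<in> grade L b \<Longrightarrow> y \<in> grade L c \<Longrightarrow> bracket L x y \<in> grade L (b + c)"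
    and super_skew: "x \<in> grade L b \<Longrightarrow> y \<in> grade L c \<Longrightarrow>
          bracket L x y = vscale L (- psign (b * c)) (bracket L y x)"
    and super_jacobi: "x \<in> grade L b \<Longrightarrow> y \<in> grade L c \<Longrightarrow> z \<in> carr L \<Longrightarrow>
          bracket L x (bracket L y z) =
          vadd L (bracket L (bracket L x y) z)
                 (vscale L (psign (b * c)) (bracket L y (bracket L x z)))"

definition lie_superalgebra_iso ::
  "('k::field, 'a, 'm) lie_super_scheme \<Rightarrow> ('k, 'b, 'n) lie_super_scheme \<Rightarrow> ('a \<Rightarrow> 'b) \<Rightarrow> bool" where
  "lie_superalgebra_iso L M \<phi> \<longleftrightarrow>
     bij_betw \<phi> (carr L) (carr M) \<and>
     (\<forall>x\<in>carr L. \<forall>y\<in>carr L. \<phi> (vadd L x y) = vadd M (\<phi> x) (\<phi> y)) \<and>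
     (\<forall>c. \<forall>x\<in>carr L. \<phi> (vscale L c x) = vscale M c (\<phi> x)) \<and>
     (\<forall>b. \<phi> ` grade L b = grade M b) \<and>
     (\<forall>x\<in>carr L. \<forall>y\<in>carr L. \<phi> (bracket L x y) = bracket M (\<phi> x) (\<phi> y))"

definition lie_superalgebra_isomorphic ::
  "('k::field, 'a, 'm) lie_super_scheme \<Rightarrow> ('k, 'b, 'n) lie_super_scheme \<Rightarrow> bool" where
  "lie_superalgebra_isomorphic L M \<longleftrightarrow>
     lie_superalgebra L \<and> lie_superalgebra M \<and> (\<exists>\<phi>. lie_superalgebra_iso L M \<phi>)"


section \<open>Superderivations, inner derivations, quotients\<close>

text \<open>The component of parity \<open>b\<close> of a vector, with respect to a decomposition into the
  direct sum of \<open>Gr 0\<close> and \<open>Gr 1\<close>.\<close>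

definition hcomp :: "('a \<Rightarrow> 'a \<Rightarrow> 'a) \<Rightarrow> (bit \<Rightarrow> 'a set) \<Rightarrow> bit \<Rightarrow> 'a \<Rightarrow> 'a" where
  "hcomp add Gr b x = (THE y. y \<in> Gr b \<and> (\<exists>z\<in>Gr (b + 1). x = add y z))"

text \<open>A map of \<open>V\<close> into itself is represented by the function with value zero outside
  \<^term>\<open>carr V\<close>, so that equal maps are equal functions.\<close>

definition on_carr :: "('k, 'a, 'm) superspace_scheme \<Rightarrow> ('a \<Rightarrow> 'a) \<Rightarrow> 'a \<Rightarrow> 'a" where
  "on_carr V D = (\<lambda>x. if x \<in> carr V then D x else vzero V)"

definition endo :: "('k, 'a, 'm) superspace_scheme \<Rightarrow> ('a \<Rightarrow> 'a) set" where
  "endo V = {D. (\<forall>x\<in>carr V. D x \<in> carr V) \<and>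
     (\<forall>x. x \<notin> carr V \<longrightarrow> D x = vzero V) \<and>
     (\<forall>x\<in>carr V. \<forall>y\<in>carr V. D (vadd V x y) = vadd V (D x) (D y)) \<and>
     (\<forall>c. \<forall>x\<in>carr V. D (vscale V c x) = vscale V c (D x))}"

definition endo_grade :: "('k, 'a, 'm) superspace_scheme \<Rightarrow> bit \<Rightarrow> ('a \<Rightarrow> 'a) set" where
  "endo_grade V b = {D \<in> endo V. \<forall>c. \<forall>x\<in>grade V c. D x \<in> grade V (b + c)}"

definition endo_add ::
  "('k, 'a, 'm) superspace_scheme \<Rightarrow> ('a \<Rightarrow> 'a) \<Rightarrow> ('a \<Rightarrow> 'a) \<Rightarrow> 'a \<Rightarrow> 'a" where
  "endo_add V D E = (\<lambda>x. vadd V (D x) (E x))"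

text \<open>The supercommutator \<open>[D, E] = D E - (-1)^(bc) E D\<close> of endomorphisms of parities
  \<open>b\<close> and \<open>c\<close>, and its biadditive extension to all endomorphisms.\<close>

definition hom_commutator ::
  "('k::field, 'a, 'm) superspace_scheme \<Rightarrow> bit \<Rightarrow> bit \<Rightarrow> ('a \<Rightarrow> 'a) \<Rightarrow> ('a \<Rightarrow> 'a) \<Rightarrow> 'a \<Rightarrow> 'a" where
  "hom_commutator V b c D E =
     (\<lambda>x. vadd V (D (E x)) (vscale V (- psign (b * c)) (E (D x))))"

definition supercommutator ::
  "('k::field, 'a, 'm) superspace_scheme \<Rightarrow> ('a \<Rightarrow> 'a) \<Rightarrow> ('a \<Rightarrow> 'a) \<Rightarrow> 'a \<Rightarrow> 'a" where
  "supercommutator V D E =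
     (let part = hcomp (endo_add V) (endo_grade V);
          br = (\<lambda>b c. hom_commutator V b c (part b D) (part c E))
      in endo_add V (endo_add V (br 0 0) (br 0 1)) (endo_add V (br 1 0) (br 1 1)))"

definition gl_super :: "('k::field, 'a, 'm) superspace_scheme \<Rightarrow> ('k, 'a \<Rightarrow> 'a) lie_super" where
  "gl_super V = \<lparr>carr = endo V, vzero = (\<lambda>x. vzero V), vadd = endo_add V,
     vscale = (\<lambda>c D x. vscale V c (D x)), grade = endo_grade V,
     bracket = supercommutator V\<rparr>"

definition superder_grade :: "('k::field, 'a, 'm) lie_super_scheme \<Rightarrow> bit \<Rightarrow> ('a \<Rightarrow> 'a) set" where
  "superder_grade L b = {D \<in> endo_grade L b.
     \<forall>c. \<forall>x\<in>grade L c. \<forall>y\<in>carr L.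
       D (bracket L x y) =
       vadd L (bracket L (D x) y) (vscale L (psign (b * c)) (bracket L x (D y)))}"

definition Der :: "('k::field, 'a, 'm) lie_super_scheme \<Rightarrow> ('k, 'a \<Rightarrow> 'a) lie_super" where
  "Der L = (gl_super L)
     \<lparr>carr := {endo_add L D E | D E. D \<in> superder_grade L 0 \<and> E \<in> superder_grade L 1},
      grade := superder_grade L\<rparr>"

definition ad :: "('k::field, 'a, 'm) lie_super_scheme \<Rightarrow> 'a \<Rightarrow> 'a \<Rightarrow> 'a" where
  "ad L x = on_carr L (bracket L x)"

definition vcoset :: "('k, 'a, 'm) superspace_scheme \<Rightarrow> 'a set \<Rightarrow> 'a \<Rightarrow> 'a set" where
  "vcoset V I x = (\<lambda>y. vadd V x y) ` I"

definition quotient_lie ::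
  "('k::field, 'a, 'm) lie_super_scheme \<Rightarrow> 'a set \<Rightarrow> ('k, 'a set) lie_super" where
  "quotient_lie L I =
     \<lparr>carr = vcoset L I ` carr L,
      vzero = I,
      vadd = (\<lambda>A B. \<Union>x\<in>A. \<Union>y\<in>B. vcoset L I (vadd L x y)),
      vscale = (\<lambda>c A. \<Union>x\<in>A. vcoset L I (vscale L c x)),
      grade = (\<lambda>b. vcoset L I ` grade L b),
      bracket = (\<lambda>A B. \<Union>x\<in>A. \<Union>y\<in>B. vcoset L I (bracket L x y))\<rparr>"

definition Der_out :: "('k::field, 'a, 'm) lie_super_scheme \<Rightarrow> ('k, ('a \<Rightarrow> 'a) set) lie_super" where
  "Der_out L = quotient_lie (Der L) (ad L ` carr L)"


section \<open>The superalgebra \<open>\<O>(m; t) \<otimes> \<Lambda>(m)\<close>\<close>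

text \<open>The pair \<open>(\<alpha>, u)\<close> stands for the basis element \<open>x^(\<alpha>) x^u\<close>, where
  \<open>x^u\<close> is the product of the \<open>x\<^sub>i\<close>, \<open>i \<in> u\<close>, in increasing order of the indices. Multi-indices
  are functions vanishing outside \<open>{1..m}\<close>. An element of the superalgebra is its coefficient
  function; the characteristic \<open>p\<close> is read off the type of the coefficients.\<close>

type_synonym mono = "(nat \<Rightarrow> nat) \<times> nat set"

definition mono_set :: "nat \<Rightarrow> nat \<Rightarrow> (nat \<Rightarrow> nat) \<Rightarrow> mono set" where
  "mono_set p m t = {(\<alpha>, u). (\<forall>i. i \<notin> {1..m} \<longrightarrow> \<alpha> i = 0) \<and>
     (\<forall>i\<in>{1..m}. \<alpha> i \<le> p ^ t i - 1) \<and> u \<subseteq> {m+1..2*m}}"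

definition single :: "'x \<Rightarrow> 'x \<Rightarrow> 'k::field" where
  "single x = (\<lambda>z. if z = x then 1 else 0)"

definition fscale :: "'k \<Rightarrow> ('x \<Rightarrow> 'k::field) \<Rightarrow> 'x \<Rightarrow> 'k" where
  "fscale c a = (\<lambda>z. c * a z)"

definition O_alg :: "nat \<Rightarrow> (nat \<Rightarrow> nat) \<Rightarrow> ('k::field, mono \<Rightarrow> 'k) superspace" where
  "O_alg m t = \<lparr>carr = {a. \<forall>x. x \<notin> mono_set CHAR('k) m t \<longrightarrow> a x = 0},
     vzero = 0, vadd = (+), vscale = fscale,
     grade = (\<lambda>b. {a. \<forall>\<alpha> u. (\<alpha>, u) \<notin> mono_set CHAR('k) m t \<or> of_nat (card u) \<noteq> b \<longrightarrow> a (\<alpha>, u) = 0})\<rparr>"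

text \<open>\<open>x^u x^v\<close> is zero if \<open>u\<close> and \<open>v\<close> meet; otherwise sorting the factors
  gives one sign for each pair of indices in the wrong order.\<close>

definition mono_mult :: "nat \<Rightarrow> mono \<Rightarrow> mono \<Rightarrow> mono \<Rightarrow> 'k::field" where
  "mono_mult m = (\<lambda>(\<alpha>, u) (\<beta>, v).
     if u \<inter> v = {} then
       fscale ((- 1) ^ card {(i, j). i \<in> u \<and> j \<in> v \<and> j < i} *
               (\<Prod>i=1..m. of_nat ((\<alpha> i + \<beta> i) choose \<alpha> i)))
         (single (\<lambda>i. \<alpha> i + \<beta> i, u \<union> v))
     else 0)"

text \<open>For \<open>\<alpha>\<close>, \<open>\<beta>\<close> bounded by \<open>\<pi>\<close> such that \<open>\<alpha> + \<beta>\<close> is not, the binomial coefficient is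
  divisible by \<open>p\<close>, so the product stays in \<^term>\<open>carr (O_alg m t)\<close>.\<close>

definition omult ::
  "nat \<Rightarrow> (nat \<Rightarrow> nat) \<Rightarrow> (mono \<Rightarrow> 'k) \<Rightarrow> (mono \<Rightarrow> 'k) \<Rightarrow> mono \<Rightarrow> 'k::field" where
  "omult m t a b = (\<Sum>x\<in>mono_set CHAR('k) m t. \<Sum>y\<in>mono_set CHAR('k) m t.
     fscale (a x * b y) (mono_mult m x y))"

definition mono_partial :: "nat \<Rightarrow> nat \<Rightarrow> mono \<Rightarrow> mono \<Rightarrow> 'k::field" where
  "mono_partial m r = (\<lambda>(\<alpha>, u).
     if r \<le> m then (if \<alpha> r = 0 then 0 else single (\<alpha>(r := \<alpha> r - 1), u))
     else (if r \<in> u then fscale ((- 1) ^ card {i\<in>u. i < r}) (single (\<alpha>, u - {r})) else 0))"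

definition opartial :: "nat \<Rightarrow> (nat \<Rightarrow> nat) \<Rightarrow> nat \<Rightarrow> (mono \<Rightarrow> 'k) \<Rightarrow> mono \<Rightarrow> 'k::field" where
  "opartial m t r a = (\<Sum>x\<in>mono_set CHAR('k) m t. fscale (a x) (mono_partial m r x))"

definition xvar :: "nat \<Rightarrow> nat \<Rightarrow> mono \<Rightarrow> 'k::field" where
  "xvar m r = (if r \<le> m then single ((\<lambda>i. 0)(r := 1), {}) else single (\<lambda>i. 0, {r}))"

definition opart :: "nat \<Rightarrow> (nat \<Rightarrow> nat) \<Rightarrow> bit \<Rightarrow> (mono \<Rightarrow> 'k) \<Rightarrow> mono \<Rightarrow> 'k::field" where
  "opart m t = hcomp (+) (grade (O_alg m t :: ('k, mono \<Rightarrow> 'k) superspace))"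


section \<open>The special odd Hamiltonian superalgebra\<close>

definition conj_index :: "nat \<Rightarrow> nat \<Rightarrow> nat" where
  "conj_index m i = (if i \<le> m then i + m else i - m)"

definition mu :: "nat \<Rightarrow> nat \<Rightarrow> bit" where
  "mu m i = (if i \<le> m then 0 else 1)"

text \<open>The operator \<open>f \<partial>\<^sub>r\<close>.\<close>

definition fpartial ::
  "nat \<Rightarrow> (nat \<Rightarrow> nat) \<Rightarrow> (mono \<Rightarrow> 'k) \<Rightarrow> nat \<Rightarrow> (mono \<Rightarrow> 'k) \<Rightarrow> (mono \<Rightarrow> 'k::field)" where
  "fpartial m t f r =
     on_carr (O_alg m t :: ('k, mono \<Rightarrow> 'k) superspace) (\<lambda>a. omult m t f (opartial m t r a))"

definition W :: "nat \<Rightarrow> (nat \<Rightarrow> nat) \<Rightarrow> ((mono \<Rightarrow> 'k) \<Rightarrow> (mono \<Rightarrow> 'k::field)) set" where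
  "W m t = {(\<Sum>r=1..2*m. fpartial m t (f r) r) | f.
     \<forall>r\<in>{1..2*m}. f r \<in> carr (O_alg m t :: ('k, mono \<Rightarrow> 'k) superspace)}"

definition T_H ::
  "nat \<Rightarrow> (nat \<Rightarrow> nat) \<Rightarrow> (mono \<Rightarrow> 'k) \<Rightarrow> (mono \<Rightarrow> 'k) \<Rightarrow> (mono \<Rightarrow> 'k::field)" where
  "T_H m t a = (\<Sum>b\<in>{0, 1}. \<Sum>i=1..2*m.
     fpartial m t (fscale (psign (mu m i * b)) (opartial m t i (opart m t b a))) (conj_index m i))"

text \<open>The coefficients of \<open>D = \<Sum>\<^sub>r f\<^sub>r \<partial>\<^sub>r\<close> are \<open>f\<^sub>r = D x\<^sub>r\<close>; the lemma \<open>divergence_fpartial\<close>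
  below is the defining formula of the divergence.\<close>

definition divergence ::
  "nat \<Rightarrow> (nat \<Rightarrow> nat) \<Rightarrow> ((mono \<Rightarrow> 'k) \<Rightarrow> (mono \<Rightarrow> 'k)) \<Rightarrow> mono \<Rightarrow> 'k::field" where
  "divergence m t D = (\<Sum>b\<in>{0, 1}. \<Sum>r=1..2*m.
     fscale (psign (mu m r * b)) (opartial m t r (opart m t b (D (xvar m r)))))"

definition SHO_set :: "nat \<Rightarrow> (nat \<Rightarrow> nat) \<Rightarrow> ((mono \<Rightarrow> 'k) \<Rightarrow> (mono \<Rightarrow> 'k::field)) set" where
  "SHO_set m t = {D \<in> W m t. divergence m t D = 0} \<inter>
     {T_H m t a | a. a \<in> carr (O_alg m t :: ('k, mono \<Rightarrow> 'k) superspace)}"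

definition SHO ::
  "nat \<Rightarrow> (nat \<Rightarrow> nat) \<Rightarrow> ('k::field, (mono \<Rightarrow> 'k) \<Rightarrow> (mono \<Rightarrow> 'k)) lie_super" where
  "SHO m t = (gl_super (O_alg m t))
     \<lparr>carr := SHO_set m t, grade := (\<lambda>b. SHO_set m t \<inter> endo_grade (O_alg m t) b)\<rparr>"


lemma sum_fun_apply: "(\<Sum>x\<in>A. f x) z = (\<Sum>x\<in>A. f x z)"
  for f :: "'x \<Rightarrow> 'y \<Rightarrow> 'z::comm_monoid_add"
  by (induction A rule: infinite_finite_induct) auto

lemma mono_set_finite: "finite (mono_set p m t)"
proof -
  let ?A = "{f. (\<forall>i. i \<in> {1..m} \<longrightarrow> f i \<in> {..Max ((\<lambda>i. p ^ t i) ` {1..m})}) \<and>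
                (\<forall>i. i \<notin> {1..m} \<longrightarrow> f i = (0::nat))}"
  have "\<alpha> i \<le> Max ((\<lambda>i. p ^ t i) ` {1..m})" if "i \<in> {1..m}" "\<alpha> i \<le> p ^ t i - 1" for \<alpha> i
  proof -
    have "p ^ t i \<le> Max ((\<lambda>i. p ^ t i) ` {1..m})" using that by (intro Max_ge) auto
    then show ?thesis using that by linarith
  qed
  then have "mono_set p m t \<subseteq> ?A \<times> Pow {m+1..2*m}"
    unfolding mono_set_def by blast
  moreover have "finite (?A \<times> Pow {m+1..2*m})"
    using finite_set_of_finite_funs[of "{1..m}" "{..Max ((\<lambda>i. p ^ t i) ` {1..m})}" 0]
    by (intro finite_cartesian_product) (simp_all add: all_conj_distrib)
  ultimately show ?thesis by (rule finite_subset)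
qed

lemma single_combination:
  fixes a :: "mono \<Rightarrow> 'k::field"
  assumes "a \<in> carr (O_alg m t :: ('k, mono \<Rightarrow> 'k) superspace)"
  shows "(\<Sum>x\<in>mono_set CHAR('k) m t. fscale (a x) (single x)) = a"
proof
  fix z
  have "(\<Sum>x\<in>mono_set CHAR('k) m t. a x * single x z) =
        (\<Sum>x\<in>mono_set CHAR('k) m t. if x = z then a x else 0)"
    by (intro sum.cong) (auto simp: single_def)
  also have "\<dots> = a z"
    using assms by (cases z) (simp add: mono_set_finite O_alg_def)
  finally show "(\<Sum>x\<in>mono_set CHAR('k) m t. fscale (a x) (single x)) z = a z"
    by (simp add: sum_fun_apply fscale_def)
qed

lemma opartial_single:
  assumes "x \<in> mono_set CHAR('k) m t"
  shows "opartial m t r (single x) = (mono_partial m r x :: mono \<Rightarrow> 'k::field)"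
proof -
  have "opartial m t r (single x) =
      (\<Sum>y\<in>mono_set CHAR('k) m t. if y = x then (mono_partial m r x :: mono \<Rightarrow> 'k) else 0)"
    unfolding opartial_def
    by (intro sum.cong) (auto simp: single_def fscale_def fun_eq_iff)
  then show ?thesis using assms by (simp add: mono_set_finite)
qed

lemma omult_one:
  fixes f :: "mono \<Rightarrow> 'k::field"
  assumes "f \<in> carr (O_alg m t :: ('k, mono \<Rightarrow> 'k) superspace)"
  shows "omult m t f (single (\<lambda>i. 0, {})) = f"
proof -
  have e: "(\<lambda>i. 0, {}) \<in> mono_set CHAR('k) m t" by (simp add: mono_set_def)
  have mm: "mono_mult m x (\<lambda>i. 0, {}) = (single x :: mono \<Rightarrow> 'k)" for x
    by (cases x) (simp add: mono_mult_def fscale_def)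
  have "fscale (f x * single (\<lambda>i. 0, {}) y) (mono_mult m x y) =
      (if y = (\<lambda>i. 0, {}) then fscale (f x) (single x) else 0)" for x y
  proof (cases "y = (\<lambda>i. 0, {})")
    case True
    then show ?thesis by (simp only: mm) (simp add: single_def)
  next
    case False
    then have "single (\<lambda>i. 0, {}) y = (0 :: 'k)" by (simp add: single_def)
    then show ?thesis using False by (simp add: fscale_def fun_eq_iff)
  qed
  then have "omult m t f (single (\<lambda>i. 0, {})) =
      (\<Sum>x\<in>mono_set CHAR('k) m t. \<Sum>y\<in>mono_set CHAR('k) m t.
         if y = (\<lambda>i. 0, {}) then fscale (f x) (single x) else 0)"
    by (simp add: omult_def)
  also have "\<dots> = (\<Sum>x\<in>mono_set CHAR('k) m t. fscale (f x) (single x))"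
    using e by (simp add: mono_set_finite)
  finally show ?thesis using single_combination[OF assms] by simp
qed

lemma fpartial_xvar:
  fixes f :: "mono \<Rightarrow> 'k::field"
  assumes f: "f \<in> carr (O_alg m t :: ('k, mono \<Rightarrow> 'k) superspace)"
    and char: "CHAR('k) > 0" and t: "\<forall>i\<in>{1..m}. t i > 0"
    and r: "r \<in> {1..2*m}" and s: "s \<in> {1..2*m}"
  shows "fpartial m t f r (xvar m s) = (if r = s then f else 0)"
proof -
  define x :: mono where "x = (if s \<le> m then ((\<lambda>i. 0)(s := 1), {}) else (\<lambda>i. 0, {s}))"
  have "CHAR('k) \<ge> 2" using prime_CHAR_semidom[OF char] prime_ge_2_nat by blast
  then have "CHAR('k) ^ t s \<ge> 2" if "s \<in> {1..m}"
    using self_le_power[of "CHAR('k)" "t s"] that t by force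
  then have x: "x \<in> mono_set CHAR('k) m t"
    using s by (force simp: x_def mono_set_def)
  have xv: "xvar m s = (single x :: mono \<Rightarrow> 'k)" by (simp add: x_def xvar_def)
  have "xvar m s \<in> carr (O_alg m t :: ('k, mono \<Rightarrow> 'k) superspace)"
    using x by (auto simp: xv O_alg_def single_def)
  moreover have "opartial m t r (xvar m s) =
      (if r = s then (single (\<lambda>i. 0, {}) :: mono \<Rightarrow> 'k) else 0)"
  proof -
    have zero: "(\<lambda>i. 0)(s := 0) = (\<lambda>i. 0 :: nat)" by auto
    have none: "{i. i = s \<and> i < s} = {}" by auto
    show ?thesis
      unfolding xv opartial_single[OF x] using r s
      by (auto simp: mono_partial_def x_def fscale_def zero none)
  qed
  moreover have "omult m t f 0 = 0"
    by (simp add: omult_def fscale_def fun_eq_iff sum_fun_apply)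
  ultimately show ?thesis
    using omult_one[OF f] by (simp add: fpartial_def on_carr_def)
qed

lemma opart_zero: "opart m t b (0 :: mono \<Rightarrow> 'k::field) = 0"
proof -
  have eq0: "y = 0" if y: "y \<in> grade (O_alg m t) b" "z \<in> grade (O_alg m t) (b + 1)" "0 = y + z"
    for y z :: "mono \<Rightarrow> 'k"
  proof
    fix x :: mono
    obtain \<alpha> u where x: "x = (\<alpha>, u)" by (cases x)
    have yz: "y x + z x = 0" using y(3) by (metis plus_fun_apply zero_fun_apply)
    show "y x = 0 x"
      using y(1,2) yz by (cases "of_nat (card u) = b") (auto simp: O_alg_def x)
  qed
  show ?thesis
    unfolding opart_def hcomp_def
  proof (rule the_equality)
    have "0 \<in> grade (O_alg m t :: ('k, mono \<Rightarrow> 'k) superspace) c" for c by (simp add: O_alg_def)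
    then show "0 \<in> grade (O_alg m t :: ('k, mono \<Rightarrow> 'k) superspace) b \<and>
        (\<exists>z\<in>grade (O_alg m t :: ('k, mono \<Rightarrow> 'k) superspace) (b + 1). 0 = 0 + z)"
      by (metis add_0)
  qed (use eq0 in blast)
qed

lemma divergence_fpartial:
  fixes f :: "mono \<Rightarrow> 'k::field"
  assumes f: "f \<in> grade (O_alg m t :: ('k, mono \<Rightarrow> 'k) superspace) b"
    and char: "CHAR('k) > 0" and t: "\<forall>i\<in>{1..m}. t i > 0"
    and r: "r \<in> {1..2*m}"
  shows "divergence m t (fpartial m t f r) = fscale (psign (mu m r * b)) (opartial m t r f)"
proof -
  have fc: "f \<in> carr (O_alg m t :: ('k, mono \<Rightarrow> 'k) superspace)"
    using f by (auto simp: O_alg_def)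
  have o0: "opartial m t s (0 :: mono \<Rightarrow> 'k) = 0" for s
    by (simp add: opartial_def fscale_def fun_eq_iff sum_fun_apply)
  have s0: "fscale c (0 :: mono \<Rightarrow> 'k) = 0" for c by (simp add: fscale_def fun_eq_iff)
  have part: "opart m t c f = (if c = b then f else 0)" for c
    unfolding opart_def hcomp_def
  proof (rule the_equality)
    show "(if c = b then f else 0) \<in> grade (O_alg m t :: ('k, mono \<Rightarrow> 'k) superspace) c \<and>
      (\<exists>z\<in>grade (O_alg m t :: ('k, mono \<Rightarrow> 'k) superspace) (c + 1).
         f = (if c = b then f else 0) + z)"
    proof (cases "c = b")
      case True
      then show ?thesis using f
        by (auto intro!: bexI[of _ 0] simp: O_alg_def)
    next
      case False
      then have "b = c + 1" by (cases b; cases c) auto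
      then show ?thesis using f False
        by (auto intro!: bexI[of _ f] simp: O_alg_def)
    qed
  next
    fix y :: "mono \<Rightarrow> 'k"
    assume "y \<in> grade (O_alg m t :: ('k, mono \<Rightarrow> 'k) superspace) c \<and>
      (\<exists>z\<in>grade (O_alg m t :: ('k, mono \<Rightarrow> 'k) superspace) (c + 1). f = y + z)"
    then obtain z where y: "y \<in> grade (O_alg m t :: ('k, mono \<Rightarrow> 'k) superspace) c"
      and z: "z \<in> grade (O_alg m t :: ('k, mono \<Rightarrow> 'k) superspace) (c + 1)" and fyz: "f = y + z"
      by blast
    show "y = (if c = b then f else 0)"
    proof
      fix x :: mono
      obtain \<alpha> u where x: "x = (\<alpha>, u)" by (cases x)
      have fx: "f x = y x + z x" using fyz by simp
      show "y x = (if c = b then f else 0) x"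
        using y z f fx by (cases "of_nat (card u) = c"; cases "c = b") (auto simp: O_alg_def x)
    qed
  qed
  have "divergence m t (fpartial m t f r) =
      (\<Sum>c\<in>{0, 1}. \<Sum>s=1..2*m.
         if s = r then (if c = b then fscale (psign (mu m r * b)) (opartial m t r f) else 0) else 0)"
    unfolding divergence_def
    by (intro sum.cong refl)
      (auto simp: fpartial_xvar[OF fc char t r] opart_zero o0 s0 part)
  also have "\<dots> = (\<Sum>c\<in>{0, 1}.
      if c = b then fscale (psign (mu m r * b)) (opartial m t r f) else 0)"
    using r by simp
  also have "\<dots> = fscale (psign (mu m r * b)) (opartial m t r f)"
    by (cases b) auto
  finally show ?thesis .
qed


section \<open>The Lie superalgebra \<open>G\<close>\<close>

datatype gbasis = hvec int | gvec nat

definition iota :: "nat \<Rightarrow> (nat \<Rightarrow> nat) \<Rightarrow> int" where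
  "iota m t = (\<Sum>i=1..m. int (t i)) - int m"

definition G_basis :: "nat \<Rightarrow> (nat \<Rightarrow> nat) \<Rightarrow> gbasis set" where
  "G_basis m t = hvec ` {-1..iota m t} \<union> gvec ` {1..m}"

text \<open>The value of \<open>[g\<^sub>j, h\<^sub>i]\<close> is forced by super skew-symmetry.\<close>

fun G_basis_bracket :: "gbasis \<Rightarrow> gbasis \<Rightarrow> gbasis \<Rightarrow> 'k::field" where
  "G_basis_bracket (hvec i) (gvec j) = (if i = 0 then fscale (- 2) (single (gvec j)) else 0)"
| "G_basis_bracket (gvec j) (hvec i) = (if i = 0 then fscale 2 (single (gvec j)) else 0)"
| "G_basis_bracket (hvec i) (hvec k) = 0"
| "G_basis_bracket (gvec j) (gvec l) = 0"

definition G_alg :: "nat \<Rightarrow> (nat \<Rightarrow> nat) \<Rightarrow> ('k::field, gbasis \<Rightarrow> 'k) lie_super" where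
  "G_alg m t = \<lparr>carr = {v. \<forall>x. x \<notin> G_basis m t \<longrightarrow> v x = 0},
     vzero = 0, vadd = (+), vscale = fscale,
     grade = (\<lambda>b. {v. \<forall>x. x \<notin> (if b = 0 then hvec ` {-1..iota m t} else gvec ` {1..m})
                          \<longrightarrow> v x = 0}),
     bracket = (\<lambda>v w. \<Sum>x\<in>G_basis m t. \<Sum>y\<in>G_basis m t.
                  fscale (v x * w y) (G_basis_bracket x y))\<rparr>"

lemma G_basis_card:
  assumes "\<forall>i\<in>{1..m}. t i > 0"
  shows "card (G_basis m t) = (\<Sum>i=1..m. t i) + 2"
proof -
  have "(\<Sum>i=1..m. 1) \<le> (\<Sum>i=1..m. t i)"
    using assms by (intro sum_mono) (simp add: Suc_leI)
  then have "m \<le> (\<Sum>i=1..m. t i)" by simp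
  moreover have "card (G_basis m t) = card {-1..iota m t} + card {1..m}"
    unfolding G_basis_def
    by (subst card_Un_disjoint) (auto simp: card_image inj_on_def)
  ultimately show ?thesis
    by (simp add: iota_def flip: of_nat_sum)
qed

lemma G_bracket_single:
  assumes "x \<in> G_basis m t" "y \<in> G_basis m t"
  shows "bracket (G_alg m t) (single x) (single y) = (G_basis_bracket x y :: gbasis \<Rightarrow> 'k::field)"
proof -
  have fin: "finite (G_basis m t)" by (simp add: G_basis_def)
  have s0: "fscale (0::'k) a = 0" for a :: "gbasis \<Rightarrow> 'k" by (simp add: fscale_def fun_eq_iff)
  have s1: "fscale (1::'k) a = a" for a :: "gbasis \<Rightarrow> 'k" by (simp add: fscale_def fun_eq_iff)
  have "(\<Sum>x'\<in>G_basis m t. \<Sum>y'\<in>G_basis m t.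
          fscale (single x x' * single y y' :: 'k) (G_basis_bracket x' y')) =
        (\<Sum>x'\<in>G_basis m t. \<Sum>y'\<in>G_basis m t.
          if y' = y then (if x' = x then G_basis_bracket x y else 0) else 0)"
    by (intro sum.cong refl) (auto simp: single_def s0 s1)
  also have "\<dots> = G_basis_bracket x y"
    using fin assms by (simp add: sum.delta)
  finally show ?thesis by (simp add: G_alg_def)
qed

lemma G_bracket_formula:
  fixes v w :: "gbasis \<Rightarrow> 'k::field"
  assumes "\<forall>i\<in>{1..m}. t i > 0"
  shows "bracket (G_alg m t) v w =
    (\<lambda>z. case z of hvec i \<Rightarrow> 0
       | gvec j \<Rightarrow> if j \<in> {1..m} then 2 * (v (gvec j) * w (hvec 0) - v (hvec 0) * w (gvec j)) else 0)"
proof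
  fix z
  have "(\<Sum>i=1..m. 1) \<le> (\<Sum>i=1..m. t i)"
    using assms by (intro sum_mono) (simp add: Suc_leI)
  then have iota: "iota m t \<ge> 0" by (simp add: iota_def flip: of_nat_sum)
  have s: "(\<Sum>x\<in>G_basis m t. f x) = (\<Sum>i\<in>{-1..iota m t}. f (hvec i)) + (\<Sum>j\<in>{1..m}. f (gvec j))"
    for f :: "gbasis \<Rightarrow> 'k"
    unfolding G_basis_def
    by (subst sum.union_disjoint) (auto simp: sum.reindex inj_on_def)
  have p:
    "fscale (v (hvec i) * w (gvec j)) (G_basis_bracket (hvec i) (gvec j)) z =
      (if i = 0 then (if gvec j = z then - 2 * (v (hvec 0) * w (gvec j)) else 0) else 0)"
    "fscale (v (gvec j) * w (hvec i)) (G_basis_bracket (gvec j) (hvec i)) z =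
      (if i = 0 then (if gvec j = z then 2 * (v (gvec j) * w (hvec 0)) else 0) else 0)"
    "fscale (v (hvec i) * w (hvec k)) (G_basis_bracket (hvec i) (hvec k)) z = 0"
    "fscale (v (gvec j) * w (gvec l)) (G_basis_bracket (gvec j) (gvec l)) z = 0" for i j k l
    by (auto simp: fscale_def single_def)
  have "bracket (G_alg m t) v w z =
    (\<Sum>i\<in>{-1..iota m t}. \<Sum>j\<in>{1..m}.
       if i = 0 then (if gvec j = z then - 2 * (v (hvec 0) * w (gvec j)) else 0) else 0) +
    (\<Sum>j\<in>{1..m}. \<Sum>i\<in>{-1..iota m t}.
       if i = 0 then (if gvec j = z then 2 * (v (gvec j) * w (hvec 0)) else 0) else 0)"
    by (simp add: G_alg_def sum_fun_apply s p del: G_basis_bracket.simps)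
  also have "\<dots> = (\<Sum>j\<in>{1..m}. if gvec j = z then - 2 * (v (hvec 0) * w (gvec j)) else 0) +
      (\<Sum>j\<in>{1..m}. if gvec j = z then 2 * (v (gvec j) * w (hvec 0)) else 0)"
    using iota by (subst sum.swap) simp
  also have "\<dots> = (case z of hvec i \<Rightarrow> 0
       | gvec j \<Rightarrow> if j \<in> {1..m} then 2 * (v (gvec j) * w (hvec 0) - v (hvec 0) * w (gvec j)) else 0)"
    by (cases z) (auto simp: algebra_simps)
  finally show "bracket (G_alg m t) v w z = \<dots>" .
qed

lemma all_gbasis: "(\<forall>x. P x) \<longleftrightarrow> (\<forall>i. P (hvec i)) \<and> (\<forall>j. P (gvec j))"
proof (intro iffI allI)
  fix x assume "(\<forall>i. P (hvec i)) \<and> (\<forall>j. P (gvec j))"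
  then show "P x" by (cases x) auto
qed auto

lemma G_lie_superalgebra:
  assumes t: "\<forall>i\<in>{1..m}. t i > 0"
  shows "lie_superalgebra (G_alg m t :: ('k::field, gbasis \<Rightarrow> 'k) lie_super)"
proof -
  let ?G = "G_alg m t :: ('k, gbasis \<Rightarrow> 'k) lie_super"
  note br = G_bracket_formula[OF t]
  note sel = G_alg_def G_basis_def
  have carr: "v \<in> carr ?G \<longleftrightarrow> (\<forall>i. i \<notin> {-1..iota m t} \<longrightarrow> v (hvec i) = 0) \<and>
      (\<forall>j. j \<notin> {1..m} \<longrightarrow> v (gvec j) = 0)" for v
  proof -
    show ?thesis unfolding sel by (auto simp: all_gbasis image_iff)
  qed
  have grade: "v \<in> grade ?G b \<longleftrightarrow> v \<in> carr ?G \<and>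
      (if b = 0 then \<forall>j. v (gvec j) = 0 else \<forall>i. v (hvec i) = 0)" for v b
  proof -
    show ?thesis unfolding carr by (auto simp: sel all_gbasis image_iff)
  qed
  have ops: "vzero ?G = 0" "vadd ?G = (+)" "vscale ?G = fscale" by (simp_all add: G_alg_def)
  have "superspace ?G"
  proof
    fix x assume x: "x \<in> carr ?G"
    let ?y = "\<lambda>b. case b of hvec i \<Rightarrow> x b | gvec j \<Rightarrow> 0"
    let ?z = "\<lambda>b. case b of hvec i \<Rightarrow> 0 | gvec j \<Rightarrow> x b"
    show "\<exists>!(y, z). y \<in> grade ?G 0 \<and> z \<in> grade ?G 1 \<and> x = vadd ?G y z"
    proof (rule ex1I[of _ "(?y, ?z)"])
      show "case (?y, ?z) of (y, z) \<Rightarrow> y \<in> grade ?G 0 \<and> z \<in> grade ?G 1 \<and> x = vadd ?G y z"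
        using x by (auto simp: grade carr ops fun_eq_iff split: gbasis.splits)
    next
      fix q assume "case q of (y, z) \<Rightarrow> y \<in> grade ?G 0 \<and> z \<in> grade ?G 1 \<and> x = vadd ?G y z"
      then show "q = (?y, ?z)"
        by (cases q) (auto simp: grade carr ops fun_eq_iff split: gbasis.splits)
    qed
  qed (auto simp: vsubspace_def grade carr ops fscale_def fun_eq_iff algebra_simps)
  then show ?thesis
  proof (rule lie_superalgebra.intro)
    show "lie_superalgebra_axioms ?G"
    proof
      fix x y b c assume xy: "x \<in> grade ?G b" "y \<in> grade ?G c"
      then show "bracket ?G x y \<in> grade ?G (b + c)"
        by (cases b; cases c) (auto simp: grade carr br)
      show "bracket ?G x y = vscale ?G (- psign (b * c)) (bracket ?G y x)"
      proof
        fix q show "bracket ?G x y q = vscale ?G (- psign (b * c)) (bracket ?G y x) q"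
          using xy by (cases q; cases b; cases c) (simp_all add: grade br ops psign_def fscale_def algebra_simps)
      qed
      fix z assume "z \<in> carr ?G"
      show "bracket ?G x (bracket ?G y z) = vadd ?G (bracket ?G (bracket ?G x y) z)
              (vscale ?G (psign (b * c)) (bracket ?G y (bracket ?G x z)))"
      proof
        fix q
        show "bracket ?G x (bracket ?G y z) q = vadd ?G (bracket ?G (bracket ?G x y) z)
              (vscale ?G (psign (b * c)) (bracket ?G y (bracket ?G x z))) q"
          using xy by (cases q; cases b; cases c) (simp_all add: grade br ops psign_def fscale_def algebra_simps)
      qed
    qed (simp_all add: carr br ops fscale_def fun_eq_iff algebra_simps split: gbasis.split)
  qed
qed

end

theory Submission
  imports Defs
begin

text \<open>The elements of \<open>SHO\<close> are the \<open>T_H a\<close> with \<open>a\<close> in the kernel \<open>K\<close> of the odd Laplacian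
  \<open>Dl = \<Sum>\<^sub>i \<partial>\<^sub>i \<partial>\<^sub>i\<^sub>'\<close>, and the deviation of \<open>Dl\<close> from being a derivation is the Buttin bracket
  \<open>T a b\<close>, so that superderivations of \<open>SHO\<close> become maps of \<open>K\<close> that are derivations of this bracket modulo
  constants. Superderivations of the superalgebra supercommuting with \<open>Dl\<close> up to a scalar give such maps, and
  the outer ones among them are bracketing with \<open>x\<^sub>1 x\<^sub>1\<^sub>'\<close>, the degree, \<open>\<partial>\<^sub>k^(p^s)\<close> for \<open>1 \<le> s < t\<^sub>k\<close>,
  and \<open>x^(\<pi>\<^sub>j \<epsilon>\<^sub>j) \<partial>\<^sub>j\<^sub>'\<close>. Conversely, by a Poincare lemma the values of a superderivation on the variables are those
  of an inner one plus a combination of the first, second and fourth kind. What remains kills the variables;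
  after the elements \<open>x\<^sub>j x\<^sub>j\<^sub>' - x\<^sub>k x\<^sub>k\<^sub>'\<close> are made to be killed too, it preserves weights modulo \<open>p\<close>, and its linear coefficients
  vanish on \<open>K\<close> once the \<open>\<partial>\<^sub>k^(p^s)\<close> are subtracted; then it is zero by induction on the degree. Hence the
  outer derivations have the stated basis, and the Lie superalgebra axioms are transported from \<open>G\<close>.\<close>

text \<open>These two simplification rules would hide the additive structure of parities.\<close>

declare add_bit_eq_xor [simp del] mult_bit_eq_and [simp del]

section \<open>Binomial coefficients modulo a prime\<close>

text \<open>Each kind of outer map marks a place where a classical argument breaks down modulo p or
  modulo constants. The Poincare lemma fails exactly at \<open>x_j^(p^(t_j) - 1)\<close>; bracketing
  with the missing \<open>x_j^(p^(t_j))\<close> would be this power times the derivative in the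
  conjugate variable, an odd outer map. Since potentials are defined only up to constants, the
  one-form of values on the variables is closed only up to one constant, corrected by the degree,
  and the potential found has a constant Laplacian, corrected by bracketing with
  \<open>x_1 x_1'\<close>. The monomials \<open>x_l x_k^(p^s)\<close> escape because the binomial
  coefficients needed to split \<open>x_k^(p^s)\<close> vanish modulo p; the p^s-th powers of
  derivatives detect them. The relation \<open>[h_0, g_j] = -2 g_j\<close> is a degree count:
  multiplying by a power of degree -1 modulo p and differentiating once changes the degree by -2.
  The condition m > 3 leaves a quadratic term without some index other than l; weights are told
  apart by inverting 2 and 3.\<close>

lemma prime_dvd_choose_power:
  fixes p :: nat
  assumes p: "prime p" and k: "0 < k" "k < p ^ s"
  shows "p dvd (p ^ s choose k)"
proof (rule ccontr)
  assume "\<not> p dvd (p ^ s choose k)"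
  then have "coprime (p ^ s) (p ^ s choose k)"
    using p by (metis coprime_power_left_iff prime_imp_coprime)
  moreover have "p ^ s dvd k * (p ^ s choose k)"
    using times_binomial_minus1_eq[OF k(1), of "p ^ s"] by simp
  ultimately have "p ^ s dvd k" by (simp add: coprime_dvd_mult_left_iff)
  then show False using k dvd_imp_le by fastforce
qed

text \<open>Write a + b = p^s + r; then r < a because b < p^s. In the Vandermonde sum the term k = 0
  is (r choose a) = 0, and every other term contains (p^s choose k) with 0 < k < p^s. This is why
  the truncated divided powers are closed under multiplication.\<close>

lemma prime_dvd_choose_carry:
  fixes p :: nat
  assumes p: "prime p" and ab: "a < p ^ s" "b < p ^ s" "p ^ s \<le> a + b"
  shows "p dvd (a + b choose a)"
proof -
  obtain r where r: "a + b = p ^ s + r" using ab(3) le_Suc_ex by blast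
  have "p dvd (\<Sum>k\<le>a. (p ^ s choose k) * (r choose (a - k)))"
  proof (intro dvd_sum)
    fix k assume "k \<in> {..a}"
    show "p dvd (p ^ s choose k) * (r choose (a - k))"
    proof (cases "k = 0")
      case True
      then show ?thesis using ab r by (simp add: binomial_eq_0)
    next
      case False
      then show ?thesis using prime_dvd_choose_power[OF p, of k s] ab \<open>k \<in> {..a}\<close> by auto
    qed
  qed
  then show ?thesis unfolding r vandermonde .
qed

text \<open>A case of Lucas' congruence: in the Vandermonde sum for p^s + p^s r only the two end
  terms survive modulo p, so raising r by one raises the binomial coefficient by one.\<close>

lemma choose_multiple_cong:
  fixes p :: nat
  assumes p: "prime p"
  shows "(p ^ s * r choose p ^ s) mod p = r mod p"
proof (induction r)
  case 0
  then show ?case using p by (simp add: prime_gt_0_nat binomial_eq_0)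
next
  case (Suc r)
  let ?q = "p ^ s"
  have q: "?q > 0" using p by (simp add: prime_gt_0_nat)
  have "(?q * Suc r choose ?q) = (\<Sum>k\<le>?q. (?q choose k) * (?q * r choose (?q - k)))"
    unfolding vandermonde by simp
  also have "\<dots> = (\<Sum>k\<in>{0, ?q}. (?q choose k) * (?q * r choose (?q - k)))
      + (\<Sum>k\<in>{0<..<?q}. (?q choose k) * (?q * r choose (?q - k)))"
  proof -
    have un: "{..?q} = {0, ?q} \<union> {0<..<?q}" using q by auto
    have disj: "{0, ?q} \<inter> {0<..<?q} = {}" by auto
    show ?thesis unfolding un by (rule sum.union_disjoint[OF _ _ disj]) simp_all
  qed
  also have "(\<Sum>k\<in>{0, ?q}. (?q choose k) * (?q * r choose (?q - k))) = (?q * r choose ?q) + 1"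
    using q by (subst sum.insert) auto
  finally have "(?q * Suc r choose ?q) =
    (?q * r choose ?q) + 1 + (\<Sum>k\<in>{0<..<?q}. (?q choose k) * (?q * r choose (?q - k)))" .
  moreover have "p dvd (\<Sum>k\<in>{0<..<?q}. (?q choose k) * (?q * r choose (?q - k)))"
    by (intro dvd_sum) (simp add: prime_dvd_choose_power[OF p])
  ultimately have "(?q * Suc r choose ?q) mod p = ((?q * r choose ?q) + 1) mod p"
    by (elim dvdE) (simp only: mod_mult_self2)
  also have "\<dots> = Suc r mod p" using Suc mod_Suc_eq[of "?q * r choose ?q" p] mod_Suc_eq[of r p] by simp
  finally show ?case .
qed

lemma psign_of_nat: "psign (of_nat n) = ((- 1) ^ n :: 'k::field)"
proof (induction n)
  case (Suc n)
  have "psign (1 + b) = (- psign b :: 'k)" for b by (cases b) (simp_all add: psign_def)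
  then show ?case using Suc by simp
qed (simp add: psign_def)

lemma psign_add: "psign (a + b) = (psign a * psign b :: 'k::field)"
  by (cases a; cases b) (simp_all add: psign_def)

lemma psign_square [simp]: "psign a * psign a = (1 :: 'k::field)"
  by (auto simp: psign_def)

lemma psign_zero [simp]: "psign 0 = (1 :: 'k::field)"
  and psign_one [simp]: "psign 1 = (- 1 :: 'k::field)"
  by (auto simp: psign_def)

lemma psign_nonzero [simp]: "psign a \<noteq> (0 :: 'k::field)"
  by (auto simp: psign_def)

lemma bit_add_self [simp]: "(b :: bit) + b = 0" "b + (b + c) = (c :: bit)"
  by (cases b; cases c; simp)+

section \<open>The superalgebra\<close>

lemma fscale_apply [simp]: "fscale c f x = c * f x" by (simp add: fscale_def)

lemma fscale_simps [simp]:
  "fscale 1 f = (f :: 'x \<Rightarrow> 'k::field)" "fscale 0 f = (0 :: 'x \<Rightarrow> 'k)" "fscale c (0 :: 'x \<Rightarrow> 'k) = 0"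
  "fscale c (fscale d f) = fscale (c * d) f"
  by (auto simp: fun_eq_iff)

lemma fscale_add: "fscale c (f + g) = fscale c f + (fscale c g :: 'x \<Rightarrow> 'k::field)"
  and fscale_diff: "fscale c (f - g) = fscale c f - (fscale c g :: 'x \<Rightarrow> 'k::field)"
  and fscale_minus: "fscale c (- f) = - (fscale c f :: 'x \<Rightarrow> 'k::field)"
  and fscale_add_left: "fscale (c + d) f = fscale c f + (fscale d f :: 'x \<Rightarrow> 'k::field)"
  and fscale_minus_left: "fscale (- c) f = - (fscale c f :: 'x \<Rightarrow> 'k::field)"
  and fscale_sum: "fscale c (sum F A) = (\<Sum>x\<in>A. fscale c (F x) :: 'x \<Rightarrow> 'k::field)"
  by (auto simp: fun_eq_iff algebra_simps sum_fun_apply sum_distrib_left)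

lemma single_apply: "single x z = (if z = x then 1 else 0)" by (simp add: single_def)

text \<open>Linearity is required on the whole function space, so that it carries no membership
  conditions; support in \<open>M\<close> enters only when two such maps are compared on the basis
  monomials.\<close>

definition lin :: "(('x \<Rightarrow> 'k::field) \<Rightarrow> ('y \<Rightarrow> 'k)) \<Rightarrow> bool" where
  "lin F \<longleftrightarrow> (\<forall>f g. F (f + g) = F f + F g) \<and> (\<forall>c f. F (fscale c f) = fscale c (F f))"

lemma
  assumes "lin F"
  shows lin_add: "F (f + g) = F f + F g" and lin_scale: "F (fscale c f) = fscale c (F f)"
    and lin_zero: "F 0 = 0" and lin_minus: "F (- f) = - F f" and lin_diff: "F (f - g) = F f - F g"
    and lin_sum: "F (\<Sum>i\<in>A. h i) = (\<Sum>i\<in>A. F (h i))"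
proof -
  show add: "F (f + g) = F f + F g" for f g using assms by (simp add: lin_def)
  show sc: "F (fscale c f) = fscale c (F f)" for c f using assms by (simp add: lin_def)
  show z: "F 0 = 0" using sc[of 0 0] by simp
  show mi: "F (- f) = - F f" for f
    using sc[of "-1" f] by (simp add: fscale_minus_left)
  show "F (f - g) = F f - F g" using add[of f "- g"] mi by simp
  show "F (\<Sum>i\<in>A. h i) = (\<Sum>i\<in>A. F (h i))"
    by (induction A rule: infinite_finite_induct) (simp_all only: sum.insert sum.infinite sum.empty z add not_False_eq_True)
qed

lemma lin_comp: "lin F \<Longrightarrow> lin G \<Longrightarrow> lin (\<lambda>f. F (G f))"
  by (simp add: lin_def)

lemma lin_plus: "lin F \<Longrightarrow> lin G \<Longrightarrow> lin (\<lambda>f. F f + G f)"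
  by (simp add: lin_def fscale_add algebra_simps)

lemma lin_fscale: "lin F \<Longrightarrow> lin (\<lambda>f. fscale c (F f))"
  by (simp add: lin_def fscale_add mult.commute)

lemma lin_sumI: "(\<And>i. i \<in> A \<Longrightarrow> lin (F i)) \<Longrightarrow> lin (\<lambda>f. \<Sum>i\<in>A. F i f)"
  by (simp add: lin_def sum.distrib fscale_sum)

lemma lin_id: "lin (\<lambda>f. f)" by (simp add: lin_def)

definition madd :: "mono \<Rightarrow> mono \<Rightarrow> mono" where
  "madd x y = (\<lambda>i. fst x i + fst y i, snd x \<union> snd y)"

definition mcoeff :: "nat \<Rightarrow> mono \<Rightarrow> mono \<Rightarrow> 'k::field" where
  "mcoeff m x y = (if snd x \<inter> snd y = {} then
     (- 1) ^ card {(i, j). i \<in> snd x \<and> j \<in> snd y \<and> j < i} *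
     (\<Prod>i=1..m. of_nat ((fst x i + fst y i) choose fst x i)) else 0)"

lemma mono_mult_eq: "mono_mult m x y = fscale (mcoeff m x y) (single (madd x y))"
  by (cases x; cases y) (simp add: mono_mult_def mcoeff_def madd_def)

text \<open>The parameter \<open>ty\<close> only carries the type of the coefficients.\<close>

locale sho =
  fixes m :: nat and t :: "nat \<Rightarrow> nat" and p :: nat and M :: "mono set" and ty :: "'k::field itself"
  assumes p_eq: "p = CHAR('k)" and M_eq: "M = mono_set p m t" and char: "p > 3" and m3: "m > 3" and tpos: "\<forall>i\<in>{1..m}. t i > 0"
begin

definition Osp :: "(mono \<Rightarrow> 'k) set" where "Osp = {a. \<forall>x. x \<notin> M \<longrightarrow> a x = 0}"
definition d :: "nat \<Rightarrow> (mono \<Rightarrow> 'k) \<Rightarrow> mono \<Rightarrow> 'k" where "d = opartial m t"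
definition mul :: "(mono \<Rightarrow> 'k) \<Rightarrow> (mono \<Rightarrow> 'k) \<Rightarrow> mono \<Rightarrow> 'k" (infixl "\<odot>" 70) where
  "mul = omult m t"
text \<open>The parity automorphism. Writing signs through it lets most identities be stated without
  splitting into homogeneous parts.\<close>

definition sg :: "(mono \<Rightarrow> 'k) \<Rightarrow> mono \<Rightarrow> 'k" where
  "sg f = (\<lambda>x. (- 1) ^ card (snd x) * f x)"
definition "one = (single (\<lambda>i. 0, {}) :: mono \<Rightarrow> 'k)"
definition Gr :: "bit \<Rightarrow> (mono \<Rightarrow> 'k) set" where
  "Gr b = {a \<in> Osp. \<forall>x. of_nat (card (snd x)) \<noteq> b \<longrightarrow> a x = 0}"

lemma MM: "mono_set CHAR('k) m t = M" by (simp add: M_eq p_eq)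

lemma O_carr: "carr (O_alg m t :: ('k, mono \<Rightarrow> 'k) superspace) = Osp"
  by (simp add: O_alg_def Osp_def MM)

lemma O_grade: "grade (O_alg m t :: ('k, mono \<Rightarrow> 'k) superspace) b = Gr b"
  by (auto simp: O_alg_def Gr_def Osp_def MM)

lemma prime_p: "prime p" using char prime_CHAR_semidom[where 'a='k] by (simp add: p_eq)

lemma p_pow_ge: "i \<in> {1..m} \<Longrightarrow> p ^ t i \<ge> p"
  using tpos prime_p by (metis prime_gt_0_nat self_le_power One_nat_def Suc_leI)

lemma finite_M [simp]: "finite M" unfolding M_eq by (rule mono_set_finite)

lemma M_iff: "(\<alpha>, u) \<in> M \<longleftrightarrow> (\<forall>i. i \<notin> {1..m} \<longrightarrow> \<alpha> i = 0) \<and>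
    (\<forall>i\<in>{1..m}. \<alpha> i < p ^ t i) \<and> u \<subseteq> {m+1..2*m}"
proof -
  have "p ^ t i > 0" for i using prime_p by (simp add: prime_gt_0_nat)
  then have "\<alpha> i \<le> p ^ t i - 1 \<longleftrightarrow> \<alpha> i < p ^ t i" for i by (metis Suc_pred' less_Suc_eq_le)
  then show ?thesis by (simp add: mono_set_def M_eq)
qed

lemma finite_odd: "(\<alpha>, u) \<in> M \<Longrightarrow> finite u"
  by (auto simp: M_iff intro: finite_subset)

lemma of_nat_p_dvd: "p dvd n \<Longrightarrow> of_nat n = (0::'k)"
  by (simp add: of_nat_eq_0_iff_char_dvd p_eq)

text \<open>A product monomial leaves \<open>M\<close> only if some exponent overflows, and then the
  addition of the two exponents has a carry that makes its binomial coefficient vanish.\<close>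

lemma mcoeff_outside:
  assumes "x \<in> M" "y \<in> M" "madd x y \<notin> M" shows "mcoeff m x y = (0::'k)"
proof -
  obtain \<alpha> u \<beta> v where [simp]: "x = (\<alpha>, u)" "y = (\<beta>, v)" by (cases x; cases y)
  obtain i where i: "i \<in> {1..m}" "p ^ t i \<le> \<alpha> i + \<beta> i" "\<alpha> i < p ^ t i" "\<beta> i < p ^ t i"
    using assms by (fastforce simp: M_iff madd_def not_less)
  then have "of_nat (\<alpha> i + \<beta> i choose \<alpha> i) = (0::'k)"
    by (intro of_nat_p_dvd prime_dvd_choose_carry[OF prime_p])
  then have "(\<Prod>i=1..m. of_nat ((\<alpha> i + \<beta> i) choose \<alpha> i)) = (0::'k)" using i(1) by auto
  then show ?thesis by (simp add: mcoeff_def)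
qed

lemma O_zero: "0 \<in> Osp" and O_add: "f \<in> Osp \<Longrightarrow> g \<in> Osp \<Longrightarrow> f + g \<in> Osp"
  and O_diff: "f \<in> Osp \<Longrightarrow> g \<in> Osp \<Longrightarrow> f - g \<in> Osp"
  and O_minus: "f \<in> Osp \<Longrightarrow> - f \<in> Osp"
  and O_scale: "f \<in> Osp \<Longrightarrow> fscale c f \<in> Osp"
  and O_sum: "(\<And>i. i \<in> A \<Longrightarrow> F i \<in> Osp) \<Longrightarrow> sum F A \<in> Osp"
  and O_single: "x \<in> M \<Longrightarrow> single x \<in> Osp"
  and O_sg: "f \<in> Osp \<Longrightarrow> sg f \<in> Osp"
  by (auto simp: Osp_def sum_fun_apply single_def sg_def intro: sum.neutral)

lemma one_M: "(\<lambda>i. 0, {}) \<in> M" using prime_p by (auto simp: M_iff prime_gt_0_nat)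

lemma O_one: "one \<in> Osp" by (simp add: one_def O_single one_M)

lemma d_single: "x \<in> M \<Longrightarrow> d r (single x) = mono_partial m r x"
  unfolding d_def by (rule opartial_single) (simp add: MM)

lemma lin_d: "lin (d r)"
  by (auto simp: lin_def d_def opartial_def fun_eq_iff sum_fun_apply algebra_simps sum.distrib sum_distrib_left)

lemma lin_mul_left: "lin (\<lambda>f. f \<odot> g)"
  by (auto simp: lin_def mul_def omult_def fun_eq_iff sum_fun_apply algebra_simps sum.distrib sum_distrib_left)

lemma lin_mul_right: "lin (\<lambda>g. f \<odot> g)"
  by (auto simp: lin_def mul_def omult_def fun_eq_iff sum_fun_apply algebra_simps sum.distrib sum_distrib_left)

lemma lin_sg: "lin sg"
  by (auto simp: lin_def sg_def fun_eq_iff algebra_simps)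

lemma mul_single:
  assumes "x \<in> M" "y \<in> M" shows "single x \<odot> single y = fscale (mcoeff m x y) (single (madd x y))"
proof -
  have "single x \<odot> single y = (\<Sum>x'\<in>M. \<Sum>y'\<in>M.
     if y' = y then (if x' = x then mono_mult m x y else 0) else 0)"
    unfolding mul_def omult_def MM by (intro sum.cong refl) (auto simp: single_def)
  also have "\<dots> = mono_mult m x y" using assms by (simp add: sum.delta)
  finally show ?thesis by (simp add: mono_mult_eq)
qed

lemma lin_ext:
  assumes F: "lin F" and G: "lin G" and s: "\<And>x. x \<in> M \<Longrightarrow> F (single x) = G (single x)" and f: "f \<in> Osp"
  shows "F f = G f"
proof -
  have f: "f = (\<Sum>x\<in>M. fscale (f x) (single x))"
    using single_combination[of f m t] f by (simp add: O_carr MM)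
  show ?thesis
    by (subst (1 2) f) (simp add: lin_sum[OF F] lin_sum[OF G] lin_scale[OF F] lin_scale[OF G] s cong: sum.cong)
qed

lemma O_decomp: "f \<in> Osp \<Longrightarrow> f = (\<Sum>x\<in>M. fscale (f x) (single x))"
  using single_combination[of f m t] by (simp add: O_carr MM)

lemma lin_closed:
  assumes F: "lin F" and s: "\<And>x. x \<in> M \<Longrightarrow> F (single x) \<in> Osp" and f: "f \<in> Osp"
  shows "F f \<in> Osp"
  by (subst O_decomp[OF f]) (auto simp: lin_sum[OF F] lin_scale[OF F] intro!: O_sum O_scale s)

lemma O_mul [intro]: "f \<in> Osp \<Longrightarrow> g \<in> Osp \<Longrightarrow> f \<odot> g \<in> Osp"
proof (rule lin_closed[OF lin_mul_left])
  fix x assume x: "x \<in> M" and g: "g \<in> Osp"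
  show "single x \<odot> g \<in> Osp"
  proof (rule lin_closed[OF lin_mul_right _ g])
    fix y assume y: "y \<in> M"
    show "single x \<odot> single y \<in> Osp"
      using mcoeff_outside[OF x y] by (cases "madd x y \<in> M") (auto simp: mul_single x y O_zero intro!: O_scale O_single)
  qed
qed auto

section \<open>Partial derivatives read off on coefficients\<close>

lemma d_even:
  assumes r: "r \<in> {1..m}" and f: "f \<in> Osp"
  shows "d r f (\<alpha>, u) = f (\<alpha>(r := Suc (\<alpha> r)), u)"
proof (cases "(\<alpha>(r := Suc (\<alpha> r)), u) \<in> M")
  case True
  have "f x * mono_partial m r x (\<alpha>, u) = (if x = (\<alpha>(r := Suc (\<alpha> r)), u) then f x else 0)" for x
    using r by (cases x) (auto simp: mono_partial_def single_def)
  then show ?thesis unfolding d_def opartial_def MM using True by (simp add: sum_fun_apply)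
next
  case False
  have "f x * mono_partial m r x (\<alpha>, u) = 0" if "x \<in> M" for x
    using r that False by (cases x) (auto simp: mono_partial_def single_def)
  then have "(\<Sum>x\<in>M. f x * mono_partial m r x (\<alpha>, u)) = 0" by (rule sum.neutral[OF ballI])
  then show ?thesis unfolding d_def opartial_def MM using False f by (auto simp: sum_fun_apply Osp_def)
qed

lemma d_odd:
  assumes r: "r \<in> {m+1..2*m}" and f: "f \<in> Osp"
  shows "d r f (\<alpha>, u) = (if r \<in> u then 0 else (- 1) ^ card {i\<in>u. i < r} * f (\<alpha>, insert r u))"
proof (cases "(\<alpha>, insert r u) \<in> M \<and> r \<notin> u")
  case True
  have c: "{i. (i = r \<or> i \<in> u) \<and> i < r} = {i \<in> u. i < r}" by auto
  have "f x * mono_partial m r x (\<alpha>, u) = 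
    (if x = (\<alpha>, insert r u) then (- 1) ^ card {i\<in>u. i < r} * f x else 0)" for x
    using r True by (cases x) (auto simp: mono_partial_def single_def c)
  then show ?thesis unfolding d_def opartial_def MM using True by (simp add: sum_fun_apply)
next
  case False
  have "f x * mono_partial m r x (\<alpha>, u) = 0" if "x \<in> M" for x
    using r that False by (cases x) (auto simp: mono_partial_def single_def insert_absorb)
  then have "(\<Sum>x\<in>M. f x * mono_partial m r x (\<alpha>, u)) = 0" by (rule sum.neutral[OF ballI])
  then show ?thesis unfolding d_def opartial_def MM using False f by (auto simp: sum_fun_apply Osp_def)
qed

lemma O_d [intro]:
  assumes "f \<in> Osp" shows "d r f \<in> Osp"
proof (rule lin_closed[OF lin_d _ assms])
  fix x assume x: "x \<in> M"
  obtain \<alpha> u where [simp]: "x = (\<alpha>, u)" by (cases x)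
  have "(\<alpha>(r := \<alpha> r - 1), u) \<in> M" "(\<alpha>, u - {r}) \<in> M"
    using x by (auto simp: M_iff less_imp_diff_less)
  then show "d r (single x) \<in> Osp"
    unfolding d_single[OF x] by (auto simp: mono_partial_def O_zero intro!: O_scale O_single)
qed

end

section \<open>Signs and binomial factors of monomial products\<close>

lemma card_lt_insert:
  assumes "finite u" "s \<notin> u"
  shows "card {i \<in> insert s u. i < r} = (if s < r then Suc (card {i\<in>u. i < r}) else card {i\<in>u. i < r})"
proof -
  have "{i \<in> insert s u. i < r} = (if s < r then insert s {i\<in>u. i < r} else {i\<in>u. i < r})" by auto
  then show ?thesis using assms by auto
qed

lemma card_inversions_sum:
  assumes "finite u" "finite v"
  shows "card {(i, j). i \<in> u \<and> j \<in> v \<and> j < i} = (\<Sum>i\<in>u. card {j\<in>v. j < i})"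
    and "card {(i, j). i \<in> u \<and> j \<in> v \<and> j < i} = (\<Sum>j\<in>v. card {i\<in>u. j < i})"
proof -
  have "{(i, j). i \<in> u \<and> j \<in> v \<and> j < i} = (SIGMA i:u. {j\<in>v. j < i})" by auto
  then show "card {(i, j). i \<in> u \<and> j \<in> v \<and> j < i} = (\<Sum>i\<in>u. card {j\<in>v. j < i})"
    using assms by (simp add: card_SigmaI)
  have "{(i, j). i \<in> u \<and> j \<in> v \<and> j < i} = prod.swap ` (SIGMA j:v. {i\<in>u. j < i})" by auto
  then show "card {(i, j). i \<in> u \<and> j \<in> v \<and> j < i} = (\<Sum>j\<in>v. card {i\<in>u. j < i})"
    using assms by (simp add: card_SigmaI card_image)
qed

lemma bit_shift: "1 + a = b \<Longrightarrow> a = b + (1::bit)"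
  by (cases a; cases b) simp_all

lemmas card_lt_insert' = card_lt_insert[unfolded insert_iff]

text \<open>The sign of sorting \<open>x^u x^v\<close>. Being multiplicative over disjoint unions in
  each argument, it spares counting inversions in the proofs of associativity and of the Leibniz
  rule.\<close>

definition inv_sign :: "nat set \<Rightarrow> nat set \<Rightarrow> 'k::field" where
  "inv_sign u v = (- 1) ^ card {(i, j). i \<in> u \<and> j \<in> v \<and> j < i}"

lemma inv_sign_empty [simp]: "inv_sign {} v = 1" "inv_sign u {} = 1"
  by (simp_all add: inv_sign_def)

lemma inv_sign_union_left:
  assumes "finite u" "finite v" "finite w" "u \<inter> v = {}"
  shows "inv_sign (u \<union> v) w = (inv_sign u w * inv_sign v w :: 'k::field)"
  using assms by (simp add: inv_sign_def card_inversions_sum(1) sum.union_disjoint power_add del: Un_iff)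

lemma inv_sign_union_right:
  assumes "finite u" "finite v" "finite w" "v \<inter> w = {}"
  shows "inv_sign u (v \<union> w) = (inv_sign u v * inv_sign u w :: 'k::field)"
  using assms by (simp add: inv_sign_def card_inversions_sum(2) sum.union_disjoint power_add del: Un_iff)

text \<open>Each pair from u and v is inverted in exactly one of the two orders, so the two
  inversion counts add up to card u * card v.\<close>

lemma inv_sign_swap:
  assumes "finite u" "finite v" "u \<inter> v = {}"
  shows "inv_sign u v = ((- 1) ^ (card u * card v) * inv_sign v u :: 'k::field)"
proof -
  have "card {(i, j). i \<in> u \<and> j \<in> v \<and> j < i} + card {(j, i). j \<in> v \<and> i \<in> u \<and> i < j}
      = (\<Sum>i\<in>u. card {j\<in>v. j < i} + card {j\<in>v. i < j})"
    using card_inversions_sum(1)[OF assms(1,2)] card_inversions_sum(2)[OF assms(2,1)] by (simp add: sum.distrib)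
  also have "\<dots> = (\<Sum>i\<in>u. card v)"
  proof (rule sum.cong[OF refl])
    fix i assume "i \<in> u"
    then have "{j\<in>v. j < i} \<union> {j\<in>v. i < j} = v" using assms(3) by (auto simp: neq_iff)
    then show "card {j\<in>v. j < i} + card {j\<in>v. i < j} = card v"
      using assms by (subst card_Un_disjoint[symmetric]) auto
  qed
  finally have e: "card u * card v = card {(i, j). i \<in> u \<and> j \<in> v \<and> j < i} + card {(j, i). j \<in> v \<and> i \<in> u \<and> i < j}"
    by simp
  have "(- 1) ^ card {(j, i). j \<in> v \<and> i \<in> u \<and> i < j} * (- 1) ^ card {(j, i). j \<in> v \<and> i \<in> u \<and> i < j} = (1::'k)"
    by (simp flip: power_add add: mult_2[symmetric])
  then show ?thesis unfolding inv_sign_def e power_add by (simp add: mult.assoc)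
qed

lemma inv_sign_single:
  shows "inv_sign {r} v = ((- 1) ^ card {j\<in>v. j < r} :: 'k::field)"
proof -
  have "{(i, j). i \<in> {r} \<and> j \<in> v \<and> j < i} = Pair r ` {j\<in>v. j < r}" by auto
  then show ?thesis by (simp add: inv_sign_def card_image inj_on_def)
qed

lemma inv_sign_square [simp]: "inv_sign u v * inv_sign u v = (1::'k::field)"
  "inv_sign u v * (inv_sign u v * c) = (c::'k)"
proof -
  show "inv_sign u v * inv_sign u v = (1::'k::field)"
    by (simp add: inv_sign_def flip: power_add mult_2)
  then show "inv_sign u v * (inv_sign u v * c) = (c::'k)" by (simp flip: mult.assoc)
qed

definition bprod :: "nat \<Rightarrow> (nat \<Rightarrow> nat) \<Rightarrow> (nat \<Rightarrow> nat) \<Rightarrow> 'k::field" where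
  "bprod m \<alpha> \<beta> = (\<Prod>i=1..m. of_nat ((\<alpha> i + \<beta> i) choose \<alpha> i))"

lemma mcoeff_eq: "mcoeff m (\<alpha>, u) (\<beta>, v) = (if u \<inter> v = {} then inv_sign u v * bprod m \<alpha> \<beta> else 0)"
  by (simp add: mcoeff_def inv_sign_def bprod_def)

text \<open>Both sides are products of trinomial coefficients, factored in the two possible
  ways.\<close>

lemma bprod_assoc:
  "bprod m \<alpha> \<beta> * bprod m (\<lambda>i. \<alpha> i + \<beta> i) \<gamma> = (bprod m \<beta> \<gamma> * bprod m \<alpha> (\<lambda>i. \<beta> i + \<gamma> i) :: 'k::field)"
proof -
  have "((a + b) choose a) * ((a + b + c) choose (a + b)) = ((b + c) choose b) * ((a + (b + c)) choose a)" for a b c :: nat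
    using choose_mult_lemma[of b c a] by (simp add: ac_simps)
  then show ?thesis unfolding bprod_def prod.distrib[symmetric] of_nat_mult[symmetric] by simp
qed

lemma bprod_comm: "bprod m \<alpha> \<beta> = (bprod m \<beta> \<alpha> :: 'k::field)"
proof -
  have "(\<alpha> i + \<beta> i choose \<alpha> i) = (\<beta> i + \<alpha> i choose \<beta> i)" for i
    using binomial_symmetric[of "\<alpha> i" "\<alpha> i + \<beta> i"] by (simp add: add.commute)
  then show ?thesis by (simp add: bprod_def)
qed

lemma bprod_pascal:
  assumes r: "r \<in> {1..m}" and pos: "\<alpha> r + \<beta> r > 0"
  shows "bprod m \<alpha> \<beta> = ((if \<alpha> r = 0 then 0 else bprod m (\<alpha>(r := \<alpha> r - 1)) \<beta>) +
     (if \<beta> r = 0 then 0 else bprod m \<alpha> (\<beta>(r := \<beta> r - 1))) :: 'k::field)"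
proof -
  define R where "R = (\<Prod>i\<in>{1..m} - {r}. of_nat ((\<alpha> i + \<beta> i) choose \<alpha> i) :: 'k)"
  have 1: "bprod m \<alpha> \<beta> = of_nat ((\<alpha> r + \<beta> r) choose \<alpha> r) * R"
    unfolding bprod_def R_def using r by (subst prod.remove[of _ r]) auto
  have 2: "bprod m (\<alpha>(r := \<alpha> r - 1)) \<beta> = of_nat ((\<alpha> r - 1 + \<beta> r) choose (\<alpha> r - 1)) * R"
    unfolding bprod_def R_def using r by (subst prod.remove[of _ r]) (auto intro!: prod.cong)
  have 3: "bprod m \<alpha> (\<beta>(r := \<beta> r - 1)) = of_nat ((\<alpha> r + (\<beta> r - 1)) choose (\<alpha> r)) * R"
    unfolding bprod_def R_def using r by (subst prod.remove[of _ r]) (auto intro!: prod.cong)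
  have "(\<alpha> r + \<beta> r) choose \<alpha> r = (if \<alpha> r = 0 then 0 else ((\<alpha> r - 1 + \<beta> r) choose (\<alpha> r - 1))) +
      (if \<beta> r = 0 then 0 else ((\<alpha> r + (\<beta> r - 1)) choose (\<alpha> r)))"
    using pos by (cases "\<alpha> r"; cases "\<beta> r") auto
  then have "of_nat ((\<alpha> r + \<beta> r) choose \<alpha> r) = 
     ((if \<alpha> r = 0 then 0 else of_nat ((\<alpha> r - 1 + \<beta> r) choose (\<alpha> r - 1))) +
      (if \<beta> r = 0 then 0 else of_nat ((\<alpha> r + (\<beta> r - 1)) choose (\<alpha> r))) :: 'k)"
    by (auto simp flip: of_nat_add)
  then show ?thesis unfolding 1 2 3 by (simp add: distrib_right)
qed

section \<open>Parity, associativity, supercommutativity and the Leibniz rule\<close>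

context sho begin

lemma Gr_Osp: "f \<in> Gr b \<Longrightarrow> f \<in> Osp" by (simp add: Gr_def)

lemma Gr_zero: "0 \<in> Gr b" and Gr_add: "f \<in> Gr b \<Longrightarrow> g \<in> Gr b \<Longrightarrow> f + g \<in> Gr b"
  and Gr_diff: "f \<in> Gr b \<Longrightarrow> g \<in> Gr b \<Longrightarrow> f - g \<in> Gr b"
  and Gr_minus: "f \<in> Gr b \<Longrightarrow> - f \<in> Gr b"
  and Gr_scale: "f \<in> Gr b \<Longrightarrow> fscale c f \<in> Gr b"
  and Gr_sum: "(\<And>i. i \<in> A \<Longrightarrow> F i \<in> Gr b) \<Longrightarrow> sum F A \<in> Gr b"
  and Gr_single: "x \<in> M \<Longrightarrow> of_nat (card (snd x)) = b \<Longrightarrow> single x \<in> Gr b"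
  and Gr_sg: "f \<in> Gr b \<Longrightarrow> sg f \<in> Gr b"
  by (auto simp: Gr_def Osp_def sum_fun_apply single_def sg_def intro: sum.neutral)

lemmas O_closed [simp] = O_zero O_add O_diff O_minus O_scale O_single O_sg O_one O_mul O_d Gr_Osp
lemmas Gr_closed = Gr_zero Gr_add Gr_diff Gr_minus Gr_scale Gr_sum Gr_single Gr_sg

lemma Gr_D: "f \<in> Gr b \<Longrightarrow> f x \<noteq> 0 \<Longrightarrow> of_nat (card (snd x)) = b"
  unfolding Gr_def by blast

lemma sg_Gr: "f \<in> Gr b \<Longrightarrow> sg f = fscale (psign b) f"
proof
  fix x assume f: "f \<in> Gr b"
  show "sg f x = fscale (psign b) f x"
  proof (cases "f x = 0")
    case False
    then have "of_nat (card (snd x)) = b" using f by (simp add: Gr_D)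
    then show ?thesis by (auto simp: sg_def psign_of_nat)
  qed (simp add: sg_def)
qed

lemma sg_sg [simp]: "sg (sg f) = f"
proof
  fix x :: mono
  have "(- 1) ^ card (snd x) * (- 1) ^ card (snd x) = (1::'k)" by (simp flip: power_add mult_2)
  then show "sg (sg f) x = f x" by (simp add: sg_def flip: mult.assoc)
qed

definition part :: "bit \<Rightarrow> (mono \<Rightarrow> 'k) \<Rightarrow> mono \<Rightarrow> 'k" where
  "part b f = (\<lambda>x. if of_nat (card (snd x)) = b then f x else 0)"

lemma part_Gr: "f \<in> Osp \<Longrightarrow> part b f \<in> Gr b" by (simp add: part_def Gr_def Osp_def)
lemma part_sum: "part 0 f + part 1 f = f"
proof
  fix x :: mono
  have "(of_nat (card (snd x)) :: bit) = 0 \<or> (of_nat (card (snd x)) :: bit) = 1"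
    by (cases "of_nat (card (snd x)) :: bit") auto
  then show "(part 0 f + part 1 f) x = f x" by (auto simp: part_def)
qed
lemma Gr_cases: 
  assumes "f \<in> Osp" obtains g h where "g \<in> Gr 0" "h \<in> Gr 1" "f = g + h"
  using part_Gr[OF assms] part_sum by metis

lemma lin_ext_Gr:
  assumes "lin F" "lin G" "\<And>b f. f \<in> Gr b \<Longrightarrow> F f = G f" "f \<in> Osp"
  shows "F f = G f"
  using Gr_cases[OF assms(4)] assms(3) lin_add[OF assms(1)] lin_add[OF assms(2)] by metis

lemma d_out:
  assumes "r \<notin> {1..2*m}" "f \<in> Osp" shows "d r f = 0"
proof -
  have "d r f = (\<lambda>f. 0) f"
  proof (rule lin_ext[OF lin_d _ _ assms(2)])
    fix x assume x: "x \<in> M"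
    obtain \<alpha> u where [simp]: "x = (\<alpha>, u)" by (cases x)
    have "r \<notin> {1..m}" "r \<notin> {m+1..2*m}" "r \<le> m \<Longrightarrow> r = 0" using assms(1) by auto
    then show "d r (single x) = 0"
      using x unfolding d_single[OF x] by (auto simp: mono_partial_def M_iff)
  qed (simp add: lin_def zero_fun_def fun_eq_iff)
  then show ?thesis by (simp add: zero_fun_def)
qed

lemma mu_cases: "r \<in> {1..2*m} \<Longrightarrow> (r \<in> {1..m} \<and> mu m r = 0) \<or> (r \<in> {m+1..2*m} \<and> mu m r = 1)"
  by (auto simp: mu_def)

lemma Gr_d:
  assumes f: "f \<in> Gr b" shows "d r f \<in> Gr (b + mu m r)"
proof (cases "r \<in> {1..2*m}")
  case True
  show ?thesis unfolding Gr_def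
  proof (intro CollectI conjI allI impI)
    show "d r f \<in> Osp" using f by simp
  next
    fix x :: mono assume c: "of_nat (card (snd x)) \<noteq> b + mu m r"
    obtain \<alpha> u where x: "x = (\<alpha>, u)" by (cases x)
    from mu_cases[OF True] show "d r f x = 0"
    proof
      assume "r \<in> {1..m} \<and> mu m r = 0"
      then show ?thesis using f c using Gr_D[OF f, of "(\<alpha>(r := Suc (\<alpha> r)), u)"] by (auto simp: x d_even Gr_Osp)
    next
      assume r: "r \<in> {m+1..2*m} \<and> mu m r = 1"
      have "f (\<alpha>, insert r u) = 0" if "r \<notin> u"
      proof (cases "finite u")
        case True
        then have "of_nat (card (insert r u)) \<noteq> b"
        proof -
          have e: "of_nat (card (insert r u)) = 1 + (of_nat (card u) :: bit)"
            unfolding card_insert_disjoint[OF True that] by (rule of_nat_Suc)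
          have "of_nat (card u) = b + (1::bit)" if "of_nat (card (insert r u)) = b"
            by (rule bit_shift) (rule that[unfolded e])
          moreover have "of_nat (card u) \<noteq> b + (1::bit)"
            using c unfolding x snd_conv conjunct2[OF r] .
          ultimately show ?thesis by blast
        qed
        then show ?thesis using Gr_D[OF f, of "(\<alpha>, insert r u)"] unfolding snd_conv by blast
      next
        case False
        then have "(\<alpha>, insert r u) \<notin> M" using finite_odd by fastforce
        then show ?thesis using f by (simp add: Gr_def Osp_def)
      qed
      then show ?thesis using f r by (simp add: x d_odd Gr_Osp)
    qed
  qed
qed (use f in \<open>simp add: d_out Gr_closed Gr_Osp\<close>)

lemma sg_d: "f \<in> Osp \<Longrightarrow> sg (d r f) = fscale (psign (mu m r)) (d r (sg f))"
proof (rule lin_ext_Gr[of "\<lambda>f. sg (d r f)"])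
  show "sg (d r f) = fscale (psign (mu m r)) (d r (sg f))" if "f \<in> Gr b" for b f
    using that by (simp add: sg_Gr[OF Gr_d[OF that]] sg_Gr[OF that] lin_scale[OF lin_d] psign_add mult.commute)
qed (assumption | rule lin_comp[OF lin_sg lin_d] lin_fscale lin_comp[OF lin_d lin_sg])+

lemma d_commute:
  assumes r: "r \<in> {1..2*m}" and s: "s \<in> {1..2*m}" and f: "f \<in> Osp"
  shows "d r (d s f) = fscale (psign (mu m r * mu m s)) (d s (d r f))"
proof
  fix x :: mono
  obtain \<alpha> u where x: "x = (\<alpha>, u)" by (cases x)
  have O: "d s f \<in> Osp" "d r f \<in> Osp" using f by simp_all
  show "d r (d s f) x = fscale (psign (mu m r * mu m s)) (d s (d r f)) x"
  proof (cases "(r \<in> {m+1..2*m} \<and> mu m r = 1) \<and> (s \<in> {m+1..2*m} \<and> mu m s = 1)")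
    case True
    show ?thesis
    proof (cases "finite u")
      case fin: True
      show ?thesis
        using True O f fin unfolding x fscale_apply
        by (cases "r = s"; cases "r < s") (auto simp: d_odd card_lt_insert' insert_commute)
    next
      case False
      then have "(\<alpha>, insert r (insert s u)) \<notin> M" using finite_odd by fastforce
      then have "f (\<alpha>, insert r (insert s u)) = 0" "f (\<alpha>, insert s (insert r u)) = 0"
        using f by (auto simp: Osp_def insert_commute)
      then show ?thesis using True O f by (auto simp: x d_odd)
    qed
  next
    case False
    then show ?thesis
      using mu_cases[OF r] mu_cases[OF s] O f unfolding x fscale_apply
      by (auto simp: d_odd d_even fun_upd_twist)
  qed
qed

lemma mul_Gr:
  assumes "f \<in> Gr b" "g \<in> Gr c" shows "f \<odot> g \<in> Gr (b + c)"
proof -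
  have f: "f = (\<Sum>x\<in>M. fscale (f x) (single x))" and g: "g = (\<Sum>x\<in>M. fscale (g x) (single x))"
    using assms by (auto intro!: O_decomp Gr_Osp)
  have s: "single x \<odot> single y \<in> Gr (b + c)"
    if "x \<in> M" "y \<in> M" "of_nat (card (snd x)) = b" "of_nat (card (snd y)) = c" for x y
  proof (cases "madd x y \<in> M \<and> snd x \<inter> snd y = {}")
    case True
    have "finite (snd x)" "finite (snd y)" using that finite_odd by (cases x; cases y; simp)+
    then show ?thesis using True that
      by (auto simp: mul_single madd_def card_Un_disjoint intro!: Gr_closed)
  next
    case False
    then have "mcoeff m x y = (0::'k)" using mcoeff_outside[OF that(1,2)] by (auto simp: mcoeff_def)
    then show ?thesis by (simp add: mul_single that Gr_zero)
  qed
  have "fscale (f x) (single x) \<odot> fscale (g y) (single y) \<in> Gr (b + c)" if "x \<in> M" "y \<in> M" for x y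
  proof (cases "f x = 0 \<or> g y = 0")
    case True
    then show ?thesis by (auto simp: lin_zero[OF lin_mul_left] lin_zero[OF lin_mul_right] Gr_zero)
  next
    case False
    then have "of_nat (card (snd x)) = b" "of_nat (card (snd y)) = c" using assms by (auto intro: Gr_D)
    then show ?thesis
      by (simp add: lin_scale[OF lin_mul_left] lin_scale[OF lin_mul_right]) (intro Gr_closed s that; assumption)
  qed
  then show ?thesis
    by (subst f, subst g) (auto simp: lin_sum[OF lin_mul_left] lin_sum[OF lin_mul_right] intro!: Gr_sum)
qed

lemma bilin_ext:
  assumes "\<And>g. lin (\<lambda>f. F f g)" "\<And>f. lin (F f)" "\<And>g. lin (\<lambda>f. G f g)" "\<And>f. lin (G f)"
    and s: "\<And>x y. x \<in> M \<Longrightarrow> y \<in> M \<Longrightarrow> F (single x) (single y) = G (single x) (single y)"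
    and f: "f \<in> Osp" and g: "g \<in> Osp"
  shows "F f g = G f g"
proof (rule lin_ext[OF assms(1,3) _ f])
  show "F (single x) g = G (single x) g" if "x \<in> M" for x
    by (rule lin_ext[OF assms(2,4) s[OF that] g])
qed

lemma trilin_ext:
  assumes "\<And>g h. lin (\<lambda>f. F f g h)" "\<And>f h. lin (\<lambda>g. F f g h)" "\<And>f g. lin (F f g)"
     "\<And>g h. lin (\<lambda>f. G f g h)" "\<And>f h. lin (\<lambda>g. G f g h)" "\<And>f g. lin (G f g)" 
    and s: "\<And>x y z. x \<in> M \<Longrightarrow> y \<in> M \<Longrightarrow> z \<in> M \<Longrightarrow> F (single x) (single y) (single z) = G (single x) (single y) (single z)"
    and f: "f \<in> Osp" and g: "g \<in> Osp" and h: "h \<in> Osp"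
  shows "F f g h = G f g h"
proof (rule lin_ext[OF assms(1,4) _ f])
  show "F (single x) g h = G (single x) g h" if "x \<in> M" for x
    by (rule bilin_ext[OF assms(2,3,5,6) s[OF that] g h])
qed

lemma mul_fscale: "fscale c f \<odot> g = fscale c (f \<odot> g)" "f \<odot> fscale c g = fscale c (f \<odot> g)"
  by (simp_all add: lin_scale[OF lin_mul_left] lin_scale[OF lin_mul_right])

lemma mul_add: "(f + g) \<odot> h = f \<odot> h + g \<odot> h" "h \<odot> (f + g) = h \<odot> f + h \<odot> g"
  "(f - g) \<odot> h = f \<odot> h - g \<odot> h" "h \<odot> (f - g) = h \<odot> f - h \<odot> g"
  "(- f) \<odot> h = - (f \<odot> h)" "h \<odot> (- f) = - (h \<odot> f)" "0 \<odot> h = 0" "h \<odot> 0 = 0"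
  using lin_add[OF lin_mul_left] lin_add[OF lin_mul_right] lin_diff[OF lin_mul_left] lin_diff[OF lin_mul_right]
    lin_minus[OF lin_mul_left] lin_minus[OF lin_mul_right] lin_zero[OF lin_mul_left] lin_zero[OF lin_mul_right]
  by auto

lemma mul_sum: "(\<Sum>i\<in>A. F i) \<odot> h = (\<Sum>i\<in>A. F i \<odot> h)" "h \<odot> (\<Sum>i\<in>A. F i) = (\<Sum>i\<in>A. h \<odot> F i)"
  by (simp_all add: lin_sum[OF lin_mul_left] lin_sum[OF lin_mul_right])

lemma d_linear: "d r (f + g) = d r f + d r g" "d r (f - g) = d r f - d r g" "d r (- f) = - d r f"
  "d r 0 = 0" "d r (fscale c f) = fscale c (d r f)" "d r (\<Sum>i\<in>A. F i) = (\<Sum>i\<in>A. d r (F i))"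
  using lin_add[OF lin_d] lin_diff[OF lin_d] lin_minus[OF lin_d] lin_zero[OF lin_d] lin_scale[OF lin_d] lin_sum[OF lin_d]
  by auto

lemma sg_linear: "sg (f + g) = sg f + sg g" "sg (f - g) = sg f - sg g" "sg (- f) = - sg f"
  "sg 0 = 0" "sg (fscale c f) = fscale c (sg f)" "sg (\<Sum>i\<in>A. F i) = (\<Sum>i\<in>A. sg (F i))"
  using lin_add[OF lin_sg] lin_diff[OF lin_sg] lin_minus[OF lin_sg] lin_zero[OF lin_sg] lin_scale[OF lin_sg] lin_sum[OF lin_sg]
  by auto

lemma mul_assoc:
  assumes "f \<in> Osp" "g \<in> Osp" "h \<in> Osp" shows "(f \<odot> g) \<odot> h = f \<odot> (g \<odot> h)"
proof (rule trilin_ext[of "\<lambda>f g h. (f \<odot> g) \<odot> h" "\<lambda>f g h. f \<odot> (g \<odot> h)", OF _ _ _ _ _ _ _ assms])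
  fix x y z assume M: "x \<in> M" "y \<in> M" "z \<in> M"
  obtain \<alpha> u \<beta> v \<gamma> w where eq: "x = (\<alpha>, u)" "y = (\<beta>, v)" "z = (\<gamma>, w)" by (cases x; cases y; cases z)
  have fin: "finite u" "finite v" "finite w" using M by (auto simp: eq dest: finite_odd)
  have key: "mcoeff m x y * mcoeff m (madd x y) z = (mcoeff m y z * mcoeff m x (madd y z) :: 'k)"
  proof (cases "u \<inter> v = {} \<and> u \<inter> w = {} \<and> v \<inter> w = {}")
    case True
    then have "u \<inter> v = {}" "v \<inter> w = {}" "(u \<union> v) \<inter> w = {}" "u \<inter> (v \<union> w) = {}" by auto
    then have "mcoeff m x y * mcoeff m (madd x y) z = (inv_sign u v * inv_sign u w * inv_sign v w) *
          (bprod m \<alpha> \<beta> * bprod m (\<lambda>i. \<alpha> i + \<beta> i) \<gamma> :: 'k)"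
      "mcoeff m y z * mcoeff m x (madd y z) = (inv_sign u v * inv_sign u w * inv_sign v w) *
          (bprod m \<beta> \<gamma> * bprod m \<alpha> (\<lambda>i. \<beta> i + \<gamma> i) :: 'k)"
      by (simp_all add: eq madd_def mcoeff_eq inv_sign_union_left inv_sign_union_right fin)
    then show ?thesis unfolding bprod_assoc by simp
  next
    case False
    then have "u \<inter> v \<noteq> {} \<or> (u \<union> v) \<inter> w \<noteq> {}" "v \<inter> w \<noteq> {} \<or> u \<inter> (v \<union> w) \<noteq> {}" by auto
    then show ?thesis by (auto simp: eq madd_def mcoeff_eq)
  qed
  have ma: "madd (madd x y) z = madd x (madd y z)" by (auto simp: madd_def add.assoc)
  have 1: "(single x \<odot> single y) \<odot> single z = fscale (mcoeff m x y * mcoeff m (madd x y) z) (single (madd (madd x y) z))"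
    using mcoeff_outside[OF M(1,2)] M
    by (cases "madd x y \<in> M") (auto simp: mul_single mul_fscale mul_add)
  have 2: "single x \<odot> (single y \<odot> single z) = fscale (mcoeff m y z * mcoeff m x (madd y z)) (single (madd x (madd y z)))"
    using mcoeff_outside[OF M(2,3)] M
    by (cases "madd y z \<in> M") (auto simp: mul_single mul_fscale mul_add)
  show "(single x \<odot> single y) \<odot> single z = single x \<odot> (single y \<odot> single z)"
    unfolding 1 2 key ma ..
qed (intro lin_mul_left lin_mul_right lin_comp[OF lin_mul_left lin_mul_left] lin_comp[OF lin_mul_left lin_mul_right]
   lin_comp[OF lin_mul_right lin_mul_left] lin_comp[OF lin_mul_right lin_mul_right])+

lemma mul_commute:
  assumes f: "f \<in> Gr b" and g: "g \<in> Gr c" shows "f \<odot> g = fscale (psign (b * c)) (g \<odot> f)"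
proof -
  have s: "single x \<odot> single y = fscale ((- 1) ^ (card (snd x) * card (snd y))) (single y \<odot> single x)"
    if M: "x \<in> M" "y \<in> M" for x y
  proof -
    obtain \<alpha> u \<beta> v where eq: "x = (\<alpha>, u)" "y = (\<beta>, v)" by (cases x; cases y)
    have fin: "finite u" "finite v" using M by (auto simp: eq dest: finite_odd)
    have "mcoeff m x y = ((- 1) ^ (card u * card v) * mcoeff m y x :: 'k)"
      using inv_sign_swap[OF fin, where 'k='k] by (auto simp: eq mcoeff_eq bprod_comm[of m \<alpha> \<beta>] Int_commute)
    moreover have "madd x y = madd y x" by (auto simp: madd_def)
    ultimately show ?thesis by (simp add: mul_single M) (simp add: eq)
  qed
  have t: "fscale (f x) (single x) \<odot> fscale (g y) (single y) =
     fscale (psign (b * c)) (fscale (g y) (single y) \<odot> fscale (f x) (single x))" if M: "x \<in> M" "y \<in> M" for x y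
  proof (cases "f x = 0 \<or> g y = 0")
    case True
    then show ?thesis by (auto simp: mul_add mul_fscale)
  next
    case False
    then have "b * c = of_nat (card (snd x) * card (snd y))" using Gr_D[OF f] Gr_D[OF g] by auto
    then have "psign (b * c) = ((- 1) ^ (card (snd x) * card (snd y)) :: 'k)" by (simp only: psign_of_nat)
    then show ?thesis using s[OF M] by (simp add: mul_fscale mult_ac)
  qed
  have f': "f = (\<Sum>x\<in>M. fscale (f x) (single x))" and g': "g = (\<Sum>x\<in>M. fscale (g x) (single x))"
    using assms by (auto intro!: O_decomp Gr_Osp)
  have "f \<odot> g = (\<Sum>x\<in>M. \<Sum>y\<in>M. fscale (f x) (single x) \<odot> fscale (g y) (single y))"
    by (subst (1) f', subst (1) g') (simp only: mul_sum(1), simp only: mul_sum(2))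
  also have "\<dots> = (\<Sum>x\<in>M. \<Sum>y\<in>M. fscale (psign (b * c)) (fscale (g y) (single y) \<odot> fscale (f x) (single x)))"
    by (intro sum.cong refl t)
  also have "\<dots> = fscale (psign (b * c))
      ((\<Sum>y\<in>M. fscale (g y) (single y)) \<odot> (\<Sum>x\<in>M. fscale (f x) (single x)))"
    unfolding mul_sum(1) unfolding mul_sum(2) fscale_sum by (rule sum.swap)
  also have "\<dots> = fscale (psign (b * c)) (g \<odot> f)" unfolding f'[symmetric] g'[symmetric] ..
  finally show ?thesis .
qed

text \<open>The sign picked up by \<open>d r\<close> when it moves past a left factor, as an
  operator, so that the Leibniz rule needs no homogeneous left factor.\<close>

definition tw :: "nat \<Rightarrow> (mono \<Rightarrow> 'k) \<Rightarrow> mono \<Rightarrow> 'k" where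
  "tw r f = (if r \<le> m then f else sg f)"

lemma mul_outside: "x \<in> M \<Longrightarrow> y \<in> M \<Longrightarrow> madd x y \<notin> M \<Longrightarrow> single x \<odot> single y = 0"
  by (simp add: mul_single mcoeff_outside)

lemma d_mul_even_single:
  assumes r: "r \<in> {1..m}" and M: "x \<in> M" "y \<in> M"
  shows "d r (single x \<odot> single y) = d r (single x) \<odot> single y + single x \<odot> d r (single y)"
proof -
  obtain \<alpha> u \<beta> v where eq: "x = (\<alpha>, u)" "y = (\<beta>, v)" by (cases x; cases y)
  define z where "z = (\<lambda>i. \<alpha> i + \<beta> i - (if i = r then 1 else 0), u \<union> v)"
  have M': "(\<alpha>(r := \<alpha> r - 1), u) \<in> M" "(\<beta>(r := \<beta> r - 1), v) \<in> M"
    using M by (auto simp: eq M_iff less_imp_diff_less)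
  define c where "c = (if u \<inter> v = {} then inv_sign u v else 0 :: 'k)"
  have mc: "mcoeff m (\<alpha>', u) (\<beta>', v) = c * bprod m \<alpha>' \<beta>'" for \<alpha>' \<beta>' by (simp add: c_def mcoeff_eq)
  have z1: "\<alpha> r \<noteq> 0 \<Longrightarrow> madd (\<alpha>(r := \<alpha> r - 1), u) (\<beta>, v) = z" 
    and z2: "\<beta> r \<noteq> 0 \<Longrightarrow> madd (\<alpha>, u) (\<beta>(r := \<beta> r - 1), v) = z"
    by (auto simp: madd_def z_def)
  have R: "d r (single x) \<odot> single y + single x \<odot> d r (single y) =
     fscale (c * ((if \<alpha> r = 0 then 0 else bprod m (\<alpha>(r := \<alpha> r - 1)) \<beta>) +
     (if \<beta> r = 0 then 0 else bprod m \<alpha> (\<beta>(r := \<beta> r - 1))))) (single z)"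
    using r M M' z1 z2 by (simp add: d_single mono_partial_def mul_single eq mc mul_add fscale_add_left distrib_left)
  show ?thesis
  proof (cases "\<alpha> r + \<beta> r > 0")
    case True
    note pas = bprod_pascal[of r m \<alpha> \<beta>, OF r True, where 'k='k]
    have R': "d r (single x) \<odot> single y + single x \<odot> d r (single y) = fscale (mcoeff m x y) (single z)"
      unfolding R unfolding pas[symmetric] unfolding eq mc ..
    show ?thesis
    proof (cases "madd x y \<in> M")
      case True
      then have "d r (single (madd x y)) = single z"
        using r \<open>\<alpha> r + \<beta> r > 0\<close> unfolding d_single[OF True]
        by (auto simp: eq madd_def mono_partial_def z_def intro!: arg_cong[where f=single])
      then show ?thesis unfolding R' by (simp add: mul_single M d_linear)
    next
      case False
      then show ?thesis unfolding R' by (simp add: mul_outside mcoeff_outside M d_linear)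
    qed
  next
    case False
    have "d r (single x \<odot> single y) = 0"
    proof (cases "madd x y \<in> M")
      case True
      have "d r (single (madd x y)) = 0"
        using r \<open>\<not> \<alpha> r + \<beta> r > 0\<close> unfolding d_single[OF True] by (simp add: eq madd_def mono_partial_def)
      then show ?thesis by (simp add: mul_single M d_linear)
    next
      case False
      then show ?thesis by (simp add: mul_outside M d_linear)
    qed
    then show ?thesis using False unfolding R by simp
  qed
qed

lemma inv_sign_remove_left:
  assumes "finite u" "finite v" "r \<in> u"
  shows "inv_sign u v = (inv_sign (u - {r}) v * (- 1) ^ card {j\<in>v. j < r} :: 'k)"
proof -
  have "inv_sign (insert r (u - {r})) v = (inv_sign {r} v * inv_sign (u - {r}) v :: 'k)"
    using inv_sign_union_left[of "{r}" "u - {r}" v] assms by simp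
  then show ?thesis using assms by (simp add: insert_absorb inv_sign_single)
qed

lemma inv_sign_remove_right:
  assumes "finite u" "finite v" "r \<in> v" "r \<notin> u"
  shows "inv_sign u v = (inv_sign u (v - {r}) * (- 1) ^ card {j\<in>u. j < r} * (- 1) ^ card u :: 'k)"
proof -
  have "inv_sign u (insert r (v - {r})) = (inv_sign u {r} * inv_sign u (v - {r}) :: 'k)"
    using inv_sign_union_right[of u "{r}" "v - {r}"] assms by simp
  moreover have "inv_sign u {r} = ((- 1) ^ card u * (- 1) ^ card {j\<in>u. j < r} :: 'k)"
    using inv_sign_swap[of u "{r}", where 'k='k] assms by (simp add: inv_sign_single)
  ultimately show ?thesis using assms by (simp add: insert_absorb mult_ac)
qed

lemma minus_one_square [simp]: "(- 1) ^ n * ((- 1) ^ n * c) = (c :: 'k)" "(- 1) ^ n * (- 1) ^ n = (1 :: 'k)"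
  by (simp_all flip: mult.assoc power_add mult_2)

lemma d_mul_odd_single:
  assumes r: "r \<in> {m+1..2*m}" and M: "x \<in> M" "y \<in> M"
  shows "d r (single x \<odot> single y) = d r (single x) \<odot> single y + sg (single x) \<odot> d r (single y)"
proof -
  obtain \<alpha> u \<beta> v where eq: "x = (\<alpha>, u)" "y = (\<beta>, v)" by (cases x; cases y)
  have fin: "finite u" "finite v" using M by (auto simp: eq dest: finite_odd)
  have sgx: "sg (single x) = fscale ((- 1) ^ card u) (single x)"
    by (auto simp: sg_def single_def eq fun_eq_iff)
  have ds: "d r (single (\<alpha>, u)) = (if r \<in> u then fscale ((- 1) ^ card {i\<in>u. i < r}) (single (\<alpha>, u - {r})) else 0)"
    if "(\<alpha>, u) \<in> M" for \<alpha> u using r that by (simp add: d_single mono_partial_def)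
  have rm: "(\<alpha>, u - {r}) \<in> M" if "(\<alpha>, u) \<in> M" for \<alpha> u using that by (auto simp: M_iff)
  define z where "z = (\<lambda>i. \<alpha> i + \<beta> i, u \<union> v - {r})"
  have L: "d r (single x \<odot> single y) = (if u \<inter> v = {} \<and> r \<in> u \<union> v then 
     fscale (inv_sign u v * bprod m \<alpha> \<beta> * (- 1) ^ card {i\<in>u \<union> v. i < r}) (single z) else 0)"
  proof (cases "madd x y \<in> M")
    case True
    then show ?thesis using M by (auto simp: mul_single d_linear eq madd_def ds mcoeff_eq z_def)
  next
    case False
    then have "mcoeff m x y = (0::'k)" using M mcoeff_outside by blast
    then have "u \<inter> v = {} \<Longrightarrow> bprod m \<alpha> \<beta> = (0::'k)" by (simp add: eq mcoeff_eq) (auto simp: inv_sign_def)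
    then show ?thesis using M False by (simp add: mul_outside d_linear)
  qed
  have c: "(- 1) ^ card {i\<in>u \<union> v. i < r} = ((- 1) ^ card {i\<in>u. i < r} * (- 1) ^ card {i\<in>v. i < r} :: 'k)" if "u \<inter> v = {}"
  proof -
    have "{i\<in>u \<union> v. i < r} = {i\<in>u. i < r} \<union> {i\<in>v. i < r}" by auto
    then show ?thesis using that fin by (simp only:) (subst card_Un_disjoint, auto simp: power_add)
  qed
  consider (1) "r \<notin> u" "r \<notin> v" | (2) "r \<in> u" "r \<notin> v" | (3) "r \<notin> u" "r \<in> v" | (4) "r \<in> u" "r \<in> v" by blast
  then show ?thesis
  proof cases
    case 1
    then show ?thesis unfolding L using M by (simp add: eq ds mul_add)
  next
    case 2
    then have i: "(u - {r}) \<inter> v = {} \<longleftrightarrow> u \<inter> v = {}" and zz: "madd (\<alpha>, u - {r}) (\<beta>, v) = z"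
      by (auto simp: madd_def z_def)
    show ?thesis unfolding L using M 2 rm[of \<alpha> u]
      by (simp add: eq ds mul_add mul_fscale mul_single zz)
        (auto simp: mcoeff_eq i c c[unfolded Un_iff] inv_sign_remove_left[OF fin 2(1)] mult_ac)
  next
    case 3
    then have i: "u \<inter> (v - {r}) = {} \<longleftrightarrow> u \<inter> v = {}" and zz: "madd (\<alpha>, u) (\<beta>, v - {r}) = z"
      by (auto simp: madd_def z_def)
    show ?thesis unfolding L using M 3 rm[of \<beta> v] 
      by (simp add: eq ds mul_add mul_fscale mul_single zz sgx[unfolded eq])
        (auto simp: mcoeff_eq i c c[unfolded Un_iff] inv_sign_remove_right[OF fin 3(2,1)] mult_ac)
  next
    \<comment> \<open>The variable of index r occurs in both factors, so their product is zero. The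
      two Leibniz terms cancel if it is the only common odd variable, and each vanishes
      otherwise.\<close>
    case 4
    show ?thesis
    proof (cases "u \<inter> v = {r}")
      case True
      then have i: "u \<inter> (v - {r}) = {}" "(u - {r}) \<inter> v = {}" by auto
      have zz: "madd (\<alpha>, u) (\<beta>, v - {r}) = madd (\<alpha>, u - {r}) (\<beta>, v)" using 4 by (auto simp: madd_def)
      have e1: "inv_sign (u - {r}) v = (inv_sign (u - {r}) (v - {r}) * (- 1) ^ card {j\<in>u - {r}. j < r} * (- 1) ^ card (u - {r}) :: 'k)"
        by (rule inv_sign_remove_right) (use fin 4 in auto)
      have e2: "inv_sign u (v - {r}) = (inv_sign (u - {r}) (v - {r}) * (- 1) ^ card {j\<in>v - {r}. j < r} :: 'k)"
        by (rule inv_sign_remove_left) (use fin 4 in auto)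
      have e3: "{j\<in>w. j \<noteq> r \<and> j < r} = {j\<in>w. j < r}" for w :: "nat set" by auto
      have e4: "(- 1) ^ card u = (- ((- 1) ^ card (u - {r})) :: 'k)" 
        using card.remove[OF fin(1) 4(1)] by simp
      have 5: "d r (single x \<odot> single y) = 0" using True by (simp add: L[unfolded eq] eq)
      show ?thesis unfolding 5 using M 4 rm[of \<beta> v] rm[of \<alpha> u]
        by (simp add: ds mul_add mul_fscale mul_single zz sgx[unfolded eq] eq)
          (simp add: mcoeff_eq i e1 e2 e3 e4 mult_ac flip: fscale_add_left)
    next
      case False
      then have i: "u \<inter> (v - {r}) \<noteq> {}" "(u - {r}) \<inter> v \<noteq> {}" "u \<inter> v \<noteq> {}" using 4 by auto
      show ?thesis unfolding L using M 4 rm[of \<beta> v] rm[of \<alpha> u] i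
        by (simp add: eq ds mul_add mul_fscale mul_single sgx[unfolded eq] mcoeff_eq)
    qed
  qed
qed

lemma d_mul:
  assumes f: "f \<in> Osp" and g: "g \<in> Osp"
  shows "d r (f \<odot> g) = d r f \<odot> g + tw r f \<odot> d r g"
proof (cases "r \<in> {1..2*m}")
  case True
  show ?thesis
  proof (rule bilin_ext[of "\<lambda>f g. d r (f \<odot> g)" "\<lambda>f g. d r f \<odot> g + tw r f \<odot> d r g", OF _ _ _ _ _ f g])
    fix x y assume M: "x \<in> M" "y \<in> M"
    show "d r (single x \<odot> single y) = d r (single x) \<odot> single y + tw r (single x) \<odot> d r (single y)"
    proof (cases "r \<le> m")
      case True
      then show ?thesis using d_mul_even_single[of r x y] M \<open>r \<in> _\<close> by (simp add: tw_def)
    next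
      case False
      then show ?thesis using d_mul_odd_single[of r x y] M \<open>r \<in> _\<close> by (simp add: tw_def)
    qed
  next
    fix f g show "lin (\<lambda>f. d r f \<odot> g + tw r f \<odot> d r g)"
      by (cases "r \<le> m") (auto simp: lin_def mul_add mul_fscale d_linear tw_def sg_linear fscale_add)
    show "lin (\<lambda>g. d r f \<odot> g + tw r f \<odot> d r g)"
      by (auto simp: lin_def mul_add mul_fscale d_linear fscale_add)
  qed (intro lin_comp[OF lin_d lin_mul_left] lin_comp[OF lin_d lin_mul_right])+
next
  case False
  then show ?thesis using f g by (simp add: d_out mul_add)
qed

lemma mul_one: "f \<in> Osp \<Longrightarrow> f \<odot> one = f" "f \<in> Osp \<Longrightarrow> one \<odot> f = f"
proof -
  show r: "f \<odot> one = f" if "f \<in> Osp" for f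
    using omult_one[of f m t] that by (simp add: mul_def one_def O_carr)
  have one: "one \<in> Gr 0" by (auto simp: one_def intro!: Gr_single one_M)
  have "one \<odot> f = f" if "f \<in> Gr b" for f b
    using mul_commute[OF one that] r[of f] that by (simp add: Gr_Osp)
  then show "f \<in> Osp \<Longrightarrow> one \<odot> f = f"
    using lin_ext_Gr[of "\<lambda>f. one \<odot> f" "\<lambda>f. f"] lin_mul_right lin_id by blast
qed

lemma d_one: "d r one = 0"
  unfolding one_def d_single[OF one_M] by (simp add: mono_partial_def)

end

section \<open>Supercommutators of endomorphisms\<close>

text \<open>Both the superalgebra and \<open>SHO\<close> itself are instances, so the definite
  descriptions hidden in \<open>supercommutator\<close> are resolved once for both.\<close>

locale cspace =
  fixes V :: "('k::field, 'a::ab_group_add, 'm) superspace_scheme"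
  assumes vadd_eq: "vadd V = (+)" and vzero_eq: "vzero V = 0"
    and scale_add: "vscale V c (x + y) = vscale V c x + vscale V c y"
    and grade_zero: "0 \<in> grade V b"
    and grade_diff: "x \<in> grade V b \<Longrightarrow> y \<in> grade V b \<Longrightarrow> x - y \<in> grade V b"
    and grade_carr: "grade V b \<subseteq> carr V"
    and grade_disjoint: "x \<in> grade V 0 \<Longrightarrow> x \<in> grade V 1 \<Longrightarrow> x = 0"
    and grade_sum: "x \<in> carr V \<Longrightarrow> \<exists>y\<in>grade V 0. \<exists>z\<in>grade V 1. x = y + z"
    and carr_diff: "x \<in> carr V \<Longrightarrow> y \<in> carr V \<Longrightarrow> x - y \<in> carr V"
begin

lemma zero_carr: "0 \<in> carr V" using grade_zero grade_carr by blast

lemma scale_zero: "vscale V c 0 = 0"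
  using scale_add[of c 0 0] by simp

lemma scale_minus: "vscale V c (- x) = - vscale V c x"
  using scale_add[of c x "- x"] by (simp add: scale_zero add_eq_0_iff)

lemma scale_diff: "vscale V c (x - y) = vscale V c x - vscale V c y"
  using scale_add[of c x "- y"] by (simp add: scale_minus)

lemma endo_add_eq: "endo_add V = (+)"
  by (intro ext) (simp add: endo_add_def vadd_eq)

lemma endoD:
  assumes "D \<in> endo V"
  shows "x \<in> carr V \<Longrightarrow> D x \<in> carr V" "x \<notin> carr V \<Longrightarrow> D x = 0"
    "x \<in> carr V \<Longrightarrow> y \<in> carr V \<Longrightarrow> D (x + y) = D x + D y"
    "x \<in> carr V \<Longrightarrow> D (vscale V c x) = vscale V c (D x)"
  using assms by (auto simp: endo_def vadd_eq vzero_eq)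

lemma endo_diff: "D \<in> endo V \<Longrightarrow> E \<in> endo V \<Longrightarrow> D - E \<in> endo V"
  by (auto simp: endo_def vadd_eq vzero_eq scale_diff intro!: carr_diff)

lemma endo_grade_diff: "D \<in> endo_grade V b \<Longrightarrow> E \<in> endo_grade V b \<Longrightarrow> D - E \<in> endo_grade V b"
  by (auto simp: endo_grade_def endo_diff grade_diff)

lemma endo_grade_disjoint:
  assumes "D \<in> endo_grade V 0" "D \<in> endo_grade V 1" shows "D = 0"
proof
  fix x
  have D: "D \<in> endo V" using assms(1) by (simp add: endo_grade_def)
  have h: "D x = 0" if x: "x \<in> grade V c" for c x
  proof -
    have "D x \<in> grade V (0 + c)" "D x \<in> grade V (1 + c)"
      using assms x unfolding endo_grade_def by blast+
    then show ?thesis using grade_disjoint by (cases c) auto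
  qed
  show "D x = 0 x"
  proof (cases "x \<in> carr V")
    case True
    then obtain y z where "y \<in> grade V 0" "z \<in> grade V 1" "x = y + z" using grade_sum by blast
    moreover then have "D x = D y + D z" using endoD(3)[OF D] grade_carr by blast
    ultimately show ?thesis using h by simp
  qed (simp add: endoD(2)[OF D])
qed

lemma hcomp_endo:
  assumes "D \<in> endo_grade V b" "E \<in> endo_grade V (b + 1)"
  shows "hcomp (+) (endo_grade V) b (D + E) = D"
  unfolding hcomp_def
proof (rule the_equality)
  show "D \<in> endo_grade V b \<and> (\<exists>z\<in>endo_grade V (b + 1). D + E = D + z)" using assms by blast
next
  fix y assume "y \<in> endo_grade V b \<and> (\<exists>z\<in>endo_grade V (b + 1). D + E = y + z)"
  then obtain z where y: "y \<in> endo_grade V b" and z: "z \<in> endo_grade V (b + 1)" and e: "D + E = y + z" by blast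
  have e': "D - y = z - E" using e by (simp add: algebra_simps)
  have "D - y \<in> endo_grade V b" "D - y \<in> endo_grade V (b + 1)"
    using endo_grade_diff[OF assms(1) y] endo_grade_diff[OF z assms(2)] e' by simp_all
  then show "y = D" using endo_grade_disjoint[of "D - y"] by (cases b) simp_all
qed

lemma supercommutator_parts:
  assumes "D0 \<in> endo_grade V 0" "D1 \<in> endo_grade V 1" "E0 \<in> endo_grade V 0" "E1 \<in> endo_grade V 1"
  shows "supercommutator V (D0 + D1) (E0 + E1) =
    (hom_commutator V 0 0 D0 E0 + hom_commutator V 0 1 D0 E1) +
    (hom_commutator V 1 0 D1 E0 + hom_commutator V 1 1 D1 E1)"
proof -
  have h: "hcomp (+) (endo_grade V) 0 (D0 + D1) = D0" "hcomp (+) (endo_grade V) 1 (D0 + D1) = D1"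
    "hcomp (+) (endo_grade V) 0 (E0 + E1) = E0" "hcomp (+) (endo_grade V) 1 (E0 + E1) = E1"
    using hcomp_endo[of D0 0 D1] hcomp_endo[of D1 1 D0] hcomp_endo[of E0 0 E1] hcomp_endo[of E1 1 E0] assms
    by (simp_all add: add.commute)
  show ?thesis unfolding supercommutator_def endo_add_eq Let_def h ..
qed

end

section \<open>The odd Laplacian and the Buttin bracket\<close>

context sho begin

text \<open>Two objects in one: \<open>T a\<close> is the operator \<open>T_H a\<close>, with the
  parity sign absorbed into \<open>sg\<close>, and \<open>T a g\<close> is the Buttin bracket of two
  potentials.\<close>

definition T :: "(mono \<Rightarrow> 'k) \<Rightarrow> (mono \<Rightarrow> 'k) \<Rightarrow> mono \<Rightarrow> 'k" where
  "T a g = (\<Sum>i=1..m. d i a \<odot> d (i + m) g + d (i + m) (sg a) \<odot> d i g)"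

definition Dl :: "(mono \<Rightarrow> 'k) \<Rightarrow> mono \<Rightarrow> 'k" where
  "Dl f = (\<Sum>i=1..m. d i (d (i + m) f))"

definition K :: "(mono \<Rightarrow> 'k) set" where "K = {a \<in> Osp. Dl a = 0}"

lemma two_nz: "(2::'k) \<noteq> 0" and three_nz: "(3::'k) \<noteq> 0"
proof -
  have "\<not> p dvd 2" "\<not> p dvd 3" using char by (auto dest: dvd_imp_le)
  then show "(2::'k) \<noteq> 0" "(3::'k) \<noteq> 0"
    using of_nat_eq_0_iff_char_dvd[where 'a='k, of 2] of_nat_eq_0_iff_char_dvd[where 'a='k, of 3] p_eq by auto
qed

lemma lin_Dl: "lin Dl"
  unfolding Dl_def by (intro lin_sumI lin_comp[OF lin_d lin_d])

lemma lin_T_left: "lin (\<lambda>a. T a g)"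
  unfolding T_def by (intro lin_sumI lin_plus lin_comp[OF lin_mul_left] lin_d lin_comp[OF lin_d lin_sg])

lemma lin_T_right: "lin (T a)"
  unfolding T_def by (intro lin_sumI lin_plus lin_comp[OF lin_mul_right] lin_d)

lemma T_linear: "T (a + b) g = T a g + T b g" "T (a - b) g = T a g - T b g" "T (- a) g = - T a g"
  "T (fscale c a) g = fscale c (T a g)" "T 0 g = 0" "T (sum A I) g = (\<Sum>i\<in>I. T (A i) g)"
  "T a (f + g) = T a f + T a g" "T a (f - g) = T a f - T a g" "T a (- g) = - T a g"
  "T a (fscale c g) = fscale c (T a g)" "T a 0 = 0" "T a (sum A I) = (\<Sum>i\<in>I. T a (A i))"
  using lin_add[OF lin_T_left] lin_diff[OF lin_T_left] lin_minus[OF lin_T_left] lin_scale[OF lin_T_left] lin_zero[OF lin_T_left]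
    lin_sum[OF lin_T_left] lin_add[OF lin_T_right] lin_diff[OF lin_T_right] lin_minus[OF lin_T_right]
    lin_scale[OF lin_T_right] lin_zero[OF lin_T_right] lin_sum[OF lin_T_right] by auto

lemma Dl_linear: "Dl (f + g) = Dl f + Dl g" "Dl (f - g) = Dl f - Dl g" "Dl (- f) = - Dl f"
  "Dl 0 = 0" "Dl (fscale c f) = fscale c (Dl f)" "Dl (sum A I) = (\<Sum>i\<in>I. Dl (A i))"
  using lin_add[OF lin_Dl] lin_diff[OF lin_Dl] lin_minus[OF lin_Dl] lin_zero[OF lin_Dl] lin_scale[OF lin_Dl] lin_sum[OF lin_Dl]
  by auto

lemma mu_low: "i \<in> {1..m} \<Longrightarrow> mu m i = 0" and mu_high: "i \<in> {1..m} \<Longrightarrow> mu m (i + m) = 1"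
  by (auto simp: mu_def)

lemma O_Dl [simp]: "f \<in> Osp \<Longrightarrow> Dl f \<in> Osp"
  unfolding Dl_def by (intro O_sum) simp

lemma O_T [simp]: "a \<in> Osp \<Longrightarrow> g \<in> Osp \<Longrightarrow> T a g \<in> Osp"
  unfolding T_def by (intro O_sum) simp

lemma Gr_T: assumes a: "a \<in> Gr b" and g: "g \<in> Gr c" shows "T a g \<in> Gr (b + 1 + c)"
  unfolding T_def
proof (intro Gr_sum Gr_add)
  fix i assume i: "i \<in> {1..m}"
  show "d i a \<odot> d (i + m) g \<in> Gr (b + 1 + c)"
    using mul_Gr[OF Gr_d[OF a, of i] Gr_d[OF g, of "i + m"]] mu_low[OF i] mu_high[OF i]
    by (simp add: add_ac)
  show "d (i + m) (sg a) \<odot> d i g \<in> Gr (b + 1 + c)"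
    using mul_Gr[OF Gr_d[OF Gr_sg[OF a], of "i + m"] Gr_d[OF g, of "i"]] mu_low[OF i] mu_high[OF i]
    by (simp add: add_ac)
qed

lemma Gr_Dl: assumes a: "a \<in> Gr b" shows "Dl a \<in> Gr (b + 1)"
  unfolding Dl_def
proof (intro Gr_sum)
  fix i assume i: "i \<in> {1..m}"
  show "d i (d (i + m) a) \<in> Gr (b + 1)"
    using Gr_d[OF Gr_d[OF a, of "i + m"], of i] mu_low[OF i] mu_high[OF i] by simp
qed

lemma sg_Dl: "f \<in> Osp \<Longrightarrow> sg (Dl f) = - Dl (sg f)"
  unfolding Dl_def sg_linear sum_negf[symmetric]
  by (intro sum.cong refl) (simp add: sg_d d_linear mu_low mu_high fscale_minus_left del: atLeastAtMost_iff)

lemma d_Dl: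
  assumes r: "r \<in> {1..2*m}" and f: "f \<in> Osp" shows "d r (Dl f) = fscale (psign (mu m r)) (Dl (d r f))"
proof -
  have "d r (d i (d (i + m) f)) = fscale (psign (mu m r)) (d i (d (i + m) (d r f)))" if i: "i \<in> {1..m}" for i
  proof -
    have "d r (d i (d (i + m) f)) = d i (d r (d (i + m) f))"
      using d_commute[of r i "d (i + m) f"] r i f by (simp add: mu_low)
    also have "\<dots> = fscale (psign (mu m r)) (d i (d (i + m) (d r f)))"
      using d_commute[of r "i + m" f] r i f mu_high[OF i] by (simp add: d_linear)
    finally show ?thesis .
  qed
  then show ?thesis unfolding Dl_def d_linear fscale_sum by (rule sum.cong[OF refl])
qed

lemma double_zero: "f + f = 0 \<Longrightarrow> f = (0 :: mono \<Rightarrow> 'k)"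
proof
  fix x assume "f + f = 0"
  then have "(f + f) x = 0" by simp
  then have "2 * f x = 0" by (simp only: plus_fun_apply mult_2)
  then show "f x = 0 x" using two_nz by simp
qed

text \<open>Even derivatives commute and odd ones anticommute, so the double sum is antisymmetric
  under exchange of its indices; 2 is invertible.\<close>

lemma Dl_Dl:
  assumes f: "f \<in> Osp" shows "Dl (Dl f) = 0"
proof -
  let ?A = "\<lambda>i j. d i (d (i + m) (d j (d (j + m) f)))"
  have A: "?A i j = - ?A j i" if i: "i \<in> {1..m}" and j: "j \<in> {1..m}" for i j
  proof -
    have "?A i j = d i (d j (d (i + m) (d (j + m) f)))"
      using d_commute[of "i + m" j "d (j + m) f"] i j f by (simp add: mu_low)
    also have "\<dots> = d j (d i (d (i + m) (d (j + m) f)))"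
      using d_commute[of i j "d (i + m) (d (j + m) f)"] i j f by (simp add: mu_low)
    also have "\<dots> = - d j (d i (d (j + m) (d (i + m) f)))"
      using d_commute[of "i + m" "j + m" f] i j f by (simp add: mu_high d_linear fscale_minus_left)
    also have "\<dots> = - ?A j i"
      using d_commute[of i "j + m" "d (i + m) f"] i j f by (simp add: mu_low)
    finally show ?thesis .
  qed
  have "Dl (Dl f) = (\<Sum>i=1..m. \<Sum>j=1..m. ?A i j)" by (simp add: Dl_def d_linear)
  also have "\<dots> = (\<Sum>i=1..m. \<Sum>j=1..m. - ?A j i)" by (intro sum.cong refl A)
  also have "\<dots> = - (\<Sum>i=1..m. \<Sum>j=1..m. ?A i j)" by (subst sum.swap) (simp add: sum_negf)
  also have "\<dots> = - Dl (Dl f)" by (simp add: Dl_def d_linear)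
  finally show ?thesis using double_zero by (simp add: eq_neg_iff_add_eq_0)
qed

lemma tw_low: "i \<in> {1..m} \<Longrightarrow> tw i f = f" and tw_high: "i \<in> {1..m} \<Longrightarrow> tw (i + m) f = sg f"
  by (auto simp: tw_def)

text \<open>The Laplacian is a differential operator of order two, and its deviation from being a derivation
  is the Buttin bracket.\<close>

lemma Dl_mul:
  assumes f: "f \<in> Osp" and g: "g \<in> Osp"
  shows "Dl (f \<odot> g) = Dl f \<odot> g + sg f \<odot> Dl g + T (sg f) g"
proof -
  have "d i (d (i + m) (f \<odot> g)) = d i (d (i + m) f) \<odot> g + sg f \<odot> d i (d (i + m) g) +
      (d i (sg f) \<odot> d (i + m) g + d (i + m) (sg (sg f)) \<odot> d i g)" if i: "i \<in> {1..m}" for i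
    using i f g by (simp add: d_mul tw_low tw_high d_linear)
  then have "Dl (f \<odot> g) = (\<Sum>i=1..m. d i (d (i + m) f) \<odot> g + sg f \<odot> d i (d (i + m) g) +
      (d i (sg f) \<odot> d (i + m) g + d (i + m) (sg (sg f)) \<odot> d i g))"
    unfolding Dl_def by (intro sum.cong refl)
  then show ?thesis unfolding Dl_def T_def sum.distrib mul_sum[symmetric] .
qed

text \<open>Expresses the bracket through \<open>Dl\<close> and the product alone. Whatever respects
  these two respects the bracket, which is how derivations of the bracket are produced
  below.\<close>

lemma T_Dl:
  assumes a: "a \<in> Gr b" and g: "g \<in> Osp"
  shows "T a g = fscale (psign b) (Dl (a \<odot> g) - Dl a \<odot> g) - a \<odot> Dl g"
proof -
  have sg: "sg a = fscale (psign b) a" using a by (rule sg_Gr)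
  have "Dl (sg a \<odot> g) = Dl (sg a) \<odot> g + a \<odot> Dl g + T a g" using Dl_mul[of "sg a" g] a g by simp
  then have "T a g = Dl (sg a \<odot> g) - Dl (sg a) \<odot> g - a \<odot> Dl g" by simp
  then show ?thesis by (simp add: sg mul_fscale Dl_linear fscale_diff)
qed

lemma T_mul:
  assumes a: "a \<in> Gr b" and g: "g \<in> Gr c" and h: "h \<in> Osp"
  shows "T a (g \<odot> h) = T a g \<odot> h + fscale (psign ((b + 1) * c)) (g \<odot> T a h)"
proof -
  have "d i a \<odot> d (i + m) (g \<odot> h) + d (i + m) (sg a) \<odot> d i (g \<odot> h) =
     (d i a \<odot> d (i + m) g + d (i + m) (sg a) \<odot> d i g) \<odot> h +
     fscale (psign ((b + 1) * c)) (g \<odot> (d i a \<odot> d (i + m) h + d (i + m) (sg a) \<odot> d i h))"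
    if i: "i \<in> {1..m}" for i
  proof -
    have 1: "d i a \<in> Gr b" using Gr_d[OF a, of i] mu_low[OF i] by simp
    have 2: "d (i + m) (sg a) \<in> Gr (b + 1)" using Gr_d[OF Gr_sg[OF a], of "i + m"] mu_high[OF i] by simp
    have c1: "d i a \<odot> (g \<odot> x) = fscale (psign (b * c)) (g \<odot> (d i a \<odot> x))" if "x \<in> Osp" for x
      using mul_assoc[of "d i a" g x] mul_assoc[of g "d i a" x] mul_commute[OF 1 g] a g that by (simp add: mul_fscale)
    have c2: "d (i + m) (sg a) \<odot> (g \<odot> x) = fscale (psign ((b + 1) * c)) (g \<odot> (d (i + m) (sg a) \<odot> x))" if "x \<in> Osp" for x
      using mul_assoc[of "d (i + m) (sg a)" g x] mul_assoc[of g "d (i + m) (sg a)" x] mul_commute[OF 2 g] a g that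
      by (simp add: mul_fscale)
    have s: "psign ((b + 1) * c) = (psign c * psign (b * c) :: 'k)"
      by (simp only: distrib_right psign_add mult_1 mult.commute[of "psign c"])
    show ?thesis
      using a g h i by (simp add: d_mul tw_low tw_high mul_add sg_Gr[OF g] mul_fscale mul_assoc c1 c2 fscale_add)
        (simp add: s)
  qed
  then have "T a (g \<odot> h) = (\<Sum>i=1..m. (d i a \<odot> d (i + m) g + d (i + m) (sg a) \<odot> d i g) \<odot> h +
     fscale (psign ((b + 1) * c)) (g \<odot> (d i a \<odot> d (i + m) h + d (i + m) (sg a) \<odot> d i h)))"
    unfolding T_def by (intro sum.cong refl)
  then show ?thesis unfolding T_def sum.distrib mul_sum[symmetric] fscale_sum[symmetric] .
qed

text \<open>Superderivations of the associative product that supercommute with \<open>Dl\<close> up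
  to the scalar \<kappa>. The last conjunct makes adding \<kappa> times the identity compatible with
  the parity e.\<close>

definition Lder :: "bit \<Rightarrow> 'k \<Rightarrow> ((mono \<Rightarrow> 'k) \<Rightarrow> mono \<Rightarrow> 'k) \<Rightarrow> bool" where
  "Lder e \<kappa> X \<longleftrightarrow> lin X \<and> (\<forall>c. \<forall>f\<in>Gr c. X f \<in> Gr (c + e)) \<and>
     (\<forall>c. \<forall>f\<in>Gr c. \<forall>g\<in>Osp. X (f \<odot> g) = X f \<odot> g + fscale (psign (e * c)) (f \<odot> X g)) \<and>
     (\<forall>f\<in>Osp. X (Dl f) = fscale (psign e) (Dl (X f)) + fscale \<kappa> (Dl f)) \<and> (\<kappa> = 0 \<or> e = 0)"

text \<open>Maps of potentials that induce superderivations of \<open>SHO\<close> through \<open>T a \<mapsto> T (F a)\<close>.\<close>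

definition nice :: "bit \<Rightarrow> ((mono \<Rightarrow> 'k) \<Rightarrow> mono \<Rightarrow> 'k) \<Rightarrow> bool" where
  "nice e F \<longleftrightarrow> lin F \<and> (\<forall>c. \<forall>f\<in>Gr c. F f \<in> Gr (c + e)) \<and> (\<forall>a\<in>K. F a \<in> K) \<and> (\<exists>c. F one = fscale c one) \<and>
     (\<forall>c. \<forall>a\<in>K \<inter> Gr c. \<forall>g\<in>Osp. F (T a g) = T (F a) g + fscale (psign (e * (c + 1))) (T a (F g)))"

lemma lin_Osp:
  assumes "lin X" "\<forall>c. \<forall>f\<in>Gr c. X f \<in> Gr (c + e)" "f \<in> Osp" shows "X f \<in> Osp"
proof -
  obtain g h where gh: "g \<in> Gr 0" "h \<in> Gr 1" "f = g + h" using Gr_cases[OF assms(3)] by blast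
  then have "X g \<in> Osp" "X h \<in> Osp" using assms(2) Gr_Osp by blast+
  then show ?thesis unfolding gh(3) lin_add[OF assms(1)] by simp
qed

lemma one_Gr: "one \<in> Gr 0" by (auto simp: one_def intro!: Gr_single one_M)

lemma K_Osp [simp]: "a \<in> K \<Longrightarrow> a \<in> Osp" unfolding K_def by blast
lemma K_Dl: "a \<in> K \<Longrightarrow> Dl a = 0" unfolding K_def by blast
lemma K_I: "a \<in> Osp \<Longrightarrow> Dl a = 0 \<Longrightarrow> a \<in> K" unfolding K_def by blast

text \<open>The bracket contains \<open>Dl\<close> once, so \<open>X (T a g)\<close> differs from
  the derivation rule by \<kappa> times \<open>T a g\<close>. Adding \<kappa> to X contributes one
  such term on the left and two on the right, which restores the rule.\<close>

lemma Lder_nice: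
  assumes X: "Lder e \<kappa> X" shows "nice e (\<lambda>f. X f + fscale \<kappa> f)"
proof -
  have linX: "lin X" and gr: "\<And>c f. f \<in> Gr c \<Longrightarrow> X f \<in> Gr (c + e)"
    and lb: "\<And>c f g. f \<in> Gr c \<Longrightarrow> g \<in> Osp \<Longrightarrow> X (f \<odot> g) = X f \<odot> g + fscale (psign (e * c)) (f \<odot> X g)"
    and XD: "\<And>f. f \<in> Osp \<Longrightarrow> X (Dl f) = fscale (psign e) (Dl (X f)) + fscale \<kappa> (Dl f)"
    and ke: "\<kappa> = 0 \<or> e = 0"
    using X by (auto simp: Lder_def)
  have XO [simp]: "X f \<in> Osp" if "f \<in> Osp" for f
    using lin_Osp[OF linX _ that] gr by blast
  have DX: "Dl (X f) = fscale (psign e) (X (Dl f) - fscale \<kappa> (Dl f))" if "f \<in> Osp" for f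
    using XD[OF that] by simp
  have "X one = 0"
    using lb[OF one_Gr, of one] by (simp add: mul_one)
  then have one: "\<exists>c. X one + fscale \<kappa> one = fscale c one" by (intro exI[of _ \<kappa>]) simp
  have F: "X (T a g) + fscale \<kappa> (T a g) = T (X a + fscale \<kappa> a) g + fscale (psign (e * (c + 1))) (T a (X g + fscale \<kappa> g))"
    if a: "a \<in> K" "a \<in> Gr c" and g: "g \<in> Osp" for a g c
  proof -
    have Da: "Dl a = 0" using a(1) by (rule K_Dl)
    have DXa: "Dl (X a) = 0" using DX[of a] a Da by (simp add: lin_zero[OF linX])
    have ps: "psign (e * (c + 1)) = (psign e * psign (e * c) :: 'k)" by (simp add: distrib_left psign_add)
    have 1: "T a h = fscale (psign c) (Dl (a \<odot> h)) - a \<odot> Dl h" if "h \<in> Osp" for h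
      using T_Dl[OF a(2) that] by (simp add: Da mul_add)
    have 2: "T (X a) g = fscale (psign c * psign e) (Dl (X a \<odot> g)) - X a \<odot> Dl g"
      using T_Dl[OF gr[OF a(2)] g] by (simp add: DXa mul_add psign_add)
    have "X (T a g) = fscale (psign c) (fscale (psign e) (Dl (X (a \<odot> g))) + fscale \<kappa> (Dl (a \<odot> g))) - X (a \<odot> Dl g)"
      unfolding 1[OF g] using XD[of "a \<odot> g"] a g by (simp add: lin_diff[OF linX] lin_scale[OF linX])
    also have "\<dots> = fscale (psign c * psign e) (Dl (X a \<odot> g + fscale (psign (e * c)) (a \<odot> X g)))
        + fscale (psign c * \<kappa>) (Dl (a \<odot> g)) - (X a \<odot> Dl g + fscale (psign (e * c)) (a \<odot> X (Dl g)))"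
      using lb[OF a(2) g] lb[OF a(2), of "Dl g"] g by (simp add: fscale_add)
    also have "\<dots> = T (X a) g + fscale (psign e * psign (e * c)) (fscale (psign c) (Dl (a \<odot> X g)) - a \<odot> Dl (X g))
        + fscale \<kappa> (fscale (psign c) (Dl (a \<odot> g)) - fscale (psign (e * c)) (a \<odot> Dl g))"
      using g by (simp add: 2 XD[OF g] Dl_linear fscale_add fscale_diff mul_add mul_fscale algebra_simps)
    also have "\<dots> = T (X a) g + fscale (psign (e * (c + 1))) (T a (X g)) + fscale \<kappa> (T a g)"
      using g 1[of "X g"] 1[OF g] ke by (auto simp: ps)
    finally show ?thesis using ke by (auto simp: T_linear fscale_add)
  qed
  show ?thesis unfolding nice_def
  proof (intro conjI allI ballI)
    show "lin (\<lambda>f. X f + fscale \<kappa> f)" by (intro lin_plus linX lin_fscale lin_id)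
    show "X f + fscale \<kappa> f \<in> Gr (c + e)" if "f \<in> Gr c" for f c
      using ke gr[OF that] that by (cases "e = 0") (simp_all add: Gr_add Gr_scale)
    show "X a + fscale \<kappa> a \<in> K" if "a \<in> K" for a
      using that DX[of a] by (intro K_I) (simp_all add: K_Dl Dl_linear lin_zero[OF linX])
  qed (use one F in blast)+
qed

lemma Lder_T:
  assumes y: "y \<in> Gr b" and c: "Dl y = fscale c one" shows "Lder (b + 1) 0 (T y)"
  unfolding Lder_def
proof (intro conjI allI ballI)
  fix f assume f: "f \<in> Osp"
  \<comment> \<open>For even y the Laplacian is odd and cannot be a nonzero constant; hence the sign
    of y times c is always - c.\<close>
  have "b = 0 \<Longrightarrow> c = 0"
  proof -
    assume "b = 0"
    then have "fscale c one \<in> Gr 1" using Gr_Dl[OF y] c by simp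
    then have "fscale c one (\<lambda>i. 0, {}) = 0" using Gr_D[of "fscale c one" 1 "(\<lambda>i. 0, {})"] by auto
    then show "c = 0" by (simp add: one_def single_def)
  qed
  then have bc: "fscale (psign b * c) f = - fscale c f" for f :: "mono \<Rightarrow> 'k"
    by (cases b) (auto simp: fscale_minus_left)
  have 1: "T y h = fscale (psign b) (Dl (y \<odot> h)) + fscale c h - y \<odot> Dl h" if "h \<in> Osp" for h
    using T_Dl[OF y that] that bc by (simp add: c mul_fscale mul_one fscale_diff)
  show "T y (Dl f) = fscale (psign (b + 1)) (Dl (T y f)) + fscale 0 (Dl f)"
    using f y bc by (simp add: 1 Dl_linear Dl_Dl mul_add psign_add fscale_add fscale_diff fscale_minus_left)
next
  show "T y f \<in> Gr (c + (b + 1))" if "f \<in> Gr c" for f c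
    using Gr_T[OF y that] by (simp only: add_ac)
qed (simp_all add: lin_T_right T_mul[OF y])

lemma nice_T:
  assumes "y \<in> Gr b" "Dl y = fscale c one" shows "nice (b + 1) (T y)"
  using Lder_nice[OF Lder_T[OF assms]] by simp

text \<open>This contains the super Jacobi identity of the Buttin bracket for left arguments from
  \<open>K\<close>, and that \<open>K\<close> is closed under the bracket.\<close>

lemma nice_T_K: "y \<in> K \<Longrightarrow> y \<in> Gr b \<Longrightarrow> nice (b + 1) (T y)"
  using nice_T[of y b 0] by (simp add: K_Dl)

end

section \<open>The Lie superalgebra \<open>SHO\<close> in terms of potentials\<close>

context sho begin

abbreviation z0 :: mono where "z0 \<equiv> (\<lambda>i. 0, {})"

text \<open>Potentials matter only up to constants.\<close>

definition eqv :: "(mono \<Rightarrow> 'k) \<Rightarrow> (mono \<Rightarrow> 'k) \<Rightarrow> bool" where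
  "eqv f g \<longleftrightarrow> (\<forall>z. z \<noteq> z0 \<longrightarrow> f z = g z)"

lemma one_apply: "one z = (if z = z0 then 1 else 0)"
  by (simp add: one_def single_def)

lemma eqv_iff: "eqv f g \<longleftrightarrow> (\<exists>c. f = g + fscale c one)"
proof
  assume "eqv f g"
  then have e: "f z = g z" if "z \<noteq> z0" for z using that unfolding eqv_def by blast
  have "f = g + fscale (f z0 - g z0) one"
  proof
    fix z show "f z = (g + fscale (f z0 - g z0) one) z"
      using e[of z] by (cases "z = z0") (auto simp: one_def single_def)
  qed
  then show "\<exists>c. f = g + fscale c one" by blast
next
  assume "\<exists>c. f = g + fscale c one"
  then obtain c where "f = g + fscale c one" by blast
  then show "eqv f g" unfolding eqv_def by (intro allI impI) (simp add: one_apply)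
qed

lemma eqv_eqI: "eqv f g \<Longrightarrow> f z0 = g z0 \<Longrightarrow> f = g"
  unfolding eqv_def by (metis ext)

lemma eqv_refl [simp]: "eqv f f" and eqv_sym: "eqv f g \<Longrightarrow> eqv g f"
  and eqv_trans: "eqv f g \<Longrightarrow> eqv g h \<Longrightarrow> eqv f h"
  and eqv_diff: "eqv f g \<Longrightarrow> eqv f' g' \<Longrightarrow> eqv (f - f') (g - g')"
  and eqv_minus: "eqv f g \<Longrightarrow> eqv (- f) (- g)"
  and eqv_scale: "eqv f g \<Longrightarrow> eqv (fscale c f) (fscale c g)"
  by (auto simp: eqv_def)

lemma eqv_sum: "(\<And>i. i \<in> I \<Longrightarrow> eqv (f i) (g i)) \<Longrightarrow> eqv (sum f I) (sum g I)"
  by (auto simp: eqv_def sum_fun_apply intro!: sum.cong)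

lemma eqv_one: "eqv (fscale c one) 0" "eqv one 0"
  by (auto simp: eqv_def one_def single_def)

lemma d_eqv: "eqv f g \<Longrightarrow> d r f = d r g"
  by (auto simp: eqv_iff d_linear d_one)

lemma sg_eqv: "eqv f g \<Longrightarrow> eqv (sg f) (sg g)"
  by (auto simp: eqv_def sg_def)

lemma T_eqv_left: "eqv f g \<Longrightarrow> T f h = T g h"
  using d_eqv[of f g] d_eqv[of "sg f" "sg g"] sg_eqv[of f g] by (simp add: T_def)

lemma T_eqv_right: "eqv f g \<Longrightarrow> T h f = T h g"
  using d_eqv[of f g] by (simp add: T_def)

lemma nonconst_cases:
  assumes "(\<alpha>, u) \<in> M" "(\<alpha>, u) \<noteq> z0"
  obtains i \<beta> where "i \<in> {1..m}" "\<alpha> = \<beta>(i := Suc (\<beta> i))" "(\<beta>, u) \<in> M"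
  | r where "r \<in> {m+1..2*m}" "r \<in> u"
proof (cases "\<alpha> = (\<lambda>i. 0)")
  case True
  then obtain r where r: "r \<in> u" using assms by auto
  have "u \<subseteq> {m+1..2*m}" using assms(1) by (simp add: M_iff)
  then show ?thesis using that(2)[OF _ r] r by blast
next
  case False
  then obtain i where i: "\<alpha> i \<noteq> 0" by auto
  then have "i \<in> {1..m}" using assms(1) by (auto simp: M_iff)
  then show ?thesis
    using i assms(1) by (intro that(1)[of i "\<alpha>(i := \<alpha> i - 1)"]) (auto simp: M_iff less_imp_diff_less)
qed

lemma O_out: "f \<in> Osp \<Longrightarrow> z \<notin> M \<Longrightarrow> f z = 0"
  unfolding Osp_def by blast

lemma d_zero_eqv:
  assumes f: "f \<in> Osp" and z: "\<And>r. r \<in> {1..2*m} \<Longrightarrow> d r f = 0" shows "eqv f 0"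
  unfolding eqv_def
proof (intro allI impI)
  fix z :: mono assume nz: "z \<noteq> z0"
  obtain \<alpha> u where zz: "z = (\<alpha>, u)" by (cases z)
  show "f z = 0 z"
  proof (cases "z \<in> M")
    case True
    then show ?thesis using nz unfolding zz
    proof (rule nonconst_cases)
      fix i \<beta> assume i: "i \<in> {1..m}" "\<alpha> = \<beta>(i := Suc (\<beta> i))"
      then have "d i f (\<beta>, u) = 0" using z[of i] by simp
      then show "f (\<alpha>, u) = 0 (\<alpha>, u)" using i f by (simp add: d_even)
    next
      fix r assume r: "r \<in> {m+1..2*m}" "r \<in> u"
      then have "d r f (\<alpha>, u - {r}) = 0" using z[of r] by simp
      then show "f (\<alpha>, u) = 0 (\<alpha>, u)" using r f by (simp add: d_odd insert_absorb)
    qed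
  qed (simp add: O_out[OF f])
qed

definition xv :: "nat \<Rightarrow> mono \<Rightarrow> 'k" where "xv r = xvar m r"

definition xmono :: "nat \<Rightarrow> mono" where
  "xmono s = (if s \<le> m then ((\<lambda>i. 0)(s := 1), {}) else (\<lambda>i. 0, {s}))"

lemma xv_eq: "xv s = single (xmono s)"
  by (simp add: xv_def xvar_def xmono_def)

lemma p_pow_gt: "i \<in> {1..m} \<Longrightarrow> p ^ t i > 3"
  using p_pow_ge[of i] char by simp

lemma xmono_M: "s \<in> {1..2*m} \<Longrightarrow> xmono s \<in> M"
proof (cases "s \<le> m")
  case True
  assume s: "s \<in> {1..2*m}"
  have "p ^ t i > 0" for i using prime_p by (simp add: prime_gt_0_nat)
  moreover have "p ^ t s > 1" using p_pow_gt[of s] s True by simp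
  ultimately show ?thesis using s True by (auto simp: xmono_def M_iff)
next
  case False
  assume s: "s \<in> {1..2*m}"
  have "p ^ t i > 0" for i using prime_p by (simp add: prime_gt_0_nat)
  then show ?thesis using s False by (auto simp: xmono_def M_iff)
qed

lemma O_xv [simp]: "s \<in> {1..2*m} \<Longrightarrow> xv s \<in> Osp"
  by (simp add: xv_eq xmono_M)

lemma Gr_xv: "s \<in> {1..2*m} \<Longrightarrow> xv s \<in> Gr (mu m s)"
  unfolding xv_eq by (intro Gr_single xmono_M) (auto simp: xmono_def mu_def)

lemma fpartial_eq: "fpartial m t f r = (\<lambda>g. if g \<in> Osp then f \<odot> d r g else 0)"
proof
  fix g
  have "vzero (O_alg m t :: ('k, mono \<Rightarrow> 'k) superspace) = 0" by (simp add: O_alg_def)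
  then show "fpartial m t f r g = (if g \<in> Osp then f \<odot> d r g else 0)"
    by (simp add: fpartial_def on_carr_def O_carr mul_def d_def)
qed

lemma d_xv:
  assumes r: "r \<in> {1..2*m}" and s: "s \<in> {1..2*m}" shows "d r (xv s) = (if r = s then one else 0)"
proof -
  have "fpartial m t one r (xvar m s) = (if r = s then one else 0)"
    using r s tpos char by (intro fpartial_xvar) (auto simp: O_carr p_eq)
  then show ?thesis using s by (simp add: fpartial_eq xv_def[symmetric] mul_one)
qed

lemma Dl_xv: "s \<in> {1..2*m} \<Longrightarrow> Dl (xv s) = 0"
  unfolding Dl_def by (intro sum.neutral ballI) (auto simp: d_xv d_one d_linear)

lemma K_xv: "s \<in> {1..2*m} \<Longrightarrow> xv s \<in> K"
  by (intro K_I) (auto simp: Dl_xv)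

lemma K_one: "one \<in> K" by (intro K_I) (auto simp: Dl_def d_one d_linear)

text \<open>This and the next three lemmas turn brackets with variables into partial derivatives, in
  either argument. So the values of \<open>TH a\<close> on the variables are the derivatives of a,
  and commuting with brackets by variables means commuting with derivatives.\<close>

lemma T_xv_low: "i \<in> {1..m} \<Longrightarrow> a \<in> Osp \<Longrightarrow> T a (xv i) = d (i + m) (sg a)"
proof -
  assume i: "i \<in> {1..m}" and a: "a \<in> Osp"
  have "T a (xv i) = (\<Sum>j=1..m. if j = i then d (i + m) (sg a) else 0)"
    unfolding T_def using i a by (intro sum.cong refl) (auto simp: d_xv mul_add mul_one)
  then show ?thesis using i by simp
qed

lemma T_xv_high: "i \<in> {1..m} \<Longrightarrow> a \<in> Osp \<Longrightarrow> T a (xv (i + m)) = d i a"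
proof -
  assume i: "i \<in> {1..m}" and a: "a \<in> Osp"
  have "T a (xv (i + m)) = (\<Sum>j=1..m. if j = i then d i a else 0)"
    unfolding T_def using i a by (intro sum.cong refl) (auto simp: d_xv mul_add mul_one)
  then show ?thesis using i by simp
qed

lemma xv_T_low: "i \<in> {1..m} \<Longrightarrow> a \<in> Osp \<Longrightarrow> T (xv i) a = d (i + m) a"
proof -
  assume i: "i \<in> {1..m}" and a: "a \<in> Osp"
  have sg: "sg (xv i) = xv i" using i sg_Gr[OF Gr_xv[of i]] by (simp add: mu_low)
  have "T (xv i) a = (\<Sum>j=1..m. if j = i then d (i + m) a else 0)"
    unfolding T_def using i a by (intro sum.cong refl) (auto simp: sg d_xv mul_add mul_one)
  then show ?thesis using i by simp
qed

lemma xv_T_high: "i \<in> {1..m} \<Longrightarrow> a \<in> Osp \<Longrightarrow> T (xv (i + m)) a = - d i a"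
proof -
  assume i: "i \<in> {1..m}" and a: "a \<in> Osp"
  have sg: "sg (xv (i + m)) = - xv (i + m)"
    using i sg_Gr[OF Gr_xv[of "i + m"]] mu_high[OF i] by (simp add: fscale_minus_left)
  have "T (xv (i + m)) a = (\<Sum>j=1..m. if j = i then - d i a else 0)"
    unfolding T_def using i a by (intro sum.cong refl) (auto simp: sg d_xv mul_add mul_one d_linear)
  then show ?thesis using i by simp
qed

lemma sum_2m: "(\<Sum>r=1..2*m. f r) = (\<Sum>i=1..m. f i + f (i + m))"
proof -
  have u: "{1..2*m} = {1..m} \<union> {m+1..2*m}" by auto
  have "(\<Sum>r=1..2*m. f r) = (\<Sum>r\<in>{1..m}. f r) + (\<Sum>r\<in>{m+1..2*m}. f r)"
    unfolding u by (rule sum.union_disjoint) auto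
  also have "(\<Sum>r\<in>{m+1..2*m}. f r) = (\<Sum>i=1..m. f (i + m))"
    by (rule sum.reindex_bij_witness[of _ "\<lambda>i. i + m" "\<lambda>i. i - m"]) auto
  finally show ?thesis by (simp add: sum.distrib)
qed

definition TH :: "(mono \<Rightarrow> 'k) \<Rightarrow> (mono \<Rightarrow> 'k) \<Rightarrow> mono \<Rightarrow> 'k" where
  "TH a = (\<lambda>g. if g \<in> Osp then T a g else 0)"

lemma Gr_disjoint: "f \<in> Gr 0 \<Longrightarrow> f \<in> Gr 1 \<Longrightarrow> f = 0"
proof
  fix x assume "f \<in> Gr 0" "f \<in> Gr 1"
  then show "f x = 0 x" using Gr_D[of f 0 x] Gr_D[of f 1 x] by auto
qed

lemma opart_eq: 
  assumes a: "a \<in> Osp" shows "opart m t b a = part b a"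
  unfolding opart_def hcomp_def O_grade
proof (rule the_equality)
  have b: "b = 0 \<or> b = 1" by (cases b) auto
  then have s: "a = part b a + part (b + 1) a" using part_sum[of a] by (auto simp: add.commute)
  show "part b a \<in> Gr b \<and> (\<exists>z\<in>Gr (b + 1). a = part b a + z)"
    using s part_Gr[OF a] by blast
  fix y assume "y \<in> Gr b \<and> (\<exists>z\<in>Gr (b + 1). a = y + z)"
  then obtain z where y: "y \<in> Gr b" and z: "z \<in> Gr (b + 1)" and e: "a = y + z" by blast
  have e': "y - part b a = part (b + 1) a - z" using s e by (simp add: algebra_simps)
  have "y - part b a \<in> Gr b" using part_Gr[OF a] y by (intro Gr_diff)
  moreover have "y - part b a \<in> Gr (b + 1)" unfolding e' using part_Gr[OF a] z by (intro Gr_diff)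
  ultimately show "y = part b a" using b Gr_disjoint[of "y - part b a"] by auto
qed

lemma sg_part: "sg a = part 0 a - part 1 a"
proof
  fix x :: mono
  have "(- 1) ^ card (snd x) = (psign (of_nat (card (snd x))) :: 'k)" by (simp add: psign_of_nat)
  then show "sg a x = (part 0 a - part 1 a) x"
    by (cases "of_nat (card (snd x)) :: bit") (auto simp: part_def sg_def)
qed

lemma sum_parity: "(\<Sum>b\<in>{0, 1}. f b) = f (0::bit) + f 1"
  by simp

lemma part_sum_d:
  assumes "a \<in> Osp" "i \<in> {1..m}"
  shows "(\<Sum>b\<in>{0, 1}. fscale (psign (mu m i * b)) (d i (part b a))) = d i a"
    "(\<Sum>b\<in>{0, 1}. fscale (psign (mu m (i + m) * b)) (d (i + m) (part b a))) = d (i + m) (sg a)"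
  using part_sum[of a] mu_low[OF assms(2)] mu_high[OF assms(2)] unfolding sum_parity sg_part
  by (simp_all flip: d_linear add: fscale_minus_left)

lemma T_H_eq:
  assumes a: "a \<in> Osp" shows "T_H m t a = TH a"
proof
  fix g
  show "T_H m t a g = TH a g"
  proof (cases "g \<in> Osp")
    case False
    then show ?thesis by (simp add: T_H_def TH_def sum_fun_apply fpartial_eq)
  next
    case g: True
    have "T_H m t a g = (\<Sum>b\<in>{0, 1}. \<Sum>i=1..2*m. fscale (psign (mu m i * b)) (d i (part b a)) \<odot> d (conj_index m i) g)"
      unfolding T_H_def sum_fun_apply fpartial_eq opart_eq[OF a] d_def[symmetric] using g by (simp only: if_True)
    also have "\<dots> = (\<Sum>i=1..2*m. (\<Sum>b\<in>{0, 1}. fscale (psign (mu m i * b)) (d i (part b a))) \<odot> d (conj_index m i) g)"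
      by (subst sum.swap) (simp only: mul_sum)
    also have "\<dots> = (\<Sum>i=1..m. d i a \<odot> d (i + m) g + d (i + m) (sg a) \<odot> d i g)"
      unfolding sum_2m
    proof (rule sum.cong[OF refl])
      fix i assume i: "i \<in> {1..m}"
      then have c: "conj_index m i = i + m" "conj_index m (i + m) = i" by (auto simp: conj_index_def)
      show "(\<Sum>b\<in>{0, 1}. fscale (psign (mu m i * b)) (d i (part b a))) \<odot> d (conj_index m i) g +
        (\<Sum>b\<in>{0, 1}. fscale (psign (mu m (i + m) * b)) (d (i + m) (part b a))) \<odot> d (conj_index m (i + m)) g =
        d i a \<odot> d (i + m) g + d (i + m) (sg a) \<odot> d i g"
        unfolding part_sum_d[OF a i] c ..
    qed
    finally show ?thesis using g by (simp add: TH_def T_def)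
  qed
qed

lemma TH_W:
  assumes a: "a \<in> Osp" shows "TH a \<in> W m t"
proof -
  define f where "f r = (if r \<le> m then d (r + m) (sg a) else d (r - m) a)" for r
  have "TH a = (\<Sum>r=1..2*m. fpartial m t (f r) r)"
    unfolding sum_2m
  proof
    fix g 
    show "TH a g = (\<Sum>i=1..m. fpartial m t (f i) i + fpartial m t (f (i + m)) (i + m)) g"
      unfolding TH_def T_def sum_fun_apply
      by (auto simp: f_def fpartial_eq add.commute intro!: sum.cong)
  qed
  moreover have "\<forall>r\<in>{1..2*m}. f r \<in> carr (O_alg m t :: ('k, mono \<Rightarrow> 'k) superspace)"
    using a by (simp add: f_def O_carr)
  ultimately show ?thesis unfolding W_def by blast
qed

text \<open>Each conjugate pair contributes the same mixed second derivative twice. As 2 is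
  invertible, vanishing divergence is the same as membership of the potential in
  \<open>K\<close>.\<close>

lemma divergence_TH:
  assumes a: "a \<in> Osp" shows "divergence m t (TH a) = fscale 2 (Dl (sg a))"
proof -
  have O: "TH a (xvar m r) \<in> Osp" if "r \<in> {1..2*m}" for r
    using a that by (simp add: TH_def flip: xv_def)
  have "divergence m t (TH a) = (\<Sum>b\<in>{0, 1}. \<Sum>r=1..2*m. fscale (psign (mu m r * b)) (d r (part b (TH a (xvar m r)))))"
    unfolding divergence_def by (intro sum.cong refl) (simp only: opart_eq[OF O] d_def)
  also have "\<dots> = (\<Sum>r=1..2*m. \<Sum>b\<in>{0, 1}. fscale (psign (mu m r * b)) (d r (part b (TH a (xvar m r)))))"
    by (rule sum.swap)
  also have "\<dots> = (\<Sum>i=1..m. fscale 2 (d i (d (i + m) (sg a))))"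
    unfolding sum_2m
  proof (rule sum.cong[OF refl])
    fix i assume i: "i \<in> {1..m}"
    have i2: "i \<in> {1..2*m}" "i + m \<in> {1..2*m}" using i by auto
    have x: "TH a (xvar m i) = d (i + m) (sg a)" "TH a (xvar m (i + m)) = d i a"
      using a i i2 by (simp_all add: TH_def T_xv_low T_xv_high flip: xv_def)
    have c: "d (i + m) (d i (sg a)) = d i (d (i + m) (sg a))"
      using d_commute[OF i2(2,1), of "sg a"] a i by (simp add: mu_low)
    have s: "d (i + m) (sg (d i a)) = d i (d (i + m) (sg a))"
      using sg_d[OF a, of i] i c by (simp add: mu_low)
    have two: "f + f = fscale 2 f" for f :: "mono \<Rightarrow> 'k" by (auto simp: fun_eq_iff)
    show "(\<Sum>b\<in>{0, 1}. fscale (psign (mu m i * b)) (d i (part b (TH a (xvar m i))))) +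
         (\<Sum>b\<in>{0, 1}. fscale (psign (mu m (i + m) * b)) (d (i + m) (part b (TH a (xvar m (i + m)))))) =
         fscale 2 (d i (d (i + m) (sg a)))"
      unfolding part_sum_d(1)[OF O[OF i2(1)] i] part_sum_d(2)[OF O[OF i2(2)] i]
      by (simp only: x s two)
  qed
  finally show ?thesis by (simp add: Dl_def fscale_sum)
qed

lemma SHO_set_eq: "SHO_set m t = TH ` K"
proof -
  have "divergence m t (T_H m t a) = 0 \<longleftrightarrow> Dl a = 0" if a: "a \<in> Osp" for a
  proof -
    have "divergence m t (T_H m t a) = fscale (- 2) (sg (Dl a))"
      using a by (simp add: T_H_eq divergence_TH sg_Dl fscale_minus_left fscale_minus)
    moreover have "fscale (- 2) f = 0 \<longleftrightarrow> f = 0" for f :: "mono \<Rightarrow> 'k"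
      using two_nz by (auto simp: fun_eq_iff)
    moreover have "sg (Dl a) = 0 \<longleftrightarrow> Dl a = 0" using sg_sg[of "Dl a"] by (metis sg_linear(4))
    ultimately show ?thesis by simp
  qed
  then show ?thesis
    unfolding SHO_set_def O_carr K_def using TH_W T_H_eq by (auto simp: image_iff) metis+
qed

lemma TH_linear: "TH (a + b) = TH a + TH b" "TH (a - b) = TH a - TH b" "TH (- a) = - TH a" "TH 0 = 0"
  "TH (fscale c a) = (\<lambda>g. fscale c (TH a g))"
  by (auto simp: TH_def T_linear fun_eq_iff)

text \<open>The operator is determined by its values on the variables, which are the derivatives of
  the potential up to sign; only constants have all derivatives zero.\<close>

lemma TH_eq_iff:
  assumes a: "a \<in> Osp" and b: "b \<in> Osp" shows "TH a = TH b \<longleftrightarrow> eqv a b"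
proof
  assume e: "TH a = TH b"
  have x: "T a (xv s) = T b (xv s)" if "s \<in> {1..2*m}" for s
    using fun_cong[OF e, of "xv s"] that by (simp add: TH_def)
  have "d r (a - b) = 0" if r: "r \<in> {1..2*m}" for r
  proof (cases "r \<le> m")
    case True
    then show ?thesis using r x[of "r + m"] a b by (simp add: T_xv_high d_linear)
  next
    case False
    define i where "i = r - m"
    have i: "i \<in> {1..m}" "r = i + m" using False r by (auto simp: i_def)
    have "d (i + m) (sg (a - b)) = 0" using i x[of i] a b by (simp add: T_xv_low d_linear sg_linear)
    then have "sg (d (i + m) (a - b)) = 0" using sg_d[of "a - b"] a b by simp
    then have "sg (sg (d (i + m) (a - b))) = 0" by (simp only: sg_linear)
    then show ?thesis by (simp add: i)
  qed
  then have "eqv (a - b) 0" using a b by (intro d_zero_eqv) simp_all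
  then show "eqv a b" by (simp add: eqv_def)
next
  assume "eqv a b" then show "TH a = TH b" by (auto simp: TH_def T_eqv_left)
qed

abbreviation OA :: "('k, mono \<Rightarrow> 'k) superspace" where "OA \<equiv> O_alg m t"
abbreviation L :: "('k, (mono \<Rightarrow> 'k) \<Rightarrow> (mono \<Rightarrow> 'k)) lie_super" where "L \<equiv> SHO m t"

lemma OA_cspace: "cspace OA"
proof
  show "vadd OA = (+)" "vzero OA = 0" by (simp_all add: O_alg_def)
  show "vscale OA c (x + y) = vscale OA c x + vscale OA c y" for c x y by (simp add: O_alg_def fscale_add)
  show "0 \<in> grade OA b" for b unfolding O_grade by (rule Gr_zero)
  show "x - y \<in> grade OA b" if "x \<in> grade OA b" "y \<in> grade OA b" for x y b using that unfolding O_grade by (rule Gr_diff)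
  show "grade OA b \<subseteq> carr OA" for b unfolding O_grade O_carr using Gr_Osp by blast
  show "x = 0" if "x \<in> grade OA 0" "x \<in> grade OA 1" for x using that unfolding O_grade by (rule Gr_disjoint)
  show "\<exists>y\<in>grade OA 0. \<exists>z\<in>grade OA 1. x = y + z" if "x \<in> carr OA" for x
    using that Gr_cases[of x] unfolding O_grade O_carr by metis
  show "x - y \<in> carr OA" if "x \<in> carr OA" "y \<in> carr OA" for x y using that unfolding O_carr by simp
qed

interpretation OA: cspace OA by (rule OA_cspace)

lemma OA_ops: "vadd OA = (+)" "vzero OA = 0" "vscale OA = fscale" by (simp_all add: O_alg_def)

lemma TH_endo_grade:
  assumes a: "a \<in> Gr b" shows "TH a \<in> endo_grade OA (b + 1)"
  unfolding endo_grade_def endo_def O_carr O_grade OA_ops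
  using a Gr_T[OF a] by (auto simp: TH_def T_linear)

lemma L_sel: "carr L = TH ` K" "vadd L = (+)" "vzero L = 0" "vscale L c D = (\<lambda>x. fscale c (D x))"
  "grade L b = TH ` K \<inter> endo_grade OA b" "bracket L = supercommutator OA"
  by (auto simp: SHO_def gl_super_def SHO_set_eq OA.endo_add_eq OA_ops)

lemma K_zero: "0 \<in> K" and K_add: "a \<in> K \<Longrightarrow> b \<in> K \<Longrightarrow> a + b \<in> K"
  and K_diff: "a \<in> K \<Longrightarrow> b \<in> K \<Longrightarrow> a - b \<in> K" and K_minus: "a \<in> K \<Longrightarrow> - a \<in> K"
  and K_scale: "a \<in> K \<Longrightarrow> fscale c a \<in> K"
  by (auto intro!: K_I simp: Dl_linear K_Dl)

lemma K_sum: "(\<And>i. i \<in> I \<Longrightarrow> f i \<in> K) \<Longrightarrow> sum f I \<in> K"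
  by (induction I rule: infinite_finite_induct) (auto simp: K_zero K_add)

text \<open>\<open>Dl\<close> reverses parity, so the Laplacians of the two homogeneous parts cannot
  cancel each other.\<close>

lemma K_parts:
  assumes "a \<in> K" obtains a0 a1 where "a0 \<in> K" "a0 \<in> Gr 0" "a1 \<in> K" "a1 \<in> Gr 1" "a = a0 + a1"
proof -
  obtain a0 a1 where g: "a0 \<in> Gr 0" "a1 \<in> Gr 1" "a = a0 + a1" using Gr_cases[of a] assms by auto
  have s: "Dl a0 + Dl a1 = 0" using K_Dl[OF assms] by (simp add: g(3) Dl_linear)
  have 1: "Dl a0 \<in> Gr 1" and 2: "Dl a1 \<in> Gr 0" using Gr_Dl[OF g(1)] Gr_Dl[OF g(2)] by simp_all
  have "Dl a0 = - Dl a1" using s by (simp add: eq_neg_iff_add_eq_0)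
  then have "Dl a0 \<in> Gr 0" using Gr_minus[OF 2] by simp
  then have "Dl a0 = 0" using Gr_disjoint 1 by blast
  moreover then have "Dl a1 = 0" using s by simp
  ultimately show ?thesis using that[of a0 a1] g K_I Gr_Osp by blast
qed

lemma L_grade: "grade L b = TH ` (K \<inter> Gr (b + 1))"
proof
  show "TH ` (K \<inter> Gr (b + 1)) \<subseteq> grade L b"
  proof
    fix D assume "D \<in> TH ` (K \<inter> Gr (b + 1))"
    then obtain a where a: "a \<in> K" "a \<in> Gr (b + 1)" "D = TH a" by blast
    then show "D \<in> grade L b" using TH_endo_grade[OF a(2)] unfolding L_sel by (auto simp: add.assoc)
  qed
  show "grade L b \<subseteq> TH ` (K \<inter> Gr (b + 1))"
  proof
    fix D assume "D \<in> grade L b"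
    then obtain a where a: "a \<in> K" "D = TH a" and D: "TH a \<in> endo_grade OA b" unfolding L_sel by blast
    obtain a' a'' where aa: "a' \<in> K" "a' \<in> Gr (b + 1)" "a'' \<in> K" "a'' \<in> Gr b" "a = a' + a''"
    proof -
      obtain a0 a1 where "a0 \<in> K" "a0 \<in> Gr 0" "a1 \<in> K" "a1 \<in> Gr 1" "a = a0 + a1" using K_parts[OF a(1)] by blast
      then show thesis using that[of a0 a1] that[of a1 a0] by (cases b) (simp_all add: add.commute)
    qed
    have "TH a' \<in> endo_grade OA b" using TH_endo_grade[OF aa(2)] by (simp add: add.assoc)
    moreover have e: "TH a'' = TH a - TH a'" unfolding aa(5) by (simp add: TH_linear)
    ultimately have "TH a'' \<in> endo_grade OA b" using OA.endo_grade_diff[OF D] by simp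
    moreover have "TH a'' \<in> endo_grade OA (b + 1)" using TH_endo_grade[OF aa(4)] .
    \<comment> \<open>The part of the potential with the wrong parity yields an operator that is
      both even and odd.\<close>
    ultimately have "TH a'' = 0" using OA.endo_grade_disjoint by (cases b) auto
    then have "TH a = TH a'" using e by simp
    then show "D \<in> TH ` (K \<inter> Gr (b + 1))" using a aa by blast
  qed
qed

lemma L_cspace: "cspace L"
proof
  show "vadd L = (+)" "vzero L = 0" by (simp_all add: L_sel)
  show "vscale L c (x + y) = vscale L c x + vscale L c y" for c x y by (auto simp: L_sel fscale_add fun_eq_iff algebra_simps)
  show "0 \<in> grade L b" for b unfolding L_grade using K_zero Gr_zero TH_linear(4) by (intro image_eqI[of _ _ 0]) auto
  show "x - y \<in> grade L b" if "x \<in> grade L b" "y \<in> grade L b" for x y b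
    using that unfolding L_grade by (auto simp: TH_linear(2)[symmetric] intro!: imageI K_diff Gr_diff)
  show "grade L b \<subseteq> carr L" for b unfolding L_sel by blast
  show "x = 0" if "x \<in> grade L 0" "x \<in> grade L 1" for x
    using that OA.endo_grade_disjoint unfolding L_sel by blast
  show "\<exists>y\<in>grade L 0. \<exists>z\<in>grade L 1. x = y + z" if x: "x \<in> carr L" for x
  proof -
    obtain a where a: "a \<in> K" "x = TH a" using x unfolding L_sel by blast
    obtain a0 a1 where "a0 \<in> K" "a0 \<in> Gr 0" "a1 \<in> K" "a1 \<in> Gr 1" "a = a0 + a1" using K_parts[OF a(1)] by blast
    then have "TH a1 \<in> grade L 0" "TH a0 \<in> grade L 1" "x = TH a1 + TH a0"
      unfolding L_grade a(2) by (auto simp: TH_linear add.commute)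
    then show ?thesis by blast
  qed
  show "x - y \<in> carr L" if "x \<in> carr L" "y \<in> carr L" for x y
    using that unfolding L_sel by (auto simp: TH_linear(2)[symmetric] intro!: imageI K_diff)
qed

interpretation L: cspace L by (rule L_cspace)

lemma niceD:
  assumes "nice e F"
  shows "lin F" "f \<in> Gr c \<Longrightarrow> F f \<in> Gr (c + e)" "a \<in> K \<Longrightarrow> F a \<in> K" "\<exists>c. F one = fscale c one"
    "a \<in> K \<Longrightarrow> a \<in> Gr c \<Longrightarrow> g \<in> Osp \<Longrightarrow> F (T a g) = T (F a) g + fscale (psign (e * (c + 1))) (T a (F g))"
  using assms unfolding nice_def by blast+

lemma K_T: assumes "a \<in> K" "b \<in> K" shows "T a b \<in> K"
proof -
  obtain a0 a1 where a: "a0 \<in> K" "a0 \<in> Gr 0" "a1 \<in> K" "a1 \<in> Gr 1" "a = a0 + a1" using K_parts[OF assms(1)] by blast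
  show ?thesis unfolding a(5) T_linear
    using niceD(3)[OF nice_T_K[OF a(1,2)] assms(2)] niceD(3)[OF nice_T_K[OF a(3,4)] assms(2)] by (rule K_add)
qed

lemma hom_commutator_TH:
  assumes "a \<in> K" "a \<in> Gr b" "a' \<in> K" "a' \<in> Gr c"
  shows "hom_commutator OA (b + 1) (c + 1) (TH a) (TH a') = TH (T a a')"
proof
  fix g
  show "hom_commutator OA (b + 1) (c + 1) (TH a) (TH a') g = TH (T a a') g"
    using niceD(5)[OF nice_T_K[OF assms(1,2)] assms(3,4), of g] assms
    by (simp add: hom_commutator_def TH_def OA_ops fscale_minus_left T_linear)
qed

lemma bracket_TH:
  assumes "a \<in> K" "b \<in> K" shows "bracket L (TH a) (TH b) = TH (T a b)"
proof -
  obtain a0 a1 where a: "a0 \<in> K" "a0 \<in> Gr 0" "a1 \<in> K" "a1 \<in> Gr 1" "a = a0 + a1" using K_parts[OF assms(1)] by blast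
  obtain b0 b1 where b: "b0 \<in> K" "b0 \<in> Gr 0" "b1 \<in> K" "b1 \<in> Gr 1" "b = b0 + b1" using K_parts[OF assms(2)] by blast
  have e: "TH a1 \<in> endo_grade OA 0" "TH a0 \<in> endo_grade OA 1" "TH b1 \<in> endo_grade OA 0" "TH b0 \<in> endo_grade OA 1"
    using TH_endo_grade[OF a(2)] TH_endo_grade[OF a(4)] TH_endo_grade[OF b(2)] TH_endo_grade[OF b(4)] by simp_all
  have ab: "TH a = TH a1 + TH a0" "TH b = TH b1 + TH b0" by (simp_all add: a b TH_linear add.commute)
  have h: "hom_commutator OA 0 0 (TH a1) (TH b1) = TH (T a1 b1)" "hom_commutator OA 0 1 (TH a1) (TH b0) = TH (T a1 b0)"
    "hom_commutator OA 1 0 (TH a0) (TH b1) = TH (T a0 b1)" "hom_commutator OA 1 1 (TH a0) (TH b0) = TH (T a0 b0)"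
    using hom_commutator_TH[OF a(3,4) b(3,4)] hom_commutator_TH[OF a(3,4) b(1,2)]
      hom_commutator_TH[OF a(1,2) b(3,4)] hom_commutator_TH[OF a(1,2) b(1,2)] by simp_all
  show ?thesis unfolding L_sel ab OA.supercommutator_parts[OF e] h
    unfolding a(5) b(5) by (simp add: T_linear TH_linear add_ac)
qed

section \<open>Superderivations as maps of potentials\<close>

text \<open>The potential normalised to have constant term 0. The normalisation makes it unique, so
  that maps defined through it are linear.\<close>

definition pot :: "((mono \<Rightarrow> 'k) \<Rightarrow> mono \<Rightarrow> 'k) \<Rightarrow> mono \<Rightarrow> 'k" where
  "pot y = (SOME a. a \<in> K \<and> a z0 = 0 \<and> TH a = y)"

lemma TH_const: "TH (a + fscale c one) = TH a"
proof -
  have "eqv (a + fscale c one) a" unfolding eqv_iff by blast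
  then show ?thesis unfolding TH_def using T_eqv_left by presburger
qed

lemma pot_TH:
  assumes a: "a \<in> K" shows "pot (TH a) = a - fscale (a z0) one"
proof -
  let ?b = "a - fscale (a z0) one"
  have ex: "?b \<in> K \<and> ?b z0 = 0 \<and> TH ?b = TH a"
  proof (intro conjI)
    show "TH ?b = TH a" using a TH_const[of a "- a z0"] by (simp add: fscale_minus_left)
  qed (use a in \<open>simp_all add: one_apply K_diff K_scale K_one\<close>)
  then have s: "pot (TH a) \<in> K \<and> pot (TH a) z0 = 0 \<and> TH (pot (TH a)) = TH a"
    unfolding pot_def by (rule someI[of "\<lambda>b. b \<in> K \<and> b z0 = 0 \<and> TH b = TH a"])
  then have "eqv (pot (TH a)) ?b" using ex TH_eq_iff[of "pot (TH a)" ?b] by (metis K_Osp)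
  then show ?thesis using s ex by (metis eqv_eqI)
qed

definition dmap :: "((mono \<Rightarrow> 'k) \<Rightarrow> mono \<Rightarrow> 'k) \<Rightarrow> ((mono \<Rightarrow> 'k) \<Rightarrow> mono \<Rightarrow> 'k) \<Rightarrow> (mono \<Rightarrow> 'k) \<Rightarrow> mono \<Rightarrow> 'k" where
  "dmap F = on_carr L (\<lambda>y. TH (F (pot y)))"

text \<open>What it takes for sending \<open>TH a\<close> to \<open>TH (F a)\<close> to be well
  defined. It does not mention parity, so it survives sums of an even and an odd map, unlike
  \<open>nice\<close>.\<close>

definition compatible :: "((mono \<Rightarrow> 'k) \<Rightarrow> mono \<Rightarrow> 'k) \<Rightarrow> bool" where
  "compatible F \<longleftrightarrow> lin F \<and> (\<forall>a\<in>K. F a \<in> K) \<and> (\<exists>c. F one = fscale c one)"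

lemma nice_compatible: "nice e F \<Longrightarrow> compatible F"
  by (simp add: nice_def compatible_def)

lemma dmap_TH:
  assumes F: "compatible F" and a: "a \<in> K" shows "dmap F (TH a) = TH (F a)"
proof -
  obtain c where c: "F one = fscale c one" using F by (auto simp: compatible_def)
  have lin: "lin F" using F by (simp add: compatible_def)
  have "F (a - fscale (a z0) one) = F a + fscale (- (a z0 * c)) one"
    by (simp add: lin_diff[OF lin] lin_scale[OF lin] c fscale_minus_left)
  then show ?thesis using a by (simp add: dmap_def on_carr_def L_sel pot_TH TH_const)
qed

lemma dmap_out: "y \<notin> carr L \<Longrightarrow> dmap F y = 0"
  by (simp add: dmap_def on_carr_def L_sel)

lemma dmap_eqI:
  assumes F: "compatible F" and D: "\<And>y. y \<notin> carr L \<Longrightarrow> D y = 0" and "\<And>a. a \<in> K \<Longrightarrow> D (TH a) = TH (F a)"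
  shows "D = dmap F"
proof
  fix y show "D y = dmap F y"
  proof (cases "y \<in> carr L")
    case True
    then obtain a where "a \<in> K" "y = TH a" unfolding L_sel by blast
    then show ?thesis using assms(3) dmap_TH[OF F] by simp
  qed (simp add: D dmap_out)
qed

lemma dmap_endo: assumes F: "compatible F" shows "dmap F \<in> endo L"
proof -
  have lin: "lin F" and FK: "\<And>a. a \<in> K \<Longrightarrow> F a \<in> K" using F by (auto simp: compatible_def)
  show ?thesis unfolding endo_def L_sel
    using dmap_TH[OF F] dmap_out[of _ F] FK
    by (auto simp: L_sel(1) TH_linear(1)[symmetric] TH_linear(5)[symmetric] K_add K_scale lin_add[OF lin] lin_scale[OF lin])
qed

lemma dmap_superder:
  assumes F: "nice e F" shows "dmap F \<in> superder_grade L e"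
proof -
  note cF = nice_compatible[OF F]
  have eg: "dmap F \<in> endo_grade L e"
    unfolding endo_grade_def
  proof (intro CollectI conjI allI ballI)
    fix c x assume "x \<in> grade L c"
    then obtain a where a: "a \<in> K" "a \<in> Gr (c + 1)" "x = TH a" unfolding L_grade by blast
    have "F a \<in> Gr (c + 1 + e)" using niceD(2)[OF F a(2)] .
    then have "F a \<in> Gr (e + c + 1)" by (simp only: add_ac)
    then show "dmap F x \<in> grade L (e + c)"
      unfolding L_grade a(3) dmap_TH[OF cF a(1)] using niceD(3)[OF F a(1)] by blast
  qed (rule dmap_endo[OF cF])
  have "dmap F (bracket L x y) = vadd L (bracket L (dmap F x) y) (vscale L (psign (e * c)) (bracket L x (dmap F y)))"
    if x: "x \<in> grade L c" and y: "y \<in> carr L" for c x y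
  proof -
    obtain a where a: "a \<in> K" "a \<in> Gr (c + 1)" "x = TH a" using x unfolding L_grade by blast
    obtain b where b: "b \<in> K" "y = TH b" using y unfolding L_sel by blast
    have "F (T a b) = T (F a) b + fscale (psign (e * c)) (T a (F b))"
      using niceD(5)[OF F a(1,2), of b] b by (simp add: add.assoc)
    then show ?thesis unfolding a(3) b(2)
      by (simp add: bracket_TH a b K_T dmap_TH[OF cF] niceD(3)[OF F] L_sel(2,4) TH_linear)
  qed
  then show ?thesis using eg unfolding superder_grade_def by blast
qed

lemma ad_TH: assumes y: "y \<in> K" shows "ad L (TH y) = dmap (T y)"
proof (rule dmap_eqI)
  have "T y one = fscale 0 one" using T_eqv_right[OF eqv_one(2), of y] by (simp add: T_linear)
  then show "compatible (T y)" unfolding compatible_def using K_T[OF y] lin_T_right by blast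
  show "ad L (TH y) D = 0" if "D \<notin> carr L" for D using that by (simp add: ad_def on_carr_def L_sel)
  show "ad L (TH y) (TH a) = TH (T y a)" if "a \<in> K" for a
    using that y bracket_TH by (simp add: ad_def on_carr_def L_sel(1))
qed

text \<open>The potential form of a superderivation: a map of \<open>K\<close> that is a derivation of the Buttin bracket
  modulo constants.\<close>

definition pder :: "bit \<Rightarrow> ((mono \<Rightarrow> 'k) \<Rightarrow> mono \<Rightarrow> 'k) \<Rightarrow> bool" where
  "pder e \<phi> \<longleftrightarrow> (\<forall>a\<in>K. \<phi> a \<in> K) \<and> (\<forall>a\<in>K. \<forall>b\<in>K. \<phi> (a + b) = \<phi> a + \<phi> b) \<and>
     (\<forall>c. \<forall>a\<in>K. \<phi> (fscale c a) = fscale c (\<phi> a)) \<and> eqv (\<phi> one) 0 \<and>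
     (\<forall>c. \<forall>a\<in>K \<inter> Gr c. \<phi> a \<in> Gr (c + e)) \<and>
     (\<forall>c. \<forall>a\<in>K \<inter> Gr c. \<forall>b\<in>K. eqv (\<phi> (T a b)) (T (\<phi> a) b + fscale (psign (e * (c + 1))) (T a (\<phi> b))))"

lemma superder_pder:
  assumes D: "D \<in> superder_grade L e"
  obtains \<phi> where "pder e \<phi>" "\<And>a. a \<in> K \<Longrightarrow> D (TH a) = TH (\<phi> a)"
proof -
  have De: "D \<in> endo L" and Dg: "\<And>c x. x \<in> grade L c \<Longrightarrow> D x \<in> grade L (e + c)"
    and Db: "\<And>c x y. x \<in> grade L c \<Longrightarrow> y \<in> carr L \<Longrightarrow>
       D (bracket L x y) = vadd L (bracket L (D x) y) (vscale L (psign (e * c)) (bracket L x (D y)))"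
    using D unfolding superder_grade_def endo_grade_def by blast+
  define \<phi> where "\<phi> a = pot (D (TH a))" for a
  have ex: "\<exists>b\<in>K. D (TH a) = TH b" if "a \<in> K" for a
    using L.endoD(1)[OF De, of "TH a"] that unfolding L_sel(1) by blast
  have phi: "\<phi> a \<in> K \<and> D (TH a) = TH (\<phi> a) \<and> \<phi> a z0 = 0" if a: "a \<in> K" for a
  proof -
    obtain b where b: "b \<in> K" "D (TH a) = TH b" using ex[OF a] by blast
    have "\<phi> a = b - fscale (b z0) one" unfolding \<phi>_def b(2) using b(1) by (rule pot_TH)
    moreover have "TH (b - fscale (b z0) one) = TH b"
      using TH_const[of b "- b z0"] by (simp add: fscale_minus_left)
    ultimately show ?thesis using b K_one by (auto simp: K_diff K_scale one_apply)
  qed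
  \<comment> \<open>Values are known only modulo constants; the normalised constant term turns such
    equalities into true ones, which gives additivity and homogeneity.\<close>
  have uniq: "\<phi> a = b" if "a \<in> K" "b \<in> K" "b z0 = 0" "D (TH a) = TH b" for a b
  proof -
    have "eqv (\<phi> a) b" using phi[OF that(1)] that TH_eq_iff[of "\<phi> a" b] by simp
    moreover have "\<phi> a z0 = b z0" using phi[OF that(1)] that by simp
    ultimately show ?thesis by (rule eqv_eqI)
  qed
  have add: "\<phi> (a + b) = \<phi> a + \<phi> b" if "a \<in> K" "b \<in> K" for a b
  proof (rule uniq)
    have "D (TH (a + b)) = D (TH a) + D (TH b)"
      unfolding TH_linear using that by (intro L.endoD(3)[OF De]) (auto simp: L_sel(1))
    then show "D (TH (a + b)) = TH (\<phi> a + \<phi> b)" using phi that by (simp add: TH_linear)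
  qed (use that phi in \<open>auto intro: K_add\<close>)
  have scale: "\<phi> (fscale c a) = fscale c (\<phi> a)" if "a \<in> K" for a c
  proof (rule uniq)
    have "D (TH (fscale c a)) = vscale L c (D (TH a))"
      using L.endoD(4)[OF De, of "TH a" c] that by (simp add: L_sel TH_linear)
    then show "D (TH (fscale c a)) = TH (fscale c (\<phi> a))" using phi that by (simp add: TH_linear L_sel)
  qed (use that phi in \<open>auto intro: K_scale\<close>)
  have one: "\<phi> one = 0"
  proof (rule uniq[OF K_one K_zero])
    have "TH one = TH 0" using K_one K_zero by (subst TH_eq_iff) (auto simp: eqv_one)
    then have "D (TH one) = D 0" by (simp add: TH_linear)
    also have "D 0 = 0" using L.endoD(3)[OF De L.zero_carr L.zero_carr] by simp
    finally show "D (TH one) = TH 0" by (simp add: TH_linear)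
  qed simp
  have gr: "\<phi> a \<in> Gr (c + e)" if a: "a \<in> K" "a \<in> Gr c" for a c
  proof -
    have "TH a \<in> grade L (c + 1)" unfolding L_grade using a by (auto simp: add.assoc)
    then have "D (TH a) \<in> grade L (e + (c + 1))" by (rule Dg)
    then obtain b where b: "b \<in> K" "b \<in> Gr (e + (c + 1) + 1)" "D (TH a) = TH b" unfolding L_grade by blast
    have b': "b \<in> Gr (c + e)" using b(2) by (simp add: add.assoc add.commute)
    have "\<phi> a = b - fscale (b z0) one" unfolding \<phi>_def b(3) using b(1) by (rule pot_TH)
    moreover have "b - fscale (b z0) one \<in> Gr (c + e)"
    proof (cases "b z0 = 0")
      case False
      \<comment> \<open>Subtracting the constant term respects parity: it is nonzero only if the
        element has even parity.\<close>
      then have "c + e = 0" using Gr_D[OF b', of z0] by simp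
      then show ?thesis using b' one_Gr by (simp add: Gr_diff Gr_scale)
    qed (simp add: b')
    ultimately show ?thesis by simp
  qed
  have br: "eqv (\<phi> (T a b)) (T (\<phi> a) b + fscale (psign (e * (c + 1))) (T a (\<phi> b)))"
    if a: "a \<in> K" "a \<in> Gr c" and b: "b \<in> K" for a b c
  proof -
    have ag: "TH a \<in> grade L (c + 1)" unfolding L_grade using a by (auto simp: add.assoc)
    have bc: "TH b \<in> carr L" using b by (simp add: L_sel)
    have "TH (\<phi> (T a b)) = D (bracket L (TH a) (TH b))"
      using phi[OF K_T[OF a(1) b]] a b by (simp add: bracket_TH)
    also have "\<dots> = bracket L (TH (\<phi> a)) (TH b) + (\<lambda>x. fscale (psign (e * (c + 1))) (bracket L (TH a) (TH (\<phi> b)) x))"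
      unfolding Db[OF ag bc] using phi a b by (simp add: L_sel(2,4))
    also have "\<dots> = TH (T (\<phi> a) b + fscale (psign (e * (c + 1))) (T a (\<phi> b)))"
      using phi a b by (simp add: bracket_TH TH_linear)
    finally show ?thesis using phi[OF a(1)] phi[OF b] phi[OF K_T[OF a(1) b]] a b by (subst (asm) TH_eq_iff) simp_all
  qed
  have "pder e \<phi>" unfolding pder_def using phi add scale one gr br by simp
  then show ?thesis using that phi by blast
qed

end

section \<open>Outer superderivations\<close>

context sho begin

lemma funpow_lin: "lin F \<Longrightarrow> lin (F ^^ n)" for F :: "(mono \<Rightarrow> 'k) \<Rightarrow> mono \<Rightarrow> 'k"
  by (induction n) (simp_all add: lin_def)

lemma O_dpow [simp]: "f \<in> Osp \<Longrightarrow> (d i ^^ n) f \<in> Osp"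
  by (induction n) auto

lemma dpow_linear: "(d i ^^ n) (f + g) = (d i ^^ n) f + (d i ^^ n) g" "(d i ^^ n) (f - g) = (d i ^^ n) f - (d i ^^ n) g"
  "(d i ^^ n) (fscale c f) = fscale c ((d i ^^ n) f)" "(d i ^^ n) 0 = 0"
  "(d i ^^ n) (sum A I) = (\<Sum>j\<in>I. (d i ^^ n) (A j))"
  using lin_add[OF funpow_lin[OF lin_d]] lin_diff[OF funpow_lin[OF lin_d]] lin_scale[OF funpow_lin[OF lin_d]]
    lin_zero[OF funpow_lin[OF lin_d]] lin_sum[OF funpow_lin[OF lin_d]] by auto

lemma dpow_coeff:
  assumes i: "i \<in> {1..m}" and f: "f \<in> Osp"
  shows "(d i ^^ n) f (\<alpha>, u) = f (\<alpha>(i := \<alpha> i + n), u)"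
  using f
proof (induction n arbitrary: f)
  case (Suc n)
  have "(d i ^^ Suc n) f (\<alpha>, u) = (d i ^^ n) (d i f) (\<alpha>, u)" by (simp add: funpow_swap1)
  also have "\<dots> = d i f (\<alpha>(i := \<alpha> i + n), u)" by (rule Suc.IH) (simp add: Suc.prems)
  also have "\<dots> = f (\<alpha>(i := \<alpha> i + Suc n), u)" using i Suc.prems by (simp add: d_even)
  finally show ?case .
qed simp

lemma dpow_top:
  assumes i: "i \<in> {1..m}" and f: "f \<in> Osp" shows "(d i ^^ (p ^ t i)) f = 0"
proof
  fix z :: mono
  obtain \<alpha> u where z: "z = (\<alpha>, u)" by (cases z)
  have "(\<alpha>(i := \<alpha> i + p ^ t i), u) \<notin> M" using i by (auto simp: M_iff)
  then show "(d i ^^ (p ^ t i)) f z = 0 z" using O_out[OF f] by (simp add: z dpow_coeff[OF i f])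
qed

lemma Gr_dpow: "i \<in> {1..m} \<Longrightarrow> f \<in> Gr c \<Longrightarrow> (d i ^^ n) f \<in> Gr c"
proof (induction n)
  case (Suc n)
  then show ?case using Gr_d[of "(d i ^^ n) f" c i] by (simp add: mu_low)
qed simp

text \<open>The operation B is kept abstract because the formula is used both for the product and
  for the bracket \<open>T\<close>.\<close>

lemma dpow_bilinear:
  assumes D: "\<And>f g. f \<in> Osp \<Longrightarrow> g \<in> Osp \<Longrightarrow> d i (B f g) = B (d i f) g + B f (d i g)"
    and f: "f \<in> Osp" and g: "g \<in> Osp"
  shows "(d i ^^ n) (B f g) = (\<Sum>j\<le>n. fscale (of_nat (n choose j)) (B ((d i ^^ j) f) ((d i ^^ (n - j)) g)))"
proof (induction n)
  case (Suc n)
  let ?b = "\<lambda>j k. B ((d i ^^ j) f) ((d i ^^ k) g)"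
  have B: "d i (?b j k) = ?b (Suc j) k + ?b j (Suc k)" for j k
    using D[of "(d i ^^ j) f" "(d i ^^ k) g"] f g by simp
  have "(d i ^^ Suc n) (B f g) = (\<Sum>j\<le>n. fscale (of_nat (n choose j)) (?b (Suc j) (n - j) + ?b j (Suc (n - j))))"
    by (simp only: funpow.simps comp_apply Suc.IH d_linear B)
  also have "\<dots> = (\<Sum>j\<le>n. fscale (of_nat (n choose j)) (?b (Suc j) (n - j))) +
     (\<Sum>j\<le>n. fscale (of_nat (n choose j)) (?b j (Suc n - j)))"
    by (simp add: fscale_add sum.distrib Suc_diff_le)
  also have "(\<Sum>j\<le>n. fscale (of_nat (n choose j)) (?b j (Suc n - j))) =
     (\<Sum>j\<le>Suc n. fscale (of_nat (n choose j)) (?b j (Suc n - j)))"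
    by (simp add: binomial_eq_0)
  also have "\<dots> = ?b 0 (Suc n) + (\<Sum>j\<le>n. fscale (of_nat (n choose Suc j)) (?b (Suc j) (n - j)))"
    by (subst sum.atMost_Suc_shift) simp
  finally have "(d i ^^ Suc n) (B f g) = (\<Sum>j\<le>n. fscale (of_nat (n choose j)) (?b (Suc j) (n - j))) +
     (?b 0 (Suc n) + (\<Sum>j\<le>n. fscale (of_nat (n choose Suc j)) (?b (Suc j) (n - j))))" .
  also have "\<dots> = ?b 0 (Suc n) + ((\<Sum>j\<le>n. fscale (of_nat (n choose j)) (?b (Suc j) (n - j))) +
     (\<Sum>j\<le>n. fscale (of_nat (n choose Suc j)) (?b (Suc j) (n - j))))"
    by (rule add.left_commute)
  also have "\<dots> = ?b 0 (Suc n) + (\<Sum>j\<le>n. fscale (of_nat (Suc n choose Suc j)) (?b (Suc j) (n - j)))"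
    unfolding sum.distrib[symmetric] fscale_add_left[symmetric] by (simp only: binomial_Suc_Suc of_nat_add)
  also have "\<dots> = (\<Sum>j\<le>Suc n. fscale (of_nat (Suc n choose j)) (?b j (Suc n - j)))"
    by (subst sum.atMost_Suc_shift) simp
  finally show ?case .
qed simp

text \<open>All inner binomial coefficients of p^s vanish modulo p, so the p^s-th power of a
  derivation is again a derivation.\<close>

lemma dpow_prime_bilinear:
  assumes D: "\<And>f g. f \<in> Osp \<Longrightarrow> g \<in> Osp \<Longrightarrow> d i (B f g) = B (d i f) g + B f (d i g)"
    and f: "f \<in> Osp" and g: "g \<in> Osp"
  shows "(d i ^^ (p ^ s)) (B f g) = B ((d i ^^ (p ^ s)) f) g + B f ((d i ^^ (p ^ s)) g)"
proof -
  let ?q = "p ^ s" 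
  let ?b = "\<lambda>j. fscale (of_nat (?q choose j)) (B ((d i ^^ j) f) ((d i ^^ (?q - j)) g))"
  have q: "?q > 0" using prime_p by (simp add: prime_gt_0_nat)
  have "(\<Sum>j\<le>?q. ?b j) = (\<Sum>j\<in>{0, ?q}. ?b j)"
  proof (rule sum.mono_neutral_right)
    show "\<forall>j\<in>{..?q} - {0, ?q}. ?b j = 0"
      using of_nat_p_dvd[OF prime_dvd_choose_power[OF prime_p]] by simp
  qed auto
  also have "\<dots> = ?b 0 + ?b ?q" using q by (subst sum.insert) auto
  finally have "(\<Sum>j\<le>?q. ?b j) = ?b 0 + ?b ?q" .
  moreover have "(d i ^^ ?q) (B f g) = (\<Sum>j\<le>?q. ?b j)" by (rule dpow_bilinear[where i=i and B=B, OF D f g])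
  ultimately show ?thesis by (simp add: add.commute)
qed

lemma d_mul_Gr:
  assumes "f \<in> Gr c" "g \<in> Osp"
  shows "d r (f \<odot> g) = d r f \<odot> g + fscale (psign (mu m r * c)) (f \<odot> d r g)"
  using assms by (cases "r \<le> m") (auto simp: d_mul tw_def mu_def sg_Gr mul_fscale)

lemma Lder_d: assumes r: "r \<in> {1..2*m}" shows "Lder (mu m r) 0 (d r)"
  unfolding Lder_def using lin_d Gr_d d_mul_Gr d_Dl[OF r] by simp

lemma nice_d: "r \<in> {1..2*m} \<Longrightarrow> nice (mu m r) (d r)"
  using Lder_nice[OF Lder_d] by simp

lemma K_d: "a \<in> K \<Longrightarrow> d r a \<in> K"
  using niceD(3)[OF nice_d[of r]] d_out[of r a] K_zero by (cases "r \<in> {1..2*m}") auto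

lemma d_T_even:
  assumes i: "i \<in> {1..m}" and a: "a \<in> Osp" and g: "g \<in> Osp"
  shows "d i (T a g) = T (d i a) g + T a (d i g)"
proof -
  have c: "d i (d j f) = d j (d i f)" if "j \<in> {1..2*m}" "f \<in> Osp" for j f
    using d_commute[of i j f] that i by (simp add: mu_low)
  have s: "sg (d i a) = d i (sg a)" using sg_d[OF a, of i] i by (simp add: mu_low)
  have "d i (d j a \<odot> d (j + m) g + d (j + m) (sg a) \<odot> d j g) =
     (d j (d i a) \<odot> d (j + m) g + d (j + m) (sg (d i a)) \<odot> d j g) +
     (d j a \<odot> d (j + m) (d i g) + d (j + m) (sg a) \<odot> d j (d i g))" if j: "j \<in> {1..m}" for j
    using i j a g by (simp add: d_linear d_mul tw_low c s add_ac)
  then show ?thesis unfolding T_def d_linear sum.distrib[symmetric] by (rule sum.cong[OF refl])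
qed

lemma Lder_dpow: assumes i: "i \<in> {1..m}" shows "Lder 0 0 (d i ^^ (p ^ s))"
  unfolding Lder_def
proof (intro conjI allI ballI)
  have Dl: "(d i ^^ n) (Dl f) = Dl ((d i ^^ n) f)" if "f \<in> Osp" for f n
    using that i by (induction n) (auto simp: d_Dl mu_low)
  show "(d i ^^ (p ^ s)) (f \<odot> g) = (d i ^^ (p ^ s)) f \<odot> g + fscale (psign (0 * c)) (f \<odot> (d i ^^ (p ^ s)) g)"
    if "f \<in> Gr c" "g \<in> Osp" for f g c
    using dpow_prime_bilinear[of i "(\<odot>)" f g s] i that by (simp add: d_mul tw_low)
  show "(d i ^^ (p ^ s)) (Dl f) = fscale (psign 0) (Dl ((d i ^^ (p ^ s)) f)) + fscale 0 (Dl f)" if "f \<in> Osp" for f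
    using Dl[OF that] by simp
qed (use i in \<open>auto simp: funpow_lin lin_d Gr_dpow\<close>)

lemma nice_dpow: "i \<in> {1..m} \<Longrightarrow> nice 0 (d i ^^ (p ^ s))"
  using Lder_nice[OF Lder_dpow] by simp

definition deg :: "mono \<Rightarrow> nat" where
  "deg z = (\<Sum>i=1..m. fst z i) + card (snd z)"

definition Eop :: "(mono \<Rightarrow> 'k) \<Rightarrow> mono \<Rightarrow> 'k" where
  "Eop f = (\<lambda>z. of_nat (deg z) * f z)"

lemma deg_up: "i \<in> {1..m} \<Longrightarrow> deg (\<alpha>(i := Suc (\<alpha> i)), u) = Suc (deg (\<alpha>, u))"
proof -
  assume i: "i \<in> {1..m}"
  have "(\<Sum>j=1..m. (\<alpha>(i := Suc (\<alpha> i))) j) = Suc (\<alpha> i) + (\<Sum>j\<in>{1..m} - {i}. \<alpha> j)"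
    using i by (subst sum.remove[of _ i]) (auto intro!: sum.cong)
  moreover have "(\<Sum>j=1..m. \<alpha> j) = \<alpha> i + (\<Sum>j\<in>{1..m} - {i}. \<alpha> j)"
    using i by (subst sum.remove[of _ i]) auto
  ultimately show ?thesis by (simp add: deg_def)
qed

lemma deg_insert: "finite u \<Longrightarrow> r \<notin> u \<Longrightarrow> deg (\<alpha>, insert r u) = Suc (deg (\<alpha>, u))"
  by (simp add: deg_def)

lemma O_Eop [simp]: "f \<in> Osp \<Longrightarrow> Eop f \<in> Osp"
  unfolding Osp_def Eop_def by simp

lemma Eop_apply: "Eop f z = of_nat (deg z) * f z"
  by (simp add: Eop_def)

lemma lin_Eop: "lin Eop"
  by (auto simp: lin_def Eop_def fun_eq_iff algebra_simps)

lemma Gr_Eop: "f \<in> Gr c \<Longrightarrow> Eop f \<in> Gr c"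
  unfolding Gr_def Osp_def Eop_def by auto

lemma d_Eop:
  assumes r: "r \<in> {1..2*m}" and f: "f \<in> Osp" shows "d r (Eop f) = Eop (d r f) + d r f"
proof
  fix z :: mono
  obtain \<alpha> u where z: "z = (\<alpha>, u)" by (cases z)
  from mu_cases[OF r] show "d r (Eop f) z = (Eop (d r f) + d r f) z"
  proof
    assume "r \<in> {1..m} \<and> mu m r = 0"
    then show ?thesis using f by (simp add: z d_even Eop_apply deg_up algebra_simps)
  next
    assume r: "r \<in> {m+1..2*m} \<and> mu m r = 1"
    show ?thesis
    proof (cases "finite u \<and> r \<notin> u")
      case True
      then show ?thesis using f r by (simp add: z d_odd Eop_apply deg_insert algebra_simps)
    next
      case False
      then have "r \<in> u \<or> (\<alpha>, insert r u) \<notin> M" using finite_odd by fastforce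
      then show ?thesis using f r O_out[OF f] by (auto simp: z d_odd Eop_apply)
    qed
  qed
qed

lemma Eop_single: "Eop (single z) = fscale (of_nat (deg z)) (single z)"
  by (auto simp: Eop_def single_def fun_eq_iff)

lemma deg_madd:
  assumes "x \<in> M" "y \<in> M" "snd x \<inter> snd y = {}" shows "deg (madd x y) = deg x + deg y"
proof -
  have "finite (snd x)" "finite (snd y)" using assms finite_odd by (metis prod.collapse)+
  then show ?thesis using assms(3) by (simp add: deg_def madd_def sum.distrib card_Un_disjoint)
qed

lemma Eop_mul:
  assumes "f \<in> Osp" "g \<in> Osp" shows "Eop (f \<odot> g) = Eop f \<odot> g + f \<odot> Eop g"
proof (rule bilin_ext[of "\<lambda>f g. Eop (f \<odot> g)" "\<lambda>f g. Eop f \<odot> g + f \<odot> Eop g", OF _ _ _ _ _ assms])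
  fix x y assume M: "x \<in> M" "y \<in> M"
  show "Eop (single x \<odot> single y) = Eop (single x) \<odot> single y + single x \<odot> Eop (single y)"
  proof (cases "mcoeff m x y = (0::'k)")
    case True
    then show ?thesis using M by (simp add: mul_single lin_zero[OF lin_Eop] Eop_single mul_fscale)
  next
    case False
    then have "deg (madd x y) = deg x + deg y" using M by (intro deg_madd) (auto simp: mcoeff_def split: if_splits)
    then show ?thesis using M
      by (simp add: mul_single lin_scale[OF lin_Eop] Eop_single mul_fscale flip: fscale_add_left)
        (simp add: algebra_simps)
  qed
next
  show "lin (\<lambda>f. Eop f \<odot> g + f \<odot> Eop g)" "lin (\<lambda>g. Eop f \<odot> g + f \<odot> Eop g)" for f g
    by (intro lin_plus lin_comp[OF lin_mul_left lin_Eop] lin_comp[OF lin_mul_right lin_Eop] lin_mul_left lin_mul_right)+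
qed (intro lin_comp[OF lin_Eop lin_mul_left] lin_comp[OF lin_Eop lin_mul_right])+

text \<open>\<open>Dl\<close> lowers the degree by two, whence the scalar -2 and, through
  \<open>Lder_nice\<close>, the shift in \<open>E2\<close>.\<close>

lemma Lder_Eop: "Lder 0 (- 2) Eop"
  unfolding Lder_def
proof (intro conjI allI ballI)
  fix f assume f: "f \<in> Osp"
  have "Eop (d i (d (i + m) f)) = d i (d (i + m) (Eop f)) + fscale (- 2) (d i (d (i + m) f))" if i: "i \<in> {1..m}" for i
  proof -
    have "d i (d (i + m) (Eop f)) = Eop (d i (d (i + m) f)) + d i (d (i + m) f) + d i (d (i + m) f)"
      using i f by (simp add: d_Eop d_linear)
    then show ?thesis by (simp add: fscale_minus_left fun_eq_iff)
  qed
  then have "Eop (Dl f) = (\<Sum>i=1..m. d i (d (i + m) (Eop f)) + fscale (- 2) (d i (d (i + m) f)))"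
    unfolding Dl_def lin_sum[OF lin_Eop] by (rule sum.cong[OF refl])
  then show "Eop (Dl f) = fscale (psign 0) (Dl (Eop f)) + fscale (- 2) (Dl f)"
    by (simp add: Dl_def sum.distrib fscale_sum)
qed (auto simp: lin_Eop Gr_Eop Eop_mul)

definition E2 :: "(mono \<Rightarrow> 'k) \<Rightarrow> mono \<Rightarrow> 'k" where "E2 f = Eop f + fscale (- 2) f"

lemma nice_E2: "nice 0 E2"
  using Lder_nice[OF Lder_Eop] unfolding E2_def[abs_def] .

lemma E2_apply: "E2 f z = (of_nat (deg z) - 2) * f z"
  by (simp add: E2_def Eop_def algebra_simps)

definition tmono :: "nat \<Rightarrow> mono" where
  "tmono i = ((\<lambda>j. 0)(i := p ^ t i - 1), {})"

definition xpi :: "nat \<Rightarrow> mono \<Rightarrow> 'k" where "xpi i = single (tmono i)"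

lemma p_pos: "p > 0" using char by simp

lemma p_pow_pos: "p ^ n > 0" using prime_p by (simp add: prime_gt_0_nat)

lemma tmono_M: "i \<in> {1..m} \<Longrightarrow> tmono i \<in> M"
  by (auto simp: tmono_def M_iff p_pow_pos p_pos)

lemma xpi_Gr: "i \<in> {1..m} \<Longrightarrow> xpi i \<in> Gr 0"
  unfolding xpi_def by (intro Gr_single tmono_M) (simp_all add: tmono_def)

lemma d_xpi: "i \<in> {1..m} \<Longrightarrow> r \<in> {1..2*m} \<Longrightarrow> r \<noteq> i \<Longrightarrow> d r (xpi i) = 0"
  unfolding xpi_def by (auto simp: d_single tmono_M) (auto simp: tmono_def mono_partial_def)

definition Gop :: "nat \<Rightarrow> (mono \<Rightarrow> 'k) \<Rightarrow> mono \<Rightarrow> 'k" where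
  "Gop i f = xpi i \<odot> d (i + m) f"

text \<open>The factor \<open>xpi i\<close> depends on the i-th variable only, so the bracket term
  in \<open>Dl_mul\<close> contains the conjugate odd derivative twice and vanishes.
  \<open>Gop i\<close> would be inner, namely bracketing with the next divided power, if that power
  were not cut off by the truncation.\<close>

lemma Lder_Gop: assumes i: "i \<in> {1..m}" shows "Lder 1 0 (Gop i)"
  unfolding Lder_def
proof (intro conjI allI ballI)
  note [simp] = Gr_Osp[OF xpi_Gr[OF i]]
  show "lin (Gop i)" unfolding Gop_def[abs_def] by (intro lin_comp[OF lin_mul_right lin_d])
  show "Gop i f \<in> Gr (c + 1)" if "f \<in> Gr c" for f c
    using mul_Gr[OF xpi_Gr[OF i] Gr_d[OF that, of "i + m"]] by (simp add: Gop_def mu_high[OF i])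
  show "Gop i (f \<odot> g) = Gop i f \<odot> g + fscale (psign (1 * c)) (f \<odot> Gop i g)" if f: "f \<in> Gr c" and g: "g \<in> Osp" for f g c
  proof -
    have "xpi i \<odot> (f \<odot> d (i + m) g) = f \<odot> (xpi i \<odot> d (i + m) g)"
      using mul_assoc[of "xpi i" f "d (i + m) g"] mul_assoc[of f "xpi i" "d (i + m) g"] mul_commute[OF xpi_Gr[OF i] f] f g
      by simp
    then show ?thesis
      using f g by (simp add: Gop_def d_mul_Gr[OF f g] mu_high[OF i] mul_add mul_fscale mul_assoc)
  qed
  fix f assume f: "f \<in> Osp"
  have im: "i + m \<in> {1..2*m}" using i by auto
  have sgx: "sg (xpi i) = xpi i" using sg_Gr[OF xpi_Gr[OF i]] by simp
  have dd: "d (i + m) (d (i + m) f) = 0"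
  proof -
    have "d (i + m) (d (i + m) f) = - d (i + m) (d (i + m) f)"
      by (rule d_commute[OF im im f, unfolded mu_high[OF i] mult_1 psign_one fscale_minus_left fscale_simps(1)])
    then show ?thesis using double_zero by (metis eq_neg_iff_add_eq_0)
  qed
  have "T (xpi i) (d (i + m) f) = 0"
    unfolding T_def sgx
  proof (intro sum.neutral ballI)
    fix j assume j: "j \<in> {1..m}"
    have "d (j + m) (xpi i) = 0" using i j by (intro d_xpi) auto
    moreover have "j \<noteq> i \<Longrightarrow> d j (xpi i) = 0" using i j by (intro d_xpi) auto
    ultimately show "d j (xpi i) \<odot> d (j + m) (d (i + m) f) + d (j + m) (xpi i) \<odot> d j (d (i + m) f) = 0"
      by (cases "j = i") (simp_all add: mul_add dd)
  qed
  moreover have "Dl (xpi i) = 0"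
    unfolding Dl_def
  proof (intro sum.neutral ballI)
    fix j assume j: "j \<in> {1..m}"
    have "d (j + m) (xpi i) = 0" using i j by (intro d_xpi) auto
    then show "d j (d (j + m) (xpi i)) = 0" by (simp add: d_linear)
  qed
  ultimately have "Dl (Gop i f) = xpi i \<odot> Dl (d (i + m) f)"
    unfolding Gop_def using f by (simp add: Dl_mul sgx mul_add)
  then show "Gop i (Dl f) = fscale (psign 1) (Dl (Gop i f)) + fscale 0 (Dl f)"
    using f d_Dl[OF im f] mu_high[OF i] by (simp add: Gop_def mul_fscale)
qed simp

lemma nice_Gop: "i \<in> {1..m} \<Longrightarrow> nice 1 (Gop i)"
  using Lder_nice[OF Lder_Gop] by simp

definition xximono :: "nat \<Rightarrow> nat \<Rightarrow> mono" where
  "xximono i j = ((\<lambda>k. 0)(i := 1), {j + m})"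

definition xxi :: "nat \<Rightarrow> nat \<Rightarrow> mono \<Rightarrow> 'k" where "xxi i j = single (xximono i j)"

lemma xximono_M: "i \<in> {1..m} \<Longrightarrow> j \<in> {1..m} \<Longrightarrow> xximono i j \<in> M"
  using p_pow_gt[of i] by (auto simp: xximono_def M_iff p_pow_pos p_pos)

lemma xxi_Gr: "i \<in> {1..m} \<Longrightarrow> j \<in> {1..m} \<Longrightarrow> xxi i j \<in> Gr 1"
  unfolding xxi_def by (intro Gr_single xximono_M) (simp_all add: xximono_def)

lemma d_xxi:
  assumes "i \<in> {1..m}" "j \<in> {1..m}" "k \<in> {1..m}"
  shows "d k (xxi i j) = (if k = i then xv (j + m) else 0)" "d (k + m) (xxi i j) = (if k = j then xv i else 0)"
proof -
  have e: "((\<lambda>k. 0)(i := 1))(i := 0) = (\<lambda>k. 0 :: nat)" by auto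
  have c: "{l. l = j + m \<and> l < j + m} = {}" by auto
  show "d k (xxi i j) = (if k = i then xv (j + m) else 0)" "d (k + m) (xxi i j) = (if k = j then xv i else 0)"
    unfolding xxi_def using assms
    by (auto simp: d_single xximono_M) (auto simp: xximono_def mono_partial_def xv_eq xmono_def c fun_upd_def intro!: arg_cong[where f=single])
qed

lemma Dl_xxi:
  assumes "i \<in> {1..m}" "j \<in> {1..m}" shows "Dl (xxi i j) = (if i = j then one else 0)"
proof -
  have "Dl (xxi i j) = (\<Sum>k=1..m. if k = j then if i = j then one else 0 else 0)"
    unfolding Dl_def
  proof (rule sum.cong[OF refl])
    fix k assume k: "k \<in> {1..m}"
    then show "d k (d (k + m) (xxi i j)) = (if k = j then if i = j then one else 0 else 0)"
      using assms by (auto simp: d_xxi d_xv d_linear)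
  qed
  then show ?thesis using assms by simp
qed

lemma nice_T_xxi: "i \<in> {1..m} \<Longrightarrow> nice 0 (T (xxi i i))"
  using nice_T[OF xxi_Gr[of i i], of 1] by (simp add: Dl_xxi)

lemma T_xxi:
  assumes i: "i \<in> {1..m}" and j: "j \<in> {1..m}" and f: "f \<in> Osp"
  shows "T (xxi i j) f = xv (j + m) \<odot> d (i + m) f - xv i \<odot> d j f"
proof -
  have sg: "sg (xxi i j) = - xxi i j" using sg_Gr[OF xxi_Gr[OF i j]] by (simp add: fscale_minus_left)
  have "T (xxi i j) f = (\<Sum>k=1..m. if k = i then xv (j + m) \<odot> d (i + m) f else 0) +
     (\<Sum>k=1..m. if k = j then - (xv i \<odot> d j f) else 0)"
    unfolding T_def sum.distrib[symmetric]
    by (intro sum.cong refl) (auto simp: sg d_linear d_xxi[OF i j] mul_add simp del: atLeastAtMost_iff)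
  then show ?thesis using i j by simp
qed

end

section \<open>Values of a superderivation on the variables\<close>

context sho begin

lemma nice_zero: "nice e (\<lambda>f. 0)"
  by (auto simp: nice_def lin_def Gr_zero K_zero T_linear intro!: exI[of _ 0])

lemma nice_add:
  assumes F: "nice e F" and G: "nice e G" shows "nice e (\<lambda>f. F f + G f)"
  unfolding nice_def
proof (intro conjI allI ballI)
  show "lin (\<lambda>f. F f + G f)" using niceD(1)[OF F] niceD(1)[OF G] by (rule lin_plus)
  obtain c c' where "F one = fscale c one" "G one = fscale c' one" using niceD(4)[OF F] niceD(4)[OF G] by blast
  then have "F one + G one = fscale (c + c') one" by (simp add: fscale_add_left)
  then show "\<exists>c. F one + G one = fscale c one" by blast
  fix c a g assume a: "a \<in> K \<inter> Gr c" and g: "g \<in> Osp"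
  then show "F (T a g) + G (T a g) = T (F a + G a) g + fscale (psign (e * (c + 1))) (T a (F g + G g))"
    using niceD(5)[OF F, of a c g] niceD(5)[OF G, of a c g] by (simp add: T_linear fscale_add add_ac)
qed (auto intro: Gr_add K_add niceD(2)[OF F] niceD(2)[OF G] niceD(3)[OF F] niceD(3)[OF G])

lemma nice_scale:
  assumes "c = 0 \<or> nice e F" shows "nice e (\<lambda>f. fscale c (F f))"
proof (cases "c = 0")
  case False
  then have F: "nice e F" using assms by simp
  show ?thesis unfolding nice_def
  proof (intro conjI allI ballI)
    show "lin (\<lambda>f. fscale c (F f))" using niceD(1)[OF F] by (rule lin_fscale)
    obtain c' where "F one = fscale c' one" using niceD(4)[OF F] by blast
    then have "fscale c (F one) = fscale (c * c') one" by simp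
    then show "\<exists>c'. fscale c (F one) = fscale c' one" by blast
    fix b a g assume a: "a \<in> K \<inter> Gr b" and g: "g \<in> Osp"
    then show "fscale c (F (T a g)) = T (fscale c (F a)) g + fscale (psign (e * (b + 1))) (T a (fscale c (F g)))"
      using niceD(5)[OF F, of a b g] by (simp add: T_linear fscale_add mult.commute)
  qed (auto intro: Gr_scale K_scale niceD(2)[OF F] niceD(3)[OF F])
qed (simp add: nice_zero)

lemma nice_sum: "(\<And>i. i \<in> I \<Longrightarrow> nice e (F i)) \<Longrightarrow> nice e (\<lambda>f. \<Sum>i\<in>I. F i f)"
  by (induction I rule: infinite_finite_induct) (simp_all add: nice_zero nice_add)

lemma pderD:
  assumes "pder e \<phi>"
  shows "a \<in> K \<Longrightarrow> \<phi> a \<in> K" "a \<in> K \<Longrightarrow> b \<in> K \<Longrightarrow> \<phi> (a + b) = \<phi> a + \<phi> b"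
    "a \<in> K \<Longrightarrow> \<phi> (fscale c a) = fscale c (\<phi> a)" "eqv (\<phi> one) 0"
    "a \<in> K \<Longrightarrow> a \<in> Gr b' \<Longrightarrow> \<phi> a \<in> Gr (b' + e)"
    "a \<in> K \<Longrightarrow> a \<in> Gr b' \<Longrightarrow> b \<in> K \<Longrightarrow>
       eqv (\<phi> (T a b)) (T (\<phi> a) b + fscale (psign (e * (b' + 1))) (T a (\<phi> b)))"
  using assms unfolding pder_def by blast+

lemma pder_zero: "pder e \<phi> \<Longrightarrow> \<phi> 0 = 0"
  using pderD(3)[of e \<phi> 0 0] K_zero by simp

lemma pder_minus: "pder e \<phi> \<Longrightarrow> a \<in> K \<Longrightarrow> \<phi> (- a) = - \<phi> a"
  using pderD(3)[of e \<phi> a "- 1"] by (simp add: fscale_minus_left)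

lemma pder_sum: "pder e \<phi> \<Longrightarrow> (\<And>i. i \<in> I \<Longrightarrow> f i \<in> K) \<Longrightarrow> \<phi> (sum f I) = (\<Sum>i\<in>I. \<phi> (f i))"
proof (induction I rule: infinite_finite_induct)
  case (insert x F)
  then have "\<phi> (f x + sum f F) = \<phi> (f x) + \<phi> (sum f F)" by (intro pderD(2)) (auto intro: K_sum)
  moreover have "\<phi> (sum f F) = (\<Sum>i\<in>F. \<phi> (f i))" using insert by blast
  ultimately show ?case unfolding sum.insert[OF insert.hyps] by (simp only:)
qed (simp_all only: sum.infinite sum.empty pder_zero not_False_eq_True)

lemma pder_const: "pder e \<phi> \<Longrightarrow> eqv (\<phi> (fscale c one)) 0"
  using pderD(3)[OF _ K_one] eqv_scale[OF pderD(4)] by (metis fscale_simps(3))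

lemma pder_sub:
  assumes \<phi>: "pder e \<phi>" and F: "nice e F" shows "pder e (\<lambda>a. \<phi> a - F a)"
  unfolding pder_def
proof (intro conjI allI ballI)
  note lin = niceD(1)[OF F]
  show "\<phi> (a + b) - F (a + b) = \<phi> a - F a + (\<phi> b - F b)" if "a \<in> K" "b \<in> K" for a b
    using that pderD(2)[OF \<phi>] by (simp add: lin_add[OF lin])
  show "\<phi> (fscale c a) - F (fscale c a) = fscale c (\<phi> a - F a)" if "a \<in> K" for a c
    using that pderD(3)[OF \<phi>] by (simp add: lin_scale[OF lin] fscale_diff)
  obtain c where "F one = fscale c one" using niceD(4)[OF F] by blast
  then have "eqv (F one) 0" by (simp add: eqv_one)
  then show "eqv (\<phi> one - F one) 0" using eqv_diff[OF pderD(4)[OF \<phi>]] by fastforce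
  fix c a b assume a: "a \<in> K \<inter> Gr c" and b: "b \<in> K"
  have "eqv (\<phi> (T a b) - F (T a b)) (T (\<phi> a) b + fscale (psign (e * (c + 1))) (T a (\<phi> b)) -
     (T (F a) b + fscale (psign (e * (c + 1))) (T a (F b))))"
    using a b niceD(5)[OF F, of a c b] pderD(6)[OF \<phi>, of a c b] by (intro eqv_diff) auto
  then show "eqv (\<phi> (T a b) - F (T a b)) (T (\<phi> a - F a) b + fscale (psign (e * (c + 1))) (T a (\<phi> b - F b)))"
    by (simp add: T_linear fscale_diff algebra_simps)
qed (auto intro: K_diff Gr_diff niceD(2)[OF F] niceD(3)[OF F] pderD(1)[OF \<phi>] pderD(5)[OF \<phi>])

text \<open>The one-form of \<phi>: if \<phi> agrees on the variables with bracketing by A, then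
  \<open>ww \<phi> r\<close> is \<open>d r A\<close>. The second branch undoes the sign in
  \<open>T_xv_low\<close>.\<close>

definition ww :: "((mono \<Rightarrow> 'k) \<Rightarrow> mono \<Rightarrow> 'k) \<Rightarrow> nat \<Rightarrow> mono \<Rightarrow> 'k" where
  "ww \<phi> r = (if r \<le> m then \<phi> (xv (r + m)) else - sg (\<phi> (xv (r - m))))"

lemma ww_low: "i \<in> {1..m} \<Longrightarrow> ww \<phi> i = \<phi> (xv (i + m))"
  and ww_high: "i \<in> {1..m} \<Longrightarrow> ww \<phi> (i + m) = - sg (\<phi> (xv i))"
  by (auto simp: ww_def)

lemma idx: "i \<in> {1..m} \<Longrightarrow> i \<in> {1..2*m}" "i \<in> {1..m} \<Longrightarrow> i + m \<in> {1..2*m}" by auto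

lemma K_sg: "a \<in> K \<Longrightarrow> sg a \<in> K"
  using sg_Dl[of a] by (intro K_I) (simp_all add: K_Dl sg_linear)

lemma idx_cases:
  assumes "r \<in> {1..2*m}" obtains i where "i \<in> {1..m}" "r = i" | i where "i \<in> {1..m}" "r = i + m"
proof (cases "r \<le> m")
  case False
  then show ?thesis using that(2)[of "r - m"] assms by auto
qed (use assms that(1) in auto)

lemma K_ww: "pder e \<phi> \<Longrightarrow> r \<in> {1..2*m} \<Longrightarrow> ww \<phi> r \<in> K"
proof (erule idx_cases)
  assume \<phi>: "pder e \<phi>"
  have x: "\<phi> (xv s) \<in> K" if "s \<in> {1..2*m}" for s using pderD(1)[OF \<phi> K_xv[OF that]] .
  show "ww \<phi> r \<in> K" if "i \<in> {1..m}" "r = i" for i using x[OF idx(2)[OF that(1)]] that by (simp add: ww_low)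
  show "ww \<phi> r \<in> K" if "i \<in> {1..m}" "r = i + m" for i
    using x[OF idx(1)[OF that(1)]] that by (simp add: ww_high K_minus K_sg)
qed

lemma Gr_ww: 
  assumes \<phi>: "pder e \<phi>" and r: "r \<in> {1..2*m}" shows "ww \<phi> r \<in> Gr (e + 1 + mu m r)"
  using r
proof (cases rule: idx_cases)
  case (1 i)
  then show ?thesis
    using pderD(5)[OF \<phi> K_xv Gr_xv, OF idx(2) idx(2), of i] mu_high[of i] by (simp add: ww_low mu_low add_ac)
next
  case (2 i)
  then show ?thesis
    using Gr_minus[OF Gr_sg[OF pderD(5)[OF \<phi> K_xv Gr_xv, OF idx(1) idx(1), of i]]] mu_high[of i]
    by (simp only: ww_high mu_low add.assoc add_0 bit_add_self add_0_right)
qed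

lemma eqv_move: "eqv 0 (f + g) \<Longrightarrow> eqv (- f) g"
  unfolding eqv_def by (metis minus_unique plus_fun_apply uminus_apply zero_fun_apply)

lemma eqv_move': "eqv 0 (f - g) \<Longrightarrow> eqv f g"
  unfolding eqv_def by (metis eq_iff_diff_eq_0 minus_apply zero_fun_apply)

text \<open>Two variables have a constant bracket, which \<phi> sends to a constant. Expanding
  \<phi> of this bracket by the derivation rule says that the one-form is closed up to
  constants.\<close>

lemma ww_closed_eqv:
  assumes \<phi>: "pder e \<phi>" and r: "r \<in> {1..2*m}" and s: "s \<in> {1..2*m}"
  shows "eqv (d s (ww \<phi> r)) (fscale (psign (mu m r * mu m s)) (d r (ww \<phi> s)))"
proof -
  have OK: "\<phi> (xv r) \<in> Osp" if "r \<in> {1..2*m}" for r using pderD(1)[OF \<phi> K_xv[OF that]] by simp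
  have ll: "eqv (d i (ww \<phi> j)) (d j (ww \<phi> i))" if i: "i \<in> {1..m}" and j: "j \<in> {1..m}" for i j
  proof -
    have "eqv (\<phi> (T (xv (j + m)) (xv (i + m)))) (d i (\<phi> (xv (j + m))) - d j (\<phi> (xv (i + m))))"
      using pderD(6)[OF \<phi> K_xv Gr_xv K_xv, of "j + m" "i + m"] i j mu_high[OF j] OK
      by (simp add: T_xv_high xv_T_high)
    moreover have "T (xv (j + m)) (xv (i + m)) = 0" using i j by (simp add: xv_T_high d_xv)
    ultimately have "eqv 0 (d i (ww \<phi> j) - d j (ww \<phi> i))" using i j by (simp add: ww_low pder_zero[OF \<phi>])
    then show ?thesis by (rule eqv_move')
  qed
  have hh: "eqv (d (i + m) (ww \<phi> (j + m))) (- d (j + m) (ww \<phi> (i + m)))" if i: "i \<in> {1..m}" and j: "j \<in> {1..m}" for i j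
  proof -
    have "eqv (\<phi> (T (xv j) (xv i))) (d (i + m) (sg (\<phi> (xv j))) + fscale (psign e) (d (j + m) (\<phi> (xv i))))"
      using pderD(6)[OF \<phi> K_xv Gr_xv K_xv, of "j" "i"] i j mu_low[OF j] OK
      by (simp add: T_xv_low xv_T_low)
    moreover have "T (xv j) (xv i) = 0" using i j by (simp add: xv_T_low d_xv)
    moreover have "sg (\<phi> (xv i)) = fscale (psign e) (\<phi> (xv i))"
      using sg_Gr[OF pderD(5)[OF \<phi> K_xv Gr_xv, of i]] i by (simp add: mu_low)
    ultimately have "eqv 0 (d (i + m) (sg (\<phi> (xv j))) + d (j + m) (sg (\<phi> (xv i))))"
      by (simp add: pder_zero[OF \<phi>] d_linear)
    then have "eqv (- d (i + m) (sg (\<phi> (xv j)))) (d (j + m) (sg (\<phi> (xv i))))" by (rule eqv_move)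
    then show ?thesis using i j by (simp only: ww_high d_linear minus_minus)
  qed
  have hl: "eqv (d (i + m) (ww \<phi> j)) (d j (ww \<phi> (i + m)))" if i: "i \<in> {1..m}" and j: "j \<in> {1..m}" for i j
  proof -
    have "eqv (\<phi> (T (xv (j + m)) (xv i))) (d (i + m) (sg (\<phi> (xv (j + m)))) - d j (\<phi> (xv i)))"
      using pderD(6)[OF \<phi> K_xv Gr_xv K_xv, of "j + m" "i"] i j mu_high[OF j] OK
      by (simp add: T_xv_low xv_T_high)
    moreover have "T (xv (j + m)) (xv i) = fscale (if i = j then - 1 else 0) one"
      using i j by (simp add: xv_T_high d_xv fscale_minus_left)
    then have "eqv (\<phi> (T (xv (j + m)) (xv i))) 0" by (simp only: pder_const[OF \<phi>])
    ultimately have "eqv (d (i + m) (sg (\<phi> (xv (j + m)))) - d j (\<phi> (xv i))) 0" using eqv_sym eqv_trans by blast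
    from sg_eqv[OF this] have neg: "eqv (- d (i + m) (\<phi> (xv (j + m))) - d j (sg (\<phi> (xv i)))) 0"
      using OK i j by (simp add: sg_linear sg_d mu_low mu_high[OF i] fscale_minus_left)
    then have "eqv 0 (d (i + m) (\<phi> (xv (j + m))) + d j (sg (\<phi> (xv i))))"
      using eqv_sym[OF eqv_minus[OF neg]] by (simp add: add.commute)
    from eqv_minus[OF eqv_move[OF this]] show ?thesis using i j by (simp only: ww_low ww_high d_linear minus_minus)
  qed
  from r s show ?thesis
    by (elim idx_cases; simp add: mu_low mu_high fscale_minus_left ll hh hl eqv_sym del: atLeastAtMost_iff)
qed

text \<open>Toral elements: a product of conjugate variables has Laplacian 1, so that only
  differences of two of them lie in \<open>K\<close>.\<close>

definition tor :: "nat \<Rightarrow> nat \<Rightarrow> mono \<Rightarrow> 'k" where "tor j k = xxi j j - xxi k k"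

lemma K_tor: "j \<in> {1..m} \<Longrightarrow> k \<in> {1..m} \<Longrightarrow> tor j k \<in> K"
  by (intro K_I) (simp_all add: tor_def Dl_linear Dl_xxi Gr_Osp[OF xxi_Gr])

lemma Gr_tor: "j \<in> {1..m} \<Longrightarrow> k \<in> {1..m} \<Longrightarrow> tor j k \<in> Gr 1"
  by (simp add: tor_def Gr_diff xxi_Gr)

text \<open>The weight of the variable conjugate to the \<open>r\<close>-th one with respect to \<open>tor j k\<close>.\<close>

definition th :: "nat \<Rightarrow> nat \<Rightarrow> nat \<Rightarrow> 'k" where
  "th j k r = (if r \<le> m then of_bool (j = r) - of_bool (k = r) else of_bool (k = r - m) - of_bool (j = r - m))"

lemma th_simps: "i \<in> {1..m} \<Longrightarrow> th j k i = of_bool (j = i) - of_bool (k = i)"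
  "i \<in> {1..m} \<Longrightarrow> th j k (i + m) = of_bool (k = i) - of_bool (j = i)"
  by (auto simp: th_def)

lemma T_tor:
  assumes "j \<in> {1..m}" "k \<in> {1..m}" "f \<in> Osp"
  shows "T (tor j k) f = xv (j + m) \<odot> d (j + m) f - xv j \<odot> d j f - (xv (k + m) \<odot> d (k + m) f - xv k \<odot> d k f)"
  using assms by (simp add: tor_def T_linear T_xxi)

lemma T_tor_xv:
  assumes j: "j \<in> {1..m}" and k: "k \<in> {1..m}" and i: "i \<in> {1..m}"
  shows "T (tor j k) (xv (i + m)) = fscale (th j k i) (xv (i + m))" "T (tor j k) (xv i) = fscale (th j k (i + m)) (xv i)"
  using assms idx by (auto simp: T_tor th_simps d_xv mul_add mul_one fscale_minus_left)

lemma d_T_tor: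
  assumes j: "j \<in> {1..m}" and k: "k \<in> {1..m}" and s: "s \<in> {1..2*m}" and h: "h \<in> Osp"
  shows "d s (T (tor j k) h) = T (tor j k) (d s h) - fscale (th j k s) (d s h)"
proof -
  have 1: "d s (T (tor j k) h) = T (d s (tor j k)) h + T (tor j k) (d s h)"
    using niceD(5)[OF nice_d[OF s] K_tor[OF j k] Gr_tor[OF j k] h] by simp
  have "T (d s (tor j k)) h = - fscale (th j k s) (d s h)"
    using s
  proof (cases rule: idx_cases)
    case (1 i)
    then show ?thesis using j k h
      by (auto simp: tor_def d_linear d_xxi T_linear xv_T_high th_simps fscale_minus_left)
  next
    case (2 i)
    then show ?thesis using j k h
      by (auto simp: tor_def d_linear d_xxi T_linear xv_T_low th_simps fscale_minus_left)
  qed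
  then show ?thesis using 1 by simp
qed

lemma sg_T: assumes a: "a \<in> Gr 1" and h: "h \<in> Osp" shows "sg (T a h) = T a (sg h)"
proof (rule lin_ext_Gr[OF _ _ _ h, of "\<lambda>h. sg (T a h)" "\<lambda>h. T a (sg h)"])
  fix b f assume f: "f \<in> Gr b"
  have "T a f \<in> Gr b" using Gr_T[OF a f] by simp
  then show "sg (T a f) = T a (sg f)" using f by (simp add: sg_Gr T_linear)
qed (intro lin_comp[OF lin_sg lin_T_right] lin_comp[OF lin_T_right lin_sg])+

lemma ww_bracket:
  assumes \<phi>: "pder e \<phi>" and q: "q \<in> K" "q \<in> Gr 1"
  shows "i \<in> {1..m} \<Longrightarrow> eqv (\<phi> (T q (xv (i + m)))) (d i (\<phi> q) + T q (ww \<phi> i))"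
    "i \<in> {1..m} \<Longrightarrow> eqv (- sg (\<phi> (T q (xv i)))) (d (i + m) (\<phi> q) + T q (ww \<phi> (i + m)))"
proof -
  note Q = pderD(1)[OF \<phi> q(1)]
  show "eqv (\<phi> (T q (xv (i + m)))) (d i (\<phi> q) + T q (ww \<phi> i))" if i: "i \<in> {1..m}"
    using pderD(6)[OF \<phi> q K_xv, of "i + m"] i Q by (simp add: T_xv_high ww_low)
  show "eqv (- sg (\<phi> (T q (xv i)))) (d (i + m) (\<phi> q) + T q (ww \<phi> (i + m)))" if i: "i \<in> {1..m}"
  proof -
    have "eqv (\<phi> (T q (xv i))) (d (i + m) (sg (\<phi> q)) + T q (\<phi> (xv i)))"
      using pderD(6)[OF \<phi> q K_xv, of "i"] i Q by (simp add: T_xv_low)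
    from eqv_minus[OF sg_eqv[OF this]] show ?thesis
      using i Q q K_xv[of i] pderD(1)[OF \<phi>, of "xv i"]
      by (simp add: sg_linear sg_d mu_high sg_T ww_high T_linear fscale_minus_left)
  qed
qed

lemma ww_tor:
  assumes \<phi>: "pder e \<phi>" and j: "j \<in> {1..m}" and k: "k \<in> {1..m}" and r: "r \<in> {1..2*m}"
  shows "eqv (fscale (th j k r) (ww \<phi> r)) (d r (\<phi> (tor j k)) + T (tor j k) (ww \<phi> r))"
  using r
proof (cases rule: idx_cases)
  case (1 i)
  then show ?thesis using ww_bracket(1)[OF \<phi> K_tor[OF j k] Gr_tor[OF j k], of i] j k
    by (simp add: T_tor_xv pderD(3)[OF \<phi> K_xv] ww_low del: atLeastAtMost_iff) (simp add: pderD(3)[OF \<phi> K_xv])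
next
  case (2 i)
  then show ?thesis using ww_bracket(2)[OF \<phi> K_tor[OF j k] Gr_tor[OF j k], of i] j k
    by (simp add: T_tor_xv pderD(3)[OF \<phi> K_xv] ww_high sg_linear fscale_minus)
qed

text \<open>The constant by which the one-form fails to be closed in the directions s and r.\<close>

definition cc :: "((mono \<Rightarrow> 'k) \<Rightarrow> mono \<Rightarrow> 'k) \<Rightarrow> nat \<Rightarrow> nat \<Rightarrow> 'k" where
  "cc \<phi> s r = (d s (ww \<phi> r) - fscale (psign (mu m r * mu m s)) (d r (ww \<phi> s))) z0"

lemma eqv_const: "eqv f 0 \<Longrightarrow> f = fscale (f z0) one"
  by (rule eqv_eqI) (auto simp: one_apply intro: eqv_trans eqv_sym[OF eqv_one(1)])

lemma cc_eq:
  assumes "pder e \<phi>" "r \<in> {1..2*m}" "s \<in> {1..2*m}"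
  shows "d s (ww \<phi> r) - fscale (psign (mu m r * mu m s)) (d r (ww \<phi> s)) = fscale (cc \<phi> s r) one"
  unfolding cc_def
  by (rule eqv_const) (use ww_closed_eqv[OF assms] in \<open>auto simp: eqv_def\<close>)

lemma T_const [simp]: "T a (fscale c one) = 0" "T (fscale c one) a = 0" "T a one = 0" "T one a = 0"
  using T_eqv_right[OF eqv_one(1), of a c] T_eqv_left[OF eqv_one(1), of c a]
   T_eqv_right[OF eqv_one(2), of a] T_eqv_left[OF eqv_one(2), of a] by (auto simp: T_linear)

text \<open>Differentiating \<open>ww_tor\<close> and antisymmetrising removes the contribution of
  \<phi> of \<open>tor j k\<close>, an exact form, and bracketing with \<open>tor j k\<close> kills
  the constant that remains. So this constant equals zero after multiplication by its
  weight.\<close>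

lemma cc_tor:
  assumes \<phi>: "pder e \<phi>" and j: "j \<in> {1..m}" and k: "k \<in> {1..m}" and r: "r \<in> {1..2*m}" and s: "s \<in> {1..2*m}"
  shows "(th j k r + th j k s) * cc \<phi> s r = 0"
proof -
  let ?B = "\<phi> (tor j k)" and ?T = "T (tor j k)" and ?X = "\<lambda>s r. d s (ww \<phi> r)"
  have B: "?B \<in> Osp" using pderD(1)[OF \<phi> K_tor[OF j k]] by simp
  have X: "fscale (th j k r + th j k s) (?X s r) = d s (d r ?B) + ?T (?X s r)"
    if r: "r \<in> {1..2*m}" and s: "s \<in> {1..2*m}" for r s
  proof -
    have "d s (fscale (th j k r) (ww \<phi> r)) = d s (d r ?B + ?T (ww \<phi> r))"
      by (rule d_eqv) (rule ww_tor[OF \<phi> j k r])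
    then show ?thesis using K_ww[OF \<phi> r] by (simp add: d_linear d_T_tor[OF j k s] fscale_add_left algebra_simps)
  qed
  let ?e = "psign (mu m r * mu m s) :: 'k"
  have "fscale (th j k r + th j k s) (?X s r - fscale ?e (?X r s)) =
      (d s (d r ?B) - fscale ?e (d r (d s ?B))) + ?T (?X s r - fscale ?e (?X r s))"
  proof -
    have "fscale (th j k r + th j k s) (?X r s) = d r (d s ?B) + ?T (?X r s)"
      using X[OF s r] by (simp only: add.commute[of "th j k s"])
    then have "fscale ?e (fscale (th j k r + th j k s) (?X r s)) = fscale ?e (d r (d s ?B)) + fscale ?e (?T (?X r s))"
      by (simp only: fscale_add)
    then show ?thesis using X[OF r s] unfolding T_linear fscale_diff fscale_simps(4) by (simp add: mult.commute)
  qed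
  moreover have "d s (d r ?B) = fscale ?e (d r (d s ?B))" using d_commute[OF s r B] by (simp add: mult.commute)
  ultimately have "fscale (th j k r + th j k s) (fscale (cc \<phi> s r) one) = 0"
    unfolding cc_eq[OF \<phi> r s] by simp
  then have "(fscale (th j k r + th j k s) (fscale (cc \<phi> s r) one)) z0 = 0" by (simp only: zero_fun_apply)
  then show ?thesis by (simp add: one_apply)
qed

lemma other_index: 
  obtains k where "k \<in> {1..m}" "k \<noteq> i" "k \<noteq> j"
proof -
  have "card {i, j} < card {1..m}" using m3 card_insert_le_m1[of 2 "{j}" i] by (simp add: card_insert_if)
  then have "\<not> {1..m} \<subseteq> {i, j}" by (meson card_mono finite.intros leD)
  then obtain k where "k \<in> {1..m}" "k \<notin> {i, j}" by blast
  then show ?thesis using that by blast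
qed

lemma minus_one_neq_one: "(- 1 :: 'k) \<noteq> 1"
  using two_nz by (metis add.right_inverse one_add_one)

text \<open>With k different from i and j, the weights in \<open>cc_tor\<close> are 1 or 2 up to
  sign, hence invertible. Only conjugate pairs have total weight zero and escape.\<close>

lemma cc_zero:
  assumes \<phi>: "pder e \<phi>" and i: "i \<in> {1..m}" and j: "j \<in> {1..m}"
  shows "cc \<phi> i j = 0" "cc \<phi> (i + m) (j + m) = 0" "i \<noteq> j \<Longrightarrow> cc \<phi> (i + m) j = 0" "i \<noteq> j \<Longrightarrow> cc \<phi> i (j + m) = 0"
proof -
  obtain k where k: "k \<in> {1..m}" "k \<noteq> i" "k \<noteq> j" by (rule other_index)
  note t = cc_tor[OF \<phi> j k(1)]
  note ii = idx(1)[OF i] idx(2)[OF i] and jj = idx(1)[OF j] idx(2)[OF j]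
  show "cc \<phi> i j = 0" using t[OF jj(1) ii(1)] i j k two_nz
    by (cases "i = j") (auto simp: th_simps simp del: atLeastAtMost_iff split: if_splits)
  show "cc \<phi> (i + m) (j + m) = 0" using t[OF jj(2) ii(2)] i j k two_nz minus_one_neq_one
    by (cases "i = j") (auto simp: th_simps simp del: atLeastAtMost_iff split: if_splits)
  show "i \<noteq> j \<Longrightarrow> cc \<phi> (i + m) j = 0" using t[OF jj(1) ii(2)] i j k two_nz
    by (auto simp: th_simps simp del: atLeastAtMost_iff split: if_splits)
  show "i \<noteq> j \<Longrightarrow> cc \<phi> i (j + m) = 0" using t[OF jj(2) ii(1)] i j k two_nz
    by (auto simp: th_simps simp del: atLeastAtMost_iff split: if_splits)
qed

lemma K_xxi: "i \<in> {1..m} \<Longrightarrow> j \<in> {1..m} \<Longrightarrow> i \<noteq> j \<Longrightarrow> xxi i j \<in> K"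
  by (intro K_I) (simp_all add: Dl_xxi Gr_Osp[OF xxi_Gr])

text \<open>Bracketing with the product of the i-th variable and the conjugate of the j-th carries
  one conjugate pair into the other. The two relations from \<open>ww_bracket\<close> then identify
  the defects of both pairs, so a single constant remains.\<close>

lemma cc_constant:
  assumes \<phi>: "pder e \<phi>" and i: "i \<in> {1..m}" and j: "j \<in> {1..m}"
  shows "cc \<phi> (j + m) j = cc \<phi> (i + m) i"
proof (cases "i = j")
  case False
  let ?q = "xxi i j" and ?w = "ww \<phi>"
  note q = K_xxi[OF i j False] xxi_Gr[OF i j]
  have B: "\<phi> ?q \<in> Osp" using pderD(1)[OF \<phi> q(1)] by simp
  have w: "?w r \<in> Osp" if "r \<in> {1..2*m}" for r using K_ww[OF \<phi> that] by simp
  have Tq: "T ?q (xv (i + m)) = xv (j + m)" "T ?q (xv j) = - xv i"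
    using i j False idx by (simp_all add: T_xxi d_xv mul_add mul_one)
  have 1: "eqv (?w j) (d i (\<phi> ?q) + T ?q (?w i))"
    using ww_bracket(1)[OF \<phi> q i] j by (simp add: Tq ww_low)
  have "- sg (\<phi> (T ?q (xv j))) = - ?w (i + m)"
    using i by (simp add: Tq pder_minus[OF \<phi> K_xv] sg_linear ww_high)
  then have 2: "eqv (- ?w (i + m)) (d (j + m) (\<phi> ?q) + T ?q (?w (j + m)))"
    using ww_bracket(2)[OF \<phi> q j] by simp
  have n1: "d (j + m) (T ?q h) = d (i + m) h + T ?q (d (j + m) h)" if "h \<in> Osp" for h
    using niceD(5)[OF nice_d[OF idx(2)[OF j]] q that] i j that by (simp add: d_xxi xv_T_low)
  have n2: "d i (T ?q h) = - d j h + T ?q (d i h)" if "h \<in> Osp" for h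
    using niceD(5)[OF nice_d[OF idx(1)[OF i]] q that] i j that by (simp add: d_xxi xv_T_high)
  have e1: "d (j + m) (?w j) = d (j + m) (d i (\<phi> ?q)) + d (i + m) (?w i) + T ?q (d (j + m) (?w i))"
    using d_eqv[OF 1, of "j + m"] n1[OF w[OF idx(1)[OF i]]] by (simp add: d_linear)
  have e2: "- d i (?w (i + m)) = d i (d (j + m) (\<phi> ?q)) - d j (?w (j + m)) + T ?q (d i (?w (j + m)))"
    using d_eqv[OF 2, of i] n2[OF w[OF idx(2)[OF j]]] by (simp add: d_linear)
  have "d (j + m) (?w i) - d i (?w (j + m)) = 0"
    using cc_eq[OF \<phi> idx(1)[OF i] idx(2)[OF j]] cc_zero(3)[OF \<phi> j i] False i by (simp add: mu_low)
  moreover have "d (j + m) (d i (\<phi> ?q)) = d i (d (j + m) (\<phi> ?q))"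
    using d_commute[OF idx(2)[OF j] idx(1)[OF i] B] i by (simp add: mu_low)
  ultimately have "d (j + m) (?w j) - d j (?w (j + m)) = d (i + m) (?w i) - d i (?w (i + m))"
    using e1 e2 by (simp add: algebra_simps)
  then show ?thesis using i j by (simp add: cc_def mu_low)
qed simp

lemma ww_diff: "ww (\<lambda>a. \<phi> a - \<psi> a) r = ww \<phi> r - ww \<psi> r"
  by (simp add: ww_def sg_linear)

lemma cc_diff: "cc (\<lambda>a. \<phi> a - \<psi> a) s r = cc \<phi> s r - cc \<psi> s r"
  by (simp add: cc_def ww_diff d_linear algebra_simps)

lemma Gr_even_z0: "f \<in> Gr 1 \<Longrightarrow> f z0 = 0"
  using Gr_D[of f 1 z0] by auto

lemma cc_odd: 
  assumes \<phi>: "pder 1 \<phi>" and i: "i \<in> {1..m}" shows "cc \<phi> (i + m) i = 0"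
proof -
  have "d (i + m) (ww \<phi> i) \<in> Gr 1"
    using Gr_d[OF Gr_ww[OF \<phi> idx(1)[OF i]], of "i + m"] i by (simp add: mu_low mu_high add.assoc)
  moreover have "d i (ww \<phi> (i + m)) \<in> Gr 1"
    using Gr_d[OF Gr_ww[OF \<phi> idx(2)[OF i]], of "i"] i by (simp add: mu_low mu_high add.assoc)
  ultimately show ?thesis using i by (simp add: cc_def Gr_even_z0 mu_low)
qed

lemma E2_xv: "r \<in> {1..2*m} \<Longrightarrow> E2 (xv r) = - xv r"
proof
  fix z assume r: "r \<in> {1..2*m}"
  have "deg (xmono r) = 1" using r by (auto simp: xmono_def deg_def)
  then show "E2 (xv r) z = (- xv r) z" by (simp add: E2_apply xv_eq single_apply)
qed

lemma cc_E2: assumes i: "i \<in> {1..m}" shows "cc E2 (i + m) i = - 2"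
proof -
  have "sg (xv i) = xv i" using sg_Gr[OF Gr_xv[OF idx(1)[OF i]]] i by (simp add: mu_low)
  then have "ww E2 i = - xv (i + m)" "ww E2 (i + m) = xv i"
    by (simp_all only: ww_low[OF i] ww_high[OF i] E2_xv[OF idx(1)[OF i]] E2_xv[OF idx(2)[OF i]] sg_linear minus_minus)
  then show ?thesis using i idx[of i]
    unfolding cc_def by (simp only: d_linear d_xv mu_low mult_zero_left psign_zero fscale_simps if_True) (simp add: one_apply)
qed

end

section \<open>Top powers, the Poincare lemma, and reduction on the variables\<close>

context sho begin

lemma xmono_eq_iff: "r \<in> {1..2*m} \<Longrightarrow> s \<in> {1..2*m} \<Longrightarrow> xmono r = xmono s \<longleftrightarrow> r = s"
proof
  assume r: "r \<in> {1..2*m}" and s: "s \<in> {1..2*m}" and e: "xmono r = xmono s"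
  have "xv s (xmono r) = 1" by (simp add: xv_eq single_apply e)
  show "r = s"
  proof (rule ccontr)
    assume "r \<noteq> s"
    have "d r (xv s) = d r (xv r)" by (simp only: xv_eq e)
    then have "(0 :: mono \<Rightarrow> 'k) z0 = one z0" using d_xv[OF r s] d_xv[OF r r] \<open>r \<noteq> s\<close> by simp
    then show False by (simp add: one_apply)
  qed
qed simp

lemma xv_xmono: "r \<in> {1..2*m} \<Longrightarrow> s \<in> {1..2*m} \<Longrightarrow> xv r (xmono s) = of_bool (r = s)"
  using xmono_eq_iff[of r s] by (auto simp: xv_eq single_apply)

lemma xmono_nonconst: "r \<in> {1..2*m} \<Longrightarrow> xmono r \<noteq> z0"
  by (auto simp: xmono_def fun_eq_iff)

lemma T_xxi_right:
  assumes j: "j \<in> {1..m}"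
  shows "T z (xxi j j) = d j z \<odot> xv j + d (j + m) (sg z) \<odot> xv (j + m)"
proof -
  have "T z (xxi j j) = (\<Sum>i=1..m. if i = j then d j z \<odot> xv j + d (j + m) (sg z) \<odot> xv (j + m) else 0)"
    unfolding T_def
  proof (rule sum.cong[OF refl])
    fix i assume i: "i \<in> {1..m}"
    show "d i z \<odot> d (i + m) (xxi j j) + d (i + m) (sg z) \<odot> d i (xxi j j) =
      (if i = j then d j z \<odot> xv j + d (j + m) (sg z) \<odot> xv (j + m) else 0)"
      unfolding d_xxi[OF j j i] by (simp add: mul_add)
  qed
  then show ?thesis using j by simp
qed

text \<open>Bracketing with the variables forces all derivatives of z to be constant, and bracketing
  with the elements \<open>tor\<close> forces these constants to be zero.\<close>

lemma center:
  assumes z: "z \<in> Osp" and c: "\<And>g. g \<in> K \<Longrightarrow> eqv (T z g) 0" shows "eqv z 0"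
proof -
  define a where "a i = d i z z0" for i
  define b where "b i = d (i + m) (sg z) z0" for i
  have a: "d i z = fscale (a i) one" if i: "i \<in> {1..m}" for i
    using eqv_const[OF c[OF K_xv[OF idx(2)[OF i]]]] i z by (simp add: a_def T_xv_high)
  have b: "d (i + m) (sg z) = fscale (b i) one" if i: "i \<in> {1..m}" for i
    using eqv_const[OF c[OF K_xv[OF idx(1)[OF i]]]] i z by (simp add: b_def T_xv_low)
  have ab: "a j = 0 \<and> b j = 0" if j: "j \<in> {1..m}" for j
  proof -
    obtain k where k: "k \<in> {1..m}" "k \<noteq> j" using other_index by metis
    have "T z (tor j k) = fscale (a j) (xv j) + fscale (b j) (xv (j + m)) - (fscale (a k) (xv k) + fscale (b k) (xv (k + m)))"
      using j k idx by (simp add: tor_def T_linear T_xxi_right a b mul_fscale mul_one del: atLeastAtMost_iff)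
    then have e: "(fscale (a j) (xv j) + fscale (b j) (xv (j + m)) - (fscale (a k) (xv k) + fscale (b k) (xv (k + m)))) y = 0"
      if "y \<noteq> z0" for y
      using c[OF K_tor[OF j k(1)]] that unfolding eqv_def zero_fun_apply by metis
    show ?thesis
      using e[OF xmono_nonconst[OF idx(1)[OF j]]] e[OF xmono_nonconst[OF idx(2)[OF j]]] j k
      by (simp add: xv_xmono)
  qed
  show ?thesis
  proof (rule d_zero_eqv[OF z])
    fix r assume "r \<in> {1..2*m}"
    then show "d r z = 0"
    proof (cases rule: idx_cases)
      case (1 i)
      then show ?thesis using a[of i] ab[of i] by simp
    next
      case (2 i)
      then have "sg (d (i + m) z) = 0" using b[of i] ab[of i] sg_d[OF z, of "i + m"] by simp
      then have "sg (sg (d (i + m) z)) = 0" by (simp only: sg_linear)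
      then show ?thesis using 2 by simp
    qed
  qed
qed

text \<open>With q = p^(t_i), apply \<phi> to the q-th derivative of g, which is zero. In the
  resulting sum of brackets all binomial coefficients vanish modulo p except the last, so the (q -
  1)-st derivative of the one-form component brackets \<open>K\<close> into constants;
  \<open>center\<close> finishes.\<close>

lemma ww_top:
  assumes \<phi>: "pder e \<phi>" and i: "i \<in> {1..m}"
  shows "eqv ((d i ^^ (p ^ t i - 1)) (ww \<phi> i)) 0"
proof -
  let ?w = "ww \<phi> i"
  have w: "?w \<in> Osp" using K_ww[OF \<phi> idx(1)[OF i]] by simp
  have Kd: "(d i ^^ n) g \<in> K" if "g \<in> K" for n g using that by (induction n) (auto intro: K_d)
  have step: "eqv (\<phi> (d i g)) (d i (\<phi> g) - T ?w g)" if g: "g \<in> K" for g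
  proof -
    have "eqv (\<phi> (T (xv (i + m)) g)) (T (\<phi> (xv (i + m))) g + T (xv (i + m)) (\<phi> g))"
      using pderD(6)[OF \<phi> K_xv Gr_xv g, OF idx(2)[OF i] idx(2)[OF i]] mu_high[OF i] by simp
    then have "eqv (- \<phi> (d i g)) (T ?w g - d i (\<phi> g))"
      using i g pderD(1)[OF \<phi> g] by (simp add: xv_T_high pder_minus[OF \<phi> K_d] ww_low)
    from eqv_minus[OF this] show ?thesis by simp
  qed
  \<comment> \<open>The commutator of \<phi> with the n-th power of \<open>d i\<close>. The
    coefficient n choose j + 1 arises by summing j-th Leibniz coefficients over all smaller
    powers.\<close>
  have "eqv (\<phi> ((d i ^^ n) g)) ((d i ^^ n) (\<phi> g) -
      (\<Sum>j<n. fscale (of_nat (n choose Suc j)) (T ((d i ^^ j) ?w) ((d i ^^ (n - 1 - j)) g))))" if "g \<in> K" for n g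
    using that
  proof (induction n arbitrary: g)
    case (Suc n)
    let ?S = "\<lambda>j. T ((d i ^^ j) ?w) ((d i ^^ (n - j)) g)"
    have gO: "g \<in> Osp" using Suc.prems by simp
    have 1: "eqv (\<phi> ((d i ^^ n) (d i g))) ((d i ^^ n) (\<phi> (d i g)) -
      (\<Sum>j<n. fscale (of_nat (n choose Suc j)) (T ((d i ^^ j) ?w) ((d i ^^ (n - 1 - j)) (d i g)))))"
      using K_d[OF Suc.prems] by (rule Suc.IH)
    have "(\<Sum>j<n. fscale (of_nat (n choose Suc j)) (T ((d i ^^ j) ?w) ((d i ^^ (n - 1 - j)) (d i g)))) =
       (\<Sum>j<n. fscale (of_nat (n choose Suc j)) (?S j))"
    proof (rule sum.cong[OF refl])
      fix j assume "j \<in> {..<n}"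
      then have "n - j = Suc (n - 1 - j)" by auto
      then show "fscale (of_nat (n choose Suc j)) (T ((d i ^^ j) ?w) ((d i ^^ (n - 1 - j)) (d i g))) =
        fscale (of_nat (n choose Suc j)) (?S j)" by (simp add: funpow_swap1)
    qed
    also have "\<dots> = (\<Sum>j\<le>n. fscale (of_nat (n choose Suc j)) (?S j))"
      by (simp add: lessThan_Suc_atMost[symmetric] binomial_eq_0)
    finally have 2: "eqv (\<phi> ((d i ^^ n) (d i g))) ((d i ^^ n) (\<phi> (d i g)) - (\<Sum>j\<le>n. fscale (of_nat (n choose Suc j)) (?S j)))"
      using 1 by simp
    have "(d i ^^ n) (T ?w g) = (\<Sum>j\<le>n. fscale (of_nat (n choose j)) (?S j))"
      by (rule dpow_bilinear[where i=i and B=T, OF d_T_even[OF i] w gO])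
    moreover have "eqv ((d i ^^ n) (\<phi> (d i g))) ((d i ^^ n) (d i (\<phi> g) - T ?w g))"
    proof (cases n)
      case 0
      then show ?thesis using step[OF Suc.prems] by simp
    next
      case (Suc l)
      then show ?thesis using d_eqv[OF step[OF \<open>g \<in> K\<close>], of i] by (simp add: funpow_swap1)
    qed
    ultimately have 3: "eqv ((d i ^^ n) (\<phi> (d i g))) ((d i ^^ Suc n) (\<phi> g) - (\<Sum>j\<le>n. fscale (of_nat (n choose j)) (?S j)))"
      by (simp add: dpow_linear funpow_swap1)
    have "eqv (\<phi> ((d i ^^ n) (d i g))) ((d i ^^ Suc n) (\<phi> g) - (\<Sum>j\<le>n. fscale (of_nat (n choose j)) (?S j))
        - (\<Sum>j\<le>n. fscale (of_nat (n choose Suc j)) (?S j)))"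
      using eqv_trans[OF 2 eqv_diff[OF 3 eqv_refl]] .
    also have "(d i ^^ Suc n) (\<phi> g) - (\<Sum>j\<le>n. fscale (of_nat (n choose j)) (?S j)) - (\<Sum>j\<le>n. fscale (of_nat (n choose Suc j)) (?S j))
       = (d i ^^ Suc n) (\<phi> g) - (\<Sum>j\<le>n. fscale (of_nat (Suc n choose Suc j)) (?S j))"
      unfolding binomial_Suc_Suc of_nat_add fscale_add_left sum.distrib by (rule diff_diff_eq)
    finally show ?case by (simp only: funpow.simps comp_apply funpow_swap1 lessThan_Suc_atMost diff_Suc_1)
  qed simp
  note main = this
  let ?q = "p ^ t i"
  have q: "?q > 0" by (rule p_pow_pos)
  show ?thesis
  proof (rule center)
    show "(d i ^^ (?q - 1)) ?w \<in> Osp" using w by simp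
    fix g assume g: "g \<in> K"
    have z: "(\<Sum>j<?q. fscale (of_nat (?q choose Suc j)) (T ((d i ^^ j) ?w) ((d i ^^ (?q - 1 - j)) g))) = T ((d i ^^ (?q - 1)) ?w) g"
    proof -
      have "(\<Sum>j<?q. fscale (of_nat (?q choose Suc j)) (T ((d i ^^ j) ?w) ((d i ^^ (?q - 1 - j)) g))) =
        (\<Sum>j\<in>{?q - 1}. fscale (of_nat (?q choose Suc j)) (T ((d i ^^ j) ?w) ((d i ^^ (?q - 1 - j)) g)))"
      proof (rule sum.mono_neutral_right)
        show "\<forall>j\<in>{..<?q} - {?q - 1}. fscale (of_nat (?q choose Suc j)) (T ((d i ^^ j) ?w) ((d i ^^ (?q - 1 - j)) g)) = 0"
        proof
          fix j assume "j \<in> {..<?q} - {?q - 1}"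
          then have "Suc j < ?q" by auto
          then show "fscale (of_nat (?q choose Suc j)) (T ((d i ^^ j) ?w) ((d i ^^ (?q - 1 - j)) g)) = 0"
            using of_nat_p_dvd[OF prime_dvd_choose_power[OF prime_p, of "Suc j"]] by simp
        qed
      qed (use q in auto)
      then show ?thesis using q by simp
    qed
    have "eqv 0 (0 - T ((d i ^^ (?q - 1)) ?w) g)"
      using main[OF g, of ?q] g pderD(1)[OF \<phi> g] unfolding z by (simp add: dpow_top[OF i] pder_zero[OF \<phi>])
    from eqv_move'[OF this] show "eqv (T ((d i ^^ (?q - 1)) ?w) g) 0" by (rule eqv_sym)
  qed
qed

text \<open>The Poincare lemma: in top degree of \<open>x\<^sub>i\<close> the truncated divided powers have no antiderivative, whence
  the vanishing hypothesis.\<close>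

definition ap :: "nat \<Rightarrow> mono \<Rightarrow> bool" where
  "ap r z \<longleftrightarrow> (if r \<le> m then r \<in> {1..m} \<and> fst z r > 0 else r \<in> snd z)"

definition sgn_at :: "nat \<Rightarrow> nat set \<Rightarrow> 'k" where
  "sgn_at r u = (- 1) ^ card {j\<in>u. j < r}"

text \<open>The coefficient at z that a potential A must have so that \<open>d r A\<close> equals
  \<open>w r\<close>.\<close>

definition cand :: "(nat \<Rightarrow> mono \<Rightarrow> 'k) \<Rightarrow> nat \<Rightarrow> mono \<Rightarrow> 'k" where
  "cand w r z = (if r \<le> m then w r ((fst z)(r := fst z r - 1), snd z)
     else sgn_at r (snd z - {r}) * w r (fst z, snd z - {r}))"

lemma sgn_at_square [simp]: "sgn_at r u * sgn_at r u = 1" "sgn_at r u * (sgn_at r u * c) = c"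
  by (simp_all add: sgn_at_def)

lemma d_odd': "r \<in> {m+1..2*m} \<Longrightarrow> f \<in> Osp \<Longrightarrow> r \<notin> u \<Longrightarrow> d r f (\<alpha>, u) = sgn_at r u * f (\<alpha>, insert r u)"
  by (simp add: d_odd sgn_at_def)

lemma poincare:
  assumes wO: "\<And>r. r \<in> {1..2*m} \<Longrightarrow> w r \<in> Osp"
    and cl: "\<And>r s. r \<in> {1..2*m} \<Longrightarrow> s \<in> {1..2*m} \<Longrightarrow> d s (w r) = fscale (psign (mu m r * mu m s)) (d r (w s))"
    and top: "\<And>i \<alpha> u. i \<in> {1..m} \<Longrightarrow> Suc (\<alpha> i) = p ^ t i \<Longrightarrow> w i (\<alpha>, u) = 0"
  shows "\<exists>A\<in>Osp. \<forall>r\<in>{1..2*m}. d r A = w r"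
proof -
  have mixed: "cand w r z = cand w s z" if z: "z \<in> M" "ap r z" "ap s z" and rs: "r \<le> m" "\<not> s \<le> m" for r s z
  proof -
    obtain \<beta> v where zz: "z = (\<beta>, v)" by (cases z)
    have r: "r \<in> {1..m}" "\<beta> r > 0" and s: "s \<in> v" "s \<in> {m+1..2*m}"
      using z rs by (auto simp: ap_def zz M_iff)
    have "d s (w r) (\<beta>(r := \<beta> r - 1), v - {s}) = d r (w s) (\<beta>(r := \<beta> r - 1), v - {s})"
      using cl[of r s] r s by (simp add: mu_low)
    then have "sgn_at s (v - {s}) * w r (\<beta>(r := \<beta> r - 1), v) = w s (\<beta>, v - {s})"
      using r s wO[of r] wO[of s] by (simp add: d_odd' d_even insert_absorb)
    then have "w r (\<beta>(r := \<beta> r - 1), v) = sgn_at s (v - {s}) * w s (\<beta>, v - {s})" by (metis sgn_at_square(2))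
    then show ?thesis using rs by (simp add: cand_def zz)
  qed
  have low: "cand w r z = cand w s z" if z: "ap r z" "ap s z" and rs: "r \<le> m" "s \<le> m" "r \<noteq> s" for r s z
  proof -
    obtain \<beta> v where zz: "z = (\<beta>, v)" by (cases z)
    have r: "r \<in> {1..m}" "\<beta> r > 0" and s: "s \<in> {1..m}" "\<beta> s > 0" using z rs by (auto simp: ap_def zz)
    let ?\<gamma> = "\<beta>(r := \<beta> r - 1, s := \<beta> s - 1)"
    have e: "?\<gamma>(s := Suc (?\<gamma> s)) = \<beta>(r := \<beta> r - 1)" "?\<gamma>(r := Suc (?\<gamma> r)) = \<beta>(s := \<beta> s - 1)"
      using r s rs by (auto simp: fun_eq_iff)
    have "d s (w r) (?\<gamma>, v) = d r (w s) (?\<gamma>, v)" using cl[of r s] r s by (simp add: mu_low)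
    then have "w r (\<beta>(r := \<beta> r - 1), v) = w s (\<beta>(s := \<beta> s - 1), v)"
      unfolding d_even[OF s(1) wO[OF idx(1)[OF r(1)]]] d_even[OF r(1) wO[OF idx(1)[OF s(1)]]] e .
    then show ?thesis using rs by (simp add: cand_def zz)
  qed
  have high: "cand w r z = cand w s z" if z: "z \<in> M" "ap r z" "ap s z" and rs: "\<not> r \<le> m" "\<not> s \<le> m" "r < s" for r s z
  proof -
    obtain \<beta> v where zz: "z = (\<beta>, v)" by (cases z)
    have r: "r \<in> v" "r \<in> {m+1..2*m}" and s: "s \<in> v" "s \<in> {m+1..2*m}" and fin: "finite v"
      using z rs finite_odd[of \<beta> v] by (auto simp: ap_def zz M_iff)
    let ?u = "v - {r, s}"
    have v: "insert s ?u = v - {r}" "insert r ?u = v - {s}" using r s rs by auto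
    have "d s (w r) (\<beta>, ?u) = - d r (w s) (\<beta>, ?u)"
      using cl[of r s] r s mu_cases[of r] mu_cases[of s] by (auto simp: fscale_minus_left)
    then have e: "sgn_at s ?u * w r (\<beta>, v - {r}) = - (sgn_at r ?u * w s (\<beta>, v - {s}))"
      using r s wO[of r] wO[of s] by (simp add: d_odd' v)
    have s1: "sgn_at r (v - {r}) = sgn_at r ?u"
      using card_lt_insert[of ?u s r] fin rs unfolding v[symmetric] by (simp add: sgn_at_def)
    have s2: "sgn_at s (v - {s}) = - sgn_at s ?u"
      using card_lt_insert[of ?u r s] fin rs unfolding v[symmetric] by (simp add: sgn_at_def)
    have X: "w r (\<beta>, v - {r}) = - (sgn_at s ?u * (sgn_at r ?u * w s (\<beta>, v - {s})))"
      using arg_cong[OF e, of "\<lambda>x. sgn_at s ?u * x"] by simp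
    have "sgn_at r ?u * w r (\<beta>, v - {r}) = - (sgn_at s ?u * w s (\<beta>, v - {s}))"
      unfolding X by (simp add: mult.left_commute[of "sgn_at r ?u" "sgn_at s ?u"])
    then show ?thesis using rs by (simp add: cand_def zz s1 s2)
  qed
  have cand: "cand w r z = cand w s z" if "z \<in> M" "ap r z" "ap s z" for r s z
    using mixed[of z r s] mixed[of z s r] low[of r z s] high[of z r s] high[of z s r] that
    by (metis linorder_neqE_nat)
  \<comment> \<open>Closedness makes the coefficients dictated by different variables agree, so the
    choice of a variable occurring in z does not matter.\<close>
  define A where "A z = (if z \<in> M \<and> (\<exists>r. ap r z) then cand w (SOME r. ap r z) z else 0)" for z
  have A: "A z = cand w r z" if "z \<in> M" "ap r z" for z r
    using cand[OF that(1) someI[of "\<lambda>r. ap r z", OF that(2)] that(2)] that by (auto simp: A_def)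
  have AO: "A \<in> Osp" unfolding Osp_def by (simp add: A_def)
  have "d r A z = w r z" if r: "r \<in> {1..2*m}" for r z
  proof -
    obtain \<alpha> u where z: "z = (\<alpha>, u)" by (cases z)
    from mu_cases[OF r] show ?thesis
    proof
      assume r': "r \<in> {1..m} \<and> mu m r = 0"
      show ?thesis
      proof (cases "(\<alpha>(r := Suc (\<alpha> r)), u) \<in> M")
        case True
        have "ap r (\<alpha>(r := Suc (\<alpha> r)), u)" using r' by (simp add: ap_def)
        from A[OF True this] show ?thesis using r' AO by (simp add: z d_even cand_def)
      next
        case False
        \<comment> \<open>The monomial obtained by integration lies outside \<open>M\<close>. If the
          given one lies inside, its exponent is the top one, which is where \<open>top\<close> is
          used.\<close>
        have "w r (\<alpha>, u) = 0"
        proof (cases "(\<alpha>, u) \<in> M")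
          case True
          then have "\<not> Suc (\<alpha> r) < p ^ t r" "\<alpha> r < p ^ t r" using False r' by (auto simp: M_iff split: if_splits)
          then show ?thesis using top[of r \<alpha> u] r' by simp
        next
          case False
          then show ?thesis using O_out[OF wO[OF r]] by simp
        qed
        then show ?thesis using False r' AO by (simp add: z d_even O_out[OF AO])
      qed
    next
      assume r': "r \<in> {m+1..2*m} \<and> mu m r = 1"
      show ?thesis
      proof (cases "r \<in> u")
        case True
        \<comment> \<open>Closedness with both indices equal to an odd r: the component
          \<open>w r\<close> does not contain its own variable.\<close>
        have "d r (w r) = - d r (w r)"
          by (rule cl[OF r r, unfolded conjunct2[OF r'] mult_1 psign_one fscale_minus_left fscale_simps(1)])
        then have "d r (w r) = 0" using double_zero by (metis eq_neg_iff_add_eq_0)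
        then have "d r (w r) (\<alpha>, u - {r}) = 0" by simp
        then have "w r (\<alpha>, u) = 0" using r' wO[OF r] True by (simp add: d_odd insert_absorb)
        then show ?thesis using True r' AO by (simp add: z d_odd)
      next
        case False
        show ?thesis
        proof (cases "(\<alpha>, insert r u) \<in> M")
          case True
          have "ap r (\<alpha>, insert r u)" using r' by (auto simp: ap_def)
          from A[OF True this] have "A (\<alpha>, insert r u) = sgn_at r u * w r (\<alpha>, u)" using r' False by (auto simp: cand_def)
          then show ?thesis using r' AO False by (simp add: z d_odd')
        next
          case False
          then have "(\<alpha>, u) \<notin> M" using r' by (auto simp: M_iff)
          then show ?thesis using False r' AO \<open>r \<notin> u\<close> by (simp add: z d_odd' O_out[OF AO] O_out[OF wO[OF r]])
        qed
      qed
    qed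
  qed
  then show ?thesis using AO by blast
qed

lemma mu_low_pair: "i \<in> {1..m} \<Longrightarrow> mu m i * x = 0" "i \<in> {1..m} \<Longrightarrow> x * mu m i = 0"
  by (simp_all add: mu_low)

lemma Gop_xv:
  assumes "i \<in> {1..m}" "j \<in> {1..m}"
  shows "Gop j (xv (i + m)) = (if i = j then xpi j else 0)" "Gop j (xv i) = 0"
  using assms idx Gr_Osp[OF xpi_Gr] by (auto simp: Gop_def d_xv mul_add mul_one)

lemma part_d: 
  assumes A: "A \<in> Osp" shows "d r (part b A) = part (b + mu m r) (d r A)"
proof -
  have h: "f = part c (f + g)" if "f \<in> Gr c" "g \<in> Gr (c + 1)" for f g c
  proof
    fix x
    have c: "c + 1 \<noteq> c" by (cases c) auto
    show "f x = part c (f + g) x"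
      using Gr_D[OF that(1), of x] Gr_D[OF that(2), of x] c by (cases "g x = 0") (auto simp: part_def)
  qed
  have b: "A = part b A + part (b + 1) A" using part_sum[of A] by (cases b) (auto simp: add.commute)
  have "d r (part b A) = part (b + mu m r) (d r (part b A) + d r (part (b + 1) A))"
    by (rule h) (use Gr_d[OF part_Gr[OF A], of r b] Gr_d[OF part_Gr[OF A], of r "b + 1"] in \<open>simp_all add: add_ac\<close>)
  then show ?thesis unfolding d_linear(1)[symmetric] b[symmetric] .
qed

lemma part_id: "f \<in> Gr b \<Longrightarrow> part b f = f"
proof
  fix x assume "f \<in> Gr b"
  then show "part b f x = f x" using Gr_D[of f b x] by (auto simp: part_def)
qed

lemma pder_closed:
  assumes \<phi>: "pder e \<phi>" and k: "cc \<phi> (1 + m) 1 = 0" and r: "r \<in> {1..2*m}" and s: "s \<in> {1..2*m}"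
  shows "d s (ww \<phi> r) = fscale (psign (mu m r * mu m s)) (d r (ww \<phi> s))"
proof -
  have one: "1 \<in> {1..m}" using m3 by simp
  have hl: "d (i + m) (ww \<phi> j) = d j (ww \<phi> (i + m))" if i: "i \<in> {1..m}" and j: "j \<in> {1..m}" for i j
  proof -
    have "cc \<phi> (i + m) j = 0" using cc_zero(3)[OF \<phi> i j] cc_constant[OF \<phi> one i] k by (cases "i = j") simp_all
    then show ?thesis using cc_eq[OF \<phi> idx(1)[OF j] idx(2)[OF i]] j by (simp add: mu_low)
  qed
  have ll: "d i (ww \<phi> j) = d j (ww \<phi> i)" if i: "i \<in> {1..m}" and j: "j \<in> {1..m}" for i j
    using cc_eq[OF \<phi> idx(1)[OF j] idx(1)[OF i]] cc_zero(1)[OF \<phi> i j] j by (simp add: mu_low)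
  have hh: "d (i + m) (ww \<phi> (j + m)) = fscale (psign (mu m (j + m) * mu m (i + m))) (d (j + m) (ww \<phi> (i + m)))"
    if i: "i \<in> {1..m}" and j: "j \<in> {1..m}" for i j
    using cc_eq[OF \<phi> idx(2)[OF j] idx(2)[OF i]] cc_zero(2)[OF \<phi> i j] by simp
  show ?thesis
    using r
  proof (cases rule: idx_cases)
    case r1: (1 i)
    from s show ?thesis
    proof (cases rule: idx_cases)
      case (1 j)
      show ?thesis unfolding r1 1 using ll[OF 1(1) r1(1)] r1 by (simp only: mu_low_pair psign_zero fscale_simps)
    next
      case (2 j)
      show ?thesis unfolding r1 2 using hl[OF 2(1) r1(1)] r1 by (simp only: mu_low_pair psign_zero fscale_simps)
    qed
  next
    case r2: (2 i)
    from s show ?thesis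
    proof (cases rule: idx_cases)
      case (1 j)
      show ?thesis unfolding r2 1 using hl[OF r2(1) 1(1)] 1 by (simp only: mu_low_pair psign_zero fscale_simps)
    next
      case (2 j)
      show ?thesis unfolding r2 2 by (rule hh[OF 2(1) r2(1)])
    qed
  qed
qed

text \<open>Three corrections prepare and complete the Poincare lemma: \<gamma> removes the top
  powers that \<open>ww_top\<close> leaves, \<kappa> makes the form closed, and c moves the
  potential into \<open>K\<close>. Parity decides which of them can be nonzero.\<close>

lemma reduction:
  assumes \<phi>: "pder e \<phi>"
  shows "\<exists>\<kappa> \<gamma> c A. (e = 1 \<longrightarrow> \<kappa> = 0 \<and> c = 0) \<and> (e = 0 \<longrightarrow> (\<forall>i\<in>{1..m}. \<gamma> i = 0)) \<and> A \<in> K \<and> A \<in> Gr (e + 1) \<and>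
    (\<forall>r\<in>{1..2*m}. \<phi> (xv r) = (\<Sum>i=1..m. fscale (\<gamma> i) (Gop i (xv r))) + fscale \<kappa> (E2 (xv r)) +
      (T A (xv r) + fscale c (T (xxi 1 1) (xv r))))"
proof -
  have one: "1 \<in> {1..m}" using m3 by simp
  \<comment> \<open>By \<open>ww_top\<close> the pure top power is the only monomial with top
    exponent that can occur in the i-th component.\<close>
  define \<gamma> where "\<gamma> i = ww \<phi> i (tmono i)" for i
  have g0: "\<gamma> i = 0" if "e = 0" "i \<in> {1..m}" for i
  proof -
    have "ww \<phi> i \<in> Gr 1" using Gr_ww[OF \<phi> idx(1)[OF that(2)]] that by (simp add: mu_low)
    then show ?thesis using Gr_D[of "ww \<phi> i" 1 "tmono i"] by (auto simp: \<gamma>_def tmono_def)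
  qed
  define G where "G a = (\<Sum>i=1..m. fscale (\<gamma> i) (Gop i a))" for a
  have nG: "nice e G"
    unfolding G_def[abs_def]
  proof (intro nice_sum nice_scale)
    fix i assume i: "i \<in> {1..m}"
    show "\<gamma> i = 0 \<or> nice e (Gop i)" using nice_Gop[OF i] g0[OF _ i] by (cases e) auto
  qed
  define \<phi>1 where "\<phi>1 a = \<phi> a - G a" for a
  have p1: "pder e \<phi>1" unfolding \<phi>1_def[abs_def] using pder_sub[OF \<phi> nG] .
  have t1: "ww \<phi>1 i (tmono i) = 0" if i: "i \<in> {1..m}" for i
  proof -
    have "G (xv (i + m)) = (\<Sum>j=1..m. if j = i then fscale (\<gamma> i) (xpi i) else 0)"
      unfolding G_def using i by (intro sum.cong refl) (auto simp: Gop_xv)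
    then have "G (xv (i + m)) = fscale (\<gamma> i) (xpi i)" using i by simp
    then show ?thesis using i by (simp add: ww_low \<phi>1_def \<gamma>_def xpi_def single_apply)
  qed
  \<comment> \<open>The defect of the degree map \<open>E2\<close> is -2 by \<open>cc_E2\<close>;
    this multiple of it cancels the defect of \<phi>1 at every conjugate pair, by
    \<open>cc_constant\<close>.\<close>
  define \<kappa> where "\<kappa> = - (cc \<phi>1 (1 + m) 1 / 2)"
  have k0: "\<kappa> = 0" if "e = 1" using cc_odd[of \<phi>1 1] p1 that one by (simp add: \<kappa>_def)
  have nE: "nice e (\<lambda>a. fscale \<kappa> (E2 a))"
    by (rule nice_scale) (use nice_E2 k0 in \<open>cases e; simp\<close>)
  define \<phi>2 where "\<phi>2 a = \<phi>1 a - fscale \<kappa> (E2 a)" for a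
  have p2: "pder e \<phi>2" unfolding \<phi>2_def[abs_def] using pder_sub[OF p1 nE] .
  have wE: "ww (\<lambda>a. fscale \<kappa> (E2 a)) r = fscale \<kappa> (ww E2 r)" for r
    by (simp add: ww_def sg_linear fscale_minus)
  have "cc (\<lambda>a. fscale \<kappa> (E2 a)) (1 + m) 1 = \<kappa> * cc E2 (1 + m) 1"
    unfolding cc_def wE using one by (simp add: d_linear mu_low algebra_simps)
  then have c2: "cc \<phi>2 (1 + m) 1 = 0"
    unfolding \<phi>2_def[abs_def] cc_diff cc_E2[OF one] using two_nz by (simp add: \<kappa>_def)
  have t2: "ww \<phi>2 i (tmono i) = 0" if i: "i \<in> {1..m}" for i
  proof -
    have "ww \<phi>2 i = ww \<phi>1 i - fscale \<kappa> (ww E2 i)" unfolding \<phi>2_def[abs_def] ww_diff wE ..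
    moreover have "ww E2 i (tmono i) = 0"
    proof -
      have "ww E2 i = - xv (i + m)" by (simp only: ww_low[OF i] E2_xv[OF idx(2)[OF i]])
      then show ?thesis using i by (simp add: xv_eq single_apply tmono_def xmono_def)
    qed
    ultimately show ?thesis using t1[OF i] by simp
  qed
  have top: "ww \<phi>2 i (\<alpha>, u) = 0" if i: "i \<in> {1..m}" and a: "Suc (\<alpha> i) = p ^ t i" for i \<alpha> u
  proof (cases "(\<alpha>(i := 0), u) = z0")
    case True
    then have "u = {}" "\<alpha>(i := 0) = (\<lambda>i. 0)" by auto
    moreover then have "\<alpha> = (\<lambda>i. 0)(i := p ^ t i - 1)" using a by (metis diff_Suc_1 fun_upd_triv fun_upd_upd)
    ultimately have "(\<alpha>, u) = tmono i" by (simp add: tmono_def)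
    then show ?thesis using t2[OF i] by simp
  next
    case False
    have O: "ww \<phi>2 i \<in> Osp" using K_ww[OF p2 idx(1)[OF i]] by simp
    have "(d i ^^ (p ^ t i - 1)) (ww \<phi>2 i) (\<alpha>(i := 0), u) = 0"
      using ww_top[OF p2 i] False unfolding eqv_def zero_fun_apply by blast
    then have "ww \<phi>2 i (\<alpha>(i := p ^ t i - 1), u) = 0" by (simp add: dpow_coeff[OF i O])
    then show ?thesis using a by (metis diff_Suc_1 fun_upd_triv)
  qed
  obtain A0 where A0: "A0 \<in> Osp" "\<forall>r\<in>{1..2*m}. d r A0 = ww \<phi>2 r"
    using poincare[of "ww \<phi>2"] K_ww[OF p2] pder_closed[OF p2 c2] top K_Osp by blast
  \<comment> \<open>The potential from \<open>poincare\<close> need not be homogeneous. Its part of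
    the right parity has the same derivatives, as these are homogeneous.\<close>
  define A1 where "A1 = part (e + 1) A0"
  have A1: "A1 \<in> Gr (e + 1)" unfolding A1_def by (rule part_Gr[OF A0(1)])
  have dA1: "d r A1 = ww \<phi>2 r" if r: "r \<in> {1..2*m}" for r
    using part_d[OF A0(1), of r "e + 1"] part_id[OF Gr_ww[OF p2 r]] A0(2) r by (simp add: A1_def)
  \<comment> \<open>Up to sign the derivatives of \<open>Dl A1\<close> are the Laplacians of the
    components of the one-form, which lie in \<open>K\<close>.\<close>
  have "eqv (Dl A1) 0"
  proof (rule d_zero_eqv)
    fix r assume r: "r \<in> {1..2*m}"
    show "d r (Dl A1) = 0"
      using d_Dl[OF r, of A1] A1 by (simp add: dA1[OF r] K_Dl[OF K_ww[OF p2 r]])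
  qed (use A1 in simp)
  then obtain c where c: "Dl A1 = fscale c one" using eqv_const by blast
  have c0: "c = 0" if "e = 1"
  proof -
    have "Dl A1 \<in> Gr 1" using Gr_Dl[OF A1] that by simp
    then have "Dl A1 z0 = 0" by (rule Gr_even_z0)
    then show ?thesis by (simp add: c one_apply)
  qed
  define A where "A = A1 - fscale c (xxi 1 1)"
  have AG: "A \<in> Gr (e + 1)"
  proof (cases e)
    case zero
    then show ?thesis unfolding A_def using A1 xxi_Gr[OF one one] by (intro Gr_diff Gr_scale) simp_all
  qed (use c0 A1 in \<open>simp add: A_def\<close>)
  have AK: "A \<in> K"
    using A1 one by (intro K_I) (simp_all add: A_def c Dl_linear Dl_xxi Gr_Osp[OF xxi_Gr])
  have x: "\<phi>2 (xv r) = T A1 (xv r)" if r: "r \<in> {1..2*m}" for r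
    using r
  proof (cases rule: idx_cases)
    case (1 i)
    have "\<phi>2 (xv i) = - sg (ww \<phi>2 (i + m))" using 1 by (simp add: ww_high sg_linear)
    also have "\<dots> = d (i + m) (sg A1)"
      using sg_d[of A1 "i + m"] A1 1 idx mu_high[of i] by (simp add: dA1[symmetric] fscale_minus_left)
    finally show ?thesis using 1 A1 by (simp add: T_xv_low)
  next
    case (2 i)
    then show ?thesis using dA1[of i] A1 by (simp add: ww_low T_xv_high)
  qed
  have "\<phi> (xv r) = (\<Sum>i=1..m. fscale (\<gamma> i) (Gop i (xv r))) + fscale \<kappa> (E2 (xv r)) +
      (T A (xv r) + fscale c (T (xxi 1 1) (xv r)))" if r: "r \<in> {1..2*m}" for r
    using x[OF r] by (simp add: \<phi>2_def \<phi>1_def G_def A_def T_linear algebra_simps)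
  then show ?thesis using k0 c0 g0 AK AG by blast
qed

end

section \<open>Superderivations vanishing on the variables\<close>

context sho begin

section \<open>Linear coefficients of brackets, weights, and splitting of divided powers\<close>

lemma mul_coeff:
  "(f \<odot> g) z = (\<Sum>x\<in>M. \<Sum>y\<in>M. f x * g y * (mcoeff m x y * single (madd x y) z))"
  unfolding mul_def omult_def MM sum_fun_apply mono_mult_eq by (simp add: mult.assoc)

lemma madd_z0: "madd x y = z0 \<Longrightarrow> x = z0 \<and> y = z0"
  by (cases x; cases y) (auto simp: madd_def fun_eq_iff)

lemma madd_xmono:
  assumes "madd x y = xmono l" "l \<in> {1..m}"
  shows "(x = z0 \<and> y = xmono l) \<or> (x = xmono l \<and> y = z0)"
proof -
  obtain \<alpha> u \<beta> v where eq: "x = (\<alpha>, u)" "y = (\<beta>, v)" by (cases x; cases y)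
  have s: "\<alpha> i + \<beta> i = (if i = l then 1 else 0)" for i
    using assms by (auto simp: eq madd_def xmono_def fun_eq_iff dest: spec[of _ i])
  have uv: "u = {}" "v = {}" using assms by (auto simp: eq madd_def xmono_def)
  show ?thesis
  proof (cases "\<alpha> l = 0")
    case True
    then have "\<alpha> i = 0" "\<beta> i = (if i = l then 1 else 0)" for i using s[of i] by (auto split: if_splits)
    then have "\<alpha> = (\<lambda>i. 0)" "\<beta> = (\<lambda>i. 0)(l := 1)" by auto
    then show ?thesis using uv assms(2) by (simp add: eq xmono_def)
  next
    case False
    then have "\<beta> i = 0" "\<alpha> i = (if i = l then 1 else 0)" for i
      using s[of i] s[of l] by (auto split: if_splits)
    then have "\<beta> = (\<lambda>i. 0)" "\<alpha> = (\<lambda>i. 0)(l := 1)" by auto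
    then show ?thesis using uv assms(2) by (simp add: eq xmono_def)
  qed
qed

lemma mul_z0: "f z0 = 0 \<or> g z0 = 0 \<Longrightarrow> (f \<odot> g) z0 = 0"
  unfolding mul_coeff by (intro sum.neutral ballI) (auto simp: single_apply dest: madd_z0[OF sym])

lemma mul_xmono:
  assumes l: "l \<in> {1..m}" and h: "(f z0 = 0 \<and> f (xmono l) = 0) \<or> (g z0 = 0 \<and> g (xmono l) = 0)"
  shows "(f \<odot> g) (xmono l) = 0"
  unfolding mul_coeff
proof (intro sum.neutral ballI)
  fix x y
  show "f x * g y * (mcoeff m x y * single (madd x y) (xmono l)) = 0"
  proof (cases "xmono l = madd x y")
    case True
    then show ?thesis using madd_xmono[of x y l] l h by auto
  qed (simp add: single_apply)
qed

text \<open>Says that f has no linear terms and no quadratic terms involving the l-th variable, in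
  the form in which derivatives enter a bracket.\<close>

definition good :: "nat \<Rightarrow> (mono \<Rightarrow> 'k) \<Rightarrow> bool" where
  "good l f \<longleftrightarrow> (\<forall>r\<in>{1..2*m}. d r f z0 = 0 \<and> d r f (xmono l) = 0)"

lemma sg_z0: "sg f z0 = f z0" by (simp add: sg_def)
lemma sg_xmono_low: "l \<in> {1..m} \<Longrightarrow> sg f (xmono l) = f (xmono l)" by (simp add: sg_def xmono_def)

text \<open>A product has an \<open>x_l\<close> term only if one factor supplies a constant and the
  other an \<open>x_l\<close>. The derivatives of a good element supply neither.\<close>

lemma T_good:
  assumes l: "l \<in> {1..m}" and a: "a \<in> Osp" and g: "g \<in> Osp" and h: "good l a \<or> good l g"
  shows "T a g (xmono l) = 0"
  unfolding T_def sum_fun_apply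
proof (intro sum.neutral ballI)
  fix i assume i: "i \<in> {1..m}"
  have s: "d (i + m) (sg a) = - sg (d (i + m) a)"
    using sg_d[OF a, of "i + m"] mu_high[OF i] by (simp add: fscale_minus_left)
  show "(d i a \<odot> d (i + m) g + d (i + m) (sg a) \<odot> d i g) (xmono l) = 0"
    using h idx[OF i] l unfolding s mul_add good_def
    by (auto simp: mul_xmono sg_z0 sg_xmono_low simp del: atLeastAtMost_iff)
qed

text \<open>Monomials without a conjugate pair: every term of \<open>Dl\<close> kills them, so they
  lie in \<open>K\<close> individually.\<close>

definition pure :: "mono \<Rightarrow> bool" where
  "pure z \<longleftrightarrow> (\<forall>i\<in>{1..m}. fst z i > 0 \<longrightarrow> i + m \<notin> snd z)"

lemma d_low_single: "z \<in> M \<Longrightarrow> i \<in> {1..m} \<Longrightarrow>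
    d i (single z) = (if fst z i = 0 then 0 else single ((fst z)(i := fst z i - 1), snd z))"
  by (cases z) (simp add: d_single mono_partial_def)

lemma d_high_single: "z \<in> M \<Longrightarrow> i \<in> {1..m} \<Longrightarrow>
    d (i + m) (single z) = (if i + m \<in> snd z then fscale (sgn_at (i + m) (snd z)) (single (fst z, snd z - {i + m})) else 0)"
  by (cases z) (simp add: d_single mono_partial_def sgn_at_def)

lemma M_remove: "(\<alpha>, u) \<in> M \<Longrightarrow> (\<alpha>, u - w) \<in> M" "(\<alpha>, u) \<in> M \<Longrightarrow> (\<alpha>(i := \<alpha> i - 1), u) \<in> M"
  by (auto simp: M_iff less_imp_diff_less)

lemma Dl_term:
  assumes z: "(\<alpha>, u) \<in> M" and i: "i \<in> {1..m}"
  shows "d i (d (i + m) (single (\<alpha>, u))) = (if \<alpha> i > 0 \<and> i + m \<in> u then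
    fscale (sgn_at (i + m) u) (single (\<alpha>(i := \<alpha> i - 1), u - {i + m})) else 0)"
  using z i M_remove(1)[OF z, of "{i + m}"] by (simp add: d_high_single d_linear d_low_single)

lemma Dl_pure: "z \<in> M \<Longrightarrow> pure z \<Longrightarrow> Dl (single z) = 0"
  unfolding Dl_def by (cases z) (intro sum.neutral ballI, auto simp: Dl_term pure_def simp del: atLeastAtMost_iff)

lemma K_pure: "z \<in> M \<Longrightarrow> pure z \<Longrightarrow> single z \<in> K"
  by (intro K_I) (simp_all add: Dl_pure)

lemma deg_one:
  assumes z: "z \<in> M" and d: "deg z \<le> 1" shows "z = z0 \<or> (\<exists>r\<in>{1..2*m}. z = xmono r)"
proof (cases "z = z0")
  case False
  obtain \<alpha> u where zz: "z = (\<alpha>, u)" by (cases z)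
  have fin: "finite u" using z finite_odd by (simp add: zz)
  have fu: "\<alpha> i = 0" if "i \<notin> {1..m}" for i using z that by (simp add: zz M_iff)
  from z False have zM: "(\<alpha>, u) \<in> M" "(\<alpha>, u) \<noteq> z0" by (simp_all add: zz)
  then show ?thesis
  proof (rule nonconst_cases)
    fix i \<beta> assume i: "i \<in> {1..m}" "\<alpha> = \<beta>(i := Suc (\<beta> i))"
    then have "deg (\<alpha>, u) = Suc (deg (\<beta>, u))" using deg_up[of i \<beta> u] by simp
    then have "deg (\<beta>, u) = 0" using d by (simp add: zz)
    then have "u = {}" "\<forall>j\<in>{1..m}. \<beta> j = 0" using fin by (auto simp: deg_def)
    moreover have "\<alpha> = (\<lambda>i. 0)(i := 1)"
    proof
      fix x show "\<alpha> x = ((\<lambda>i. 0)(i := 1)) x"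
        using i fu[of x] \<open>\<forall>j\<in>{1..m}. \<beta> j = 0\<close> by (cases "x \<in> {1..m}") auto
    qed
    ultimately show ?thesis using i by (auto simp: zz xmono_def intro!: bexI[of _ i])
  next
    fix r assume r: "r \<in> {m+1..2*m}" "r \<in> u"
    then have "deg (\<alpha>, u) = Suc (deg (\<alpha>, u - {r}))" using deg_insert[of "u - {r}" r \<alpha>] fin by (simp add: insert_absorb)
    then have "deg (\<alpha>, u - {r}) = 0" using d by (simp add: zz)
    then have "u - {r} = {}" "\<forall>j\<in>{1..m}. \<alpha> j = 0" using fin by (auto simp: deg_def)
    then have "u = {r}" "\<alpha> = (\<lambda>i. 0)" using r fu by (auto simp: fun_eq_iff)
    then show ?thesis using r by (auto simp: zz xmono_def intro!: bexI[of _ r])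
  qed
qed simp

lemma deg_xmono: "r \<in> {1..2*m} \<Longrightarrow> deg (xmono r) = 1"
  by (auto simp: xmono_def deg_def)

lemma deg_z0: "deg z0 = 0" by (simp add: deg_def)

lemma d_single_support:
  assumes z: "z \<in> M" and r: "r \<in> {1..2*m}" and y: "d r (single z) y \<noteq> (0::'k)"
  shows "Suc (deg y) = deg z" "fst y i \<le> fst z i"
proof -
  obtain \<alpha> u where zz: "z = (\<alpha>, u)" by (cases z)
  have fin: "finite u" using z finite_odd by (simp add: zz)
  have "Suc (deg y) = deg z \<and> fst y i \<le> fst z i"
    using r
  proof (cases rule: idx_cases)
    case (1 i)
    then have y': "\<alpha> i \<noteq> 0" "y = (\<alpha>(i := \<alpha> i - 1), u)"
      using y d_low_single[OF z, of i] by (auto simp: zz single_apply split: if_splits)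
    have e: "(\<alpha>(i := \<alpha> i - 1))(i := Suc ((\<alpha>(i := \<alpha> i - 1)) i)) = \<alpha>" using y' by auto
    show ?thesis using deg_up[OF 1(1), of "\<alpha>(i := \<alpha> i - 1)" u] unfolding e by (simp add: zz y')
  next
    case (2 i)
    then have y': "i + m \<in> u" "y = (\<alpha>, u - {i + m})"
      using y d_high_single[OF z, of i] by (auto simp: zz single_apply split: if_splits)
    then show ?thesis using deg_insert[of "u - {i + m}" "i + m" \<alpha>] fin by (simp add: zz insert_absorb)
  qed
  then show "Suc (deg y) = deg z" "fst y i \<le> fst z i" by auto
qed

lemma good_single:
  assumes z: "z \<in> M" and l: "l \<in> {1..m}" and deg: "deg z \<ge> 3 \<or> deg z = 2 \<and> fst z l = 0"
  shows "good l (single z)"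
  unfolding good_def
proof (intro ballI conjI)
  fix r assume r: "r \<in> {1..2*m}"
  show "d r (single z) z0 = 0" using d_single_support(1)[OF z r, of z0] deg deg_z0 by (cases "d r (single z) z0 = (0::'k)") auto
  show "d r (single z) (xmono l) = 0"
  proof (rule ccontr)
    assume n: "d r (single z) (xmono l) \<noteq> 0"
    have "deg z = 2" using d_single_support(1)[OF z r n] deg_xmono[OF idx(1)[OF l]] by simp
    moreover have "fst (xmono l) l \<le> fst z l" by (rule d_single_support(2)[OF z r n])
    ultimately show False using deg l by (simp add: xmono_def)
  qed
qed

text \<open>The eigenvalue, up to sign, of bracketing with the product of the j-th conjugate pair;
  hence a field element and not an integer.\<close>

definition wt :: "nat \<Rightarrow> mono \<Rightarrow> 'k" where
  "wt j z = of_nat (fst z j) - of_bool (j + m \<in> snd z)"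

lemma bprod_xmono:
  assumes j: "j \<in> {1..m}" and a: "\<alpha> j > 0"
  shows "bprod m ((\<lambda>i. 0)(j := 1)) (\<alpha>(j := \<alpha> j - 1)) = (of_nat (\<alpha> j) :: 'k)"
proof -
  have "bprod m ((\<lambda>i. 0)(j := 1)) (\<alpha>(j := \<alpha> j - 1)) = (\<Prod>i=1..m. if i = j then of_nat (\<alpha> j) else 1 :: 'k)"
    unfolding bprod_def using a by (intro prod.cong refl) auto
  then show ?thesis using j by simp
qed

lemma single_scale: "g z = c \<Longrightarrow> (\<lambda>y. g y * single z y) = (fscale c (single z) :: mono \<Rightarrow> 'k)"
proof
  fix y assume "g z = c"
  then show "g y * single z y = fscale c (single z) y" by (cases "y = z") (simp_all add: single_apply)
qed

lemma xv_d_low: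
  assumes j: "j \<in> {1..m}" and f: "f \<in> Osp" shows "xv j \<odot> d j f = (\<lambda>z. of_nat (fst z j) * f z)"
proof (rule lin_ext[OF _ _ _ f, of "\<lambda>f. xv j \<odot> d j f" "\<lambda>f z. of_nat (fst z j) * f z"])
  fix z assume z: "z \<in> M"
  obtain \<alpha> u where zz: "z = (\<alpha>, u)" by (cases z)
  show "xv j \<odot> d j (single z) = (\<lambda>y. of_nat (fst y j) * single z y)"
  proof (cases "\<alpha> j = 0")
    case True
    then show ?thesis using z j by (auto simp: d_low_single zz mul_add single_apply fun_eq_iff)
  next
    case False
    have e: "madd ((\<lambda>i. 0)(j := 1), {}) (\<alpha>(j := \<alpha> j - 1), u) = (\<alpha>, u)" using False by (auto simp: madd_def)
    have xm: "xmono j = ((\<lambda>i. 0)(j := 1), {})" using j by (simp add: xmono_def)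
    have b: "bprod m ((\<lambda>i. 0)(j := 1)) (\<alpha>(j := \<alpha> j - 1)) = (of_nat (\<alpha> j) :: 'k)"
      using False by (intro bprod_xmono[OF j]) simp
    have "d j (single z) = single (\<alpha>(j := \<alpha> j - 1), u)" using z j False by (simp add: d_low_single zz)
    moreover have "single (xmono j) \<odot> single (\<alpha>(j := \<alpha> j - 1), u) =
        fscale (mcoeff m (xmono j) (\<alpha>(j := \<alpha> j - 1), u)) (single (madd (xmono j) (\<alpha>(j := \<alpha> j - 1), u)))"
      by (rule mul_single[OF xmono_M[OF idx(1)[OF j]] M_remove(2)[OF z[unfolded zz]]])
    ultimately have "xv j \<odot> d j (single z) = fscale (of_nat (\<alpha> j)) (single z)"
      unfolding xv_eq zz xm e mcoeff_eq b by simp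
    moreover have "(\<lambda>y. of_nat (fst y j) * single z y) = (fscale (of_nat (\<alpha> j)) (single z) :: mono \<Rightarrow> 'k)"
      by (rule single_scale) (simp add: zz)
    ultimately show ?thesis by simp
  qed
qed (auto simp: lin_def fun_eq_iff d_linear mul_add mul_fscale algebra_simps)

lemma bprod_zero [simp]: "bprod m (\<lambda>i. 0) \<alpha> = (1 :: 'k)" "bprod m \<alpha> (\<lambda>i. 0) = (1 :: 'k)"
  by (simp_all add: bprod_def)

lemma xv_d_high:
  assumes j: "j \<in> {1..m}" and f: "f \<in> Osp" shows "xv (j + m) \<odot> d (j + m) f = (\<lambda>z. of_bool (j + m \<in> snd z) * f z)"
proof (rule lin_ext[OF _ _ _ f, of "\<lambda>f. xv (j + m) \<odot> d (j + m) f" "\<lambda>f z. of_bool (j + m \<in> snd z) * f z"])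
  fix z assume z: "z \<in> M"
  obtain \<alpha> u where zz: "z = (\<alpha>, u)" by (cases z)
  have nj: "\<not> j + m \<le> m" using j by simp
  show "xv (j + m) \<odot> d (j + m) (single z) = (\<lambda>y. of_bool (j + m \<in> snd y) * single z y)"
  proof (cases "j + m \<in> u")
    case False
    then show ?thesis using z j by (auto simp: d_high_single zz mul_add single_apply fun_eq_iff)
  next
    case True
    have e: "madd (\<lambda>i. 0, {j + m}) (\<alpha>, u - {j + m}) = (\<alpha>, u)" using True by (auto simp: madd_def)
    have c: "{i \<in> u. i \<noteq> j + m \<and> i < j + m} = {i \<in> u. i < j + m}" by auto
    have "xv (j + m) \<odot> d (j + m) (single z) = single z"
      using z j True M_remove(1)[of \<alpha> u "{j + m}"] xmono_M[OF idx(2)[OF j]] nj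
      by (simp add: d_high_single zz xv_eq mul_single mul_fscale)
        (simp add: xmono_def e mcoeff_eq inv_sign_single c sgn_at_def)
    moreover have "(\<lambda>y. of_bool (j + m \<in> snd y) * single z y) = (fscale 1 (single z) :: mono \<Rightarrow> 'k)"
      by (rule single_scale) (simp add: zz True)
    ultimately show ?thesis by simp
  qed
qed (auto simp: lin_def fun_eq_iff d_linear mul_add mul_fscale algebra_simps)

lemma T_xxi_diag:
  assumes j: "j \<in> {1..m}" and f: "f \<in> Osp" shows "T (xxi j j) f = (\<lambda>z. - wt j z * f z)"
  unfolding T_xxi[OF j j f] xv_d_low[OF j f] xv_d_high[OF j f]
  by (auto simp: wt_def fun_eq_iff algebra_simps)

lemma T_tor_diag:
  assumes j: "j \<in> {1..m}" and k: "k \<in> {1..m}" and f: "f \<in> Osp"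
  shows "T (tor j k) f z = (wt k z - wt j z) * f z"
  using assms by (simp add: tor_def T_linear T_xxi_diag algebra_simps)

lemma wt_xmono: "j \<in> {1..m} \<Longrightarrow> l \<in> {1..m} \<Longrightarrow> wt j (xmono l) = of_bool (j = l)"
  "j \<in> {1..m} \<Longrightarrow> l \<in> {1..m} \<Longrightarrow> wt j (xmono (l + m)) = - of_bool (j = l)"
  by (auto simp: wt_def xmono_def)

text \<open>Take for b the exact power of p dividing n: by \<open>choose_multiple_cong\<close> the
  binomial coefficient is n / b modulo p, which is nonzero. Only for a power of p is this b equal to
  n.\<close>

lemma binomial_split:
  assumes n: "n > 0" "p dvd n" and np: "\<And>s. n \<noteq> p ^ s"
  obtains b where "0 < b" "b < n" "p dvd b" "of_nat (n choose b) \<noteq> (0::'k)"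
proof -
  let ?v = "multiplicity p n"
  have "n \<noteq> 0" "\<not> is_unit p" using n prime_p by (auto simp: not_prime_unit)
  then obtain r where r: "n = p ^ ?v * r" "\<not> p dvd r" by (rule multiplicity_decompose')
  have v: "?v \<noteq> 0" using r n by (cases "?v = 0") auto
  have r2: "r > 1" using r np[of ?v] n by (cases r; cases "r = 1") auto
  have "(n choose p ^ ?v) mod p = r mod p" using choose_multiple_cong[OF prime_p, of ?v r] r(1) by simp
  then have "\<not> p dvd (n choose p ^ ?v)" using r(2) by (simp add: dvd_eq_mod_eq_0)
  then have "of_nat (n choose p ^ ?v) \<noteq> (0::'k)" by (simp add: of_nat_eq_0_iff_char_dvd p_eq)
  moreover have "p ^ ?v < n"
  proof -
    have "p ^ ?v * 1 < p ^ ?v * r" using r2 p_pow_pos[of ?v] by (intro mult_strict_left_mono) auto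
    then show ?thesis using r(1) by simp
  qed
  moreover have "p dvd p ^ ?v" using v by (simp add: dvd_power)
  ultimately show ?thesis using that[of "p ^ ?v"] p_pow_pos[of ?v] by blast
qed

text \<open>Exponents are added and not overwritten, so that l = k gives the exponent p^s +
  1.\<close>

definition xpow :: "nat \<Rightarrow> nat \<Rightarrow> nat \<Rightarrow> mono" where
  "xpow l k s = (\<lambda>i. of_bool (i = l) + (if i = k then p ^ s else 0), {})"

lemma sum_ge_two:
  fixes \<beta> :: "nat \<Rightarrow> nat"
  assumes "i \<in> {1..m}" "j \<in> {1..m}" "i \<noteq> j" shows "\<beta> i + \<beta> j \<le> (\<Sum>i=1..m. \<beta> i)"
proof -
  have "sum \<beta> {i, j} \<le> sum \<beta> {1..m}" using assms by (intro sum_mono2) auto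
  then show ?thesis using assms by simp
qed

lemma sum_ge_three:
  fixes \<beta> :: "nat \<Rightarrow> nat"
  assumes "i \<in> {1..m}" "j \<in> {1..m}" "k \<in> {1..m}" "i \<noteq> j" "k \<noteq> i" "k \<noteq> j" shows "\<beta> i + \<beta> j + \<beta> k \<le> (\<Sum>i=1..m. \<beta> i)"
proof -
  have "sum \<beta> {i, j, k} \<le> sum \<beta> {1..m}" using assms by (intro sum_mono2) auto
  then show ?thesis using assms by simp
qed

lemma sum_ge_one:
  fixes \<beta> :: "nat \<Rightarrow> nat"
  assumes "i \<in> {1..m}" shows "\<beta> i \<le> (\<Sum>i=1..m. \<beta> i)"
  using assms by (intro member_le_sum) auto

end

locale sho_kill = sho m t p M ty for m t p M and ty :: "'k::field itself" +
  fixes e :: bit and \<psi> :: "(mono \<Rightarrow> 'k) \<Rightarrow> mono \<Rightarrow> 'k"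
  assumes \<psi>: "pder e \<psi>" and kill: "\<And>r. r \<in> {1..2*m} \<Longrightarrow> eqv (\<psi> (xv r)) 0"
begin

lemma psi_K: "a \<in> K \<Longrightarrow> \<psi> a \<in> K" by (rule pderD(1)[OF \<psi>])

lemma psi_O [simp]: "a \<in> K \<Longrightarrow> \<psi> a \<in> Osp" using psi_K by simp

text \<open>Brackets with the variables are derivatives, so killing the variables means
  supercommuting with all derivatives modulo constants.\<close>

lemma psi_d:
  assumes r: "r \<in> {1..2*m}" and a: "a \<in> K"
  shows "eqv (\<psi> (d r a)) (fscale (psign (e * mu m r)) (d r (\<psi> a)))"
  using r
proof (cases rule: idx_cases)
  case (1 i)
  have "eqv (\<psi> (T (xv (i + m)) a)) (T (\<psi> (xv (i + m))) a + T (xv (i + m)) (\<psi> a))"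
    using pderD(6)[OF \<psi> K_xv Gr_xv a, OF idx(2) idx(2), of i] 1 mu_high[of i] by simp
  moreover have "T (\<psi> (xv (i + m))) a = 0" using T_eqv_left[OF kill[OF idx(2)]] 1 by (simp add: T_linear)
  ultimately have "eqv (- \<psi> (d i a)) (- d i (\<psi> a))"
    using 1 a by (simp add: xv_T_high pder_minus[OF \<psi>] K_d)
  from eqv_minus[OF this] show ?thesis using 1 by (simp add: mu_low)
next
  case (2 i)
  have "eqv (\<psi> (T (xv i) a)) (T (\<psi> (xv i)) a + fscale (psign e) (T (xv i) (\<psi> a)))"
    using pderD(6)[OF \<psi> K_xv Gr_xv a, OF idx(1) idx(1), of i] 2 mu_low[of i] by simp
  moreover have "T (\<psi> (xv i)) a = 0" using T_eqv_left[OF kill[OF idx(1)]] 2 by (simp add: T_linear)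
  ultimately show ?thesis using 2 a mu_high[of i] by (simp add: xv_T_low)
qed

lemma psi_low:
  assumes a: "a \<in> Osp" and low: "\<And>z. a z \<noteq> 0 \<Longrightarrow> deg z \<le> 1" shows "eqv (\<psi> a) 0"
proof -
  have t: "fscale (a z) (single z) \<in> K \<and> eqv (\<psi> (fscale (a z) (single z))) 0" if z: "z \<in> M" for z
  proof (cases "a z = 0")
    case True
    then show ?thesis by (simp add: K_zero pder_zero[OF \<psi>])
  next
    case False
    have "single z \<in> K \<and> eqv (\<psi> (single z)) 0"
      using deg_one[OF z low[OF False]]
    proof
      assume "z = z0"
      then show ?thesis using K_one pderD(4)[OF \<psi>] by (simp add: one_def)
    next
      assume "\<exists>r\<in>{1..2*m}. z = xmono r"
      then show ?thesis using K_xv kill by (auto simp: xv_eq simp del: atLeastAtMost_iff)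
    qed
    then have k: "single z \<in> K" and e: "eqv (\<psi> (single z)) 0" by auto
    show ?thesis using K_scale[OF k] pderD(3)[OF \<psi> k, of "a z"] eqv_scale[OF e, of "a z"] by simp
  qed
  have "\<psi> a = \<psi> (\<Sum>z\<in>M. fscale (a z) (single z))" using O_decomp[OF a] by (rule arg_cong)
  also have "\<dots> = (\<Sum>z\<in>M. \<psi> (fscale (a z) (single z)))" by (rule pder_sum[OF \<psi>]) (use t in blast)
  finally have 1: "\<psi> a = (\<Sum>z\<in>M. \<psi> (fscale (a z) (single z)))" .
  have "eqv (\<Sum>z\<in>M. \<psi> (fscale (a z) (single z))) (\<Sum>z\<in>M. 0)" by (rule eqv_sum) (use t in blast)
  then show ?thesis unfolding 1 by (simp only: sum.neutral_const)
qed

lemma lambda_T: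
  assumes l: "l \<in> {1..m}" and a: "a \<in> K" "a \<in> Gr c" "good l a" and b: "b \<in> K" "good l b"
  shows "\<psi> (T a b) (xmono l) = 0"
proof -
  have "eqv (\<psi> (T a b)) (T (\<psi> a) b + fscale (psign (e * (c + 1))) (T a (\<psi> b)))"
    by (rule pderD(6)[OF \<psi> a(1,2) b(1)])
  then have "\<psi> (T a b) (xmono l) = (T (\<psi> a) b + fscale (psign (e * (c + 1))) (T a (\<psi> b))) (xmono l)"
    using xmono_nonconst[OF idx(1)[OF l]] unfolding eqv_def by blast
  also have "\<dots> = 0" using T_good[OF l, of "\<psi> a" b] T_good[OF l, of a "\<psi> b"] a b by simp
  finally show ?thesis .
qed

lemma Dl_T:
  assumes a: "a \<in> K" "a \<in> Gr c" and b: "b \<in> K" shows "Dl (a \<odot> b) = fscale (psign c) (T a b)"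
  using Dl_mul[of a b] a b by (simp add: K_Dl mul_add sg_Gr T_linear)

text \<open>On products of elements of \<open>K\<close> the Laplacian is the bracket, up to sign. So
  \<open>Dl\<close> of a monomial is a bracket once the monomial factors into two pure ones with
  nonzero coefficient, and \<open>lambda_T\<close> applies if both factors are good.\<close>

lemma lambda_split:
  assumes l: "l \<in> {1..m}" and x: "x \<in> M" "pure x" "deg x \<ge> 3 \<or> deg x = 2 \<and> fst x l = 0"
    and y: "y \<in> M" "pure y" "deg y \<ge> 3 \<or> deg y = 2 \<and> fst y l = 0"
    and nz: "mcoeff m x y \<noteq> (0::'k)" and z: "madd x y = z"
  shows "\<psi> (Dl (single z)) (xmono l) = 0"
proof -
  let ?c = "of_nat (card (snd x)) :: bit"
  have xk: "single x \<in> K" "single x \<in> Gr ?c" "good l (single x)" and yk: "single y \<in> K" "good l (single y)"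
    using K_pure[OF x(1,2)] K_pure[OF y(1,2)] good_single[OF x(1) l x(3)] good_single[OF y(1) l y(3)] Gr_single[OF x(1) refl]
    by auto
  have "fscale (mcoeff m x y) (Dl (single z)) = fscale (psign ?c) (T (single x) (single y))"
    using Dl_T[OF xk(1,2) yk(1)] mul_single[OF x(1) y(1)] z by (simp add: Dl_linear)
  then have "fscale (1 / mcoeff m x y) (fscale (mcoeff m x y) (Dl (single z))) =
    fscale (1 / mcoeff m x y) (fscale (psign ?c) (T (single x) (single y)))" by simp
  then have "Dl (single z) = fscale (psign ?c / mcoeff m x y) (T (single x) (single y))" using nz by simp
  then show ?thesis using lambda_T[OF l xk yk] pderD(3)[OF \<psi> K_T[OF xk(1) yk(1)]] by simp
qed

end

text \<open>The coefficient of \<open>x\<^sub>l\<close> in \<open>\<psi> a\<close> is a linear functional of \<open>a\<close> that vanishes on brackets of elements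
  without terms of degree one and without quadratic terms involving \<open>x\<^sub>l\<close>, and vanishes by weight on most
  monomials; the monomials \<open>x\<^sub>l x\<^sub>k^(p^s)\<close> are the only ones that neither argument reaches, whence the
  assumption \<open>exc\<close>.\<close>

locale sho_tor = sho_kill m t p M ty e \<psi> for m t p M and ty :: "'k::field itself" and e \<psi> +
  assumes tor0: "\<And>j k. j \<in> {1..m} \<Longrightarrow> k \<in> {1..m} \<Longrightarrow> eqv (\<psi> (tor j k)) 0"
    and exc: "\<And>l k s. l \<in> {1..m} \<Longrightarrow> k \<in> {1..m} \<Longrightarrow> 1 \<le> s \<Longrightarrow> s < t k \<Longrightarrow> \<psi> (single (xpow l k s)) (xmono l) = 0"
begin

text \<open>Bracketing with \<open>tor j k\<close> is diagonal on monomials and commutes with \<psi>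
  modulo constants, so nonconstant coefficients of different weight cannot mix.\<close>

lemma weight:
  assumes a: "a \<in> K" and j: "j \<in> {1..m}" and k: "k \<in> {1..m}" and w: "\<And>z. a z \<noteq> 0 \<Longrightarrow> wt j z - wt k z = \<delta>"
    and y: "y \<noteq> z0" "wt j y - wt k y \<noteq> \<delta>"
  shows "\<psi> a y = 0"
proof -
  have Ta: "T (tor j k) a = fscale (- \<delta>) a"
  proof
    fix z show "T (tor j k) a z = fscale (- \<delta>) a z"
    proof (cases "a z = 0")
      case False
      then have "wt k z - wt j z = - \<delta>" using w[of z] by (simp add: algebra_simps)
      then show ?thesis using a by (simp add: T_tor_diag[OF j k])
    qed (use a in \<open>simp add: T_tor_diag[OF j k]\<close>)
  qed
  have "eqv (\<psi> (T (tor j k) a)) (T (\<psi> (tor j k)) a + T (tor j k) (\<psi> a))"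
    using pderD(6)[OF \<psi> K_tor[OF j k] Gr_tor[OF j k] a] by simp
  moreover have "T (\<psi> (tor j k)) a = 0" using T_eqv_left[OF tor0[OF j k]] by (simp add: T_linear)
  ultimately have "eqv (\<psi> (T (tor j k) a)) (T (tor j k) (\<psi> a))" by simp
  then have "\<psi> (T (tor j k) a) y = T (tor j k) (\<psi> a) y" using y(1) unfolding eqv_def by blast
  then have "- \<delta> * \<psi> a y = (wt k y - wt j y) * \<psi> a y"
    using a unfolding Ta pderD(3)[OF \<psi> a] by (simp add: T_tor_diag[OF j k])
  then have "(wt j y - wt k y - \<delta>) * \<psi> a y = 0" by (simp add: algebra_simps)
  then show ?thesis using y(2) by simp
qed

end

section \<open>Linear coefficients on images of the Laplacian\<close>

context sho_tor begin

lemma mcoeff_nz: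
  assumes "u \<inter> v = {}" "\<And>i. i \<in> {1..m} \<Longrightarrow> of_nat ((\<alpha> i + \<beta> i) choose \<alpha> i) \<noteq> (0::'k)"
  shows "mcoeff m (\<alpha>, u) (\<beta>, v) \<noteq> (0::'k)"
  using assms by (simp add: mcoeff_eq bprod_def inv_sign_def)

lemma sum_upd:
  fixes f :: "nat \<Rightarrow> nat"
  assumes "k \<in> {1..m}" shows "(\<Sum>i=1..m. (f(k := c)) i) + f k = (\<Sum>i=1..m. f i) + c"
  using assms by (subst (1 2) sum.remove[of _ k]) (auto intro!: sum.cong)

lemma deg_x: "deg (\<gamma>, {}) = (\<Sum>i=1..m. \<gamma> i)" by (simp add: deg_def)

lemma Dl_one_pair:
  assumes k: "k \<in> {1..m}" and z: "(\<beta>, {k + m}) \<in> M" and pos: "\<beta> k > 0"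
  shows "Dl (single (\<beta>, {k + m})) = single (\<beta>(k := \<beta> k - 1), {})"
proof -
  have "Dl (single (\<beta>, {k + m})) = (\<Sum>i=1..m. if i = k then single (\<beta>(k := \<beta> k - 1), {}) else 0)"
    unfolding Dl_def
  proof (rule sum.cong[OF refl])
    fix i assume i: "i \<in> {1..m}"
    have c: "{j. j = k + m \<and> j < k + m} = {}" by auto
    show "d i (d (i + m) (single (\<beta>, {k + m}))) = (if i = k then single (\<beta>(k := \<beta> k - 1), {}) else 0)"
      unfolding Dl_term[OF z i] using pos by (simp add: sgn_at_def c)
  qed
  then show ?thesis using k by simp
qed

text \<open>The even monomial is the Laplacian of itself raised in the k-th variable and multiplied
  by the conjugate of that variable. That monomial factors into exponent \<delta> times the odd
  variable, and the rest; since \<delta> vanishes at k both are pure. Raising needs room below the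
  truncation at k.\<close>

lemma lambda_x_split:
  assumes l: "l \<in> {1..m}" and g: "(\<gamma>, {}) \<in> M" and k: "k \<in> {1..m}" "\<delta> k = 0" "Suc (\<gamma> k) < p ^ t k"
    and le: "\<And>i. \<delta> i \<le> \<gamma> i" and nz: "\<And>i. i \<in> {1..m} \<Longrightarrow> of_nat (\<gamma> i choose \<delta> i) \<noteq> (0::'k)"
    and d: "(\<Sum>i=1..m. \<delta> i) \<ge> 2 \<or> (\<Sum>i=1..m. \<delta> i) = 1 \<and> \<delta> l = 0" "(\<Sum>i=1..m. \<delta> i) + 2 \<le> (\<Sum>i=1..m. \<gamma> i)"
  shows "\<psi> (single (\<gamma>, {})) (xmono l) = 0"
proof -
  define \<gamma>' where "\<gamma>' = \<gamma>(k := Suc (\<gamma> k))"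
  define \<eta> where "\<eta> i = \<gamma>' i - \<delta> i" for i
  have le': "\<delta> i \<le> \<gamma>' i" for i using le[of i] by (auto simp: \<gamma>'_def)
  have z: "(\<gamma>', {k + m}) \<in> M" using g k by (auto simp: M_iff \<gamma>'_def)
  have x: "(\<delta>, {k + m}) \<in> M" using z le' unfolding M_iff by (metis le_less_trans le_zero_eq)
  have y: "(\<eta>, {}) \<in> M" using z by (auto simp: M_iff \<eta>_def less_imp_diff_less)
  have add: "\<delta> i + \<eta> i = \<gamma>' i" for i using le'[of i] by (simp add: \<eta>_def)
  have s: "(\<Sum>i=1..m. \<delta> i) + (\<Sum>i=1..m. \<eta> i) = Suc (\<Sum>i=1..m. \<gamma> i)"
    using sum_upd[OF k(1), of \<gamma> "Suc (\<gamma> k)"] unfolding sum.distrib[symmetric] add by (simp add: \<gamma>'_def)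
  have "\<psi> (Dl (single (\<gamma>', {k + m}))) (xmono l) = 0"
  proof (rule lambda_split[OF l x _ _ y])
    show "pure (\<delta>, {k + m})" "pure (\<eta>, {})" using k by (auto simp: pure_def)
    show "3 \<le> deg (\<delta>, {k + m}) \<or> deg (\<delta>, {k + m}) = 2 \<and> fst (\<delta>, {k + m}) l = 0"
      using d(1) by (auto simp: deg_def)
    show "3 \<le> deg (\<eta>, {}) \<or> deg (\<eta>, {}) = 2 \<and> fst (\<eta>, {}) l = 0" using s d(2) by (simp add: deg_x)
    show "mcoeff m (\<delta>, {k + m}) (\<eta>, {}) \<noteq> (0::'k)"
    proof (rule mcoeff_nz)
      fix i assume i: "i \<in> {1..m}"
      show "of_nat (\<delta> i + \<eta> i choose \<delta> i) \<noteq> (0::'k)"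
        unfolding add using nz[OF i] k(2) by (cases "i = k") (auto simp: \<gamma>'_def)
    qed simp
    show "madd (\<delta>, {k + m}) (\<eta>, {}) = (\<gamma>', {k + m})" by (simp add: madd_def add)
  qed
  moreover have "Dl (single (\<gamma>', {k + m})) = single (\<gamma>, {})"
    using Dl_one_pair[OF k(1) z] by (simp add: \<gamma>'_def)
  ultimately show ?thesis by simp
qed

lemma of_nat_top: "Suc n = p ^ t k \<Longrightarrow> k \<in> {1..m} \<Longrightarrow> of_nat n = (- 1 :: 'k)"
proof -
  assume n: "Suc n = p ^ t k" and k: "k \<in> {1..m}"
  have "p dvd Suc n" using n tpos k by (simp add: dvd_power)
  then have "of_nat (Suc n) = (0::'k)" by (rule of_nat_p_dvd)
  then show ?thesis by (simp add: add_eq_0_iff)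
qed

text \<open>If the coefficient is nonzero, \<open>weight\<close> gives all exponents but the l-th a
  common residue c modulo p, and the l-th the residue c + 1. For c nonzero a single variable can be
  split off; for c = 0 a larger divided power must be, and this fails only for the monomials
  \<open>xpow\<close>.\<close>

lemma lambda_x:
  assumes l: "l \<in> {1..m}" and g: "(\<gamma>, {}) \<in> M" and deg: "(\<Sum>i=1..m. \<gamma> i) \<ge> 3"
  shows "\<psi> (single (\<gamma>, {})) (xmono l) = 0"
proof (rule ccontr)
  assume ne: "\<psi> (single (\<gamma>, {})) (xmono l) \<noteq> 0"
  have aK: "single (\<gamma>, {}) \<in> K" by (rule K_pure[OF g]) (simp add: pure_def)
  have w: "of_nat (\<gamma> j) - of_nat (\<gamma> k) = (of_bool (j = l) - of_bool (k = l) :: 'k)"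
    if j: "j \<in> {1..m}" and k: "k \<in> {1..m}" for j k
  proof (rule ccontr)
    assume n: "of_nat (\<gamma> j) - of_nat (\<gamma> k) \<noteq> (of_bool (j = l) - of_bool (k = l) :: 'k)"
    have "\<psi> (single (\<gamma>, {})) (xmono l) = 0"
    proof (rule weight[OF aK j k _ xmono_nonconst[OF idx(1)[OF l]]])
      show "wt j z - wt k z = of_nat (\<gamma> j) - of_nat (\<gamma> k)" if "single (\<gamma>, {}) z \<noteq> (0::'k)" for z
        using that by (auto simp: single_apply wt_def split: if_splits)
      show "wt j (xmono l) - wt k (xmono l) \<noteq> of_nat (\<gamma> j) - of_nat (\<gamma> k)"
        using n j k l by (simp add: wt_xmono)
    qed
    then show False using ne by simp
  qed
  have lt: "\<gamma> i < p ^ t i" if "i \<in> {1..m}" for i using g that by (simp add: M_iff)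
  have out: "\<gamma> i = 0" if "i \<notin> {1..m}" for i using g that by (simp add: M_iff)
  have not_top: "Suc (\<gamma> i) < p ^ t i" if "i \<in> {1..m}" "of_nat (\<gamma> i) \<noteq> (- 1 :: 'k)" for i
    using of_nat_top[of "\<gamma> i" i] that lt[of i] by (metis Suc_lessI)
  define c where "c = (of_nat (\<gamma> l) - 1 :: 'k)"
  have gc: "of_nat (\<gamma> j) = c" if "j \<in> {1..m}" "j \<noteq> l" for j
    using w[OF l that(1)] that(2) by (simp add: c_def algebra_simps)
  have gl: "of_nat (\<gamma> l) = c + 1" by (simp add: c_def)
  show False
  proof (cases "c = 0")
    case False
    obtain j where j: "j \<in> {1..m}" "j \<noteq> l" using other_index by metis
    \<comment> \<open>A variable other than j with room to be raised: its exponent must not be -1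
      modulo p. If c = -1 then l has residue 0, otherwise a third index has residue c.\<close>
    have "\<exists>k\<in>{1..m}. k \<noteq> j \<and> of_nat (\<gamma> k) \<noteq> (- 1 :: 'k)"
    proof (cases "c = - 1")
      case True
      then show ?thesis using gl j l by (intro bexI[of _ l]) auto
    next
      case False
      obtain k where "k \<in> {1..m}" "k \<noteq> j" "k \<noteq> l" by (rule other_index)
      then show ?thesis using gc[of k] False by (intro bexI[of _ k]) auto
    qed
    then obtain k where k: "k \<in> {1..m}" "k \<noteq> j" "of_nat (\<gamma> k) \<noteq> (- 1 :: 'k)" by blast
    have jp: "\<gamma> j \<ge> 1" using gc[OF j] False by (cases "\<gamma> j") auto
    let ?\<delta> = "\<lambda>i. of_bool (i = j) :: nat"
    have s: "(\<Sum>i=1..m. ?\<delta> i) = 1" using j(1) by simp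
    have "\<psi> (single (\<gamma>, {})) (xmono l) = 0"
    proof (rule lambda_x_split[OF l g k(1), of ?\<delta>])
      show "of_nat (\<gamma> i choose of_bool (i = j)) \<noteq> (0::'k)" if "i \<in> {1..m}" for i
        using gc[OF j] False by (cases "i = j") auto
    qed (use k j jp deg s not_top[OF k(1,3)] in auto)
    then show False using ne by simp
  next
    case c: True
    have gj: "of_nat (\<gamma> j) = (0::'k)" if "j \<in> {1..m}" "j \<noteq> l" for j using gc[OF that] c by simp
    have gl1: "of_nat (\<gamma> l) = (1::'k)" using gl c by simp
    \<comment> \<open>Only the residues 0 and 1 occur now, so every variable has room.\<close>
    have nt: "Suc (\<gamma> k) < p ^ t k" if "k \<in> {1..m}" for k
      using not_top[OF that] gj[OF that] gl1 minus_one_neq_one by (cases "k = l") auto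
    have dvd: "p dvd \<gamma> j" if "j \<in> {1..m}" "j \<noteq> l" for j
      using gj[OF that] by (simp add: of_nat_eq_0_iff_char_dvd p_eq)
    have glp: "\<gamma> l > 0" using gl1 by (cases "\<gamma> l") auto
    have single_delta: "\<psi> (single (\<gamma>, {})) (xmono l) = 0"
      if j: "j \<in> {1..m}" and b: "2 \<le> b" "b \<le> \<gamma> j" "of_nat (\<gamma> j choose b) \<noteq> (0::'k)" "b + 2 \<le> (\<Sum>i=1..m. \<gamma> i)" for j b
    proof -
      obtain k where k: "k \<in> {1..m}" "k \<noteq> j" using other_index by metis
      let ?\<delta> = "\<lambda>i. if i = j then b else 0"
      have s: "(\<Sum>i=1..m. ?\<delta> i) = b" using j by simp
      show ?thesis
      proof (rule lambda_x_split[OF l g k(1), of ?\<delta>])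
        show "of_nat (\<gamma> i choose (if i = j then b else 0)) \<noteq> (0::'k)" for i using b by simp
      qed (use k b nt[OF k(1)] s in auto)
    qed
    show False
    proof (cases "\<exists>j\<in>{1..m}. j \<noteq> l \<and> \<gamma> j > 0")
      case True
      then obtain j where j: "j \<in> {1..m}" "j \<noteq> l" "\<gamma> j > 0" by blast
      have jp: "\<gamma> j \<ge> p" using dvd[OF j(1,2)] j(3) by (rule dvd_imp_le)
      have two: "\<gamma> l + \<gamma> j \<le> (\<Sum>i=1..m. \<gamma> i)" using sum_ge_two[OF l j(1)] j by simp
      show False
      proof (cases "\<exists>s. \<gamma> j = p ^ s")
        case True
        then obtain s where s: "\<gamma> j = p ^ s" by blast
        have s1: "1 \<le> s" using s jp char by (cases s) auto
        have st: "s < t j"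
        proof -
          have "p ^ s < p ^ t j" using lt[OF j(1)] s by simp
          then show ?thesis using char by simp
        qed
        \<comment> \<open>Total degree p^s + 1 is exactly the exceptional monomial. With more degree
          available the whole j-th power can be split off, with binomial coefficient one.\<close>
        show False
        proof (cases "(\<Sum>i=1..m. \<gamma> i) = \<gamma> j + 1")
          case True
          have "\<gamma> i = of_bool (i = l) + (if i = j then p ^ s else 0)" for i
          proof (cases "i \<in> {1..m} \<and> i \<noteq> l \<and> i \<noteq> j")
            case t: True
            then have "\<gamma> l + \<gamma> j + \<gamma> i \<le> (\<Sum>i=1..m. \<gamma> i)" using sum_ge_three[OF l j(1), of i] j by auto
            then show ?thesis using True t glp by simp
          next
            case False
            then show ?thesis using True two glp s j out[of i] l by auto
          qed
          then have "(\<gamma>, {}) = xpow l j s" by (auto simp: xpow_def)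
          then show False using exc[OF l j(1) s1 st] ne by simp
        next
          case False
          then have "\<gamma> j + 2 \<le> (\<Sum>i=1..m. \<gamma> i)" using two glp by simp
          then show False using single_delta[OF j(1), of "\<gamma> j"] jp char ne by simp
        qed
      next
        case False
        then obtain b where b: "0 < b" "b < \<gamma> j" "p dvd b" "of_nat (\<gamma> j choose b) \<noteq> (0::'k)"
          using binomial_split[OF j(3) dvd[OF j(1,2)]] by metis
        have "p dvd \<gamma> j - b" using dvd[OF j(1,2)] b by (simp add: dvd_diff_nat)
        then have "p \<le> \<gamma> j - b" "p \<le> b" using b by (auto intro: dvd_imp_le)
        then have "2 \<le> b" "b + 2 \<le> (\<Sum>i=1..m. \<gamma> i)" using b(2) two char by linarith+
        then show False using single_delta[OF j(1), of b] b ne by simp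
      qed
    next
      case False
      \<comment> \<open>Only the l-th variable occurs, with exponent n + 1 where p divides n. The
        splitting is found for n and carried over to n + 1.\<close>
      have g0: "\<gamma> i = 0" if "i \<noteq> l" for i using False that out[of i] by (cases "i \<in> {1..m}") auto
      have s: "(\<Sum>i=1..m. \<gamma> i) = \<gamma> l"
      proof -
        have "(\<Sum>i=1..m. \<gamma> i) = (\<Sum>i=1..m. if i = l then \<gamma> l else 0)" by (intro sum.cong) (auto simp: g0)
        then show ?thesis using l by simp
      qed
      define n where "n = \<gamma> l - 1"
      have gn: "\<gamma> l = Suc n" using glp by (simp add: n_def)
      have n2: "n \<ge> 2" using deg s gn by simp
      have dn: "p dvd n"
      proof -
        have "of_nat n = (0::'k)" using gl1 gn by simp
        then show ?thesis by (simp add: of_nat_eq_0_iff_char_dvd p_eq)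
      qed
      have np: "p \<le> n" using dn n2 by (intro dvd_imp_le) auto
      show False
      proof (cases "\<exists>s. n = p ^ s")
        case True
        then obtain s' where s': "n = p ^ s'" by blast
        have s1: "1 \<le> s'" using s' np char by (cases s') auto
        have "p ^ s' < p ^ t l" using lt[OF l] gn s' by simp
        then have st: "s' < t l" using char by simp
        have "\<gamma> i = of_bool (i = l) + (if i = l then p ^ s' else 0)" for i using g0[of i] gn s' by auto
        then have "(\<gamma>, {}) = xpow l l s'" by (auto simp: xpow_def)
        then show False using exc[OF l l s1 st] ne by simp
      next
        case False
        then obtain b where b: "0 < b" "b < n" "p dvd b" "of_nat (n choose b) \<noteq> (0::'k)"
          using binomial_split[of n] dn n2 by (metis not_numeral_le_zero gr0I)
        have bp: "p \<le> b" using b by (intro dvd_imp_le) auto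
        \<comment> \<open>Absorption relates the binomial coefficients of n + 1 and n; modulo p the
          factor n + 1 is one, so the nonvanishing carries over.\<close>
        have "(\<gamma> l - b) * (\<gamma> l choose b) = \<gamma> l * (n choose b)"
          using binomial_absorb_comp[of "\<gamma> l" b] by (simp add: n_def)
        then have "of_nat ((\<gamma> l - b) * (\<gamma> l choose b)) = (of_nat (\<gamma> l * (n choose b)) :: 'k)" by simp
        then have "of_nat (\<gamma> l - b) * of_nat (\<gamma> l choose b) = (of_nat (n choose b) :: 'k)"
          unfolding of_nat_mult gl1 by simp
        then have "of_nat (\<gamma> l choose b) \<noteq> (0::'k)" using b by auto
        then show False using single_delta[OF l, of b] b bp char s gn ne by simp
      qed
    qed
  qed
qed

lemma two_neq_one: "(2 :: 'k) \<noteq> 1"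
  by (metis add_cancel_left_right one_add_one zero_neq_one)

lemma xi_index: "r \<in> {m+1..2*m} \<Longrightarrow> \<exists>i\<in>{1..m}. r = i + m"
  by (intro bexI[of _ "r - m"]) auto

lemma Dl_support:
  assumes z: "(\<beta>, v) \<in> M" and y: "Dl (single (\<beta>, v)) y \<noteq> (0::'k)"
  shows "\<exists>i\<in>{1..m}. \<beta> i > 0 \<and> i + m \<in> v \<and> y = (\<beta>(i := \<beta> i - 1), v - {i + m})"
proof (rule ccontr)
  assume n: "\<not> ?thesis"
  have "Dl (single (\<beta>, v)) y = (0::'k)"
    unfolding Dl_def sum_fun_apply
  proof (intro sum.neutral ballI)
    fix i assume "i \<in> {1..m}"
    then show "d i (d (i + m) (single (\<beta>, v))) y = (0::'k)" using n by (auto simp: Dl_term[OF z] single_apply)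
  qed
  then show False using y by simp
qed

lemma Dl_support_wt: "z \<in> M \<Longrightarrow> Dl (single z) y \<noteq> (0::'k) \<Longrightarrow> wt j y = wt j z"
proof -
  assume z: "z \<in> M" and y: "Dl (single z) y \<noteq> (0::'k)"
  obtain \<beta> v where zz: "z = (\<beta>, v)" by (cases z)
  show ?thesis using Dl_support[of \<beta> v y] z y by (auto simp: zz wt_def of_nat_diff)
qed

text \<open>Here splitting would produce quadratic factors that need not be good. Instead all terms
  of \<open>Dl\<close> are quadratic and share the weights of z; with so few variables these weights
  cannot match those of \<open>x_l\<close>.\<close>

lemma lambda_quadratic:
  assumes l: "l \<in> {1..m}" and z: "z \<in> M" "deg z = 4" shows "\<psi> (Dl (single z)) (xmono l) = 0"
proof (rule ccontr)
  assume ne: "\<psi> (Dl (single z)) (xmono l) \<noteq> 0"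
  obtain \<beta> v where zz: "z = (\<beta>, v)" by (cases z)
  have zM: "(\<beta>, v) \<in> M" using z zz by simp
  have fin: "finite v" using finite_odd[OF zM] .
  have DK: "Dl (single z) \<in> K" by (intro K_I) (simp_all add: z Dl_Dl)
  have supp: "\<exists>i\<in>{1..m}. \<beta> i > 0 \<and> i + m \<in> v \<and> y = (\<beta>(i := \<beta> i - 1), v - {i + m})"
    if "Dl (single z) y \<noteq> (0::'k)" for y using Dl_support[OF zM] that unfolding zz by blast
  have wt: "wt j y = wt j z" if "Dl (single z) y \<noteq> (0::'k)" for j y by (rule Dl_support_wt[OF z(1) that])
  have w: "wt j z - wt k z = of_bool (j = l) - of_bool (k = l)" if j: "j \<in> {1..m}" and k: "k \<in> {1..m}" for j k
  proof (rule ccontr)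
    assume n: "wt j z - wt k z \<noteq> of_bool (j = l) - of_bool (k = l)"
    have "\<psi> (Dl (single z)) (xmono l) = 0"
      by (rule weight[OF DK j k _ xmono_nonconst[OF idx(1)[OF l]], of "wt j z - wt k z"])
        (use n j k l in \<open>auto simp: wt wt_xmono\<close>)
    then show False using ne by simp
  qed
  have "Dl (single z) \<noteq> 0" using ne by (auto simp: pder_zero[OF \<psi>])
  then obtain y where "Dl (single z) y \<noteq> (0::'k)" by (metis ext zero_fun_apply)
  then obtain i where i: "i \<in> {1..m}" "\<beta> i > 0" "i + m \<in> v" using supp by blast
  define \<gamma> where "\<gamma> = \<beta>(i := \<beta> i - 1)"
  define u where "u = v - {i + m}"
  have "card u + 1 = card v" using card_Suc_Diff1[OF fin i(3)] by (simp add: u_def)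
  moreover have "(\<Sum>j=1..m. \<gamma> j) + 1 = (\<Sum>j=1..m. \<beta> j)"
    using sum_upd[OF i(1), of \<beta> "\<beta> i - 1"] i(2) unfolding \<gamma>_def by simp
  ultimately have deg: "(\<Sum>j=1..m. \<gamma> j) + card u = 2" using z(2) by (simp add: zz deg_def)
  have wz: "wt j z = of_nat (\<gamma> j) - of_bool (j + m \<in> u)" for j
    using i by (auto simp: zz wt_def \<gamma>_def u_def of_nat_diff)
  have uM: "u \<subseteq> {m+1..2*m}" and ufin: "finite u" using zM fin by (auto simp: M_iff u_def)
  define n where "n j = \<gamma> j + of_bool (j + m \<in> u)" for j
  have sn: "(\<Sum>j=1..m. n j) = 2"
  proof -
    have "card u = card ((\<lambda>j. j + m) ` {j \<in> {1..m}. j + m \<in> u})"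
      using uM xi_index by (intro arg_cong[where f=card]) blast
    also have "\<dots> = card {j \<in> {1..m}. j + m \<in> u}" by (rule card_image) (simp add: inj_on_def)
    also have "\<dots> = (\<Sum>j=1..m. of_bool (j + m \<in> u))" by (simp add: Int_def)
    finally show ?thesis using deg by (simp add: n_def sum.distrib)
  qed
  have "\<exists>j\<in>{1..m}. j \<noteq> l \<and> n j = 0"
  proof (rule ccontr)
    assume a: "\<not> ?thesis"
    obtain j where j: "j \<in> {1..m}" "j \<noteq> l" using other_index by metis
    obtain k where k: "k \<in> {1..m}" "k \<noteq> l" "k \<noteq> j" by (rule other_index)
    have "card {l, j, k} < card {1..m}" using m3 by (simp add: card_insert_if)
    then have "\<not> {1..m} \<subseteq> {l, j, k}" by (meson card_mono finite.intros leD)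
    then obtain h where h: "h \<in> {1..m}" "h \<noteq> l" "h \<noteq> j" "h \<noteq> k" by blast
    have "n j + n k + n h \<le> 2" unfolding sn[symmetric]
      by (rule sum_ge_three[OF j(1) k(1) h(1) k(3)[symmetric] h(3,4)])
    moreover have "n j > 0" "n k > 0" "n h > 0" using a j k h by auto
    ultimately show False by linarith
  qed
  then obtain j0 where j0: "j0 \<in> {1..m}" "j0 \<noteq> l" "n j0 = 0" by blast
  have wj0: "wt j0 z = 0" using j0 by (simp add: wz n_def)
  have wl: "wt l z = 1" using w[OF l j0(1)] j0 wj0 by simp
  have wj: "wt j z = 0" if "j \<in> {1..m}" "j \<noteq> l" for j using w[OF that(1) j0(1)] that(2) j0 wj0 by simp
  have nl: "n l \<le> 2" using sum_ge_one[OF l, of n] sn by simp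
  have "\<gamma> l = 1 \<and> l + m \<notin> u"
  proof -
    have "\<gamma> l = 0 \<or> \<gamma> l = 1 \<or> \<gamma> l = 2" using nl by (auto simp: n_def)
    then show ?thesis using wl nl minus_one_neq_one two_neq_one two_neq_one[symmetric] unfolding wz by (cases "l + m \<in> u") (auto simp: n_def)
  qed
  then have nl1: "n l = 1" by (simp add: n_def)
  have "\<exists>j\<in>{1..m}. j \<noteq> l \<and> n j \<noteq> 0"
  proof (rule ccontr)
    assume "\<not> ?thesis"
    then have "(\<Sum>j=1..m. n j) = (\<Sum>j=1..m. if j = l then 1 else 0)" using nl1 by (intro sum.cong) auto
    then show False using sn l by simp
  qed
  then obtain j where j: "j \<in> {1..m}" "j \<noteq> l" "n j \<noteq> 0" by blast
  have "n l + n j \<le> 2" using sum_ge_two[OF l j(1), of n] j sn by simp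
  then have "n j = 1" using nl1 j(3) by linarith
  then have "\<gamma> j + of_bool (j + m \<in> u) = 1" by (simp only: n_def)
  then have "wt j z \<noteq> 0" unfolding wz by (cases "j + m \<in> u") auto
  then show False using wj[OF j(1,2)] by simp
qed

text \<open>Up to degree three the Laplacian has degree at most one and is killed, and degree four
  is \<open>lambda_quadratic\<close>. From degree five on there are enough variables to factor the
  monomial into two pure good ones, except when it has a single odd variable.\<close>

lemma lambda_Dl:
  assumes l: "l \<in> {1..m}" and z: "z \<in> M" shows "\<psi> (Dl (single z)) (xmono l) = 0"
proof (cases "pure z")
  case True
  then show ?thesis using Dl_pure[OF z] by (simp add: pder_zero[OF \<psi>])
next
  case False
  obtain \<beta> v where zz: "z = (\<beta>, v)" by (cases z)
  have zM: "(\<beta>, v) \<in> M" using z zz by simp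
  have fin: "finite v" using finite_odd[OF zM] .
  have vm: "v \<subseteq> {m+1..2*m}" using zM by (simp add: M_iff)
  obtain k where k: "k \<in> {1..m}" "\<beta> k > 0" "k + m \<in> v" using False by (auto simp: pure_def zz)
  define B where "B = (\<Sum>i=1..m. \<beta> i)"
  have dz: "deg z = B + card v" by (simp add: zz deg_def B_def)
  have B1: "B \<ge> 1" using sum_ge_one[OF k(1), of \<beta>] k(2) by (simp add: B_def)
  have V1: "card v \<ge> 1" using k(3) fin by (metis card_gt_0_iff Suc_le_eq One_nat_def empty_iff)
  have sub: "(\<beta>', u) \<in> M" if "\<And>i. \<beta>' i \<le> \<beta> i" "u \<subseteq> v" for \<beta>' u
    using zM that unfolding M_iff by (metis le_less_trans le_zero_eq subset_trans)
  have binom: "of_nat ((\<alpha> i + \<alpha>' i) choose \<alpha> i) \<noteq> (0::'k)" if "\<alpha> i = 0 \<or> \<alpha>' i = 0" for \<alpha> \<alpha>' :: "nat \<Rightarrow> nat" and i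
    using that by auto
  show ?thesis
  proof (cases "deg z \<le> 3")
    case True
    have "eqv (\<psi> (Dl (single z))) 0"
    proof (rule psi_low)
      fix y assume "Dl (single z) y \<noteq> (0::'k)"
      then have "(\<Sum>i=1..m. d i (d (i + m) (single z)) y) \<noteq> (0::'k)" unfolding Dl_def sum_fun_apply .
      then obtain i where i: "i \<in> {1..m}" and n: "d i (d (i + m) (single z)) y \<noteq> (0::'k)"
        by (rule sum.not_neutral_contains_not_neutral)
      then have n': "\<beta> i > 0" "i + m \<in> v" "y = (\<beta>(i := \<beta> i - 1), v - {i + m})"
        unfolding zz Dl_term[OF zM i] by (auto simp: single_apply split: if_splits)
      have "card v = Suc (card (v - {i + m}))" using card_Suc_Diff1[OF fin n'(2)] by simp
      moreover have "(\<Sum>j=1..m. (\<beta>(i := \<beta> i - 1)) j) + 1 = B"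
        using sum_upd[OF i, of \<beta> "\<beta> i - 1"] n' unfolding B_def by simp
      ultimately show "deg y \<le> 1" using True dz unfolding n'(3) by (simp add: deg_def)
    qed (use z in simp)
    then show ?thesis using xmono_nonconst[OF idx(1)[OF l]] unfolding eqv_def by (metis zero_fun_apply)
  next
    case d4: False
    show ?thesis
    proof (cases "deg z = 4")
      case True
      then show ?thesis by (rule lambda_quadratic[OF l z])
    next
      case False
      then have d5: "B + card v \<ge> 5" using d4 dz by simp
      note sp = lambda_split[OF l, of _ _ z]
      consider (a) "card v \<ge> 2" "B \<ge> 3 \<or> B = 2 \<and> \<beta> l = 0" | (b) "B = 2" "\<beta> l > 0" "card v \<ge> 3" | (c) "card v = 1" "B \<ge> 4" | (d) "B = 1" "card v \<ge> 4"
        using d5 B1 V1 by linarith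
      then show ?thesis
      proof cases
        \<comment> \<open>The even part and the odd part are pure separately, and large enough to be
          good.\<close>
        case a
        show ?thesis
        proof (rule sp[of "(\<beta>, {})" "(\<lambda>i. 0, v)"])
          show "mcoeff m (\<beta>, {}) (\<lambda>i. 0, v) \<noteq> (0::'k)" by (simp add: mcoeff_eq)
          show "(\<beta>, {}) \<in> M" "(\<lambda>i. 0, v) \<in> M" by (auto intro: sub)
          show "3 \<le> deg (\<lambda>i. 0, v) \<or> deg (\<lambda>i. 0, v) = 2 \<and> fst (\<lambda>i. 0 :: nat, v) l = 0" using a(1) by (auto simp: deg_def)
          show "3 \<le> deg (\<beta>, {}) \<or> deg (\<beta>, {}) = 2 \<and> fst (\<beta>, {} :: nat set) l = 0" using a(2) by (auto simp: deg_def B_def)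
        qed (auto simp: pure_def madd_def zz)
      next
        \<comment> \<open>With one odd variable the Laplacian is a single monomial in the even
          variables, as treated by \<open>lambda_x\<close>.\<close>
        case c
        then have v: "v = {k + m}" using k(3) by (metis card_1_singletonE singletonD)
        let ?g = "\<beta>(k := \<beta> k - 1)"
        have "\<psi> (single (?g, {})) (xmono l) = 0"
        proof (rule lambda_x[OF l])
          show "(?g, {}) \<in> M" by (rule sub) auto
          show "3 \<le> (\<Sum>i=1..m. ?g i)" using sum_upd[OF k(1), of \<beta> "\<beta> k - 1"] k(2) c(2) by (simp add: B_def)
        qed
        then show ?thesis using Dl_one_pair[OF k(1), of \<beta>] zM k(2) by (simp add: zz v)
      next
        \<comment> \<open>The only even variable has index k. Its conjugate goes into the other
          factor, together with a second odd variable.\<close>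
        case d
        have "\<not> v \<subseteq> {k + m}" using d(2) card_mono[of "{k + m}" v] by auto
        then obtain j where j: "j \<in> v" "j \<noteq> k + m" by blast
        have bi: "\<beta> i = 0" if "i \<noteq> k" for i
        proof (cases "i \<in> {1..m}")
          case True
          then show ?thesis using sum_ge_two[OF k(1) True, of \<beta>] that d k by (simp add: B_def)
        next
          case False
          then show ?thesis using zM by (simp add: M_iff)
        qed
        have c2: "card {j, k + m} = 2" using j by simp
        have c3: "card (v - {j, k + m}) \<ge> 2" using d(2) k j fin by (simp add: card_Diff_subset)
        show ?thesis
        proof (rule sp[of "(\<lambda>i. 0, {j, k + m})" "(\<beta>, v - {j, k + m})"])
          show "mcoeff m (\<lambda>i. 0, {j, k + m}) (\<beta>, v - {j, k + m}) \<noteq> (0::'k)" by (simp add: mcoeff_eq inv_sign_def)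
          show "(\<lambda>i. 0, {j, k + m}) \<in> M" "(\<beta>, v - {j, k + m}) \<in> M" using j k by (auto intro: sub)
          show "3 \<le> deg (\<beta>, v - {j, k + m}) \<or> deg (\<beta>, v - {j, k + m}) = 2 \<and> fst (\<beta>, v - {j, k + m}) l = 0"
            using c3 d(1) by (simp add: deg_def B_def)
          show "pure (\<beta>, v - {j, k + m})" unfolding pure_def fst_conv snd_conv using bi by (metis Diff_iff insertCI less_numeral_extra(3))
          show "madd (\<lambda>i. 0, {j, k + m}) (\<beta>, v - {j, k + m}) = z" using j k by (auto simp: madd_def zz)
          show "3 \<le> deg (\<lambda>i. 0, {j, k + m}) \<or> deg (\<lambda>i. 0, {j, k + m}) = 2 \<and> fst (\<lambda>i. 0 :: nat, {j, k + m}) l = 0"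
            using c2 by (simp add: deg_def)
        qed (simp add: pure_def)
      next
        case b
        have b2: "\<beta> l = 1 \<or> \<beta> l = 2" using b sum_ge_one[OF l, of \<beta>] by (auto simp: B_def)
        show ?thesis
        proof (cases "\<beta> l = 2")
          \<comment> \<open>The even part alone is quadratic and involves \<open>x_l\<close>, hence
            not good. An odd variable not conjugate to \<open>x_l\<close> raises its degree to
            three.\<close>
          case True
          have bi: "\<beta> i = 0" if "i \<in> {1..m}" "i \<noteq> l" for i
            using sum_ge_two[OF l that(1), of \<beta>] that b True by (simp add: B_def)
          have "\<not> v \<subseteq> {l + m}" using b(3) card_mono[of "{l + m}" v] by auto
          then obtain j where j: "j \<in> v" "j \<noteq> l + m" by blast
          have c3: "card (v - {j}) \<ge> 2" using b(3) j fin by simp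
          show ?thesis
          proof (rule sp[of "(\<beta>, {j})" "(\<lambda>i. 0, v - {j})"])
            show "mcoeff m (\<beta>, {j}) (\<lambda>i. 0, v - {j}) \<noteq> (0::'k)" by (simp add: mcoeff_eq inv_sign_def)
            show "(\<beta>, {j}) \<in> M" "(\<lambda>i. 0, v - {j}) \<in> M" using j by (auto intro: sub)
            show "3 \<le> deg (\<beta>, {j}) \<or> deg (\<beta>, {j}) = 2 \<and> fst (\<beta>, {j}) l = 0" using b(1) by (simp add: deg_def B_def)
            show "pure (\<beta>, {j})" using j bi unfolding pure_def fst_conv snd_conv by (metis less_numeral_extra(3) singletonD)
            show "madd (\<beta>, {j}) (\<lambda>i. 0, v - {j}) = z" using j by (auto simp: madd_def zz)
            show "3 \<le> deg (\<lambda>i. 0, v - {j}) \<or> deg (\<lambda>i. 0, v - {j}) = 2 \<and> fst (\<lambda>i. 0 :: nat, v - {j}) l = 0"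
              using c3 by (auto simp: deg_def)
          qed (simp add: pure_def)
        next
          case False
          then have bl: "\<beta> l = 1" using b2 by simp
          have s1: "(\<Sum>i=1..m. (\<beta>(l := 0)) i) = 1" using sum_upd[OF l, of \<beta> 0] b bl by (simp add: B_def)
          \<comment> \<open>The even part is \<open>x_l\<close> times the variable of index
            \<open>k'\<close>. These two go into different factors; one odd variable j joins the
            latter and the others join \<open>x_l\<close>. The choice of j below keeps conjugate
            pairs apart.\<close>
          define k' where "k' = (SOME i. i \<in> {1..m} \<and> i \<noteq> l \<and> \<beta> i > 0)"
          have bk: "\<beta> i = 0" if i: "i \<in> {1..m}" "i \<noteq> l" "i \<noteq> k'" for i
          proof (rule ccontr)
            assume n: "\<beta> i \<noteq> 0"
            then have "k' \<in> {1..m} \<and> k' \<noteq> l \<and> \<beta> k' > 0" unfolding k'_def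
              by (intro someI[of "\<lambda>i. i \<in> {1..m} \<and> i \<noteq> l \<and> \<beta> i > 0" i]) (use i in auto)
            then have "\<beta> l + \<beta> i + \<beta> k' \<le> B" unfolding B_def using i by (intro sum_ge_three[OF l]) auto
            then show False using n b bl \<open>k' \<in> {1..m} \<and> k' \<noteq> l \<and> \<beta> k' > 0\<close> by linarith
          qed
          have "\<exists>j\<in>v. j \<noteq> k' + m \<and> (l + m \<in> v \<longrightarrow> j = l + m)"
          proof (cases "l + m \<in> v")
            case True
            have "l \<noteq> k'"
            proof
              assume "l = k'"
              then have "(\<Sum>i=1..m. (\<beta>(l := 0)) i) = 0" using bk by (intro sum.neutral) auto
              then show False using s1 by simp
            qed
            then show ?thesis using True by auto
          next
            case False
            have "\<not> v \<subseteq> {k' + m}" using b(3) card_mono[of "{k' + m}" v] by auto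
            then show ?thesis using False by blast
          qed
          then obtain j where j: "j \<in> v" "j \<noteq> k' + m" "l + m \<in> v \<longrightarrow> j = l + m" by blast
          have c3: "card (v - {j}) \<ge> 2" using b(3) j fin by simp
          let ?x = "(\<beta>(l := 0), {j})" and ?y = "((\<lambda>i. 0)(l := 1), v - {j})"
          have sy: "(\<Sum>i=1..m. ((\<lambda>i. 0)(l := 1 :: nat)) i) = 1" using l by simp
          show ?thesis
          proof (rule sp[of ?x ?y])
            show "mcoeff m ?x ?y \<noteq> (0::'k)" by (rule mcoeff_nz) (auto intro: binom)
            show "?x \<in> M" "?y \<in> M" using j bl by (auto intro!: sub)
            show "3 \<le> deg ?x \<or> deg ?x = 2 \<and> fst ?x l = 0" using s1 by (simp add: deg_def del: fun_upd_apply) simp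
            show "3 \<le> deg ?y \<or> deg ?y = 2 \<and> fst ?y l = 0" using c3 sy by (simp add: deg_def del: fun_upd_apply)
            show "pure ?x" using j bk by (auto simp: pure_def simp del: atLeastAtMost_iff) 
            show "pure ?y" using j by (auto simp: pure_def)
            show "madd ?x ?y = z" using j bl by (auto simp: madd_def zz)
          qed
        qed
      qed
    qed
  qed
qed

end

context sho begin

lemma eqvD: "eqv f g \<Longrightarrow> z \<noteq> z0 \<Longrightarrow> f z = g z"
  unfolding eqv_def by blast

lemma d_z0: assumes r: "r \<in> {1..2*m}" and f: "f \<in> Osp" shows "d r f z0 = f (xmono r)"
  using r
proof (cases rule: idx_cases)
  case (1 i)
  then show ?thesis using f by (simp add: d_even xmono_def)
next
  case (2 i)
  then show ?thesis using f by (simp add: d_odd xmono_def)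
qed

lemma d_xv4:
  assumes "i \<in> {1..m}" "j \<in> {1..m}"
  shows "d j (xv i) = (if j = i then one else 0)" "d j (xv (i + m)) = 0"
    "d (j + m) (xv i) = 0" "d (j + m) (xv (i + m)) = (if j = i then one else 0)"
  using assms by (auto simp: d_xv)

lemma xv_mul_xmono:
  assumes l: "l \<in> {1..m}" and g: "g \<in> Osp" shows "(xv l \<odot> g) (xmono l) = g z0"
proof -
  have "(xv l \<odot> g) (xmono l) = d l (xv l \<odot> g) z0" using d_z0[OF idx(1)[OF l], of "xv l \<odot> g"] l g by simp
  also have "\<dots> = (g + xv l \<odot> d l g) z0" using l g idx[OF l] by (simp add: d_mul tw_low d_xv mul_one)
  also have "\<dots> = g z0" using mul_z0[of "xv l" "d l g"] xmono_nonconst[OF idx(1)[OF l]] by (auto simp: xv_eq single_apply)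
  finally show ?thesis .
qed

lemma xpow_M:
  assumes "l \<in> {1..m}" "k \<in> {1..m}" "s < t k" shows "xpow l k s \<in> M"
proof -
  have 1: "p ^ Suc s \<le> p ^ t k" using assms(3) char by (intro power_increasing) auto
  have "1 + p ^ s < p ^ Suc s"
  proof -
    have "p ^ s * 3 < p ^ s * p" using char p_pow_pos[of s] by simp
    then show ?thesis using p_pow_pos[of s] unfolding power_Suc mult.commute[of p] by linarith
  qed
  then have "1 + p ^ s < p ^ t k" using 1 by linarith
  then show ?thesis using assms p_pow_gt[of l] by (auto simp: xpow_def M_iff p_pos)
qed

lemma pure_xpow: "pure (xpow l k s)" by (simp add: pure_def xpow_def)

lemma deg_xpow: assumes "l \<in> {1..m}" "k \<in> {1..m}" shows "deg (xpow l k s) = 1 + p ^ s"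
  using assms by (simp add: deg_def xpow_def sum.distrib)

end

section \<open>From images of the Laplacian to all of \<open>K\<close>\<close>

context sho_tor begin

lemma lambda_Dl_all:
  assumes l: "l \<in> {1..m}" and f: "f \<in> Osp" shows "\<psi> (Dl f) (xmono l) = 0"
proof -
  have DK: "Dl (single z) \<in> K" if "z \<in> M" for z using that by (intro K_I) (simp_all add: Dl_Dl)
  have "Dl f = (\<Sum>z\<in>M. fscale (f z) (Dl (single z)))"
    using arg_cong[OF O_decomp[OF f], of Dl] by (simp add: Dl_linear)
  then have "\<psi> (Dl f) = (\<Sum>z\<in>M. \<psi> (fscale (f z) (Dl (single z))))"
    using pder_sum[OF \<psi>, of M "\<lambda>z. fscale (f z) (Dl (single z))"] DK by (simp add: K_scale)
  also have "\<dots> = (\<Sum>z\<in>M. fscale (f z) (\<psi> (Dl (single z))))"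
    by (intro sum.cong refl pderD(3)[OF \<psi>] DK)
  finally show ?thesis by (simp add: sum_fun_apply lambda_Dl[OF l] sum.neutral)
qed

text \<open>The weight vector, set to zero outside the index range so that equality of functions
  compares exactly the m weights.\<close>

definition wtf :: "mono \<Rightarrow> nat \<Rightarrow> 'k" where
  "wtf z = (\<lambda>j. if j \<in> {1..m} then wt j z else 0)"

definition res :: "(nat \<Rightarrow> 'k) \<Rightarrow> (mono \<Rightarrow> 'k) \<Rightarrow> mono \<Rightarrow> 'k" where
  "res \<omega> a = (\<lambda>z. if wtf z = \<omega> then a z else 0)"

lemma lin_res: "lin (res \<omega>)" by (auto simp: lin_def res_def fun_eq_iff)

lemma Dl_res: assumes a: "a \<in> Osp" shows "Dl (res \<omega> a) = res \<omega> (Dl a)"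
proof (rule lin_ext[OF _ _ _ a, of "\<lambda>a. Dl (res \<omega> a)" "\<lambda>a. res \<omega> (Dl a)"])
  fix z assume z: "z \<in> M"
  have s: "wtf y = wtf z" if "Dl (single z) y \<noteq> (0::'k)" for y
    using Dl_support_wt[OF z that] by (auto simp: wtf_def fun_eq_iff)
  have rs: "res \<omega> (single z) = (if wtf z = \<omega> then single z else 0)"
  proof
    fix y show "res \<omega> (single z) y = (if wtf z = \<omega> then single z else 0) y"
      by (cases "y = z") (auto simp: res_def single_apply)
  qed
  show "Dl (res \<omega> (single z)) = res \<omega> (Dl (single z))"
  proof
    fix y
    show "Dl (res \<omega> (single z)) y = res \<omega> (Dl (single z)) y"
      unfolding rs using s[of y] by (cases "Dl (single z) y = (0::'k)") (auto simp: res_def Dl_linear)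
  qed
qed (intro lin_comp[OF lin_Dl lin_res] lin_comp[OF lin_res lin_Dl])+

lemma K_res: assumes "a \<in> K" shows "res \<omega> a \<in> K"
proof (rule K_I)
  show "res \<omega> a \<in> Osp" unfolding Osp_def using O_out[of a] assms by (simp add: res_def)
  show "Dl (res \<omega> a) = 0" using Dl_res[of a \<omega>] assms by (simp add: K_Dl lin_zero[OF lin_res])
qed

lemma res_sum: assumes a: "a \<in> Osp" shows "a = (\<Sum>\<omega>\<in>wtf ` M. res \<omega> a)"
proof
  fix z
  have "(\<Sum>\<omega>\<in>wtf ` M. res \<omega> a z) = (\<Sum>\<omega>\<in>wtf ` M. if \<omega> = wtf z then a z else 0)"
    by (intro sum.cong refl) (simp add: res_def eq_commute)
  also have "\<dots> = a z" using O_out[OF a, of z] by auto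
  finally show "a z = (\<Sum>\<omega>\<in>wtf ` M. res \<omega> a) z" by (simp add: sum_fun_apply)
qed

text \<open>A homotopy argument: if a in \<open>K\<close> has weight \<omega>, the Laplacian of a
  times the j-th conjugate pair is (1 + \<omega>_j) a. So a is itself a Laplacian unless all weights
  are -1; but then they are all equal, unlike those of \<open>x_l\<close>, and \<open>weight\<close>
  applies.\<close>

lemma lambda_K:
  assumes l: "l \<in> {1..m}" and a: "a \<in> K" shows "\<psi> a (xmono l) = 0"
proof -
  have r: "\<psi> (res \<omega> a) (xmono l) = 0" for \<omega>
  proof (cases "\<exists>j\<in>{1..m}. \<omega> j \<noteq> - 1")
    case True
    then obtain j where j: "j \<in> {1..m}" "1 + \<omega> j \<noteq> 0" by (metis add_eq_0_iff)
    let ?r = "res \<omega> a"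
    have rO: "?r \<in> Osp" using K_res[OF a] by simp
    have T: "T (xxi j j) ?r = fscale (- \<omega> j) ?r"
      unfolding T_xxi_diag[OF j(1) rO] using j by (auto simp: res_def wtf_def fun_eq_iff)
    have sgx: "sg (xxi j j) = - xxi j j" using sg_Gr[OF xxi_Gr[OF j(1,1)]] by (simp add: fscale_minus_left)
    have "Dl (xxi j j \<odot> ?r) = fscale (1 + \<omega> j) ?r"
      using Dl_mul[of "xxi j j" ?r] rO j K_Dl[OF K_res[OF a]] Gr_Osp[OF xxi_Gr[OF j(1,1)]]
      by (simp add: Dl_xxi mul_one mul_add sgx T_linear T fscale_add_left fscale_minus_left)
    then have "Dl (fscale (1 / (1 + \<omega> j)) (xxi j j \<odot> ?r)) = ?r" using j(2) by (simp add: Dl_linear)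
    moreover have "fscale (1 / (1 + \<omega> j)) (xxi j j \<odot> ?r) \<in> Osp" using rO Gr_Osp[OF xxi_Gr[OF j(1,1)]] by simp
    ultimately show ?thesis using lambda_Dl_all[OF l] by metis
  next
    case False
    obtain k where k: "k \<in> {1..m}" "k \<noteq> l" using other_index by metis
    show ?thesis
    proof (rule weight[OF K_res[OF a] l k(1) _ xmono_nonconst[OF idx(1)[OF l]], where \<delta>=0])
      show "wt l z - wt k z = 0" if "res \<omega> a z \<noteq> 0" for z
      proof -
        have "\<omega> = wtf z" using that by (simp add: res_def split: if_splits)
        then have "\<omega> l = wt l z" "\<omega> k = wt k z" using l k by (simp_all add: wtf_def)
        then show ?thesis using False l k by simp
      qed
      show "wt l (xmono l) - wt k (xmono l) \<noteq> 0" using l k by (simp add: wt_xmono)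
    qed
  qed
  have "\<psi> a = \<psi> (\<Sum>\<omega>\<in>wtf ` M. res \<omega> a)" using a by (intro arg_cong[where f=\<psi>] res_sum) simp
  also have "\<dots> = (\<Sum>\<omega>\<in>wtf ` M. \<psi> (res \<omega> a))" using K_res[OF a] by (intro pder_sum[OF \<psi>])
  finally have "\<psi> a (xmono l) = (\<Sum>\<omega>\<in>wtf ` M. \<psi> (res \<omega> a) (xmono l))" by (simp only: sum_fun_apply)
  also have "\<dots> = 0" using r by (intro sum.neutral ballI)
  finally show ?thesis .
qed

text \<open>Let q be the second divided power of \<open>x_l\<close>. Bracketing with q is
  \<open>x_l\<close> times the derivative in the conjugate variable, so the coefficient sought
  becomes the \<open>x_l\<close> coefficient of a bracket, where \<open>lambda_K\<close> applies. It
  remains that \<psi> kills q modulo constants, again by weights.\<close>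

lemma lambda_xi:
  assumes l: "l \<in> {1..m}" and a: "a \<in> K" shows "\<psi> a (xmono (l + m)) = 0"
proof -
  define z :: mono where "z = ((\<lambda>i. 0)(l := 2), {})"
  have zM: "z \<in> M" using p_pow_gt[OF l] l by (auto simp: z_def M_iff p_pos p_pow_pos)
  define q where "q = (single z :: mono \<Rightarrow> 'k)"
  have qK: "q \<in> K" unfolding q_def by (rule K_pure[OF zM]) (simp add: pure_def z_def)
  have qG: "q \<in> Gr 0" unfolding q_def by (rule Gr_single[OF zM]) (simp add: z_def)
  have dq: "d i q = (if i = l then xv l else 0)" "d (i + m) q = 0" if i: "i \<in> {1..m}" for i
    unfolding q_def d_low_single[OF zM i] d_high_single[OF zM i] using i l by (auto simp: z_def xv_eq xmono_def)
  have Tq: "T q h = xv l \<odot> d (l + m) h" if "h \<in> Osp" for h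
  proof -
    have "T q h = (\<Sum>i=1..m. if i = l then xv l \<odot> d (l + m) h else 0)"
      unfolding T_def using sg_Gr[OF qG] by (intro sum.cong refl) (simp add: dq mul_add del: atLeastAtMost_iff)
    then show ?thesis using l by simp
  qed
  have "eqv (\<psi> q) 0"
  proof (rule d_zero_eqv)
    show "\<psi> q \<in> Osp" using qK by simp
    fix r assume r: "r \<in> {1..2*m}"
    have "eqv (\<psi> (d r q)) 0"
      using r
    proof (cases rule: idx_cases)
      case (1 i)
      then show ?thesis using kill[OF idx(1)[OF l]] by (simp add: dq pder_zero[OF \<psi>] del: atLeastAtMost_iff)
    next
      case (2 i)
      then show ?thesis by (simp add: dq pder_zero[OF \<psi>] del: atLeastAtMost_iff)
    qed
    then have "eqv (fscale (psign (e * mu m r)) (d r (\<psi> q))) 0"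
      using psi_d[OF r qK] eqv_sym eqv_trans by blast
    from eqv_scale[OF this, of "psign (e * mu m r)"] have "eqv (d r (\<psi> q)) 0" by simp
    then have e: "d r (\<psi> q) = fscale (d r (\<psi> q) z0) one" by (rule eqv_const)
    have "\<psi> q (xmono r) = 0"
      using r
    proof (cases rule: idx_cases)
      case (1 i)
      then show ?thesis using lambda_K qK by simp
    next
      case (2 i)
      obtain k where k: "k \<in> {1..m}" "k \<noteq> l" "k \<noteq> i" by (rule other_index)
      show ?thesis unfolding 2
      proof (rule weight[OF qK l k(1) _ xmono_nonconst[OF idx(2)[OF 2(1)]], where \<delta>=2])
        show "wt l y - wt k y = 2" if "q y \<noteq> 0" for y
          using that l k by (auto simp: q_def single_apply z_def wt_def split: if_splits)
        \<comment> \<open>This is where 3 has to be nonzero in the field.\<close>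
        have "(- 1 :: 'k) \<noteq> 2" using three_nz by (metis add.commute add_eq_0_iff numeral_plus_one semiring_norm(5))
        then show "wt l (xmono (i + m)) - wt k (xmono (i + m)) \<noteq> 2"
          using 2 k l two_nz by (auto simp: wt_xmono simp del: atLeastAtMost_iff)
      qed
    qed
    then have "d r (\<psi> q) z0 = 0" using d_z0[OF r, of "\<psi> q"] qK by simp
    then show "d r (\<psi> q) = 0" using e by simp
  qed
  then have 0: "T (\<psi> q) a = 0" using T_eqv_left[of "\<psi> q" 0 a] by (simp add: T_linear)
  have "eqv (\<psi> (T q a)) (fscale (psign e) (T q (\<psi> a)))"
    using pderD(6)[OF \<psi> qK qG a] by (simp add: 0)
  then have "\<psi> (T q a) (xmono l) = (fscale (psign e) (T q (\<psi> a))) (xmono l)"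
    by (rule eqvD[OF _ xmono_nonconst[OF idx(1)[OF l]]])
  then have "T q (\<psi> a) (xmono l) = 0" using lambda_K[OF l K_T[OF qK a]] by simp
  then have "d (l + m) (\<psi> a) z0 = 0" using a l by (simp add: Tq xv_mul_xmono)
  then show ?thesis using d_z0[OF idx(2)[OF l], of "\<psi> a"] a by simp
qed

text \<open>A coefficient of higher degree is one of a derivative of \<psi> a, which is \<psi> of a
  derivative and has lower degree. Since \<psi> supercommutes with derivatives only modulo
  constants, this says nothing about linear coefficients, which come from \<open>lambda_K\<close>
  and \<open>lambda_xi\<close>.\<close>

lemma psi_zero:
  assumes a: "a \<in> K" shows "eqv (\<psi> a) 0"
proof -
  have "\<psi> a z = 0" if "z \<noteq> z0" "a \<in> K" for z a
    using that
  proof (induction "deg z" arbitrary: z a rule: less_induct)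
    case less
    have lin0: "\<psi> a (xmono r) = 0" if "r \<in> {1..2*m}" for r
      using that lambda_K[OF _ less.prems(2)] lambda_xi[OF _ less.prems(2)] by (elim idx_cases) auto
    have step: "d r (\<psi> a) y = 0" if r: "r \<in> {1..2*m}" and y: "deg y < deg z" for r y
    proof (cases "y = z0")
      case True
      then show ?thesis using d_z0[OF r, of "\<psi> a"] lin0[OF r] less.prems(2) by simp
    next
      case False
      have "\<psi> (d r a) y = 0" using less.hyps[OF y False] K_d less.prems(2) by blast
      moreover have "\<psi> (d r a) y = fscale (psign (e * mu m r)) (d r (\<psi> a)) y"
        using psi_d[OF r less.prems(2)] False unfolding eqv_def by blast
      ultimately show ?thesis by simp
    qed
    have aO: "\<psi> a \<in> Osp" using less.prems(2) by simp
    show ?case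
    proof (cases "z \<in> M")
      case True
      obtain \<alpha> u where zz: "z = (\<alpha>, u)" by (cases z)
      have fin: "finite u" using True finite_odd by (simp add: zz)
      have zM: "(\<alpha>, u) \<in> M" "(\<alpha>, u) \<noteq> z0" using True less.prems(1) by (simp_all add: zz)
      then show ?thesis
      proof (rule nonconst_cases)
        fix i \<beta> assume i: "i \<in> {1..m}" "\<alpha> = \<beta>(i := Suc (\<beta> i))"
        have "deg z = Suc (deg (\<beta>, u))" using deg_up[OF i(1), of \<beta> u] by (simp add: zz i(2))
        then have "d i (\<psi> a) (\<beta>, u) = 0" using step[OF idx(1)[OF i(1)]] by simp
        then show "\<psi> a z = 0" using d_even[OF i(1) aO] by (simp add: zz i(2))
      next
        fix r assume r: "r \<in> {m+1..2*m}" "r \<in> u"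
        have "deg z = Suc (deg (\<alpha>, u - {r}))" using deg_insert[of "u - {r}" r \<alpha>] fin r by (simp add: zz insert_absorb)
        then have "d r (\<psi> a) (\<alpha>, u - {r}) = 0" using step[of r] r by simp
        then show "\<psi> a z = 0" using d_odd[OF r(1) aO, of \<alpha> "u - {r}"] r(2) by (simp add: zz insert_absorb)
      qed
    next
      case False
      then show ?thesis by (rule O_out[OF aO])
    qed
  qed
  then show ?thesis using a by (simp add: eqv_def)
qed

end

section \<open>Exceptional monomials and values on the toral elements\<close>

context sho_kill begin

text \<open>Bracketing with \<open>xxi l l0\<close> replaces the variable l0 by l, up to sign, so
  one test index l0 different from k controls every l, including l = k.\<close>

lemma exc_transfer:
  assumes l: "l \<in> {1..m}" and l0: "l0 \<in> {1..m}" and k: "k \<in> {1..m}" "l0 \<noteq> k" and s: "1 \<le> s" "s < t k"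
    and z: "\<psi> (single (xpow l0 k s)) (xmono l0) = 0"
  shows "\<psi> (single (xpow l k s)) (xmono l) = 0"
proof (cases "l = l0")
  case False
  let ?q = "xxi l l0" and ?f = "single (xpow l0 k s) :: mono \<Rightarrow> 'k"
  note qK = K_xxi[OF l l0 False] and qG = xxi_Gr[OF l l0]
  have fM: "xpow l0 k s \<in> M" using xpow_M l0 k s by blast
  have fK: "?f \<in> K" using K_pure[OF fM pure_xpow] .
  have lM: "xpow l k s \<in> M" using xpow_M l k s by blast
  have lK: "single (xpow l k s) \<in> K" using K_pure[OF lM pure_xpow] .
  have ps: "p ^ s \<ge> 3" using s(1) char self_le_power[of p s] by simp
  let ?y = "((\<lambda>i. if i = k then p ^ s else 0), {}) :: mono"
  have yM: "?y \<in> M" using fM by (auto simp: M_iff xpow_def p_pos split: if_splits)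
  have d1: "d (l + m) ?f = 0" using d_high_single[OF fM l] by (simp add: xpow_def)
  have d2: "d l0 ?f = single ?y"
  proof -
    have "(\<lambda>i. of_bool (i = l0) + (if i = k then p ^ s else 0))(l0 := 0) = (\<lambda>i. if i = k then p ^ s else 0)"
      using k(2) by auto
    then show ?thesis using d_low_single[OF fM l0] k(2) by (simp add: xpow_def)
  qed
  have m1: "xv l \<odot> single ?y = single (xpow l k s)"
  proof -
    have "bprod m ((\<lambda>i. 0)(l := 1)) (\<lambda>i. if i = k then p ^ s else 0) = (\<Prod>i=1..m. 1 :: 'k)"
      unfolding bprod_def
    proof (rule prod.cong[OF refl])
      fix i
      \<comment> \<open>Needed for l = k, where the binomial coefficient is p^s + 1, that is, one in
        the field.\<close>
      have "p dvd p ^ s" using s(1) by (simp add: dvd_power)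
      then have "of_nat (p ^ s) = (0::'k)" by (rule of_nat_p_dvd)
      then show "of_nat (((\<lambda>i. 0)(l := 1)) i + (if i = k then p ^ s else 0) choose ((\<lambda>i. 0)(l := 1)) i) = (1::'k)"
        by auto
    qed
    then have b: "mcoeff m (xmono l) ?y = (1::'k)" using l by (simp add: mcoeff_eq xmono_def)
    have "madd (xmono l) ?y = xpow l k s" using l by (auto simp: madd_def xmono_def xpow_def)
    then show ?thesis using mul_single[OF xmono_M[OF idx(1)[OF l]] yM] by (simp add: xv_eq b)
  qed
  have Tf: "T ?q ?f = - single (xpow l k s)" using T_xxi[OF l l0, of ?f] fK by (simp add: d1 d2 m1 mul_add)
  have gf: "good l ?f" by (rule good_single[OF fM l]) (use ps in \<open>simp add: deg_xpow[OF l0 k(1)]\<close>)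
  have "eqv (\<psi> (T ?q ?f)) (T (\<psi> ?q) ?f + T ?q (\<psi> ?f))"
    using pderD(6)[OF \<psi> qK qG fK] by simp
  from eqvD[OF this xmono_nonconst[OF idx(1)[OF l]]]
  have "\<psi> (T ?q ?f) (xmono l) = T (\<psi> ?q) ?f (xmono l) + T ?q (\<psi> ?f) (xmono l)" by (simp only: plus_fun_apply)
  moreover have "T (\<psi> ?q) ?f (xmono l) = 0" using T_good[OF l, of "\<psi> ?q" ?f] gf qK fK by simp
  moreover have "T ?q (\<psi> ?f) (xmono l) = 0"
  proof -
    have "(xv (l0 + m) \<odot> d (l + m) (\<psi> ?f)) (xmono l) = 0"
      using l l0 xmono_nonconst[OF idx(2)[OF l0]] xmono_eq_iff[OF idx(1)[OF l] idx(2)[OF l0]]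
      by (intro mul_xmono[OF l]) (auto simp: xv_eq single_apply)
    moreover have "(xv l \<odot> d l0 (\<psi> ?f)) (xmono l) = 0"
      using xv_mul_xmono[OF l, of "d l0 (\<psi> ?f)"] d_z0[OF idx(1)[OF l0], of "\<psi> ?f"] z fK by simp
    ultimately show ?thesis using T_xxi[OF l l0, of "\<psi> ?f"] fK by simp
  qed
  ultimately have "\<psi> (- single (xpow l k s)) (xmono l) = 0" unfolding Tf by simp
  then show ?thesis by (simp add: pder_minus[OF \<psi> lK])
qed (use z in simp)

lemma psi_tor_d:
  assumes j: "j \<in> {1..m}" and k: "k \<in> {1..m}" and r: "r \<in> {1..2*m}"
  shows "d r (\<psi> (tor j k)) = fscale (\<psi> (tor j k) (xmono r)) one"
proof -
  note tK = K_tor[OF j k]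
  have "eqv (\<psi> (d r (tor j k))) 0"
  proof (rule psi_low)
    show "d r (tor j k) \<in> Osp" using tK by simp
    have x: "deg (xximono i i) = 2" if "i \<in> {1..m}" for i using that by (simp add: xximono_def deg_def)
    fix z assume "d r (tor j k) z \<noteq> 0"
    then have "d r (xxi j j) z \<noteq> 0 \<or> d r (xxi k k) z \<noteq> 0" by (auto simp: tor_def d_linear)
    then show "deg z \<le> 1"
      using d_single_support(1)[OF xximono_M[OF j j] r, of z] d_single_support(1)[OF xximono_M[OF k k] r, of z] x[OF j] x[OF k]
      by (auto simp: xxi_def)
  qed
  then have "eqv (fscale (psign (e * mu m r)) (d r (\<psi> (tor j k)))) 0"
    using psi_d[OF r tK] eqv_sym eqv_trans by blast
  from eqv_scale[OF this, of "psign (e * mu m r)"] have "eqv (d r (\<psi> (tor j k))) 0" by simp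
  from eqv_const[OF this] show ?thesis using d_z0[OF r, of "\<psi> (tor j k)"] tK by simp
qed

lemma xxi_support: "xxi j j z \<noteq> 0 \<Longrightarrow> wt i z = 0"
  by (auto simp: xxi_def single_apply xximono_def wt_def split: if_splits)

text \<open>Toral elements commute with each other. Applying \<psi> to their zero bracket gives a
  relation between linear coefficients, by which the value on any \<open>tor j k\<close> is
  determined by one number per variable.\<close>

lemma psi_tor_coeff:
  assumes j: "j \<in> {1..m}" and k: "k \<in> {1..m}" and i: "i \<in> {1..m}" and s: "s \<in> {1..m}" "s \<noteq> i" and h: "h = i \<or> h = i + m"
  shows "\<psi> (tor j k) (xmono h) = (of_bool (j = i) - of_bool (k = i)) * \<psi> (tor i s) (xmono h)"
proof -
  let ?L = "\<psi> (tor j k)" and ?R = "\<psi> (tor i s)"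
  note jk = K_tor[OF j k] and iss = K_tor[OF i s(1)]
  have LO: "?L \<in> Osp" using jk by simp
  have "T (tor j k) (tor i s) = 0"
  proof
    fix z show "T (tor j k) (tor i s) z = 0 z"
    proof (cases "tor i s z = 0")
      case False
      then have "xxi i i z \<noteq> 0 \<or> xxi s s z \<noteq> 0" by (auto simp: tor_def)
      then have "wt k z = 0" "wt j z = 0" using xxi_support[of i z] xxi_support[of s z] by blast+
      then show ?thesis using T_tor_diag[OF j k, of "tor i s" z] iss by simp
    qed (use T_tor_diag[OF j k, of "tor i s" z] iss in simp)
  qed
  then have e: "eqv 0 (T ?L (tor i s) + T (tor j k) ?R)"
    using pderD(6)[OF \<psi> jk Gr_tor[OF j k] iss] by (simp add: pder_zero[OF \<psi>])
  have dh: "d (r + m) (sg ?L) = fscale (- ?L (xmono (r + m))) one" if r: "r \<in> {1..m}" for r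
    using sg_d[OF LO, of "r + m"] mu_high[OF r] psi_tor_d[OF j k idx(2)[OF r]] sg_Gr[OF one_Gr]
    by (simp add: fscale_minus_left sg_linear)
  have Txx: "T ?L (xxi r r) = fscale (?L (xmono r)) (xv r) - fscale (?L (xmono (r + m))) (xv (r + m))" if r: "r \<in> {1..m}" for r
    unfolding T_xxi_right[OF r] psi_tor_d[OF j k idx(1)[OF r]] dh[OF r] using r idx
    by (simp add: mul_add mul_fscale mul_one fscale_minus_left)
  have TL: "T ?L (tor i s) = fscale (?L (xmono i)) (xv i) - fscale (?L (xmono (i + m))) (xv (i + m)) -
     (fscale (?L (xmono s)) (xv s) - fscale (?L (xmono (s + m))) (xv (s + m)))"
    unfolding tor_def[of i s] T_linear Txx[OF i] Txx[OF s(1)] ..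
  have hr: "h \<in> {1..2*m}" using h i idx by auto
  from eqvD[OF e xmono_nonconst[OF hr]]
  have "0 = T ?L (tor i s) (xmono h) + T (tor j k) ?R (xmono h)" by (simp only: plus_fun_apply zero_fun_apply)
  then have "0 = T ?L (tor i s) (xmono h) + (wt k (xmono h) - wt j (xmono h)) * ?R (xmono h)"
    using T_tor_diag[OF j k, of ?R] iss by simp
  then show ?thesis
    using h
  proof (elim disjE)
    assume h: "h = i" and z: "0 = T ?L (tor i s) (xmono h) + (wt k (xmono h) - wt j (xmono h)) * ?R (xmono h)"
    have "T ?L (tor i s) (xmono h) = ?L (xmono h)" unfolding TL h using i s idx by (simp add: xv_xmono)
    then show ?thesis using z i j k by (simp add: h wt_xmono algebra_simps)
  next
    assume h: "h = i + m" and z: "0 = T ?L (tor i s) (xmono h) + (wt k (xmono h) - wt j (xmono h)) * ?R (xmono h)"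
    have "T ?L (tor i s) (xmono h) = - ?L (xmono h)" unfolding TL h using i s idx by (simp add: xv_xmono)
    then show ?thesis using z i j k by (simp add: h wt_xmono algebra_simps)
  qed
qed

text \<open>On toral elements \<psi> has linear values up to constants, with coefficients
  proportional to weights, exactly as for bracketing with a linear y. Such a bracket sends the
  variables to constants, so subtracting it does not disturb what was achieved on them.\<close>

lemma tor_inner:
  "\<exists>y\<in>K. y \<in> Gr (e + 1) \<and> (\<forall>r\<in>{1..2*m}. eqv (T y (xv r)) 0) \<and>
     (\<forall>j\<in>{1..m}. \<forall>k\<in>{1..m}. eqv (\<psi> (tor j k)) (T y (tor j k)))"
proof -
  define nx where "nx i = (SOME k. k \<in> {1..m} \<and> k \<noteq> i)" for i
  have nx: "nx i \<in> {1..m} \<and> nx i \<noteq> i" for i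
    unfolding nx_def using other_index[of i i] by (intro someI_ex[of "\<lambda>k. k \<in> {1..m} \<and> k \<noteq> i"]) metis
  define b where "b r = \<psi> (tor (if r \<le> m then r else r - m) (nx (if r \<le> m then r else r - m))) (xmono r)" for r
  have bl: "b i = \<psi> (tor i (nx i)) (xmono i)" "b (i + m) = \<psi> (tor i (nx i)) (xmono (i + m))" if "i \<in> {1..m}" for i
    using that by (auto simp: b_def)
  define y where "y = (\<Sum>i=1..m. fscale (b i) (xv i) - fscale (b (i + m)) (xv (i + m)))"
  have yK: "y \<in> K" unfolding y_def by (intro K_sum K_diff K_scale K_xv idx)
  have bG: "fscale (b r) (xv r) \<in> Gr (e + 1)" if r: "r \<in> {1..2*m}" for r
  proof (cases "b r = 0")
    case False
    obtain i where i: "i \<in> {1..m}" "r = i \<or> r = i + m" using r by (elim idx_cases) auto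
    have "\<psi> (tor i (nx i)) \<in> Gr (1 + e)" using pderD(5)[OF \<psi> K_tor Gr_tor] i(1) nx by blast
    moreover have "\<psi> (tor i (nx i)) (xmono r) \<noteq> 0" using False i bl[OF i(1)] by auto
    ultimately have "of_nat (card (snd (xmono r))) = 1 + e" by (rule Gr_D)
    moreover have "of_nat (card (snd (xmono r))) = mu m r" by (auto simp: xmono_def mu_def)
    ultimately show ?thesis using Gr_scale[OF Gr_xv[OF r], of "b r"] by (simp add: add.commute)
  qed (simp add: Gr_zero)
  have yG: "y \<in> Gr (e + 1)" unfolding y_def by (intro Gr_sum Gr_diff bG idx)
  have dl: "d j y = fscale (b j) one" if j: "j \<in> {1..m}" for j
  proof -
    have "d j y = (\<Sum>i=1..m. if i = j then fscale (b j) one else 0)"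
      unfolding y_def d_linear using j idx by (intro sum.cong refl) (auto simp: d_xv4 simp del: atLeastAtMost_iff)
    then show ?thesis using j by simp
  qed
  have dh: "d (j + m) y = - fscale (b (j + m)) one" if j: "j \<in> {1..m}" for j
  proof -
    have "d (j + m) y = (\<Sum>i=1..m. if i = j then - fscale (b (j + m)) one else 0)"
      unfolding y_def d_linear using j idx by (intro sum.cong refl) (auto simp: d_xv4 simp del: atLeastAtMost_iff)
    then show ?thesis using j by simp
  qed
  have dhs: "d (j + m) (sg y) = fscale (b (j + m)) one" if j: "j \<in> {1..m}" for j
    using sg_d[of y "j + m"] yK mu_high[OF j] sg_Gr[OF one_Gr] dh[OF j]
    by (simp add: fscale_minus_left sg_linear)
  have "eqv (T y (xv r)) 0" if "r \<in> {1..2*m}" for r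
    using that
  proof (cases rule: idx_cases)
    case (1 i)
    then show ?thesis using yK dhs by (simp add: T_xv_low eqv_one)
  next
    case (2 i)
    then show ?thesis using yK dl by (simp add: T_xv_high eqv_one)
  qed
  moreover have "eqv (\<psi> (tor j k)) (T y (tor j k))" if j: "j \<in> {1..m}" and k: "k \<in> {1..m}" for j k
  proof -
    have Ty: "T y (tor j k) = fscale (b j) (xv j) + fscale (b (j + m)) (xv (j + m)) - (fscale (b k) (xv k) + fscale (b (k + m)) (xv (k + m)))"
      using j k idx by (simp add: tor_def T_linear T_xxi_right dl dhs mul_fscale mul_one del: atLeastAtMost_iff)
    have tO: "\<psi> (tor j k) \<in> Osp" using K_tor[OF j k] by simp
    have "eqv (\<psi> (tor j k) - T y (tor j k)) 0"
    proof (rule d_zero_eqv)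
      show "\<psi> (tor j k) - T y (tor j k) \<in> Osp" using tO yK K_tor[OF j k] by simp
      fix r assume r: "r \<in> {1..2*m}"
      obtain i where i: "i \<in> {1..m}" "r = i \<or> r = i + m" using r by (elim idx_cases) auto
      have c: "\<psi> (tor j k) (xmono r) = (of_bool (j = i) - of_bool (k = i)) * b r"
        using psi_tor_coeff[OF j k i(1), of "nx i" r] nx i bl[OF i(1)] by auto
      have "d r (T y (tor j k)) = fscale ((of_bool (j = i) - of_bool (k = i)) * b r) one"
        unfolding Ty using i j k idx by (auto simp: d_linear d_xv4 fscale_minus_left simp del: atLeastAtMost_iff)
      then show "d r (\<psi> (tor j k) - T y (tor j k)) = 0"
        using psi_tor_d[OF j k r] by (simp add: d_linear c)
    qed
    then show ?thesis by (simp add: eqv_def)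
  qed
  ultimately show ?thesis using yK yG by blast
qed

end

section \<open>The outer superderivations and the basis of \<open>G\<close>\<close>

context sho begin

definition PP :: "(nat \<times> nat) set" where "PP = (SIGMA k:{1..m}. {1..<t k})"

lemma PP_iff: "(k, s) \<in> PP \<longleftrightarrow> k \<in> {1..m} \<and> 1 \<le> s \<and> s < t k"
  by (auto simp: PP_def)

lemma finite_PP [simp]: "finite PP" by (simp add: PP_def)

text \<open>Any enumeration of the \<open>\<partial>\<^sub>k^(p^s)\<close> by \<open>1, \<dots>, \<iota>\<close> will do, since all \<open>h\<^sub>i\<close> with \<open>i \<ge> 1\<close> are central.\<close>

definition en :: "int \<Rightarrow> nat \<times> nat" where
  "en = (SOME f. bij_betw f {1..iota m t} PP)"

lemma en_bij: "bij_betw en {1..iota m t} PP"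
proof -
  have "(\<Sum>k=1..m. t k - 1) + m = (\<Sum>k=1..m. t k)"
  proof -
    have "(\<Sum>k=1..m. t k - 1) + (\<Sum>k=1..m. 1) = (\<Sum>k=1..m. t k)"
      unfolding sum.distrib[symmetric] using tpos by (intro sum.cong) (auto simp: Suc_leI)
    then show ?thesis by simp
  qed
  moreover have "card PP = (\<Sum>k=1..m. t k - 1)" unfolding PP_def by (subst card_SigmaI) auto
  ultimately have "int (card PP) = iota m t" by (simp add: iota_def flip: of_nat_sum)
  then have "card {1..iota m t} = card PP" by simp
  then have "\<exists>f. bij_betw f {1..iota m t} PP" by (intro finite_same_card_bij) simp_all
  then show ?thesis unfolding en_def by (rule someI_ex)
qed

definition dop :: "nat \<times> nat \<Rightarrow> (mono \<Rightarrow> 'k) \<Rightarrow> mono \<Rightarrow> 'k" where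
  "dop q = d (fst q) ^^ (p ^ snd q)"

text \<open>The operators on potentials that represent the basis of \<open>G\<close>. Bracketing with \<open>x\<^sub>1 x\<^sub>1\<^sub>'\<close> is not inner,
  as its Laplacian is the constant 1.\<close>

definition Fop :: "gbasis \<Rightarrow> (mono \<Rightarrow> 'k) \<Rightarrow> mono \<Rightarrow> 'k" where
  "Fop x = (case x of hvec i \<Rightarrow> if i = - 1 then T (xxi 1 1) else if i = 0 then E2 else dop (en i) | gvec j \<Rightarrow> Gop j)"

definition gpar :: "gbasis \<Rightarrow> bit" where
  "gpar x = (case x of hvec i \<Rightarrow> 0 | gvec j \<Rightarrow> 1)"

abbreviation "GB \<equiv> G_basis m t"
abbreviation GA :: "('k, gbasis \<Rightarrow> 'k) lie_super" where "GA \<equiv> G_alg m t"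

lemma finite_GB [simp]: "finite GB" by (simp add: G_basis_def)

lemma one_m: "1 \<in> {1..m}" using m3 by simp

lemma en_PP: "1 \<le> i \<Longrightarrow> i \<le> iota m t \<Longrightarrow> en i \<in> PP"
  using bij_betwE[OF en_bij] by simp

lemma nice_dop: "q \<in> PP \<Longrightarrow> nice 0 (dop q)"
  by (cases q) (simp add: PP_iff dop_def nice_dpow)

lemma nice_Fop: "x \<in> GB \<Longrightarrow> nice (gpar x) (Fop x)"
  using nice_T_xxi[OF one_m] nice_E2 nice_dop[OF en_PP] nice_Gop
  by (auto simp: G_basis_def Fop_def gpar_def)

definition FF :: "(gbasis \<Rightarrow> 'k) \<Rightarrow> (mono \<Rightarrow> 'k) \<Rightarrow> mono \<Rightarrow> 'k" where
  "FF v f = (\<Sum>x\<in>GB. fscale (v x) (Fop x f))"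

lemma FF_linear: "FF (v + w) f = FF v f + FF w f" "FF (fscale c v) f = fscale c (FF v f)" "FF 0 f = 0"
  by (simp_all add: FF_def fscale_add_left sum.distrib fscale_sum)

lemma FF_sum: "FF (\<Sum>i\<in>I. v i) f = (\<Sum>i\<in>I. FF (v i) f)"
  by (induction I rule: infinite_finite_induct) (simp_all only: sum.infinite sum.empty sum.insert FF_linear not_False_eq_True)

lemma FF_single: "x \<in> GB \<Longrightarrow> FF (single x) f = Fop x f"
proof -
  assume x: "x \<in> GB"
  have "FF (single x) f = (\<Sum>y\<in>GB. if y = x then Fop x f else 0)"
    unfolding FF_def by (intro sum.cong refl) (simp add: single_apply)
  then show ?thesis using x by simp
qed

lemma GA_grade: "v \<in> grade GA b \<longleftrightarrow> (\<forall>x. v x \<noteq> 0 \<longrightarrow> x \<in> GB \<and> gpar x = b)"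
proof -
  have "(if b = 0 then hvec ` {-1..iota m t} else gvec ` {1..m}) = {x \<in> GB. gpar x = b}"
    by (cases b) (auto simp: G_basis_def gpar_def)
  then show ?thesis by (auto simp: G_alg_def simp del: split_paired_All)
qed

lemma GA_carr: "v \<in> carr GA \<longleftrightarrow> (\<forall>x. v x \<noteq> 0 \<longrightarrow> x \<in> GB)"
  by (auto simp: G_alg_def)

lemma nice_FF: "v \<in> grade GA b \<Longrightarrow> nice b (FF v)"
  unfolding FF_def[abs_def]
proof (intro nice_sum nice_scale)
  fix x assume v: "v \<in> grade GA b" and x: "x \<in> GB"
  show "v x = 0 \<or> nice b (Fop x)" using v nice_Fop[OF x] unfolding GA_grade by auto
qed

lemma sum_GB: "(\<Sum>x\<in>GB. f x) = f (hvec (- 1)) + f (hvec 0) + (\<Sum>i=1..iota m t. f (hvec i)) + (\<Sum>j=1..m. f (gvec j))"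
  for f :: "gbasis \<Rightarrow> 'z::comm_monoid_add"
proof -
  have iota: "iota m t \<ge> 0"
  proof -
    have "(\<Sum>i=1..m. 1) \<le> (\<Sum>i=1..m. t i)" using tpos by (intro sum_mono) (simp add: Suc_leI)
    then show ?thesis by (simp add: iota_def flip: of_nat_sum)
  qed
  have "(\<Sum>x\<in>GB. f x) = (\<Sum>i\<in>{-1..iota m t}. f (hvec i)) + (\<Sum>j\<in>{1..m}. f (gvec j))"
    unfolding G_basis_def by (subst sum.union_disjoint) (auto simp: sum.reindex inj_on_def)
  moreover have "{-1..iota m t} = insert (-1) (insert 0 {1..iota m t})" using iota by auto
  ultimately show ?thesis by (simp add: add.assoc)
qed

lemma sum_en: "(\<Sum>i=1..iota m t. f (en i)) = (\<Sum>q\<in>PP. f q)"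
  by (rule sum.reindex_bij_betw[OF en_bij])

text \<open>Coordinates on \<open>G\<close> with the even coefficients indexed by pairs in
  \<open>PP\<close>, which keeps the enumeration \<open>en\<close> out of the arguments
  below.\<close>

definition vec :: "'k \<Rightarrow> 'k \<Rightarrow> (nat \<times> nat \<Rightarrow> 'k) \<Rightarrow> (nat \<Rightarrow> 'k) \<Rightarrow> gbasis \<Rightarrow> 'k" where
  "vec c \<kappa> C \<gamma> x = (case x of hvec i \<Rightarrow> if i = - 1 then c else if i = 0 then \<kappa> else if i \<in> {1..iota m t} then C (en i) else 0
     | gvec j \<Rightarrow> if j \<in> {1..m} then \<gamma> j else 0)"

lemma FF_vec: "FF (vec c \<kappa> C \<gamma>) f = fscale c (T (xxi 1 1) f) + fscale \<kappa> (E2 f) + (\<Sum>q\<in>PP. fscale (C q) (dop q f))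
    + (\<Sum>j=1..m. fscale (\<gamma> j) (Gop j f))"
proof -
  have "(\<Sum>i=1..iota m t. fscale (vec c \<kappa> C \<gamma> (hvec i)) (Fop (hvec i) f)) = (\<Sum>i=1..iota m t. fscale (C (en i)) (dop (en i) f))"
    by (intro sum.cong refl) (simp add: vec_def Fop_def)
  moreover have "(\<Sum>j=1..m. fscale (vec c \<kappa> C \<gamma> (gvec j)) (Fop (gvec j) f)) = (\<Sum>j=1..m. fscale (\<gamma> j) (Gop j f))"
    by (intro sum.cong refl) (simp add: vec_def Fop_def)
  ultimately show ?thesis unfolding FF_def sum_GB sum_en[symmetric] by (simp add: vec_def Fop_def)
qed

lemma vec_surj: assumes "v \<in> carr GA" 
  shows "v = vec (v (hvec (- 1))) (v (hvec 0)) (\<lambda>q. v (hvec (inv_into {1..iota m t} en q))) (\<lambda>j. v (gvec j))"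
proof
  fix x
  have inj: "inv_into {1..iota m t} en (en i) = i" if "i \<in> {1..iota m t}" for i
    using inv_into_f_f[OF bij_betw_imp_inj_on[OF en_bij] that] .
  show "v x = vec (v (hvec (- 1))) (v (hvec 0)) (\<lambda>q. v (hvec (inv_into {1..iota m t} en q))) (\<lambda>j. v (gvec j)) x"
  proof (cases "x \<in> GB")
    case True
    then show ?thesis using inj by (cases x) (auto simp: vec_def G_basis_def)
  next
    case False
    then have "v x = 0" using assms unfolding GA_carr by blast
    then show ?thesis using False by (cases x) (auto simp: vec_def G_basis_def)
  qed
qed

lemma vec_grade: 
  assumes "e = 1 \<longrightarrow> c = 0 \<and> \<kappa> = 0 \<and> (\<forall>q. C q = 0)" "e = 0 \<longrightarrow> (\<forall>j\<in>{1..m}. \<gamma> j = 0)"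
  shows "vec c \<kappa> C \<gamma> \<in> grade GA e"
  unfolding GA_grade
proof (intro allI impI)
  fix x assume x: "vec c \<kappa> C \<gamma> x \<noteq> 0"
  have "iota m t \<ge> 0"
  proof -
    have "(\<Sum>i=1..m. 1) \<le> (\<Sum>i=1..m. t i)" using tpos by (intro sum_mono) (simp add: Suc_leI)
    then show ?thesis by (simp add: iota_def flip: of_nat_sum)
  qed
  then show "x \<in> GB \<and> gpar x = e"
  proof (cases x)
    case (hvec i)
    have "e = 0"
    proof (rule ccontr)
      assume "e \<noteq> 0"
      then have "c = 0" "\<kappa> = 0" "C (en i) = 0" using assms(1) by (metis bit_not_zero_iff)+
      then show False using x by (simp add: vec_def hvec split: if_splits)
    qed
    then show ?thesis using x \<open>iota m t \<ge> 0\<close> by (auto simp: hvec vec_def gpar_def G_basis_def split: if_splits)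
  next
    case (gvec j)
    have j: "j \<in> {1..m}" "\<gamma> j \<noteq> 0" using x by (simp_all add: gvec vec_def split: if_splits)
    then have "e = 1" using assms(2) by (metis bit_not_zero_iff)
    then show ?thesis using j by (auto simp: gvec gpar_def G_basis_def)
  qed
qed

text \<open>The exceptional monomials with l different from k are dual to the powers of derivatives.
  This fixes the coefficients in \<open>classification\<close> and recovers them in
  \<open>independence\<close>.\<close>

lemma dop_xpow:
  assumes q: "q \<in> PP" and kq: "(k, s) \<in> PP" and l: "l \<in> {1..m}" "l \<noteq> k"
  shows "dop q (single (xpow l k s)) (xmono l) = of_bool (q = (k, s))"
proof -
  obtain k' s' where q': "q = (k', s')" by (cases q)
  have ks: "k' \<in> {1..m}" "k \<in> {1..m}" "s < t k" using q kq by (auto simp: q' PP_iff)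
  let ?\<alpha> = "\<lambda>i. of_bool (i = l) :: nat"
  have xl: "xmono l = (?\<alpha>, {})" using l by (auto simp: xmono_def)
  have "?\<alpha>(k' := ?\<alpha> k' + p ^ s') = (\<lambda>i. of_bool (i = l) + (if i = k then p ^ s else 0)) \<longleftrightarrow> k' = k \<and> s' = s"
  proof
    assume h: "?\<alpha>(k' := ?\<alpha> k' + p ^ s') = (\<lambda>i. of_bool (i = l) + (if i = k then p ^ s else 0))"
    have k: "k' = k"
    proof (rule ccontr)
      assume "k' \<noteq> k"
      then show False using fun_cong[OF h, of k] l p_pow_pos[of s] by simp
    qed
    then have "p ^ s' = p ^ s" using fun_cong[OF h, of k] by simp
    then have "s' = s" using char by (simp add: power_inject_exp)
    then show "k' = k \<and> s' = s" using k by simp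
  qed auto
  then show ?thesis
    using dpow_coeff[OF ks(1) O_single[OF xpow_M[OF l(1) ks(2,3)]], of "p ^ s'" ?\<alpha> "{}"]
    by (simp add: dop_def q' xl single_apply xpow_def)
qed

lemma single_xpow_K: "(k, s) \<in> PP \<Longrightarrow> l \<in> {1..m} \<Longrightarrow> single (xpow l k s) \<in> K"
  by (intro K_pure xpow_M pure_xpow) (auto simp: PP_iff)

lemma dop_single_small:
  assumes q: "q \<in> PP" and z: "z \<in> M" "\<And>i. fst z i < 2" shows "dop q (single z) = 0"
proof
  fix y :: mono
  obtain k s where q': "q = (k, s)" by (cases q)
  obtain \<alpha> u where y: "y = (\<alpha>, u)" by (cases y)
  have ks: "k \<in> {1..m}" using q by (simp add: q' PP_iff)
  have "p ^ s \<ge> p ^ 1" using q char by (intro power_increasing) (auto simp: q' PP_iff)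
  then have "z \<noteq> (\<alpha>(k := \<alpha> k + p ^ s), u)" using z(2)[of k] char by auto
  then show "dop q (single z) y = 0 y"
    using dpow_coeff[OF ks O_single[OF z(1)], of "p ^ s" \<alpha> u] by (simp add: dop_def q' y single_apply)
qed

lemma dop_xv: "q \<in> PP \<Longrightarrow> r \<in> {1..2*m} \<Longrightarrow> dop q (xv r) = 0"
  unfolding xv_eq by (rule dop_single_small[OF _ xmono_M]) (auto simp: xmono_def)

lemma dop_tor: "q \<in> PP \<Longrightarrow> j \<in> {1..m} \<Longrightarrow> k \<in> {1..m} \<Longrightarrow> dop q (tor j k) = 0"
  using lin_diff[OF niceD(1)[OF nice_dop], of q] dop_single_small[OF _ xximono_M, of q]
  by (simp add: tor_def xxi_def) (simp add: xximono_def)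

text \<open>Each correction keeps what the earlier ones achieved: \<open>T y\<close> sends the
  variables to constants, and \<open>dop\<close> kills the variables and the toral elements, since
  no exponent there reaches p.\<close>

lemma classification:
  assumes \<phi>: "pder e \<phi>"
  shows "\<exists>v\<in>grade GA e. \<exists>y\<in>K. y \<in> Gr (e + 1) \<and> (\<forall>a\<in>K. eqv (\<phi> a) (FF v a + T y a))"
proof -
  obtain \<kappa> \<gamma> c A where kc: "e = 1 \<longrightarrow> \<kappa> = 0 \<and> c = 0" and g: "e = 0 \<longrightarrow> (\<forall>i\<in>{1..m}. \<gamma> i = 0)" and A: "A \<in> K" "A \<in> Gr (e + 1)"
    and x: "\<And>r. r \<in> {1..2*m} \<Longrightarrow> \<phi> (xv r) = (\<Sum>i=1..m. fscale (\<gamma> i) (Gop i (xv r))) + fscale \<kappa> (E2 (xv r)) +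
      (T A (xv r) + fscale c (T (xxi 1 1) (xv r)))"
    using reduction[OF \<phi>] by blast
  define v1 where "v1 = vec c \<kappa> (\<lambda>q. 0) \<gamma>"
  have v1: "v1 \<in> grade GA e" unfolding v1_def using kc g by (intro vec_grade) auto
  have FF1: "FF v1 f = fscale c (T (xxi 1 1) f) + fscale \<kappa> (E2 f) + (\<Sum>j=1..m. fscale (\<gamma> j) (Gop j f))" for f
    by (simp add: v1_def FF_vec)
  have nA: "nice e (T A)" using nice_T_K[OF A] by (simp add: add.assoc)
  define \<psi>1 where "\<psi>1 a = \<phi> a - (FF v1 a + T A a)" for a
  have p1: "pder e \<psi>1" unfolding \<psi>1_def[abs_def] by (rule pder_sub[OF \<phi> nice_add[OF nice_FF[OF v1] nA]])
  have k1: "\<psi>1 (xv r) = 0" if "r \<in> {1..2*m}" for r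
    using x[OF that] by (simp add: \<psi>1_def FF1 add_ac)
  interpret k1: sho_kill m t p M ty e \<psi>1 by unfold_locales (use p1 k1 in auto)
  obtain y where y: "y \<in> K" "y \<in> Gr (e + 1)" "\<And>r. r \<in> {1..2*m} \<Longrightarrow> eqv (T y (xv r)) 0"
    "\<And>j k. j \<in> {1..m} \<Longrightarrow> k \<in> {1..m} \<Longrightarrow> eqv (\<psi>1 (tor j k)) (T y (tor j k))"
    using k1.tor_inner by blast
  have ny: "nice e (T y)" using nice_T_K[OF y(1,2)] by (simp add: add.assoc)
  define \<psi>2 where "\<psi>2 a = \<psi>1 a - T y a" for a
  have p2: "pder e \<psi>2" unfolding \<psi>2_def[abs_def] by (rule pder_sub[OF p1 ny])
  define nx where "nx k = (SOME l. l \<in> {1..m} \<and> l \<noteq> k)" for k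
  have nx: "nx k \<in> {1..m} \<and> nx k \<noteq> k" for k
    unfolding nx_def using other_index[of k k] by (intro someI_ex[of "\<lambda>l. l \<in> {1..m} \<and> l \<noteq> k"]) metis
  \<comment> \<open>One test index different from k is enough, by \<open>exc_transfer\<close>. In
    the odd case these coefficients vanish by parity.\<close>
  define C where "C q = (if q \<in> PP then \<psi>2 (single (xpow (nx (fst q)) (fst q) (snd q))) (xmono (nx (fst q))) else 0)" for q
  have C0: "C q = 0" if "e = 1" for q
  proof (cases "q \<in> PP")
    case True
    obtain k s where q: "q = (k, s)" by (cases q)
    have fM: "xpow (nx k) k s \<in> M" using xpow_M nx True by (auto simp: q PP_iff)
    have "single (xpow (nx k) k s) \<in> Gr 0" by (rule Gr_single[OF fM]) (simp add: xpow_def)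
    then have "\<psi>2 (single (xpow (nx k) k s)) \<in> Gr 1"
      using pderD(5)[OF p2, of "single (xpow (nx k) k s)" 0] single_xpow_K[of k s "nx k"] True nx that q by simp
    then show ?thesis
      using Gr_D[of "\<psi>2 (single (xpow (nx k) k s))" 1 "xmono (nx k)"] nx[of k] by (auto simp: C_def q xmono_def)
  qed (simp add: C_def)
  define v2 where "v2 = vec 0 0 C (\<lambda>j. 0)"
  have v2: "v2 \<in> grade GA e" unfolding v2_def using C0 by (intro vec_grade) auto
  have FF2: "FF v2 f = (\<Sum>q\<in>PP. fscale (C q) (dop q f))" for f by (simp add: v2_def FF_vec)
  define \<psi>3 where "\<psi>3 a = \<psi>2 a - FF v2 a" for a
  have p3: "pder e \<psi>3" unfolding \<psi>3_def[abs_def] by (rule pder_sub[OF p2 nice_FF[OF v2]])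
  have k3: "eqv (\<psi>3 (xv r)) 0" if r: "r \<in> {1..2*m}" for r
  proof -
    have "FF v2 (xv r) = 0" unfolding FF2 using dop_xv[OF _ r] by (intro sum.neutral ballI) simp
    then show ?thesis using eqv_minus[OF y(3)[OF r]] k1[OF r] by (simp add: \<psi>3_def \<psi>2_def)
  qed
  interpret k3: sho_kill m t p M ty e \<psi>3 by unfold_locales (use p3 k3 in auto)
  interpret t3: sho_tor m t p M ty e \<psi>3
  proof
    fix j k assume j: "j \<in> {1..m}" and k: "k \<in> {1..m}"
    have "FF v2 (tor j k) = 0" unfolding FF2 using dop_tor[OF _ j k] by (intro sum.neutral ballI) simp
    then show "eqv (\<psi>3 (tor j k)) 0" using y(4)[OF j k] by (simp add: \<psi>3_def \<psi>2_def eqv_def)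
  next
    fix l k s assume l: "l \<in> {1..m}" and k: "k \<in> {1..m}" and s: "1 \<le> s" "s < t k"
    have q: "(k, s) \<in> PP" using k s by (simp add: PP_iff)
    have n: "nx k \<in> {1..m}" "nx k \<noteq> k" using nx by auto
    have "FF v2 (single (xpow (nx k) k s)) (xmono (nx k)) = (\<Sum>q\<in>PP. if q = (k, s) then C (k, s) else 0)"
      unfolding FF2 sum_fun_apply fscale_apply by (intro sum.cong refl) (simp add: dop_xpow[OF _ q n])
    also have "\<dots> = C (k, s)" using q by simp
    finally have "\<psi>3 (single (xpow (nx k) k s)) (xmono (nx k)) = 0" using q by (simp add: \<psi>3_def C_def)
    then show "\<psi>3 (single (xpow l k s)) (xmono l) = 0" by (rule k3.exc_transfer[OF l n(1) k n(2) s])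
  qed
  have "eqv (\<phi> a) (FF (v1 + v2) a + T (A + y) a)" if a: "a \<in> K" for a
  proof -
    have "\<psi>3 a = \<phi> a - (FF (v1 + v2) a + T (A + y) a)"
      by (simp add: \<psi>3_def \<psi>2_def \<psi>1_def FF_linear T_linear algebra_simps)
    then show ?thesis using t3.psi_zero[OF a] eqv_move' eqv_sym by metis
  qed
  then have "\<forall>a\<in>K. eqv (\<phi> a) (FF (v1 + v2) a + T (A + y) a)" by (rule ballI)
  moreover have "v1 + v2 \<in> grade GA e" using v1 v2 by (auto simp: G_alg_def)
  moreover have "A + y \<in> K" "A + y \<in> Gr (e + 1)" by (rule K_add[OF A(1) y(1)], rule Gr_add[OF A(2) y(2)])
  ultimately show ?thesis by (intro bexI[of _ "v1 + v2"] bexI[of _ "A + y"] conjI) assumption+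
qed

text \<open>Every coefficient of v is isolated by values on the variables or on exceptional
  monomials that bracketing with an element y of \<open>K\<close> cannot reproduce.\<close>

lemma independence:
  assumes v: "v \<in> carr GA" and y: "y \<in> K" and e: "\<And>a. a \<in> K \<Longrightarrow> eqv (FF v a) (T y a)"
  shows "v = 0"
proof -
  define c \<kappa> C \<gamma> where "c = v (hvec (- 1))" and "\<kappa> = v (hvec 0)" and "C = (\<lambda>q. v (hvec (inv_into {1..iota m t} en q)))"
    and "\<gamma> = (\<lambda>j. v (gvec j))"
  have v': "v = vec c \<kappa> C \<gamma>" using vec_surj[OF v] by (simp add: c_def \<kappa>_def C_def \<gamma>_def)
  note F = FF_vec[of c \<kappa> C \<gamma>]
  have yO: "y \<in> Osp" using y by simp
  have D: "FF v a z = T y a z" if "a \<in> K" "z \<noteq> z0" for a z using eqvD[OF e[OF that(1)] that(2)] .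
  have dop0: "(\<Sum>q\<in>PP. fscale (C q) (dop q (xv r))) = 0" if "r \<in> {1..2*m}" for r
    using dop_xv[OF _ that] by (intro sum.neutral ballI) simp
  have Ghigh: "(\<Sum>j=1..m. fscale (\<gamma> j) (Gop j (xv (i + m)))) = fscale (\<gamma> i) (xpi i)" if i: "i \<in> {1..m}" for i
  proof -
    have "(\<Sum>j=1..m. fscale (\<gamma> j) (Gop j (xv (i + m)))) = (\<Sum>j=1..m. if j = i then fscale (\<gamma> i) (xpi i) else 0)"
      using i by (intro sum.cong refl) (auto simp: Gop_xv simp del: atLeastAtMost_iff)
    then show ?thesis using i by simp
  qed
  have Glow: "(\<Sum>j=1..m. fscale (\<gamma> j) (Gop j (xv i))) = 0" if i: "i \<in> {1..m}" for i
    using i by (intro sum.neutral ballI) (simp add: Gop_xv del: atLeastAtMost_iff)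
  have T1': "T (xxi j j) (xv (i + m)) = fscale (of_bool (i = j)) (xv (i + m))" "T (xxi j j) (xv i) = fscale (- of_bool (i = j)) (xv i)"
    if i: "i \<in> {1..m}" and j: "j \<in> {1..m}" for i j
    using T_xxi[OF j j, of "xv (i + m)"] T_xxi[OF j j, of "xv i"] i j idx[OF i] idx[OF j]
    by (auto simp: d_xv4 mul_add mul_one fscale_minus_left simp del: atLeastAtMost_iff)
  note T1 = T1'[OF _ one_m]
  have FFh: "FF v (xv (i + m)) = fscale (c * of_bool (i = 1)) (xv (i + m)) - fscale \<kappa> (xv (i + m)) + fscale (\<gamma> i) (xpi i)"
    if i: "i \<in> {1..m}" for i
    unfolding v' F dop0[OF idx(2)[OF i]] Ghigh[OF i] T1[OF i] E2_xv[OF idx(2)[OF i]] by (simp add: fscale_minus)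
  have FFl: "FF v (xv i) = fscale (- (c * of_bool (i = 1))) (xv i) - fscale \<kappa> (xv i)" if i: "i \<in> {1..m}" for i
    unfolding v' F dop0[OF idx(1)[OF i]] Glow[OF i] T1[OF i] E2_xv[OF idx(1)[OF i]] by (simp add: fscale_minus)
  have xt: "xv (i + m) (tmono i) = 0" "xpi i (xmono (i + m)) = 0" if "i \<in> {1..m}" for i
    using that by (auto simp: xv_eq xpi_def single_apply tmono_def xmono_def)
  have g0: "\<gamma> i = 0" if i: "i \<in> {1..m}" for i
  proof -
    have "tmono i \<noteq> z0" using p_pow_gt[OF i] by (auto simp: tmono_def fun_eq_iff)
    then have "FF v (xv (i + m)) (tmono i) = d i y (tmono i)"
      using D[OF K_xv[OF idx(2)[OF i]]] T_xv_high[OF i yO] by simp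
    \<comment> \<open>A derivative in the i-th variable never contains its top power, so this
      coefficient sees only \<open>Gop i\<close>.\<close>
    also have "d i y (tmono i) = 0"
    proof -
      have "((\<lambda>j. 0)(i := p ^ t i - 1))(i := Suc (((\<lambda>j. 0)(i := p ^ t i - 1)) i)) = ((\<lambda>j. 0)(i := p ^ t i))" 
        using p_pow_pos[of "t i"] by auto
      moreover have "((\<lambda>j. 0)(i := p ^ t i), {}) \<notin> M" using i by (auto simp: M_iff)
      ultimately show ?thesis using d_even[OF i yO] O_out[OF yO] by (simp add: tmono_def)
    qed
    finally show ?thesis unfolding FFh[OF i] using xt[OF i] by (simp add: xpi_def single_apply)
  qed
  define Y where "Y i = y (xximono i i)" for i
  have xx: "((\<lambda>j. 0)(i := Suc 0), {i + m}) = xximono i i" for i by (simp add: xximono_def)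
  have h1: "c * of_bool (i = 1) - \<kappa> = Y i" if i: "i \<in> {1..m}" for i
  proof -
    have "FF v (xv (i + m)) (xmono (i + m)) = d i y (xmono (i + m))"
      using D[OF K_xv[OF idx(2)[OF i]] xmono_nonconst[OF idx(2)[OF i]]] T_xv_high[OF i yO] by simp
    also have "d i y (xmono (i + m)) = Y i" using d_even[OF i yO] i by (simp add: xmono_def Y_def xx)
    finally show ?thesis unfolding FFh[OF i] using xt[OF i] idx[OF i] by (simp add: xv_xmono)
  qed
  have dy: "d (i + m) y (xmono i) = Y i" if i: "i \<in> {1..m}" for i
    using d_odd[OF _ yO, of "i + m"] i by (simp add: xmono_def Y_def xx)
  have h2: "- (c * of_bool (i = 1)) - \<kappa> = - Y i" if i: "i \<in> {1..m}" for i
  proof -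
    have s: "d (i + m) (sg y) = - sg (d (i + m) y)"
      using sg_d[OF yO, of "i + m"] mu_high[OF i] by (simp add: fscale_minus_left)
    have "FF v (xv i) (xmono i) = d (i + m) (sg y) (xmono i)"
      using D[OF K_xv[OF idx(1)[OF i]] xmono_nonconst[OF idx(1)[OF i]]] T_xv_low[OF i yO] by simp
    also have "\<dots> = - Y i" unfolding s using sg_xmono_low[OF i] dy[OF i] by simp
    finally show ?thesis unfolding FFl[OF i] using idx[OF i] by (simp add: xv_xmono)
  qed
  \<comment> \<open>On conjugate variables, brackets act with opposite eigenvalues and the degree
    map with equal ones; adding the two relations isolates 2 \<kappa>.\<close>
  have k0: "\<kappa> = 0"
  proof -
    have "c - \<kappa> = Y 1" "- c - \<kappa> = - Y 1" using h1[OF one_m] h2[OF one_m] by simp_all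
    then have "(c - \<kappa>) + (- c - \<kappa>) = 0" by (metis add.right_inverse)
    moreover have "(c - \<kappa>) + (- c - \<kappa>) = - (2 * \<kappa>)" by algebra
    ultimately have "2 * \<kappa> = 0" by (metis neg_equal_0_iff_equal)
    then show ?thesis using two_nz by simp
  qed
  \<comment> \<open>The diagonal coefficients of y are now zero except for c at the first pair.
    Their sum is the constant term of the Laplacian of y, which is zero.\<close>
  have "Dl y z0 = (\<Sum>i=1..m. Y i)"
    unfolding Dl_def sum_fun_apply
  proof (rule sum.cong[OF refl])
    fix i assume i: "i \<in> {1..m}"
    show "d i (d (i + m) y) z0 = Y i" using d_z0[OF idx(1)[OF i], of "d (i + m) y"] dy[OF i] yO by simp
  qed
  also have "\<dots> = (\<Sum>i=1..m. if i = 1 then c else 0)"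
  proof (rule sum.cong[OF refl])
    fix i assume "i \<in> {1..m}"
    from h1[OF this] k0 show "Y i = (if i = 1 then c else 0)" by (cases "i = 1") simp_all
  qed
  also have "\<dots> = c" using one_m by simp
  finally have c0: "c = 0" using K_Dl[OF y] by simp
  \<comment> \<open>An exceptional monomial has degree above two and is therefore good, so no inner
    map gives it an \<open>x_l\<close> term.\<close>
  have C0: "C q = 0" if q: "q \<in> PP" for q
  proof -
    obtain k s where q': "q = (k, s)" by (cases q)
    have ks: "k \<in> {1..m}" "1 \<le> s" "s < t k" using q by (auto simp: q' PP_iff)
    obtain l where l: "l \<in> {1..m}" "l \<noteq> k" using other_index by metis
    let ?f = "single (xpow l k s) :: mono \<Rightarrow> 'k"
    have fM: "xpow l k s \<in> M" using xpow_M l ks by blast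
    have fK: "?f \<in> K" using single_xpow_K q l q' by blast
    have ps: "p ^ s \<ge> 3" using ks(2) char self_le_power[of p s] by simp
    have "FF v ?f (xmono l) = (\<Sum>r\<in>PP. C r * dop r ?f (xmono l)) + (\<Sum>j=1..m. \<gamma> j * Gop j ?f (xmono l))"
      unfolding v' F by (simp add: c0 k0 sum_fun_apply)
    also have "(\<Sum>j=1..m. \<gamma> j * Gop j ?f (xmono l)) = 0" using g0 by (intro sum.neutral ballI) simp
    also have "(\<Sum>r\<in>PP. C r * dop r ?f (xmono l)) = (\<Sum>r\<in>PP. if r = q then C q else 0)"
      by (intro sum.cong refl) (simp add: dop_xpow[OF _ q[unfolded q'] l] q')
    finally have "FF v ?f (xmono l) = C q" using q by simp
    moreover have "T y ?f (xmono l) = 0"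
      using T_good[OF l(1) yO, of ?f] good_single[OF fM l(1)] ps fK by (simp add: deg_xpow[OF l(1) ks(1)])
    ultimately show ?thesis using D[OF fK xmono_nonconst[OF idx(1)[OF l(1)]]] by simp
  qed
  have "C (en i) = 0" if "i \<in> {1..iota m t}" for i using C0[OF en_PP] that by simp
  then show ?thesis unfolding v' using c0 k0 g0 by (auto simp: vec_def fun_eq_iff split: gbasis.splits)
qed

end

section \<open>Brackets of the outer superderivations\<close>

context sho begin

lemma of_nat_p_pow: "1 \<le> s \<Longrightarrow> of_nat (p ^ s) = (0 :: 'k)"
  by (rule of_nat_p_dvd) (simp add: dvd_power)

lemma of_nat_p_pow_minus_one: assumes "1 \<le> s" shows "of_nat (p ^ s - 1) = (- 1 :: 'k)"
proof -
  have "p ^ s = Suc (p ^ s - 1)" using p_pow_pos[of s] by simp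
  then have "(of_nat (p ^ s) :: 'k) = of_nat (p ^ s - 1) + 1" by (metis of_nat_Suc add.commute)
  then show ?thesis using of_nat_p_pow[OF assms] by (simp add: eq_neg_iff_add_eq_0)
qed

lemma dop_apply: 
  assumes "(k, s) \<in> PP" "f \<in> Osp" shows "dop (k, s) f (\<alpha>, u) = f (\<alpha>(k := \<alpha> k + p ^ s), u)"
  using dpow_coeff[of k f "p ^ s" \<alpha> u] assms by (simp add: dop_def PP_iff)

lemma O_dop [simp]: "f \<in> Osp \<Longrightarrow> dop q f \<in> Osp" 
  by (simp add: dop_def)

lemma dop_commute:
  assumes q: "q \<in> PP" "q' \<in> PP" and f: "f \<in> Osp" shows "dop q (dop q' f) = dop q' (dop q f)"
proof
  fix z :: mono
  obtain k s k' s' where e: "q = (k, s)" "q' = (k', s')" by (cases q, cases q')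
  obtain \<alpha> u where z: "z = (\<alpha>, u)" by (cases z)
  show "dop q (dop q' f) z = dop q' (dop q f) z"
    using q f unfolding e z by (cases "k = k'") (simp_all add: dop_apply fun_upd_twist add_ac)
qed

text \<open>A shift of an exponent by p^s with s at least 1 changes neither degree nor weight modulo
  p.\<close>

lemma dop_diag:
  assumes q: "q \<in> PP" and f: "f \<in> Osp" 
  shows "dop q (E2 f) = E2 (dop q f)" "dop q (T (xxi 1 1) f) = T (xxi 1 1) (dop q f)"
proof -
  obtain k s where e: "q = (k, s)" by (cases q)
  have ks: "k \<in> {1..m}" "1 \<le> s" using q by (simp_all add: e PP_iff)
  have dg: "of_nat (deg (\<alpha>(k := \<alpha> k + p ^ s), u)) = (of_nat (deg (\<alpha>, u)) :: 'k)" for \<alpha> u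
  proof -
    have "(\<Sum>j=1..m. (\<alpha>(k := \<alpha> k + p ^ s)) j) = (\<Sum>j=1..m. \<alpha> j + (if j = k then p ^ s else 0))"
      by (intro sum.cong) auto
    then have "deg (\<alpha>(k := \<alpha> k + p ^ s), u) = deg (\<alpha>, u) + p ^ s"
      using ks by (simp add: deg_def sum.distrib)
    then show ?thesis by (simp only: of_nat_add of_nat_p_pow[OF ks(2)] add_0_right)
  qed
  have w: "wt 1 (\<alpha>(k := \<alpha> k + p ^ s), u) = wt 1 (\<alpha>, u)" for \<alpha> u
    by (auto simp: wt_def of_nat_p_pow[OF ks(2), unfolded of_nat_power])
  show "dop q (E2 f) = E2 (dop q f)"
  proof
    fix z :: mono
    obtain \<alpha> u where z: "z = (\<alpha>, u)" by (cases z)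
    have "E2 f \<in> Osp" using f by (simp add: E2_def)
    then show "dop q (E2 f) z = E2 (dop q f) z"
      using q f unfolding e z by (simp add: dop_apply E2_apply dg)
  qed
  show "dop q (T (xxi 1 1) f) = T (xxi 1 1) (dop q f)"
  proof
    fix z :: mono
    obtain \<alpha> u where z: "z = (\<alpha>, u)" by (cases z)
    have O: "T (xxi 1 1) f \<in> Osp" using f xxi_Gr[OF one_m one_m] by simp
    have "dop q (T (xxi 1 1) f) z = T (xxi 1 1) f (\<alpha>(k := \<alpha> k + p ^ s), u)"
      unfolding z e by (rule dop_apply[OF q[unfolded e] O])
    also have "\<dots> = - wt 1 (\<alpha>, u) * dop q f (\<alpha>, u)"
      unfolding T_xxi_diag[OF one_m f] w e dop_apply[OF q[unfolded e] f] ..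
    also have "\<dots> = T (xxi 1 1) (dop q f) z"
      unfolding T_xxi_diag[OF one_m O_dop[OF f]] z ..
    finally show "dop q (T (xxi 1 1) f) z = T (xxi 1 1) (dop q f) z" .
  qed
qed

lemma E2_T_xxi: "f \<in> Osp \<Longrightarrow> E2 (T (xxi 1 1) f) = T (xxi 1 1) (E2 f)"
proof -
  assume f: "f \<in> Osp"
  then have "E2 f \<in> Osp" by (simp add: E2_def)
  show ?thesis
  proof
    fix z
    have "E2 (T (xxi 1 1) f) z = (of_nat (deg z) - 2) * (- wt 1 z * f z)"
      unfolding E2_apply T_xxi_diag[OF one_m f] ..
    also have "\<dots> = T (xxi 1 1) (E2 f) z" unfolding T_xxi_diag[OF one_m \<open>E2 f \<in> Osp\<close>] E2_apply by simp
    finally show "E2 (T (xxi 1 1) f) z = T (xxi 1 1) (E2 f) z" .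
  qed
qed

lemma hvec_commute:
  assumes x: "hvec i \<in> GB" and y: "hvec k \<in> GB" and f: "f \<in> Osp"
  shows "Fop (hvec i) (Fop (hvec k) f) = Fop (hvec k) (Fop (hvec i) f)"
proof -
  have "i \<noteq> - 1 \<Longrightarrow> i \<noteq> 0 \<Longrightarrow> en i \<in> PP" "k \<noteq> - 1 \<Longrightarrow> k \<noteq> 0 \<Longrightarrow> en k \<in> PP"
    using x y by (auto simp: G_basis_def intro!: en_PP)
  then show ?thesis
    using dop_diag f dop_commute E2_T_xxi by (auto simp: Fop_def)
qed

lemma xpi_Osp [simp]: "i \<in> {1..m} \<Longrightarrow> xpi i \<in> Osp"
  using xpi_Gr Gr_Osp by blast

lemma gvec_anticommute:
  assumes i: "i \<in> {1..m}" and j: "j \<in> {1..m}" and f: "f \<in> Osp" shows "Gop i (Gop j f) = - Gop j (Gop i f)"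
proof -
  have G: "Gop i (Gop j f) = (xpi i \<odot> xpi j) \<odot> d (i + m) (d (j + m) f)" if i: "i \<in> {1..m}" and j: "j \<in> {1..m}" for i j
  proof -
    have "d (i + m) (xpi j) = 0" using i j by (intro d_xpi) auto
    then have "d (i + m) (xpi j \<odot> d (j + m) f) = xpi j \<odot> d (i + m) (d (j + m) f)"
      using d_mul_Gr[OF xpi_Gr[OF j], of "d (j + m) f" "i + m"] f by (simp add: mul_add)
    then show ?thesis using mul_assoc[of "xpi i" "xpi j"] i j f by (simp add: Gop_def del: atLeastAtMost_iff)
  qed
  have "xpi i \<odot> xpi j = xpi j \<odot> xpi i" using mul_commute[OF xpi_Gr[OF i] xpi_Gr[OF j]] by simp
  moreover have "d (i + m) (d (j + m) f) = - d (j + m) (d (i + m) f)"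
    using d_commute[OF idx(2)[OF i] idx(2)[OF j] f] mu_high[OF i] mu_high[OF j] by (simp add: fscale_minus_left)
  ultimately show ?thesis unfolding G[OF i j] G[OF j i] by (simp add: mul_add)
qed

text \<open>Modulo p the factor \<open>xpi j\<close> has degree -1, and the derivative lowers the
  degree by one more: this is the structure constant -2.\<close>

lemma E2_Gop:
  assumes j: "j \<in> {1..m}" and f: "f \<in> Osp" shows "E2 (Gop j f) = Gop j (E2 f) + fscale (- 2) (Gop j f)"
proof -
  have "deg (tmono j) = p ^ t j - 1" using j by (simp add: deg_def tmono_def)
  then have "Eop (xpi j) = - xpi j"
    using of_nat_p_pow_minus_one[of "t j"] tpos j unfolding xpi_def Eop_single by (simp add: Suc_leI fscale_minus_left)
  then have "Eop (Gop j f) = - Gop j f + xpi j \<odot> Eop (d (j + m) f)"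
    unfolding Gop_def using Eop_mul[of "xpi j" "d (j + m) f"] j f by (simp add: mul_add)
  also have "Eop (d (j + m) f) = d (j + m) (Eop f) - d (j + m) f"
    using d_Eop[OF idx(2)[OF j] f] by simp
  finally have "Eop (Gop j f) = - Gop j f + xpi j \<odot> (d (j + m) (Eop f) - d (j + m) f)" .
  then have "Eop (Gop j f) = - Gop j f + (Gop j (Eop f) - Gop j f)" unfolding mul_add Gop_def .
  then have e: "Eop (Gop j f) z = - Gop j f z + (Gop j (Eop f) z - Gop j f z)" for z
    by (simp only: minus_apply plus_fun_apply uminus_apply)
  show ?thesis
    unfolding E2_def lin_add[OF niceD(1)[OF nice_Gop[OF j]]] lin_scale[OF niceD(1)[OF nice_Gop[OF j]]]
  proof
    fix z
    show "(Eop (Gop j f) + fscale (- 2) (Gop j f)) z = (Gop j (Eop f) + fscale (- 2) (Gop j f) + fscale (- 2) (Gop j f)) z"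
      unfolding plus_fun_apply fscale_apply e by simp
  qed
qed

lemma T_xxi_d:
  assumes j: "j \<in> {1..m}" and f: "f \<in> Osp"
  shows "T (xxi 1 1) (d (j + m) f) = d (j + m) (T (xxi 1 1) f) - fscale (of_bool (j = 1)) (d (j + m) f)"
proof
  fix z :: mono
  obtain \<alpha> u where z: "z = (\<alpha>, u)" by (cases z)
  have O: "T (xxi 1 1) f \<in> Osp" using f xxi_Gr[OF one_m one_m] by simp
  have r: "j + m \<in> {m+1..2*m}" using j by auto
  have w: "wt 1 (\<alpha>, insert (j + m) u) = wt 1 (\<alpha>, u) - of_bool (j = 1)" if "j + m \<notin> u"
    using that by (auto simp: wt_def)
  have D: "T (xxi 1 1) g z = - wt 1 z * g z" if "g \<in> Osp" for g z
    unfolding T_xxi_diag[OF one_m that] ..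
  show "T (xxi 1 1) (d (j + m) f) z = (d (j + m) (T (xxi 1 1) f) - fscale (of_bool (j = 1)) (d (j + m) f)) z"
  proof (cases "j + m \<in> u")
    case True
    then show ?thesis using f by (simp only: minus_apply fscale_apply z D O_d d_odd[OF r O] d_odd[OF r f]) simp
  next
    case False
    show ?thesis using f
      by (simp only: minus_apply fscale_apply z D O_d d_odd[OF r O] d_odd[OF r f] w[OF False] False if_False) (simp add: algebra_simps)
  qed
qed

text \<open>For j = 1 the factor \<open>xpi j\<close> has weight -1 modulo p, and removing the
  conjugate odd variable raises the weight by one; for other j both contributions are zero.\<close>

lemma T_xxi_Gop:
  assumes j: "j \<in> {1..m}" and f: "f \<in> Osp" shows "T (xxi 1 1) (Gop j f) = Gop j (T (xxi 1 1) f)"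
proof -
  have x: "T (xxi 1 1) (xpi j) = fscale (of_bool (j = 1)) (xpi j)"
  proof
    fix z
    show "T (xxi 1 1) (xpi j) z = fscale (of_bool (j = 1)) (xpi j) z"
    proof (cases "z = tmono j")
      case True
      have "wt 1 (tmono j) = - of_bool (j = 1)"
        using of_nat_p_pow_minus_one[of "t j"] tpos j by (auto simp: wt_def tmono_def Suc_leI)
      then show ?thesis unfolding T_xxi_diag[OF one_m xpi_Osp[OF j]] True by simp
    next
      case False
      then show ?thesis unfolding T_xxi_diag[OF one_m xpi_Osp[OF j]] by (simp add: xpi_def single_apply)
    qed
  qed
  have "T (xxi 1 1) (Gop j f) = T (xxi 1 1) (xpi j) \<odot> d (j + m) f + xpi j \<odot> T (xxi 1 1) (d (j + m) f)"
    unfolding Gop_def using T_mul[OF xxi_Gr[OF one_m one_m] xpi_Gr[OF j], of "d (j + m) f"] f by simp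
  also have "\<dots> = Gop j (T (xxi 1 1) f)"
    unfolding x T_xxi_d[OF j f] Gop_def by (simp add: mul_add mul_fscale)
  finally show ?thesis .
qed

lemma d_even_single:
  assumes k: "k \<in> {1..m}" and e: "1 \<le> e" "e < p ^ t k" and r: "r \<in> {1..2*m}"
  shows "d r (single ((\<lambda>j. 0)(k := e), {})) = (if r = k then single ((\<lambda>j. 0)(k := e - 1), {}) else 0)"
proof -
  have "((\<lambda>j. 0)(k := e), {}) \<in> M" using k e by (auto simp: M_iff p_pos p_pow_pos)
  then show ?thesis using k e r by (auto simp: d_single mono_partial_def)
qed

text \<open>The commutator differentiates the top power only. For j = k this leaves the exponent
  p^(t_j) - p^s - 1, which, unlike the top exponent, does have an antiderivative u within the
  truncation; so the commutator is inner and disappears in the quotient.\<close>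

lemma dop_Gop:
  assumes q: "q \<in> PP" and j: "j \<in> {1..m}"
  shows "\<exists>u\<in>K. \<forall>f\<in>Osp. dop q (Gop j f) = Gop j (dop q f) + T u f"
proof -
  obtain k s where e: "q = (k, s)" by (cases q)
  have ks: "k \<in> {1..m}" "1 \<le> s" "s < t k" using q by (simp_all add: e PP_iff)
  have der: "d k (f \<odot> g) = d k f \<odot> g + f \<odot> d k g" if "f \<in> Osp" "g \<in> Osp" for f g
    using d_mul[OF that, of k] ks by (simp add: tw_low)
  have "dop q (d (j + m) f) = d (j + m) (dop q f)" if "f \<in> Osp" for f
  proof -
    have "(d k ^^ n) (d (j + m) f) = d (j + m) ((d k ^^ n) f)" for n
    proof (induction n)
      case (Suc n)
      then show ?case using d_commute[OF idx(1)[OF ks(1)] idx(2)[OF j], of "(d k ^^ n) f"] that mu_low[OF ks(1)] by simp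
    qed simp
    then show ?thesis by (simp add: dop_def e)
  qed
  then have G: "dop q (Gop j f) = dop q (xpi j) \<odot> d (j + m) f + Gop j (dop q f)" if "f \<in> Osp" for f
    using dpow_prime_bilinear[where B = "\<lambda>f g. f \<odot> g" and i = k, OF der xpi_Osp[OF j] O_d[OF that]] that
    by (simp add: dop_def e Gop_def)
  show ?thesis
  proof (cases "j = k")
    case False
    have "dop q (xpi j) = 0"
    proof
      fix z :: mono
      obtain \<alpha> u where z: "z = (\<alpha>, u)" by (cases z)
      have "(\<alpha>(k := \<alpha> k + p ^ s), u) \<noteq> tmono j"
        using False p_pow_pos[of s] by (auto simp: tmono_def dest!: fun_cong[of _ _ k])
      then show "dop q (xpi j) z = 0 z"
        using dop_apply[OF q[unfolded e] xpi_Osp[OF j]] by (simp add: e z xpi_def single_apply)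
    qed
    then have "\<forall>f\<in>Osp. dop q (Gop j f) = Gop j (dop q f) + T 0 f" using G by (simp add: mul_add T_linear)
    then show ?thesis using K_zero by blast
  next
    case True
    let ?e = "p ^ t j - p ^ s"
    define u :: "mono \<Rightarrow> 'k" where "u = single ((\<lambda>i. 0)(j := ?e), {})"
    have lt: "p ^ s < p ^ t j" using ks True char by (simp add: power_strict_increasing)
    have ee: "1 \<le> ?e" "?e < p ^ t j" using lt p_pow_pos[of s] p_pow_pos[of "t j"] by linarith+
    have uM: "((\<lambda>i. 0)(j := ?e), {}) \<in> M" using j ee by (auto simp: M_iff p_pos p_pow_pos)
    have uG: "u \<in> Gr 0" unfolding u_def by (rule Gr_single[OF uM]) simp
    note du = d_even_single[OF j ee, folded u_def]
    have dx: "dop q (xpi j) = single ((\<lambda>i. 0)(j := ?e - 1), {})"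
    proof
      fix z :: mono
      obtain \<alpha> v where z: "z = (\<alpha>, v)" by (cases z)
      have "(\<alpha>(j := \<alpha> j + p ^ s), v) = tmono j \<longleftrightarrow> (\<alpha>, v) = ((\<lambda>i. 0)(j := ?e - 1), {})"
      proof
        assume h: "(\<alpha>(j := \<alpha> j + p ^ s), v) = tmono j"
        then have h': "\<alpha>(j := \<alpha> j + p ^ s) = (\<lambda>i. 0)(j := p ^ t j - 1)" "v = {}" by (simp_all add: tmono_def)
        have "\<alpha> i = ((\<lambda>i. 0)(j := ?e - 1)) i" for i
          using fun_cong[OF h'(1), of i] by (cases "i = j") auto
        then show "(\<alpha>, v) = ((\<lambda>i. 0)(j := ?e - 1), {})" using h'(2) by auto
      next
        assume "(\<alpha>, v) = ((\<lambda>i. 0)(j := ?e - 1), {})"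
        then show "(\<alpha>(j := \<alpha> j + p ^ s), v) = tmono j" using lt by (auto simp: tmono_def)
      qed
      then show "dop q (xpi j) z = single ((\<lambda>i. 0)(j := ?e - 1), {}) z"
        using dop_apply[OF q[unfolded e] xpi_Osp[OF j], of \<alpha> v] True by (simp add: e z xpi_def single_apply)
    qed
    have dh: "d (i + m) u = 0" if i: "i \<in> {1..m}" for i
      using du[OF idx(2)[OF i]] i j by auto
    have "T u f = dop q (xpi j) \<odot> d (j + m) f" if f: "f \<in> Osp" for f
    proof -
      have "T u f = (\<Sum>i=1..m. if i = j then dop q (xpi j) \<odot> d (j + m) f else 0)"
        unfolding T_def
      proof (rule sum.cong[OF refl])
        fix i assume i: "i \<in> {1..m}"
        show "d i u \<odot> d (i + m) f + d (i + m) (sg u) \<odot> d i f = (if i = j then dop q (xpi j) \<odot> d (j + m) f else 0)"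
          unfolding dx using dh[OF i] du[OF idx(1)[OF i]] sg_Gr[OF uG] by (simp add: mul_add)
      qed
      then show ?thesis using j by simp
    qed
    moreover have "u \<in> K"
    proof (rule K_I)
      show "u \<in> Osp" using uG by (rule Gr_Osp)
      show "Dl u = 0" unfolding Dl_def using dh by (intro sum.neutral ballI) (simp add: d_linear)
    qed
    ultimately show ?thesis using G by (intro bexI[of _ u]) (simp_all add: add.commute)
  qed
qed

text \<open>The argument b stands for the product of the two parities.\<close>

definition scom :: "bit \<Rightarrow> ((mono \<Rightarrow> 'k) \<Rightarrow> mono \<Rightarrow> 'k) \<Rightarrow> ((mono \<Rightarrow> 'k) \<Rightarrow> mono \<Rightarrow> 'k) \<Rightarrow> (mono \<Rightarrow> 'k) \<Rightarrow> mono \<Rightarrow> 'k" where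
  "scom b F G f = F (G f) - fscale (psign b) (G (F f))"

lemma Fop_hvec_gvec:
  assumes x: "hvec i \<in> GB" and y: "gvec j \<in> GB"
  shows "\<exists>u\<in>K. \<forall>f\<in>Osp. Fop (hvec i) (Fop (gvec j) f) - Fop (gvec j) (Fop (hvec i) f) =
      FF (G_basis_bracket (hvec i) (gvec j)) f + T u f"
proof -
  have j: "j \<in> {1..m}" using y by (auto simp: G_basis_def)
  consider "i = - 1" | "i = 0" | "i \<noteq> - 1" "i \<noteq> 0" by blast
  then show ?thesis
  proof cases
    case 1
    then show ?thesis using T_xxi_Gop[OF j] by (intro bexI[of _ 0]) (simp_all add: Fop_def FF_linear T_linear K_zero)
  next
    case 2
    then show ?thesis using E2_Gop[OF j] FF_single[OF y]
      by (intro bexI[of _ 0]) (simp_all add: Fop_def FF_linear T_linear K_zero)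
  next
    case 3
    then have "en i \<in> PP" using x by (auto simp: G_basis_def intro!: en_PP)
    from dop_Gop[OF this j] 3 show ?thesis by (auto simp: Fop_def FF_linear)
  qed
qed

lemma Fop_bracket:
  assumes x: "x \<in> GB" and y: "y \<in> GB"
  shows "\<exists>u\<in>K. \<forall>f\<in>Osp. scom (gpar x * gpar y) (Fop x) (Fop y) f = FF (G_basis_bracket x y) f + T u f"
proof (cases x; cases y)
  fix i k assume e: "x = hvec i" "y = hvec k"
  show ?thesis using hvec_commute[of i k] x y unfolding e
    by (intro bexI[of _ 0]) (simp_all add: scom_def gpar_def FF_linear T_linear K_zero)
next
  fix i j assume e: "x = hvec i" "y = gvec j"
  show ?thesis using Fop_hvec_gvec[of i j] x y unfolding e scom_def gpar_def by simp
next
  fix i j assume e: "x = gvec j" "y = hvec i"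
  obtain u where u: "u \<in> K" "\<And>f. f \<in> Osp \<Longrightarrow> Fop (hvec i) (Fop (gvec j) f) - Fop (gvec j) (Fop (hvec i) f) =
      FF (G_basis_bracket (hvec i) (gvec j)) f + T u f" using Fop_hvec_gvec[of i j] x y unfolding e by blast
  have "G_basis_bracket (gvec j) (hvec i) = fscale (- 1) (G_basis_bracket (hvec i) (gvec j) :: gbasis \<Rightarrow> 'k)"
    by simp
  then have "FF (G_basis_bracket (gvec j) (hvec i)) f = fscale (- 1) (FF (G_basis_bracket (hvec i) (gvec j)) f)" for f
    by (metis FF_linear(2))
  then have "FF (G_basis_bracket (gvec j) (hvec i)) f = - FF (G_basis_bracket (hvec i) (gvec j)) f" for f
    unfolding fscale_minus_left fscale_simps .
  then have "scom (gpar x * gpar y) (Fop x) (Fop y) f = FF (G_basis_bracket x y) f + T (- u) f" if "f \<in> Osp" for f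
    using u(2)[OF that] unfolding e scom_def gpar_def by (simp add: T_linear del: G_basis_bracket.simps) (simp add: algebra_simps)
  then show ?thesis using K_minus[OF u(1)] by blast
next
  fix j l assume e: "x = gvec j" "y = gvec l"
  have "j \<in> {1..m}" "l \<in> {1..m}" using x y by (auto simp: e G_basis_def)
  then show ?thesis using gvec_anticommute[of j l] unfolding e
    by (intro bexI[of _ 0]) (simp_all add: scom_def gpar_def Fop_def FF_linear T_linear K_zero fscale_minus_left del: atLeastAtMost_iff)
qed

lemma FF_bracket:
  assumes v: "v \<in> grade GA b" and w: "w \<in> grade GA c"
  shows "\<exists>u\<in>K. \<forall>f\<in>Osp. scom (b * c) (FF v) (FF w) f = FF (bracket GA v w) f + T u f"
proof -
  obtain U where U: "\<And>x y. x \<in> GB \<Longrightarrow> y \<in> GB \<Longrightarrow> U x y \<in> K" "\<And>x y f. x \<in> GB \<Longrightarrow> y \<in> GB \<Longrightarrow> f \<in> Osp \<Longrightarrow>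
      scom (gpar x * gpar y) (Fop x) (Fop y) f = FF (G_basis_bracket x y) f + T (U x y) f"
    using Fop_bracket by metis
  let ?u = "\<Sum>x\<in>GB. \<Sum>y\<in>GB. fscale (v x * w y) (U x y)"
  have uK: "?u \<in> K" using U(1) by (intro K_sum K_scale)
  have "scom (b * c) (FF v) (FF w) f = FF (bracket GA v w) f + T ?u f" if f: "f \<in> Osp" for f
  proof -
    note lin = lin_sum[OF niceD(1)[OF nice_Fop]] lin_scale[OF niceD(1)[OF nice_Fop]]
    have 1: "FF v (FF w f) = (\<Sum>x\<in>GB. \<Sum>y\<in>GB. fscale (v x * w y) (Fop x (Fop y f)))"
      unfolding FF_def by (intro sum.cong refl) (simp add: lin fscale_sum)
    have 2: "FF w (FF v f) = (\<Sum>x\<in>GB. \<Sum>y\<in>GB. fscale (v x * w y) (Fop y (Fop x f)))"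
      by (subst sum.swap) (unfold FF_def, intro sum.cong refl, simp add: lin fscale_sum mult.commute)
    have 3: "fscale (v x * w y) (Fop x (Fop y f)) - fscale (psign (b * c)) (fscale (v x * w y) (Fop y (Fop x f)))
        = fscale (v x * w y) (FF (G_basis_bracket x y) f) + fscale (v x * w y) (T (U x y) f)" if xy: "x \<in> GB" "y \<in> GB" for x y
    proof (cases "v x * w y = 0")
      case False
      then have g: "gpar x = b" "gpar y = c" using v w unfolding GA_grade by auto
      have "fscale (v x * w y) (scom (b * c) (Fop x) (Fop y) f) = fscale (v x * w y) (FF (G_basis_bracket x y) f + T (U x y) f)"
        using U(2)[OF xy f] unfolding g by simp
      then show ?thesis unfolding scom_def fscale_diff fscale_add fscale_simps(4) by (simp add: mult.commute)
    next
      case True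
      show ?thesis unfolding True by simp
    qed
    have "scom (b * c) (FF v) (FF w) f = (\<Sum>x\<in>GB. \<Sum>y\<in>GB. fscale (v x * w y) (Fop x (Fop y f)) -
        fscale (psign (b * c)) (fscale (v x * w y) (Fop y (Fop x f))))"
      unfolding scom_def 1 2 fscale_sum sum_subtractf ..
    also have "\<dots> = (\<Sum>x\<in>GB. \<Sum>y\<in>GB. fscale (v x * w y) (FF (G_basis_bracket x y) f) + fscale (v x * w y) (T (U x y) f))"
      by (intro sum.cong refl 3)
    also have "\<dots> = FF (bracket GA v w) f + T ?u f"
      by (simp add: G_alg_def FF_sum FF_linear T_linear sum.distrib)
    finally show ?thesis .
  qed
  then show ?thesis using uK by blast
qed

text \<open>A nice map F satisfies [F, T z] = T (F z), so all mixed terms are inner, and only the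
  bracket of the two outer parts contributes to the outer part.\<close>

lemma FT_bracket:
  assumes v: "v \<in> grade GA b" and w: "w \<in> grade GA c"
    and y: "y \<in> K" "y \<in> Gr (b + 1)" and z: "z \<in> K" "z \<in> Gr (c + 1)"
  shows "\<exists>u\<in>K. \<forall>f\<in>Osp. scom (b * c) (\<lambda>f. FF v f + T y f) (\<lambda>f. FF w f + T z f) f = FF (bracket GA v w) f + T u f"
proof -
  obtain u where u: "u \<in> K" "\<And>f. f \<in> Osp \<Longrightarrow> scom (b * c) (FF v) (FF w) f = FF (bracket GA v w) f + T u f"
    using FF_bracket[OF v w] by blast
  note nv = nice_FF[OF v] and nw = nice_FF[OF w]
  have ny: "nice b (T y)" using nice_T_K[OF y] by (simp add: add.assoc)
  let ?u = "u + FF v z - fscale (psign (b * c)) (FF w y) + T y z"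
  have uK: "?u \<in> K" using u(1) niceD(3)[OF nv z(1)] niceD(3)[OF nw y(1)] K_T[OF y(1) z(1)] by (intro K_add K_diff K_scale)
  have "scom (b * c) (\<lambda>f. FF v f + T y f) (\<lambda>f. FF w f + T z f) f = FF (bracket GA v w) f + T ?u f" if f: "f \<in> Osp" for f
  proof -
    have 1: "FF v (T z f) = T (FF v z) f + fscale (psign (b * c)) (T z (FF v f))"
      using niceD(5)[OF nv z f] by (simp add: add.assoc)
    have 2: "FF w (T y f) = T (FF w y) f + fscale (psign (b * c)) (T y (FF w f))"
      using niceD(5)[OF nw y f] by (simp add: add.assoc mult.commute)
    have 3: "T y (T z f) = T (T y z) f + fscale (psign (b * c)) (T z (T y f))"
      using niceD(5)[OF ny z f] by (simp add: add.assoc)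
    have 4: "FF v (FF w f) = FF (bracket GA v w) f + T u f + fscale (psign (b * c)) (FF w (FF v f))"
      using u(2)[OF f] unfolding scom_def by (simp add: algebra_simps)
    show ?thesis
      unfolding scom_def lin_add[OF niceD(1)[OF nv]] lin_add[OF niceD(1)[OF nw]] T_linear(7) 1 2 3 4
      by (simp add: T_linear fscale_add fscale_diff)
  qed
  then show ?thesis using uK by blast
qed

end

section \<open>The outer derivation algebra\<close>

text \<open>\<open>lie_superalgebra_iso\<close> says nothing about the stored zero, hence the
  separate hypothesis. This way the axioms of the quotient follow from those of \<open>G\<close>
  without proving them for superderivations.\<close>

lemma lie_superalgebra_transfer:
  assumes G: "lie_superalgebra G" and iso: "lie_superalgebra_iso G M \<chi>" and zero: "vzero M = \<chi> (vzero G)"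
  shows "lie_superalgebra M"
proof -
  interpret G: lie_superalgebra G by (rule G)
  have img: "carr M = \<chi> ` carr G" and inj: "inj_on \<chi> (carr G)"
    and add: "\<And>x y. x \<in> carr G \<Longrightarrow> y \<in> carr G \<Longrightarrow> vadd M (\<chi> x) (\<chi> y) = \<chi> (vadd G x y)"
    and scale: "\<And>c x. x \<in> carr G \<Longrightarrow> vscale M c (\<chi> x) = \<chi> (vscale G c x)"
    and br: "\<And>x y. x \<in> carr G \<Longrightarrow> y \<in> carr G \<Longrightarrow> bracket M (\<chi> x) (\<chi> y) = \<chi> (bracket G x y)"
    and grade: "\<And>b. grade M b = \<chi> ` grade G b"
    using iso unfolding lie_superalgebra_iso_def bij_betw_def by auto
  have gc: "x \<in> grade G b \<Longrightarrow> x \<in> carr G" for x b using G.grade_subspace[of b] unfolding vsubspace_def by blast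
  note G.zero_closed [simp] G.add_closed [simp] G.scale_closed [simp] G.bracket_closed [simp]
  note rules = zero add scale br
  have "superspace M"
  proof
    fix x assume "x \<in> carr M"
    then obtain a where a: "a \<in> carr G" "x = \<chi> a" unfolding img by blast
    obtain y z where yz: "y \<in> grade G 0" "z \<in> grade G 1" "a = vadd G y z"
      and u: "\<And>y' z'. y' \<in> grade G 0 \<Longrightarrow> z' \<in> grade G 1 \<Longrightarrow> a = vadd G y' z' \<Longrightarrow> y' = y \<and> z' = z"
      using G.grade_direct_sum[OF a(1)] by blast
    show "\<exists>!(y, z). y \<in> grade M 0 \<and> z \<in> grade M 1 \<and> x = vadd M y z"
    proof (rule ex1I[of _ "(\<chi> y, \<chi> z)"])
      show "case (\<chi> y, \<chi> z) of (y, z) \<Rightarrow> y \<in> grade M 0 \<and> z \<in> grade M 1 \<and> x = vadd M y z"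
        using yz a gc by (simp add: grade add)
    next
      fix q assume "case q of (y, z) \<Rightarrow> y \<in> grade M 0 \<and> z \<in> grade M 1 \<and> x = vadd M y z"
      then obtain y' z' where q: "q = (\<chi> y', \<chi> z')" "y' \<in> grade G 0" "z' \<in> grade G 1" "x = vadd M (\<chi> y') (\<chi> z')"
        unfolding grade by auto
      then have "\<chi> a = \<chi> (vadd G y' z')" using a gc by (simp add: add)
      then have "a = vadd G y' z'" using inj_onD[OF inj] a gc[OF q(2)] gc[OF q(3)] by simp
      then show "q = (\<chi> y, \<chi> z)" using u[OF q(2,3)] q(1) by simp
    qed
  next
    fix b
    have S: "vsubspace G (grade G b)" by (rule G.grade_subspace)
    show "vsubspace M (grade M b)"
      unfolding vsubspace_def grade img
    proof (intro conjI ballI allI)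
      show "\<chi> ` grade G b \<subseteq> \<chi> ` carr G" using gc by blast
      show "vzero M \<in> \<chi> ` grade G b" using S zero unfolding vsubspace_def by blast
    next
      fix x y assume "x \<in> \<chi> ` grade G b" "y \<in> \<chi> ` grade G b"
      then obtain x' y' where e: "x = \<chi> x'" "x' \<in> grade G b" "y = \<chi> y'" "y' \<in> grade G b" by blast
      then have "vadd G x' y' \<in> grade G b" using S unfolding vsubspace_def by blast
      then show "vadd M x y \<in> \<chi> ` grade G b" using e gc by (simp add: add)
    next
      fix c x assume "x \<in> \<chi> ` grade G b"
      then obtain x' where e: "x = \<chi> x'" "x' \<in> grade G b" by blast
      then have "vscale G c x' \<in> grade G b" using S unfolding vsubspace_def by blast
      then show "vscale M c x \<in> \<chi> ` grade G b" using e gc by (simp add: scale)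
    qed
  qed (auto simp: img rules G.add_assoc G.add_zero G.add_inverse G.scale_add_right G.scale_add_left G.scale_scale
      G.scale_one intro: arg_cong[OF G.add_comm])
  then show ?thesis
  proof (rule lie_superalgebra.intro)
    show "lie_superalgebra_axioms M"
    proof
      fix x y b c assume "x \<in> grade M b" "y \<in> grade M c"
      then obtain x' y' where e: "x = \<chi> x'" "x' \<in> grade G b" "y = \<chi> y'" "y' \<in> grade G c" unfolding grade by blast
      note [simp] = gc[OF e(2)] gc[OF e(4)]
      show "bracket M x y \<in> grade M (b + c)" using G.bracket_grade[OF e(2,4)] by (simp add: e br grade)
      show "bracket M x y = vscale M (- psign (b * c)) (bracket M y x)"
        using G.super_skew[OF e(2,4)] by (simp add: e br scale)
      fix z assume "z \<in> carr M"
      then obtain z' where z: "z = \<chi> z'" "z' \<in> carr G" unfolding img by blast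
      show "bracket M x (bracket M y z) = vadd M (bracket M (bracket M x y) z)
          (vscale M (psign (b * c)) (bracket M y (bracket M x z)))"
        using G.super_jacobi[OF e(2,4) z(2)] z(2) by (simp add: e z rules)
    qed (auto simp: img rules G.bracket_add_left G.bracket_add_right G.bracket_scale_left G.bracket_scale_right)
  qed
qed

lemma lie_superalgebra_iso_inverse:
  assumes G: "lie_superalgebra G" and iso: "lie_superalgebra_iso G M \<chi>"
  shows "lie_superalgebra_iso M G (inv_into (carr G) \<chi>)"
proof -
  interpret G: lie_superalgebra G by (rule G)
  have img: "carr M = \<chi> ` carr G" and inj: "inj_on \<chi> (carr G)"
    and add: "\<And>x y. x \<in> carr G \<Longrightarrow> y \<in> carr G \<Longrightarrow> vadd M (\<chi> x) (\<chi> y) = \<chi> (vadd G x y)"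
    and scale: "\<And>c x. x \<in> carr G \<Longrightarrow> vscale M c (\<chi> x) = \<chi> (vscale G c x)"
    and br: "\<And>x y. x \<in> carr G \<Longrightarrow> y \<in> carr G \<Longrightarrow> bracket M (\<chi> x) (\<chi> y) = \<chi> (bracket G x y)"
    and grade: "\<And>b. grade M b = \<chi> ` grade G b"
    using iso unfolding lie_superalgebra_iso_def bij_betw_def by auto
  have gc: "grade G b \<subseteq> carr G" for b using G.grade_subspace[of b] unfolding vsubspace_def by blast
  have inv: "inv_into (carr G) \<chi> (\<chi> x) = x" if "x \<in> carr G" for x using inv_into_f_f[OF inj that] .
  show ?thesis
    unfolding lie_superalgebra_iso_def
  proof (intro conjI)
    show "bij_betw (inv_into (carr G) \<chi>) (carr M) (carr G)"
      using bij_betw_inv_into[OF conjunct1[OF iso[unfolded lie_superalgebra_iso_def]]] .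
    show "\<forall>b. inv_into (carr G) \<chi> ` grade M b = grade G b"
      unfolding grade using inv_into_image_cancel[OF inj gc] by blast
  qed (auto simp: img add scale br inv G.add_closed G.scale_closed G.bracket_closed)
qed

context sho begin

interpretation L: cspace L by (rule L_cspace)

text \<open>The superderivation with outer coordinates v and inner potential y. By
  \<open>superder_DD\<close> and \<open>DD_inj\<close> every homogeneous superderivation has this
  form, with v determined by it.\<close>

definition DD :: "(gbasis \<Rightarrow> 'k) \<Rightarrow> (mono \<Rightarrow> 'k) \<Rightarrow> ((mono \<Rightarrow> 'k) \<Rightarrow> mono \<Rightarrow> 'k) \<Rightarrow> (mono \<Rightarrow> 'k) \<Rightarrow> mono \<Rightarrow> 'k" where
  "DD v y = dmap (\<lambda>f. FF v f + T y f)"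

lemma GA_lie: "lie_superalgebra GA"
  using tpos by (intro G_lie_superalgebra) auto

lemma GA_ops: "vzero GA = 0" "vadd GA = (+)" "vscale GA = fscale" by (simp_all add: G_alg_def)

lemma GA_grade_carr: "v \<in> grade GA b \<Longrightarrow> v \<in> carr GA"
  unfolding GA_grade GA_carr by blast

lemma GA_closed: "0 \<in> carr GA" "v \<in> carr GA \<Longrightarrow> w \<in> carr GA \<Longrightarrow> v + w \<in> carr GA"
  "v \<in> carr GA \<Longrightarrow> w \<in> carr GA \<Longrightarrow> v - w \<in> carr GA"
  "v \<in> carr GA \<Longrightarrow> fscale c v \<in> carr GA" "v \<in> carr GA \<Longrightarrow> w \<in> carr GA \<Longrightarrow> bracket GA v w \<in> carr GA"
  by (simp_all add: G_alg_def) (simp add: lie_superalgebra.bracket_closed[OF GA_lie, unfolded G_alg_def, simplified])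

lemma GA_parts:
  assumes "v \<in> carr GA" obtains v0 v1 where "v0 \<in> grade GA 0" "v1 \<in> grade GA 1" "v = v0 + v1"
proof
  let ?v = "\<lambda>b x. if gpar x = b then v x else 0"
  show "?v 0 \<in> grade GA 0" "?v 1 \<in> grade GA 1" using assms unfolding GA_grade GA_carr by auto
  show "v = ?v 0 + ?v 1" by (auto simp: fun_eq_iff gpar_def split: gbasis.splits)
qed

lemma compatible_add:
  assumes F: "compatible F" and G: "compatible G" shows "compatible (\<lambda>f. F f + G f)"
proof -
  obtain c d where "F one = fscale c one" "G one = fscale d one" using F G unfolding compatible_def by blast
  then have "F one + G one = fscale (c + d) one" by (simp add: fscale_add_left)
  then show ?thesis using F G K_add lin_plus unfolding compatible_def by blast
qed

lemma compatible_FF_T: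
  assumes v: "v \<in> carr GA" and y: "y \<in> K" shows "compatible (\<lambda>f. FF v f + T y f)"
proof (rule compatible_add)
  obtain v0 v1 where e: "v0 \<in> grade GA 0" "v1 \<in> grade GA 1" "v = v0 + v1" using GA_parts[OF v] .
  show "compatible (FF v)"
    unfolding e(3) FF_linear(1)[abs_def]
    using compatible_add[OF nice_compatible[OF nice_FF[OF e(1)]] nice_compatible[OF nice_FF[OF e(2)]]] .
  have "T y one = fscale 0 one" using T_eqv_right[OF eqv_one(2), of y] by (simp add: T_linear)
  then show "compatible (T y)" unfolding compatible_def using K_T[OF y] lin_T_right by blast
qed

lemma DD_TH: "v \<in> carr GA \<Longrightarrow> y \<in> K \<Longrightarrow> a \<in> K \<Longrightarrow> DD v y (TH a) = TH (FF v a + T y a)"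
  unfolding DD_def by (rule dmap_TH[OF compatible_FF_T])

lemma DD_out: "x \<notin> carr L \<Longrightarrow> DD v y x = 0"
  unfolding DD_def by (rule dmap_out)

lemma DD_eqI:
  assumes "v \<in> carr GA" "y \<in> K" "\<And>x. x \<notin> carr L \<Longrightarrow> D x = 0" "\<And>a. a \<in> K \<Longrightarrow> D (TH a) = TH (FF v a + T y a)"
  shows "D = DD v y"
  unfolding DD_def using assms(3,4) by (rule dmap_eqI[OF compatible_FF_T[OF assms(1,2)]])

lemma DD_add:
  assumes "v \<in> carr GA" "y \<in> K" "w \<in> carr GA" "z \<in> K" shows "DD v y + DD w z = DD (v + w) (y + z)"
  using assms by (intro DD_eqI GA_closed K_add)
    (simp_all add: DD_out DD_TH TH_linear(1)[symmetric] FF_linear T_linear add_ac)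

lemma DD_scale:
  assumes "v \<in> carr GA" "y \<in> K" shows "(\<lambda>x. vscale L c (DD v y x)) = DD (fscale c v) (fscale c y)"
  using assms by (intro DD_eqI GA_closed K_scale)
    (simp_all add: DD_out DD_TH L_sel TH_linear(5)[symmetric] FF_linear T_linear fscale_add fun_eq_iff)

lemma DD_superder:
  assumes v: "v \<in> grade GA e" and y: "y \<in> K" "y \<in> Gr (e + 1)" shows "DD v y \<in> superder_grade L e"
proof -
  have "nice e (T y)" using nice_T_K[OF y] by (simp add: add.assoc)
  from dmap_superder[OF nice_add[OF nice_FF[OF v] this]] show ?thesis unfolding DD_def .
qed

lemma superder_DD:
  assumes D: "D \<in> superder_grade L e" obtains v y where "v \<in> grade GA e" "y \<in> K" "y \<in> Gr (e + 1)" "D = DD v y"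
proof -
  obtain \<phi> where \<phi>: "pder e \<phi>" "\<And>a. a \<in> K \<Longrightarrow> D (TH a) = TH (\<phi> a)" using superder_pder[OF D] by blast
  obtain v y where v: "v \<in> grade GA e" and y: "y \<in> K" "y \<in> Gr (e + 1)" and ev: "\<And>a. a \<in> K \<Longrightarrow> eqv (\<phi> a) (FF v a + T y a)"
    using classification[OF \<phi>(1)] by blast
  note vc = GA_grade_carr[OF v]
  have "D = DD v y"
  proof (rule DD_eqI[OF vc y(1)])
    have "D \<in> endo L" using D by (simp add: superder_grade_def endo_grade_def)
    then show "D x = 0" if "x \<notin> carr L" for x using L.endoD(2) that by blast
    fix a assume a: "a \<in> K"
    have O: "\<phi> a \<in> Osp" using \<phi>(1) a unfolding pder_def by (simp add: K_Osp)
    have "FF v a + T y a \<in> K" using compatible_FF_T[OF vc y(1)] a unfolding compatible_def by blast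
    then have "TH (\<phi> a) = TH (FF v a + T y a)" using TH_eq_iff[OF O] ev[OF a] by simp
    then show "D (TH a) = TH (FF v a + T y a)" unfolding \<phi>(2)[OF a] .
  qed
  then show ?thesis using that v y by blast
qed

lemma DD_inj:
  assumes v: "v \<in> carr GA" and y: "y \<in> K" and w: "w \<in> carr GA" and z: "z \<in> K" and e: "DD v y = DD w z"
  shows "v = w"
proof -
  have "v - w = 0"
  proof (rule independence[OF GA_closed(3)[OF v w] K_diff[OF z y]])
    fix a assume a: "a \<in> K"
    have k: "FF v a + T y a \<in> Osp" "FF w a + T z a \<in> Osp"
      using compatible_FF_T[OF v y] compatible_FF_T[OF w z] a unfolding compatible_def by (blast intro: K_Osp)+
    have "TH (FF v a + T y a) = TH (FF w a + T z a)" using e DD_TH[OF v y a] DD_TH[OF w z a] by simp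
    then have 1: "eqv (FF v a + T y a) (FF w a + T z a)" using TH_eq_iff[OF k] by blast
    have "FF v a = FF (v - w) a + FF w a" unfolding FF_linear(1)[symmetric] by simp
    then have 2: "FF (v - w) a = (FF v a + T y a) - (FF w a + T y a)" by simp
    have 3: "T (z - y) a = (FF w a + T z a) - (FF w a + T y a)" by (simp add: T_linear)
    show "eqv (FF (v - w) a) (T (z - y) a)" unfolding 2 3 by (rule eqv_diff[OF 1 eqv_refl])
  qed
  then show ?thesis by simp
qed

lemma hom_commutator_DD:
  assumes v: "v \<in> grade GA b" and w: "w \<in> grade GA c"
    and y: "y \<in> K" "y \<in> Gr (b + 1)" and z: "z \<in> K" "z \<in> Gr (c + 1)"
  shows "\<exists>u\<in>K. hom_commutator L b c (DD v y) (DD w z) = DD (bracket GA v w) u"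
proof -
  note vc = GA_grade_carr[OF v] and wc = GA_grade_carr[OF w]
  let ?F = "\<lambda>f. FF v f + T y f" and ?G = "\<lambda>f. FF w f + T z f"
  obtain u where u: "u \<in> K" "\<And>f. f \<in> Osp \<Longrightarrow> scom (b * c) ?F ?G f = FF (bracket GA v w) f + T u f"
    using FT_bracket[OF v w y z] by blast
  have F: "?F a \<in> K" "?G a \<in> K" if "a \<in> K" for a
    using compatible_FF_T[OF vc y(1)] compatible_FF_T[OF wc z(1)] that unfolding compatible_def by blast+
  have L0: "0 \<in> K" "TH 0 = 0" using K_zero TH_linear(4) by auto
  \<comment> \<open>Outside the carrier either map returns 0, to which the other is then applied; so
    the value at 0 is needed as well.\<close>
  have "DD v y \<in> endo L" "DD w z \<in> endo L"
    unfolding DD_def by (rule dmap_endo[OF compatible_FF_T[OF vc y(1)]], rule dmap_endo[OF compatible_FF_T[OF wc z(1)]])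
  then have D0: "DD v y 0 = 0" "DD w z 0 = 0"
    using L.endoD(3)[OF _ L.zero_carr L.zero_carr] by (metis add_cancel_right_right add_0)+
  have "hom_commutator L b c (DD v y) (DD w z) = DD (bracket GA v w) u"
  proof (rule DD_eqI[OF GA_closed(5)[OF vc wc] u(1)])
    show "hom_commutator L b c (DD v y) (DD w z) x = 0" if "x \<notin> carr L" for x
      unfolding hom_commutator_def L_sel(2,4) DD_out[OF that] D0 by (simp add: fun_eq_iff)
    fix a assume a: "a \<in> K"
    have "hom_commutator L b c (DD v y) (DD w z) (TH a) = TH (?F (?G a)) + TH (fscale (- psign (b * c)) (?G (?F a)))"
      unfolding hom_commutator_def L_sel DD_TH[OF vc y(1) a] DD_TH[OF wc z(1) a] DD_TH[OF vc y(1) F(2)[OF a]] DD_TH[OF wc z(1) F(1)[OF a]]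
        TH_linear(5) ..
    also have "\<dots> = TH (scom (b * c) ?F ?G a)" unfolding TH_linear(1)[symmetric] scom_def fscale_minus_left diff_conv_add_uminus ..
    also have "\<dots> = TH (FF (bracket GA v w) a + T u a)" using u(2)[of a] a by simp
    finally show "hom_commutator L b c (DD v y) (DD w z) (TH a) = TH (FF (bracket GA v w) a + T u a)" .
  qed
  then show ?thesis using u(1) by blast
qed

lemma DD_parts:
  assumes v: "v \<in> carr GA" and y: "y \<in> K"
  obtains v0 v1 y0 y1 where "v0 \<in> grade GA 0" "v1 \<in> grade GA 1" "v = v0 + v1" "y0 \<in> K" "y0 \<in> Gr (0 + 1)" "y1 \<in> K" "y1 \<in> Gr (1 + 1)"
    "DD v y = DD v0 y0 + DD v1 y1"
proof -
  obtain v0 v1 where e: "v0 \<in> grade GA 0" "v1 \<in> grade GA 1" "v = v0 + v1" using GA_parts[OF v] .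
  obtain y1 y0 where f: "y1 \<in> K" "y1 \<in> Gr 0" "y0 \<in> K" "y0 \<in> Gr 1" "y = y1 + y0" using K_parts[OF y] .
  have "DD v y = DD v0 y0 + DD v1 y1"
    using DD_add[OF GA_grade_carr[OF e(1)] f(3) GA_grade_carr[OF e(2)] f(1)] by (simp add: e f add.commute)
  then show ?thesis using that e f by simp
qed

lemma supercommutator_DD:
  assumes v: "v \<in> carr GA" and y: "y \<in> K" and w: "w \<in> carr GA" and z: "z \<in> K"
  shows "\<exists>u\<in>K. supercommutator L (DD v y) (DD w z) = DD (bracket GA v w) u"
proof -
  interpret G: lie_superalgebra GA by (rule GA_lie)
  obtain v0 v1 y0 y1 where a: "v0 \<in> grade GA 0" "v1 \<in> grade GA 1" "v = v0 + v1" "y0 \<in> K" "y0 \<in> Gr (0 + 1)" "y1 \<in> K" "y1 \<in> Gr (1 + 1)"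
    "DD v y = DD v0 y0 + DD v1 y1" using DD_parts[OF v y] .
  obtain w0 w1 z0' z1 where b: "w0 \<in> grade GA 0" "w1 \<in> grade GA 1" "w = w0 + w1" "z0' \<in> K" "z0' \<in> Gr (0 + 1)" "z1 \<in> K" "z1 \<in> Gr (1 + 1)"
    "DD w z = DD w0 z0' + DD w1 z1" using DD_parts[OF w z] .
  have sg: "D \<in> endo_grade L e" if "D \<in> superder_grade L e" for D e using that by (simp add: superder_grade_def)
  note vc = GA_grade_carr[OF a(1)] GA_grade_carr[OF a(2)] and wc = GA_grade_carr[OF b(1)] GA_grade_carr[OF b(2)]
  obtain u00 u01 u10 u11 where u: "u00 \<in> K" "u01 \<in> K" "u10 \<in> K" "u11 \<in> K"
    and h: "hom_commutator L 0 0 (DD v0 y0) (DD w0 z0') = DD (bracket GA v0 w0) u00"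
      "hom_commutator L 0 1 (DD v0 y0) (DD w1 z1) = DD (bracket GA v0 w1) u01"
      "hom_commutator L 1 0 (DD v1 y1) (DD w0 z0') = DD (bracket GA v1 w0) u10"
      "hom_commutator L 1 1 (DD v1 y1) (DD w1 z1) = DD (bracket GA v1 w1) u11"
    using hom_commutator_DD[OF a(1) b(1) a(4,5) b(4,5)] hom_commutator_DD[OF a(1) b(2) a(4,5) b(6,7)]
      hom_commutator_DD[OF a(2) b(1) a(6,7) b(4,5)] hom_commutator_DD[OF a(2) b(2) a(6,7) b(6,7)] by blast
  have br: "bracket GA v w = (bracket GA v0 w0 + bracket GA v0 w1) + (bracket GA v1 w0 + bracket GA v1 w1)"
    using G.bracket_add_left[OF vc, of w] G.bracket_add_right[OF vc(1) wc] G.bracket_add_right[OF vc(2) wc] w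
    by (simp add: GA_ops a(3) b(3))
  have "supercommutator L (DD v y) (DD w z) =
      (DD (bracket GA v0 w0) u00 + DD (bracket GA v0 w1) u01) + (DD (bracket GA v1 w0) u10 + DD (bracket GA v1 w1) u11)"
    unfolding a(8) b(8) h[symmetric]
    by (rule L.supercommutator_parts) (use DD_superder a b sg in blast)+
  also have "\<dots> = DD (bracket GA v w) ((u00 + u01) + (u10 + u11))"
    unfolding br using vc wc u by (simp add: DD_add GA_closed K_add)
  finally show ?thesis using u by (blast intro: K_add)
qed

lemma Der_sel: "vadd (Der L) = (+)" "vscale (Der L) c D = (\<lambda>x. vscale L c (D x))" "bracket (Der L) = supercommutator L"
  "grade (Der L) = superder_grade L"
  by (simp_all add: Der_def gl_super_def L.endo_add_eq)

lemma Der_carr: "carr (Der L) = {DD v y | v y. v \<in> carr GA \<and> y \<in> K}"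
proof (intro set_eqI iffI)
  fix D assume "D \<in> carr (Der L)"
  then obtain D0 D1 where D: "D0 \<in> superder_grade L 0" "D1 \<in> superder_grade L 1" "D = D0 + D1"
    by (auto simp: Der_def L.endo_add_eq)
  obtain v0 y0 where 0: "v0 \<in> grade GA 0" "y0 \<in> K" "D0 = DD v0 y0" using superder_DD[OF D(1)] by metis
  obtain v1 y1 where 1: "v1 \<in> grade GA 1" "y1 \<in> K" "D1 = DD v1 y1" using superder_DD[OF D(2)] by metis
  have "D = DD (v0 + v1) (y0 + y1)"
    unfolding D(3) 0(3) 1(3) by (rule DD_add[OF GA_grade_carr[OF 0(1)] 0(2) GA_grade_carr[OF 1(1)] 1(2)])
  then show "D \<in> {DD v y | v y. v \<in> carr GA \<and> y \<in> K}"
    using GA_closed(2)[OF GA_grade_carr[OF 0(1)] GA_grade_carr[OF 1(1)]] K_add[OF 0(2) 1(2)] by blast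
next
  fix D assume "D \<in> {DD v y | v y. v \<in> carr GA \<and> y \<in> K}"
  then obtain v y where D: "v \<in> carr GA" "y \<in> K" "D = DD v y" by blast
  obtain v0 v1 y0 y1 where a: "v0 \<in> grade GA 0" "v1 \<in> grade GA 1" "v = v0 + v1" "y0 \<in> K" "y0 \<in> Gr (0 + 1)" "y1 \<in> K" "y1 \<in> Gr (1 + 1)"
    "DD v y = DD v0 y0 + DD v1 y1" using DD_parts[OF D(1,2)] .
  show "D \<in> carr (Der L)"
    using DD_superder[OF a(1,4,5)] DD_superder[OF a(2,6,7)] D(3) a(8) by (auto simp: Der_def L.endo_add_eq)
qed

lemma inner_eq: "ad L ` carr L = DD 0 ` K"
proof -
  have "ad L (TH y) = DD 0 y" if "y \<in> K" for y
    unfolding ad_TH[OF that] DD_def by (simp add: FF_linear)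
  then show ?thesis unfolding L_sel by (simp add: image_image)
qed

text \<open>The class of v in the quotient: all superderivations with outer coordinates v, which by
  \<open>vcoset_DD\<close> is a coset of the inner ones.\<close>

definition cs :: "(gbasis \<Rightarrow> 'k) \<Rightarrow> (((mono \<Rightarrow> 'k) \<Rightarrow> mono \<Rightarrow> 'k) \<Rightarrow> (mono \<Rightarrow> 'k) \<Rightarrow> mono \<Rightarrow> 'k) set" where
  "cs v = DD v ` K"

lemma vcoset_DD:
  assumes v: "v \<in> carr GA" and y: "y \<in> K" shows "vcoset (Der L) (ad L ` carr L) (DD v y) = cs v"
proof -
  have "vcoset (Der L) (ad L ` carr L) (DD v y) = (\<lambda>z. DD v (y + z)) ` K"
    unfolding vcoset_def inner_eq Der_sel image_image
    using DD_add[OF v y GA_closed(1)] by (intro image_cong refl) simp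
  also have "\<dots> = cs v"
  proof
    show "(\<lambda>z. DD v (y + z)) ` K \<subseteq> cs v" unfolding cs_def using K_add[OF y] by blast
    show "cs v \<subseteq> (\<lambda>z. DD v (y + z)) ` K"
    proof
      fix D assume "D \<in> cs v"
      then obtain z where z: "z \<in> K" "D = DD v z" unfolding cs_def by blast
      then have "D = DD v (y + (z - y))" by simp
      then show "D \<in> (\<lambda>z. DD v (y + z)) ` K" using K_diff[OF z(1) y] by blast
    qed
  qed
  finally show ?thesis .
qed

lemma cs_nonempty: "cs v \<noteq> {}" unfolding cs_def using K_zero by blast

lemma Der_out_iso: "lie_superalgebra_iso GA (Der_out L) cs"
proof -
  let ?I = "ad L ` carr L"
  \<comment> \<open>The operations of the quotient are unions over representatives. A nonempty union
    of equal cosets is that coset, so independence of the representatives is all that has to be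
    checked.\<close>
  have two: "(\<Union>x\<in>cs v. \<Union>y\<in>cs w. vcoset (Der L) ?I (B x y)) = cs u"
    if "\<And>y z. y \<in> K \<Longrightarrow> z \<in> K \<Longrightarrow> vcoset (Der L) ?I (B (DD v y) (DD w z)) = cs u" for v w u B
  proof -
    have "vcoset (Der L) ?I (B x y) = cs u" if "x \<in> cs v" "y \<in> cs w" for x y
      using that \<open>\<And>y z. y \<in> K \<Longrightarrow> z \<in> K \<Longrightarrow> vcoset (Der L) ?I (B (DD v y) (DD w z)) = cs u\<close> unfolding cs_def by blast
    then have "(\<Union>x\<in>cs v. \<Union>y\<in>cs w. vcoset (Der L) ?I (B x y)) = (\<Union>x\<in>cs v. \<Union>y\<in>cs w. cs u)"
      by (intro SUP_cong refl)
    then show ?thesis using cs_nonempty by simp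
  qed
  show ?thesis
    unfolding lie_superalgebra_iso_def
  proof (intro conjI ballI allI)
    show "bij_betw cs (carr GA) (carr (Der_out L))"
    proof (rule bij_betw_imageI)
      show "inj_on cs (carr GA)"
      proof (rule inj_onI)
        fix v w assume vw: "v \<in> carr GA" "w \<in> carr GA" "cs v = cs w"
        have "DD v 0 \<in> cs w" using vw(3) K_zero unfolding cs_def by blast
        then obtain z where "z \<in> K" "DD v 0 = DD w z" unfolding cs_def by blast
        then show "v = w" using DD_inj[OF vw(1) K_zero vw(2)] by blast
      qed
      have "carr (Der_out L) = vcoset (Der L) ?I ` {DD v y | v y. v \<in> carr GA \<and> y \<in> K}"
        by (simp add: Der_out_def quotient_lie_def Der_carr)
      also have "\<dots> = cs ` carr GA"
      proof
        show "vcoset (Der L) ?I ` {DD v y | v y. v \<in> carr GA \<and> y \<in> K} \<subseteq> cs ` carr GA" using vcoset_DD by blast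
        show "cs ` carr GA \<subseteq> vcoset (Der L) ?I ` {DD v y | v y. v \<in> carr GA \<and> y \<in> K}"
          using vcoset_DD[OF _ K_zero, symmetric] K_zero by blast
      qed
      finally show "cs ` carr GA = carr (Der_out L)" ..
    qed
  next
    fix v w assume v: "v \<in> carr GA" and w: "w \<in> carr GA"
    show "cs (vadd GA v w) = vadd (Der_out L) (cs v) (cs w)"
    proof -
      have "vcoset (Der L) ?I (DD v y + DD w z) = cs (v + w)" if "y \<in> K" "z \<in> K" for y z
        unfolding DD_add[OF v that(1) w that(2)] by (rule vcoset_DD[OF GA_closed(2)[OF v w] K_add[OF that]])
      from two[where v = v and w = w and B = "(+)", OF this] show ?thesis by (simp add: Der_out_def quotient_lie_def Der_sel GA_ops)
    qed
    show "cs (bracket GA v w) = bracket (Der_out L) (cs v) (cs w)"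
    proof -
      have "vcoset (Der L) ?I (supercommutator L (DD v y) (DD w z)) = cs (bracket GA v w)" if yz: "y \<in> K" "z \<in> K" for y z
      proof -
        obtain u where u: "u \<in> K" "supercommutator L (DD v y) (DD w z) = DD (bracket GA v w) u"
          using supercommutator_DD[OF v yz(1) w yz(2)] by blast
        show ?thesis unfolding u(2) by (rule vcoset_DD[OF GA_closed(5)[OF v w] u(1)])
      qed
      from two[where v = v and w = w and B = "supercommutator L", OF this] show ?thesis by (simp add: Der_out_def quotient_lie_def Der_sel)
    qed
  next
    fix c v assume v: "v \<in> carr GA"
    have "vcoset (Der L) ?I (vscale (Der L) c x) = cs (fscale c v)" if "x \<in> cs v" for x
    proof -
      obtain y where y: "y \<in> K" "x = DD v y" using \<open>x \<in> cs v\<close> unfolding cs_def by blast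
      show ?thesis unfolding y(2) Der_sel DD_scale[OF v y(1)] by (rule vcoset_DD[OF GA_closed(4)[OF v] K_scale[OF y(1)]])
    qed
    then have "(\<Union>x\<in>cs v. vcoset (Der L) ?I (vscale (Der L) c x)) = (\<Union>x\<in>cs v. cs (fscale c v))"
      by (intro SUP_cong refl)
    then show "cs (vscale GA c v) = vscale (Der_out L) c (cs v)"
      using cs_nonempty by (simp add: Der_out_def quotient_lie_def GA_ops)
  next
    fix b
    have "vcoset (Der L) ?I ` superder_grade L b = cs ` grade GA b"
    proof (intro set_eqI iffI)
      fix A assume "A \<in> vcoset (Der L) ?I ` superder_grade L b"
      then obtain D where D: "D \<in> superder_grade L b" "A = vcoset (Der L) ?I D" by blast
      obtain v y where "v \<in> grade GA b" "y \<in> K" "D = DD v y" using superder_DD[OF D(1)] by metis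
      then show "A \<in> cs ` grade GA b" using vcoset_DD[OF GA_grade_carr] D(2) by blast
    next
      fix A assume "A \<in> cs ` grade GA b"
      then obtain v where v: "v \<in> grade GA b" "A = cs v" by blast
      have "DD v 0 \<in> superder_grade L b" by (rule DD_superder[OF v(1) K_zero Gr_zero])
      then show "A \<in> vcoset (Der L) ?I ` superder_grade L b"
        using vcoset_DD[OF GA_grade_carr[OF v(1)] K_zero] v(2) by blast
    qed
    then show "cs ` grade GA b = grade (Der_out L) b" by (simp add: Der_out_def quotient_lie_def Der_sel)
  qed
qed

lemma Der_out_isomorphic: "lie_superalgebra_isomorphic (Der_out L) GA"
proof -
  have "vzero (Der_out L) = cs (vzero GA)"
    unfolding GA_ops cs_def by (simp add: Der_out_def quotient_lie_def inner_eq)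
  then have "lie_superalgebra (Der_out L)" by (rule lie_superalgebra_transfer[OF GA_lie Der_out_iso])
  then show ?thesis
    using GA_lie lie_superalgebra_iso_inverse[OF GA_lie Der_out_iso] unfolding lie_superalgebra_isomorphic_def by blast
qed

end

theorem theorem4p7:
  fixes m :: nat and t :: "nat \<Rightarrow> nat"
  assumes "CHAR('k::field) > 3"
    and "m > 3"
    and "\<forall>i\<in>{1..m}. t i > 0"
  shows "lie_superalgebra_isomorphic
           (Der_out (SHO m t :: ('k, (mono \<Rightarrow> 'k) \<Rightarrow> (mono \<Rightarrow> 'k)) lie_super))
           (G_alg m t)"
proof -
  interpret sho m t "CHAR('k)" "mono_set CHAR('k) m t" "TYPE('k)"
    using assms by unfold_locales simp_all
  show ?thesis by (rule Der_out_isomorphic)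
qed

end
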